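(* Let $\tau\in BMO^1_\alpha(\mathbb B_n,\mathbb C)$ be such that $\widetilde\tau\in L^\infty(\mathbb B_n,\mathbb C)$, and define $b:\mathbb B_n\to\mathcal L(\ell^2)$ by $b(z)(e_i)=\frac{\tau(z)}{2^i}e_i$ for $z\in\mathbb B_n$, $i=1,2,\dots$. Assume that $\widetilde\tau(z)\to0$ as $z\to\partial\mathbb B_n$. Then the Toeplitz operator $T_b$ is compact on $A^2_\alpha(\mathbb B_n,\ell^2)$.
   Context: Fix an integer $n\ge 1$ and a real $\alpha>-1$. $\mathbb B_n$ is the open unit ball of $\mathbb C^n$, $\langle z,w\rangle=\sum_k z_k\overline{w_k}$, and $d\nu_\alpha(z)=c_\alpha(1-|z|^2)^\alpha d\nu(z)$, where $\nu$ is Lebesgue measure and $c_\alpha$ is the constant making $\nu_\alpha$ a probability measure on $\mathbb B_n$. For a complex Banach space $E$ and $1\le p<\infty$, $L^p_\alpha(\mathbb B_n,E)$ is the Bochner–Lebesgue space of measurable $f:\mathbb B_n\to E$ with $\|f\|^p=\int_{\mathbb B_n}\|f(z)\|_E^p\,d\nu_\alpha(z)<\infty$; $L^\infty(\mathbb B_n,E)$ is the space of essentially bounded measurable functions; $A^p_\alpha(\mathbb B_n,E)$ is the subspace of holomorphic functions in $L^p_\alpha(\mathbb B_n,E)$; $H^\infty(\mathbb B_n,E)$ is the space of bounded holomorphic functions, which is dense in $A^2_\alpha(\mathbb B_n,E)$. $\mathcal L(E)$ denotes the bounded linear operators on $E$, and $\{e_j\}_{j\ge1}$ is a fixed orthonormal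 basis of $\ell^2$. Kernels: $K^\alpha_z(w)=(1-\langle w,z\rangle)^{-(n+1+\alpha)}$, $k^\alpha_z(w)=(1-|z|^2)^{(n+1+\alpha)/2}(1-\langle w,z\rangle)^{-(n+1+\alpha)}$. For $a\in\mathbb B_n\setminus\{0\}$, $\varphi_a(z)=\dfrac{a-P_a(z)-\sqrt{1-|a|^2}\,Q_a(z)}{1-\langle z,a\rangle}$ with $P_a(z)=\frac{\langle z,a\rangle}{|a|^2}a$, $Q_a=I-P_a$; $\varphi_0(z)=-z$. For $b\in L^1_\alpha(\mathbb B_n,E)$ the Berezin transform is $\widetilde b(z)=\int_{\mathbb B_n}|k^\alpha_z(w)|^2b(w)\,d\nu_\alpha(w)$, and $b\in BMO^1_\alpha(\mathbb B_n,E)$ if $\sup_{z\in\mathbb B_n}\|b\circ\varphi_z-\widetilde b(z)\|_{L^1_\alpha(\mathbb B_n,E)}<\infty$. For $b\in L^1_\alpha(\mathbb B_n,\mathcal L(\ell^2))$ the Toeplitz operator $T_b$ is densely defined on $A^2_\alpha(\mathbb B_n,\ell^2)$ by $T_bf(z)=\int_{\mathbb B_n}b(w)(f(w))\overline{K^\alpha_z(w)}\,d\nu_\alpha(w)$, $f\in H^\infty(\mathbb B_n,\ell^2)$; it is compact if it extends to a compact operator on $A^2_\alpha(\mathbb B_n,\ell^2)$. *)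

theory Defs
  imports "HOL-Analysis.Analysis"
begin

section \<open>The complex Hilbert space of square-summable sequences\<close>

typedef ell2 = "{x :: nat \<Rightarrow> complex. summable (\<lambda>i. (cmod (x i))\<^sup>2)}"
  morphisms coord Abs_ell2
  by (rule exI[of _ "\<lambda>_. 0"]) simp

lemma summable_coord: "summable (\<lambda>i. (cmod (coord x i))\<^sup>2)"
  using coord[of x] by simp

lemma coord_Abs_ell2: "summable (\<lambda>i. (cmod (x i))\<^sup>2) \<Longrightarrow> coord (Abs_ell2 x) = x"
  by (simp add: Abs_ell2_inverse)

lemma ell2_eqI: "(\<And>i. coord x i = coord y i) \<Longrightarrow> x = y"
  by (metis coord_inject ext)

lemma square_summable_add:
  fixes x y :: "nat \<Rightarrow> complex"
  assumes "summable (\<lambda>i. (cmod (x i))\<^sup>2)" "summable (\<lambda>i. (cmod (y i))\<^sup>2)"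
  shows "summable (\<lambda>i. (cmod (x i + y i))\<^sup>2)"
proof (rule summable_comparison_test'[where N = 0])
  show "summable (\<lambda>i. 2 * (cmod (x i))\<^sup>2 + 2 * (cmod (y i))\<^sup>2)"
    using assms by (intro summable_add summable_mult)
  fix i
  have "(cmod (x i + y i))\<^sup>2 \<le> (cmod (x i) + cmod (y i))\<^sup>2"
    by (intro power_mono norm_triangle_ineq norm_ge_zero)
  also have "\<dots> \<le> 2 * (cmod (x i))\<^sup>2 + 2 * (cmod (y i))\<^sup>2"
    using sum_squares_bound[of "cmod (x i)" "cmod (y i)"] by (simp add: power2_sum)
  finally show "norm ((cmod (x i + y i))\<^sup>2) \<le> 2 * (cmod (x i))\<^sup>2 + 2 * (cmod (y i))\<^sup>2" by simp
qed

lemma square_summable_scale: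
  fixes x :: "nat \<Rightarrow> complex"
  assumes "summable (\<lambda>i. (cmod (x i))\<^sup>2)"
  shows "summable (\<lambda>i. (cmod (c * x i))\<^sup>2)"
  using summable_mult[OF assms, of "(cmod c)\<^sup>2"] by (simp add: norm_mult power_mult_distrib)

lemma summable_coord_mult: "summable (\<lambda>i. coord x i * cnj (coord y i))"
proof (rule summable_comparison_test'[where N = 0])
  show "summable (\<lambda>i. (cmod (coord x i))\<^sup>2 + (cmod (coord y i))\<^sup>2)"
    by (intro summable_add summable_coord)
  fix i
  show "norm (coord x i * cnj (coord y i)) \<le> (cmod (coord x i))\<^sup>2 + (cmod (coord y i))\<^sup>2"
    using sum_squares_bound[of "cmod (coord x i)" "cmod (coord y i)"]
      mult_nonneg_nonneg[OF norm_ge_zero[of "coord x i"] norm_ge_zero[of "coord y i"]]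
    unfolding norm_mult complex_mod_cnj by linarith
qed

definition cinner_ell2 :: "ell2 \<Rightarrow> ell2 \<Rightarrow> complex" where
  "cinner_ell2 x y = (\<Sum>i. coord x i * cnj (coord y i))"

definition scaleC_ell2 :: "complex \<Rightarrow> ell2 \<Rightarrow> ell2"  (infixr \<open>*\<^sub>C\<close> 75) where
  "c *\<^sub>C x = Abs_ell2 (\<lambda>i. c * coord x i)"

lemma coord_scaleC [simp]: "coord (c *\<^sub>C x) i = c * coord x i"
  unfolding scaleC_ell2_def by (subst coord_Abs_ell2) (auto intro: square_summable_scale summable_coord)

instantiation ell2 :: real_inner
begin

definition "0 = Abs_ell2 (\<lambda>_. 0)"
definition "x + y = Abs_ell2 (\<lambda>i. coord x i + coord y i)"
definition "- x = (- 1) *\<^sub>C x"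
definition "x - y = x + - (y :: ell2)"
definition "r *\<^sub>R x = complex_of_real r *\<^sub>C x"
definition "inner x y = Re (cinner_ell2 x y)"
definition "norm x = sqrt (\<Sum>i. (cmod (coord x i))\<^sup>2)"
definition "dist x y = norm (x - y :: ell2)"
definition "sgn x = inverse (norm x) *\<^sub>R (x :: ell2)"
definition [code del]:
  "(uniformity :: (ell2 \<times> ell2) filter) = (INF e\<in>{0 <..}. principal {(x, y). dist x y < e})"
definition [code del]:
  "open (S :: ell2 set) = (\<forall>x\<in>S. \<forall>\<^sub>F (x', y) in uniformity. x' = x \<longrightarrow> y \<in> S)"

lemma coord_zero [simp]: "coord 0 i = 0"
  unfolding zero_ell2_def by (subst coord_Abs_ell2) auto

lemma coord_add [simp]: "coord (x + y) i = coord x i + coord y i"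
  unfolding plus_ell2_def
  by (subst coord_Abs_ell2) (auto intro: square_summable_add summable_coord)

lemma coord_uminus [simp]: "coord (- x) i = - coord x i"
  by (simp add: uminus_ell2_def)

lemma coord_diff [simp]: "coord (x - y) i = coord x i - coord y i"
  by (simp add: minus_ell2_def)

lemma coord_scaleR [simp]: "coord (r *\<^sub>R x) i = complex_of_real r * coord x i"
  by (simp add: scaleR_ell2_def)

lemma cinner_ell2_self: "cinner_ell2 x x = complex_of_real (\<Sum>i. (cmod (coord x i))\<^sup>2)"
proof -
  have "(\<lambda>i. complex_of_real ((cmod (coord x i))\<^sup>2)) sums complex_of_real (\<Sum>i. (cmod (coord x i))\<^sup>2)"
    by (intro sums_of_real summable_sums summable_coord)
  then show ?thesis
    unfolding cinner_ell2_def by (intro sums_unique[symmetric]) (simp only: complex_norm_square)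
qed

instance
proof
  fix x y z :: ell2 and r s :: real
  show "x + y + z = x + (y + z)" "x + y = y + x" "0 + x = x" "- x + x = 0" "x - y = x + - y"
    by (auto intro!: ell2_eqI)
  show "r *\<^sub>R (x + y) = r *\<^sub>R x + r *\<^sub>R y" "(r + s) *\<^sub>R x = r *\<^sub>R x + s *\<^sub>R x"
    "r *\<^sub>R s *\<^sub>R x = (r * s) *\<^sub>R x" "1 *\<^sub>R x = x"
    by (auto intro!: ell2_eqI simp: algebra_simps)
  show "dist x y = norm (x - y)" "sgn x = inverse (norm x) *\<^sub>R x"
    by (simp_all add: dist_ell2_def sgn_ell2_def)
  show "(uniformity :: (ell2 \<times> ell2) filter) = (INF e\<in>{0 <..}. principal {(x, y). dist x y < e})"
    by (rule uniformity_ell2_def)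
  show "open U = (\<forall>x\<in>U. \<forall>\<^sub>F (x', y) in uniformity. x' = x \<longrightarrow> y \<in> U)" for U :: "ell2 set"
    by (rule open_ell2_def)
  have "cinner_ell2 y x = cnj (cinner_ell2 x y)"
    unfolding cinner_ell2_def
    by (rule sums_unique[symmetric])
       (use sums_cnj[THEN iffD2, OF summable_sums[OF summable_coord_mult[of x y]]]
        in \<open>simp add: mult.commute\<close>)
  then show "inner x y = inner y x"
    by (simp add: inner_ell2_def)
  show "inner (x + y) z = inner x z + inner y z"
    unfolding inner_ell2_def cinner_ell2_def
    by (simp add: algebra_simps suminf_add[symmetric] summable_coord_mult)
  show "inner (r *\<^sub>R x) y = r * inner x y"
    unfolding inner_ell2_def cinner_ell2_def
    by (simp add: mult.assoc suminf_mult summable_coord_mult)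
  have nn: "0 \<le> (\<Sum>i. (cmod (coord x i))\<^sup>2)"
    by (rule suminf_nonneg) (auto simp: summable_coord)
  then show "0 \<le> inner x x"
    by (simp add: inner_ell2_def cinner_ell2_self)
  show "inner x x = 0 \<longleftrightarrow> x = 0"
    using suminf_eq_zero_iff[OF summable_coord[of x]]
    by (auto simp: inner_ell2_def cinner_ell2_self intro!: ell2_eqI)
  show "norm x = sqrt (inner x x)"
    by (simp add: inner_ell2_def cinner_ell2_self norm_ell2_def)
qed

end

lemma norm_ell2_sq: "(norm x)\<^sup>2 = (\<Sum>i. (cmod (coord x i))\<^sup>2)"
  unfolding norm_ell2_def
  by (rule real_sqrt_pow2) (auto intro!: suminf_nonneg simp: summable_coord)

lemma sum_coord_le_norm: "(\<Sum>i<N. (cmod (coord x i))\<^sup>2) \<le> (norm x)\<^sup>2"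
  unfolding norm_ell2_sq by (rule sum_le_suminf) (auto simp: summable_coord)

lemma coord_le_norm: "cmod (coord x i) \<le> norm x"
proof -
  have "(cmod (coord x i))\<^sup>2 \<le> (\<Sum>j<Suc i. (cmod (coord x j))\<^sup>2)"
    by (rule member_le_sum) auto
  also have "\<dots> \<le> (norm x)\<^sup>2" by (rule sum_coord_le_norm)
  finally show ?thesis by (rule power2_le_imp_le) simp
qed

instance ell2 :: complete_space
proof
  fix X :: "nat \<Rightarrow> ell2"
  assume X: "Cauchy X"
  have "Cauchy (\<lambda>k. coord (X k) i)" for i
  proof (rule metric_CauchyI)
    fix e :: real assume "e > 0"
    then obtain M where M: "\<forall>m\<ge>M. \<forall>n\<ge>M. dist (X m) (X n) < e"
      using metric_CauchyD[OF X] by blast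
    show "\<exists>M. \<forall>m\<ge>M. \<forall>n\<ge>M. dist (coord (X m) i) (coord (X n) i) < e"
    proof (intro exI[of _ M] allI impI)
      fix m n assume "m \<ge> M" "n \<ge> M"
      then have "norm (X m - X n) < e" using M by (simp add: dist_norm)
      then show "dist (coord (X m) i) (coord (X n) i) < e"
        using coord_le_norm[of "X m - X n" i] by (simp add: dist_norm)
    qed
  qed
  then have "\<forall>i. \<exists>l. (\<lambda>k. coord (X k) i) \<longlonglongrightarrow> l"
    using Cauchy_convergent_iff convergent_def by blast
  then obtain l where l: "\<And>i. (\<lambda>k. coord (X k) i) \<longlonglongrightarrow> l i" by metis
  have key: "\<exists>M. \<forall>m\<ge>M. \<forall>N. (\<Sum>i<N. (cmod (coord (X m) i - l i))\<^sup>2) \<le> e\<^sup>2" if "e > 0" for e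
  proof -
    obtain M where M: "\<forall>m\<ge>M. \<forall>n\<ge>M. dist (X m) (X n) < e"
      using metric_CauchyD[OF X \<open>e > 0\<close>] by blast
    have "(\<Sum>i<N. (cmod (coord (X m) i - l i))\<^sup>2) \<le> e\<^sup>2" if "m \<ge> M" for m N
    proof (rule LIMSEQ_le_const2)
      show "(\<lambda>n. \<Sum>i<N. (cmod (coord (X m) i - coord (X n) i))\<^sup>2)
              \<longlonglongrightarrow> (\<Sum>i<N. (cmod (coord (X m) i - l i))\<^sup>2)"
        by (intro tendsto_intros l)
      have "(\<Sum>i<N. (cmod (coord (X m) i - coord (X n) i))\<^sup>2) \<le> e\<^sup>2" if "n \<ge> M" for n
      proof -
        have "norm (X m - X n) \<le> e"
          using M \<open>m \<ge> M\<close> that by (simp add: dist_norm less_imp_le)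
        then have "(norm (X m - X n))\<^sup>2 \<le> e\<^sup>2" by (intro power_mono) auto
        then show ?thesis using sum_coord_le_norm[of "X m - X n" N] by simp
      qed
      then show "\<exists>K. \<forall>n\<ge>K. (\<Sum>i<N. (cmod (coord (X m) i - coord (X n) i))\<^sup>2) \<le> e\<^sup>2"
        by blast
    qed
    then show ?thesis by blast
  qed
  have sm: "summable (\<lambda>i. (cmod (coord (X m) i - l i))\<^sup>2)"
    if "\<forall>N. (\<Sum>i<N. (cmod (coord (X m) i - l i))\<^sup>2) \<le> e\<^sup>2" for m e
    using that by (intro summableI_nonneg_bounded[where x = "e\<^sup>2"]) auto
  obtain m1 where "\<forall>N. (\<Sum>i<N. (cmod (coord (X m1) i - l i))\<^sup>2) \<le> 1\<^sup>2"
    using key[of 1] by auto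
  from square_summable_add[OF square_summable_scale[OF sm[OF this], of "-1"] summable_coord[of "X m1"]]
  have "summable (\<lambda>i. (cmod (l i))\<^sup>2)" by simp
  then have cl: "coord (Abs_ell2 l) = l" by (rule coord_Abs_ell2)
  have "X \<longlonglongrightarrow> Abs_ell2 l"
  proof (rule metric_LIMSEQ_I)
    fix e :: real assume "e > 0"
    then obtain M where M: "\<forall>m\<ge>M. \<forall>N. (\<Sum>i<N. (cmod (coord (X m) i - l i))\<^sup>2) \<le> (e/2)\<^sup>2"
      using key[of "e/2"] by auto
    have "dist (X m) (Abs_ell2 l) < e" if "m \<ge> M" for m
    proof -
      have b: "\<forall>N. (\<Sum>i<N. (cmod (coord (X m) i - l i))\<^sup>2) \<le> (e/2)\<^sup>2"
        using M that by blast
      have "(norm (X m - Abs_ell2 l))\<^sup>2 = (\<Sum>i. (cmod (coord (X m) i - l i))\<^sup>2)"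
        by (simp add: norm_ell2_sq cl)
      also have "\<dots> \<le> (e/2)\<^sup>2"
        by (rule suminf_le_const[OF sm[OF b]]) (use b in blast)
      finally have "norm (X m - Abs_ell2 l) \<le> e/2"
        by (rule power2_le_imp_le) (use \<open>e > 0\<close> in simp)
      then show ?thesis using \<open>e > 0\<close> by (simp add: dist_norm)
    qed
    then show "\<exists>M. \<forall>m\<ge>M. dist (X m) (Abs_ell2 l) < e" by blast
  qed
  then show "convergent X" by (auto simp: convergent_def)
qed

instance ell2 :: banach ..

lemma ell2_separable:
  obtains D :: "ell2 set" where "countable D" "\<And>x e. e > 0 \<Longrightarrow> \<exists>d\<in>D. dist d x < e"
proof -
  obtain Q :: "complex set" where Q: "countable Q"
    and Qd: "\<And>U. open U \<Longrightarrow> U \<noteq> {} \<Longrightarrow> \<exists>q\<in>Q. q \<in> U"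
    using countable_dense_setE by blast
  define v where "v = (\<lambda>qs i. if i < length qs then qs ! i else (0 :: complex))"
  define D where "D = (\<lambda>qs. Abs_ell2 (v qs)) ` lists Q"
  have cv: "coord (Abs_ell2 (v qs)) = v qs" for qs
    by (rule coord_Abs_ell2, rule summable_finite[of "{..<length qs}"]) (auto simp: v_def)
  have "countable D" unfolding D_def using Q by (intro countable_image countable_lists)
  moreover have "\<exists>d\<in>D. dist d x < e" if e: "e > 0" for x e
  proof -
    have "(\<lambda>N. \<Sum>i<N. (cmod (coord x i))\<^sup>2) \<longlonglongrightarrow> (norm x)\<^sup>2"
      using summable_LIMSEQ[OF summable_coord[of x]] by (simp add: norm_ell2_sq)
    moreover have "(norm x)\<^sup>2 > (norm x)\<^sup>2 - (e/2)\<^sup>2" using e by simp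
    ultimately have "\<forall>\<^sub>F N in sequentially. (norm x)\<^sup>2 - (e/2)\<^sup>2 < (\<Sum>i<N. (cmod (coord x i))\<^sup>2)"
      by (rule order_tendstoD)
    then obtain N where N: "(norm x)\<^sup>2 - (e/2)\<^sup>2 < (\<Sum>i<N. (cmod (coord x i))\<^sup>2)"
      by (auto simp: eventually_sequentially)
    define \<delta> where "\<delta> = e / (2 * sqrt (real (Suc N)))"
    have \<delta>: "\<delta> > 0" using e by (simp add: \<delta>_def)
    have "\<exists>q\<in>Q. q \<in> ball (coord x i) \<delta>" for i
      using \<delta> by (intro Qd) auto
    then obtain q where q: "\<And>i. q i \<in> Q" "\<And>i. dist (coord x i) (q i) < \<delta>"
      by (metis mem_ball)
    define d where "d = Abs_ell2 (v (map q [0..<N]))"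
    have cd: "coord d i = (if i < N then q i else 0)" for i
      unfolding d_def cv by (auto simp: v_def)
    have "d \<in> D" unfolding D_def d_def using q(1) by (intro imageI) auto
    have S: "summable (\<lambda>i. (cmod (coord (d - x) i))\<^sup>2)" by (rule summable_coord)
    have "(norm (d - x))\<^sup>2 = (\<Sum>i. (cmod (coord (d - x) (i + N)))\<^sup>2) + (\<Sum>i<N. (cmod (coord (d - x) i))\<^sup>2)"
      unfolding norm_ell2_sq by (rule suminf_split_initial_segment[OF S])
    also have "(\<Sum>i. (cmod (coord (d - x) (i + N)))\<^sup>2) = (\<Sum>i. (cmod (coord x (i + N)))\<^sup>2)"
      by (simp add: cd)
    also have "\<dots> = (norm x)\<^sup>2 - (\<Sum>i<N. (cmod (coord x i))\<^sup>2)"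
      using suminf_split_initial_segment[OF summable_coord[of x], of N] by (simp add: norm_ell2_sq)
    also have "\<dots> < (e/2)\<^sup>2" using N by simp
    also have "(\<Sum>i<N. (cmod (coord (d - x) i))\<^sup>2) \<le> (\<Sum>i<N. \<delta>\<^sup>2)"
      using q(2) by (intro sum_mono power_mono) (auto simp: cd dist_norm norm_minus_commute less_imp_le)
    also have "\<dots> \<le> (e/2)\<^sup>2"
    proof -
      have "real N * e\<^sup>2 \<le> (1 + real N) * e\<^sup>2" by (intro mult_right_mono) auto
      then show ?thesis
        by (simp add: \<delta>_def power_divide power_mult_distrib divide_simps algebra_simps)
    qed
    finally have "(norm (d - x))\<^sup>2 < (e/2)\<^sup>2 + (e/2)\<^sup>2" by simp
    also have "\<dots> \<le> e\<^sup>2" by (simp add: power_divide)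
    finally have "norm (d - x) < e" using e by (simp add: power2_less_imp_less)
    then show ?thesis using \<open>d \<in> D\<close> by (auto simp: dist_norm)
  qed
  ultimately show ?thesis by (rule that)
qed

instance ell2 :: second_countable_topology
proof
  obtain D :: "ell2 set" where D: "countable D" "\<And>x e. e > 0 \<Longrightarrow> \<exists>d\<in>D. dist d x < e"
    using ell2_separable by blast
  define B where "B = (\<lambda>(d, n). ball d (1 / real (Suc n))) ` (D \<times> (UNIV :: nat set))"
  have "countable B" using D(1) by (auto simp: B_def)
  moreover have "topological_basis B"
  proof (rule topological_basisI)
    show "open b" if "b \<in> B" for b using that by (auto simp: B_def)
    fix U :: "ell2 set" and x assume "open U" "x \<in> U"
    then obtain e where e: "e > 0" "ball x e \<subseteq> U" by (auto simp: open_contains_ball)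
    obtain n where n: "1 / real (Suc n) < e / 2"
      using nat_approx_posE[of "e / 2"] e by auto
    obtain d where d: "d \<in> D" "dist d x < 1 / real (Suc n)"
      using D(2)[of "1 / real (Suc n)" x] by auto
    have "ball d (1 / real (Suc n)) \<subseteq> ball x e"
    proof
      fix y assume "y \<in> ball d (1 / real (Suc n))"
      then show "y \<in> ball x e"
        using dist_triangle3[of x y d] d(2) n by simp
    qed
    then show "\<exists>b\<in>B. x \<in> b \<and> b \<subseteq> U"
      using d e(2) unfolding B_def
      by (intro bexI[of _ "ball d (1 / real (Suc n))"]) auto
  qed
  ultimately show "\<exists>B :: ell2 set set. countable B \<and> open = generate_topology B"
    using topological_basis_imp_subbasis by blast
qed

text \<open>The basis is indexed by the integers \<open>\<ge> 1\<close>; the value \<open>e 0\<close> plays no role.\<close>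

definition orthonormal_basis :: "(nat \<Rightarrow> ell2) \<Rightarrow> bool" where
  "orthonormal_basis e \<longleftrightarrow>
     (\<forall>i\<ge>1. \<forall>j\<ge>1. cinner_ell2 (e i) (e j) = (if i = j then 1 else 0)) \<and>
     (\<forall>x. ((\<lambda>j. cinner_ell2 x (e j) *\<^sub>C e j) has_sum x) {1..})"

text \<open>A bounded real-linear operator on \<open>ell2\<close> is in \<open>\<L>(\<ell>\<^sup>2)\<close> iff it commutes with complex scalars.\<close>

definition complex_homogeneous :: "(ell2 \<Rightarrow>\<^sub>L ell2) \<Rightarrow> bool" where
  "complex_homogeneous T \<longleftrightarrow> (\<forall>c x. blinfun_apply T (c *\<^sub>C x) = c *\<^sub>C blinfun_apply T x)"


section \<open>Weighted spaces on the unit ball\<close>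

abbreviation unit_ball :: "(complex ^ 'n) set"  (\<open>\<bbbB>\<close>) where
  "\<bbbB> \<equiv> ball 0 1"

definition cdot :: "complex ^ 'n \<Rightarrow> complex ^ 'n \<Rightarrow> complex" where
  "cdot z w = (\<Sum>k\<in>UNIV. z $ k * cnj (w $ k))"

definition c_const :: "'n::finite itself \<Rightarrow> real \<Rightarrow> real" where
  "c_const _ \<alpha> =
     1 / integral\<^sup>L (lebesgue_on (\<bbbB> :: (complex ^ 'n) set)) (\<lambda>z. (1 - (norm z)\<^sup>2) powr \<alpha>)"

definition nu :: "real \<Rightarrow> (complex ^ 'n) measure" where
  "nu \<alpha> = density (lebesgue_on \<bbbB>) (\<lambda>z. ennreal (c_const TYPE('n) \<alpha> * (1 - (norm z)\<^sup>2) powr \<alpha>))"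

text \<open>The \<open>p\<close>-th power of the \<open>L\<^sup>p\<close> norm.\<close>

definition Lp_power ::
    "real \<Rightarrow> real \<Rightarrow> (complex ^ 'n \<Rightarrow> 'e::{banach, second_countable_topology}) \<Rightarrow> ennreal" where
  "Lp_power \<alpha> p f = (\<integral>\<^sup>+ z. ennreal (norm (f z) powr p) \<partial>nu \<alpha>)"

definition Lp_norm ::
    "real \<Rightarrow> real \<Rightarrow> (complex ^ 'n \<Rightarrow> 'e::{banach, second_countable_topology}) \<Rightarrow> real" where
  "Lp_norm \<alpha> p f = enn2real (Lp_power \<alpha> p f) powr (1 / p)"

definition Lp ::
    "real \<Rightarrow> real \<Rightarrow> (complex ^ 'n \<Rightarrow> 'e::{banach, second_countable_topology}) set" where
  "Lp \<alpha> p = {f \<in> borel_measurable (nu \<alpha>). Lp_power \<alpha> p f < \<infinity>}"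

definition Linf :: "(complex ^ 'n \<Rightarrow> 'e::{banach, second_countable_topology}) set" where
  "Linf = {f \<in> borel_measurable (lebesgue_on \<bbbB>). \<exists>C. AE z in lebesgue_on \<bbbB>. norm (f z) \<le> C}"


section \<open>Kernels, automorphisms, Berezin transform and bounded mean oscillation\<close>

definition bergman_kernel :: "real \<Rightarrow> complex ^ 'n \<Rightarrow> complex ^ 'n \<Rightarrow> complex" where
  "bergman_kernel \<alpha> z w = (1 - cdot w z) powr (- complex_of_real (real CARD('n) + 1 + \<alpha>))"

definition normalized_kernel :: "real \<Rightarrow> complex ^ 'n \<Rightarrow> complex ^ 'n \<Rightarrow> complex" where
  "normalized_kernel \<alpha> z w =
     complex_of_real ((1 - (norm z)\<^sup>2) powr ((real CARD('n) + 1 + \<alpha>) / 2)) * bergman_kernel \<alpha> z w"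

definition mobius :: "complex ^ 'n \<Rightarrow> complex ^ 'n \<Rightarrow> complex ^ 'n" where
  "mobius a z =
     (if a = 0 then - z
      else let P = (cdot z a / complex_of_real ((norm a)\<^sup>2)) *s a; Q = z - P
           in (1 / (1 - cdot z a)) *s (a - P - sqrt (1 - (norm a)\<^sup>2) *\<^sub>R Q))"

definition berezin ::
    "real \<Rightarrow> (complex ^ 'n \<Rightarrow> 'e::{banach, second_countable_topology}) \<Rightarrow> complex ^ 'n \<Rightarrow> 'e" where
  "berezin \<alpha> b z = (\<integral>w. (cmod (normalized_kernel \<alpha> z w))\<^sup>2 *\<^sub>R b w \<partial>nu \<alpha>)"

definition BMO1 :: "real \<Rightarrow> (complex ^ 'n \<Rightarrow> 'e::{banach, second_countable_topology}) set" where
  "BMO1 \<alpha> =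
     {b \<in> Lp \<alpha> 1. (SUP z\<in>\<bbbB>. Lp_power \<alpha> 1 (\<lambda>w. b (mobius z w) - berezin \<alpha> b z)) < \<infinity>}"


section \<open>Vector-valued Bergman spaces and Toeplitz operators\<close>

definition holomorphic_ball :: "(complex ^ 'n \<Rightarrow> ell2) \<Rightarrow> bool" where
  "holomorphic_ball f \<longleftrightarrow>
     (\<forall>z\<in>\<bbbB>. \<exists>D. (f has_derivative D) (at z) \<and> (\<forall>c v. D (c *s v) = c *\<^sub>C D v))"

text \<open>
  Elements of the function spaces below are represented by functions on all of \<open>\<complex>\<^sup>n\<close>,
  of which only the restriction to the ball matters.
\<close>

definition Bergman :: "real \<Rightarrow> real \<Rightarrow> (complex ^ 'n \<Rightarrow> ell2) set" where
  "Bergman \<alpha> p = {f \<in> Lp \<alpha> p. holomorphic_ball f}"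

definition Hinf :: "(complex ^ 'n \<Rightarrow> ell2) set" where
  "Hinf = {f. holomorphic_ball f \<and> bounded (f ` \<bbbB>)}"

definition toeplitz ::
    "real \<Rightarrow> (complex ^ 'n \<Rightarrow> ell2 \<Rightarrow>\<^sub>L ell2) \<Rightarrow> (complex ^ 'n \<Rightarrow> ell2) \<Rightarrow> complex ^ 'n \<Rightarrow> ell2" where
  "toeplitz \<alpha> b f z = (\<integral>w. cnj (bergman_kernel \<alpha> z w) *\<^sub>C blinfun_apply (b w) (f w) \<partial>nu \<alpha>)"

text \<open>
  A linear operator on the Bergman space \<open>A\<^sup>2\<close> is compact if it maps bounded sequences to
  sequences with a convergent subsequence; in particular it is then bounded.
\<close>

definition compact_operator_A2 ::
    "real \<Rightarrow> ((complex ^ 'n \<Rightarrow> ell2) \<Rightarrow> (complex ^ 'n \<Rightarrow> ell2)) \<Rightarrow> bool" where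
  "compact_operator_A2 \<alpha> S \<longleftrightarrow>
     (\<forall>f\<in>Bergman \<alpha> 2. S f \<in> Bergman \<alpha> 2) \<and>
     (\<forall>f\<in>Bergman \<alpha> 2. \<forall>g\<in>Bergman \<alpha> 2. \<forall>z\<in>\<bbbB>. S (\<lambda>w. f w + g w) z = S f z + S g z) \<and>
     (\<forall>c. \<forall>f\<in>Bergman \<alpha> 2. \<forall>z\<in>\<bbbB>. S (\<lambda>w. c *\<^sub>C f w) z = c *\<^sub>C S f z) \<and>
     (\<forall>F :: nat \<Rightarrow> complex ^ 'n \<Rightarrow> ell2.
        (\<forall>k. F k \<in> Bergman \<alpha> 2) \<and> bounded (range (\<lambda>k. Lp_norm \<alpha> 2 (F k))) \<longrightarrow>
        (\<exists>g\<in>Bergman \<alpha> 2. \<exists>r. strict_mono r \<and>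
           (\<lambda>k. Lp_norm \<alpha> 2 (\<lambda>z. S (F (r k)) z - g z)) \<longlonglongrightarrow> 0))"

definition toeplitz_compact :: "real \<Rightarrow> (complex ^ 'n \<Rightarrow> ell2 \<Rightarrow>\<^sub>L ell2) \<Rightarrow> bool" where
  "toeplitz_compact \<alpha> b \<longleftrightarrow>
     (\<exists>S. compact_operator_A2 \<alpha> S \<and> (\<forall>f\<in>Hinf. \<forall>z\<in>\<bbbB>. S f z = toeplitz \<alpha> b f z))"

end

theory Submission
  imports Defs "HOL-Complex_Analysis.Complex_Analysis"
begin

text \<open>
  Put \<open>N = n + 1 + \<alpha>\<close> and \<open>H z w = \<integral> \<tau> K\<^sub>z (cnj K\<^sub>w)\<close>, so that \<open>(1 - \<parallel>w\<parallel>\<^sup>2)\<^sup>N H w w\<close> is the Berezin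
  transform of \<open>\<tau>\<close>. Bounded mean oscillation and the decay of the Berezin transform make
  \<open>\<bar>\<tau>\<bar> d\<nu>\<close> a Carleson measure. Pulled back by an automorphism, \<open>H\<close> is holomorphic in one variable and
  antiholomorphic in the other, and the Carleson condition bounds it; a Hadamard-type argument
  therefore carries the smallness of \<open>H\<close> near the boundary from the diagonal to hyperbolic
  neighbourhoods of it, while Forelli--Rudin estimates control the rest. The Schur test then gives
  \<open>\<parallel>T\<^sub>\<tau> u\<parallel>\<^sup>2 \<le> C \<integral> \<parallel>u\<parallel>\<^sup>2 s\<close> with a weight \<open>s\<close> that vanishes at the boundary, so that \<open>T\<^sub>\<tau>\<close> maps
  bounded sequences of holomorphic functions that converge pointwise to 0 to sequences converging to 0
  in norm. Finally \<open>T\<^sub>b = T\<^sub>\<tau> \<circ> D\<close> where \<open>D e\<^sub>i = e\<^sub>i / 2\<^sup>i\<close> is compact on \<open>\<ell>\<^sup>2\<close>: along a subsequence, \<open>D \<circ> f\<^sub>k\<close>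
  converges pointwise on the ball.
\<close>

text \<open>Neither factor of \<open>b\<close> gives compactness alone. For
  \<open>ell2\<close>-valued functions Montel's theorem fails, so the decay of the diagonal entries
  must supply pointwise convergence, while \<open>\<tau>\<close> must supply smallness at the
  boundary. Now \<open>\<tau>\<close> is unbounded and the hypothesis on its Berezin transform is
  about cancellation: a Carleson bound involves the modulus of \<open>\<tau>\<close> and yields
  size, never smallness. The reproducing formula is therefore inserted into \<open>T\<close> before
  any absolute value is taken, so that \<open>\<tau>\<close> enters through \<open>H\<close>, whose
  diagonal the hypothesis controls. Going off the diagonal is possible because a function
  holomorphic in one variable and antiholomorphic in the other is determined by its diagonal; the
  quantitative version needs bounds uniform in z, which the pullback by \<open>mobius z\<close>
  provides. The exponents of the Schur test are fractions of 1 + \<alpha>, the room left by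
  integrability of the weight. Composition with automorphisms and Fubini call for Borel functions,
  whence a Borel representative of \<open>\<tau>\<close> and a Borel version of the measure.\<close>

section \<open>The Hermitian form on complex n-space\<close>

lemma cdot_add_left: "cdot (x + y) z = cdot x z + cdot y z"
  by (simp add: cdot_def algebra_simps sum.distrib)

lemma cdot_diff_left: "cdot (x - y) z = cdot x z - cdot y z"
  by (simp add: cdot_def algebra_simps sum_subtractf)

lemma cdot_scale_left: "cdot (c *s x) z = c * cdot x z"
  by (simp add: cdot_def algebra_simps sum_distrib_left)

lemma cdot_commute: "cdot y x = cnj (cdot x y)"
  by (simp add: cdot_def mult.commute)

lemma cdot_add_right: "cdot z (x + y) = cdot z x + cdot z y"
  by (simp add: cdot_def algebra_simps sum.distrib)

lemma cdot_diff_right: "cdot z (x - y) = cdot z x - cdot z y"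
  by (simp add: cdot_def algebra_simps sum_subtractf)

lemma cdot_scale_right: "cdot z (c *s x) = cnj c * cdot z x"
  by (simp add: cdot_def algebra_simps sum_distrib_left)

lemma scaleR_eq_scale: "r *\<^sub>R (x :: complex ^ 'n) = vector_scalar_mult (complex_of_real r) x"
  by (simp add: vec_eq_iff scaleR_conv_of_real[where 'a = complex])

lemma cdot_scaleR_left: "cdot (r *\<^sub>R x) z = of_real r * cdot x z"
  by (simp only: scaleR_eq_scale cdot_scale_left)

lemma cdot_scaleR_right: "cdot z (r *\<^sub>R x) = of_real r * cdot z x"
  by (simp add: scaleR_eq_scale cdot_scale_right)

lemma cdot_zero [simp]: "cdot 0 z = 0" "cdot z 0 = 0"
  by (simp_all add: cdot_def)

lemma cdot_minus: "cdot (- x) z = - cdot x z" "cdot z (- x) = - cdot z x"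
  by (simp_all add: cdot_def sum_negf)

lemma Re_cdot: "Re (cdot x y) = inner x y"
  by (simp add: cdot_def inner_vec_def inner_complex_def)

lemma cdot_self: "cdot z z = of_real ((norm z)\<^sup>2)"
proof (rule complex_eqI)
  show "Re (cdot z z) = Re (of_real ((norm z)\<^sup>2))"
    by (simp only: Re_cdot Re_complex_of_real power2_norm_eq_inner)
  show "Im (cdot z z) = Im (of_real ((norm z)\<^sup>2))"
    by (simp add: cdot_def)
qed

lemma norm_scale: "norm (c *s (x :: complex ^ 'n)) = cmod c * norm x"
  by (simp add: norm_vec_def L2_set_def norm_mult power_mult_distrib real_sqrt_mult
      flip: sum_distrib_left)

text \<open>A unimodular factor \<open>g\<close> makes the Hermitian product real and nonnegative,
  so that the Cauchy-Schwarz inequality of the underlying real inner product applies.\<close>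

lemma cmod_cdot_le: "cmod (cdot x y) \<le> norm x * norm y"
proof (cases "cdot x y = 0")
  case False
  define g where "g = cnj (sgn (cdot x y))"
  have g: "cmod g = 1" using False by (simp add: g_def norm_sgn)
  have "g * cdot x y = of_real (cmod (cdot x y))"
    using False by (simp add: g_def sgn_eq complex_norm_square [symmetric] power2_eq_square field_simps)
  then have "cmod (cdot x y) = Re (cdot (g *s x) y)"
    by (simp add: cdot_scale_left)
  also have "\<dots> \<le> norm (g *s x) * norm y"
    unfolding Re_cdot by (rule norm_cauchy_schwarz)
  finally show ?thesis by (simp add: norm_scale g)
qed simp

lemma bounded_linear_cdot_left: "bounded_linear (\<lambda>x. cdot x y)"
  by (rule bounded_linear_intro[where K = "norm y"])
     (auto simp: cdot_add_left cdot_scaleR_left cmod_cdot_le scaleR_conv_of_real[where 'a = complex])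

lemma continuous_on_cdot [continuous_intros]:
  assumes "continuous_on S f" "continuous_on S g"
  shows "continuous_on S (\<lambda>x. cdot (f x) (g x))"
  unfolding cdot_def by (intro continuous_intros assms)

text \<open>These bounds keep the base of every kernel power in the open right half-plane, where the
  principal branch is holomorphic and commutes with conjugation, and away from 0 when one argument
  stays in a smaller ball.\<close>

lemma one_minus_cdot_bounds:
  assumes "norm x < 1" "norm y \<le> 1"
  shows "0 < Re (1 - cdot x y)" "0 < Re (1 - cdot y x)" "1 - norm x \<le> cmod (1 - cdot x y)"
    "1 - norm x \<le> cmod (1 - cdot y x)" "1 - cdot x y \<noteq> 0" "1 - cdot y x \<noteq> 0"
proof -
  have *: "cmod (cdot x y) \<le> norm x"
    using cmod_cdot_le[of x y] mult_left_le[OF assms(2) norm_ge_zero[of x]] by linarith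
  have **: "cmod (cdot y x) \<le> norm x"
    using * by (subst cdot_commute) simp
  show R: "0 < Re (1 - cdot x y)" "0 < Re (1 - cdot y x)"
    using * ** assms(1) complex_Re_le_cmod[of "cdot x y"] complex_Re_le_cmod[of "cdot y x"] by auto
  then show "1 - cdot x y \<noteq> 0" "1 - cdot y x \<noteq> 0" by (metis less_irrefl zero_complex.sel(1))+
  show "1 - norm x \<le> cmod (1 - cdot x y)" "1 - norm x \<le> cmod (1 - cdot y x)"
    using * ** norm_triangle_ineq2[of 1 "cdot x y"] norm_triangle_ineq2[of 1 "cdot y x"] by auto
qed

section \<open>The automorphisms of the ball\<close>

lemma mobius_0_left [simp]: "mobius 0 z = - z"
  by (simp add: mobius_def)

text \<open>Write \<open>mobius a z\<close> as (a - A z) / (1 - <z,a>) with A = P + s Q and s^2 = 1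
  - |a|^2, where P and Q are the projections onto the line of a and its complement. Then <A z, a> =
  <z,a> and <A z, A w> = (1 - |a|^2) <z,w> + <z,a> <a,w>, and the expanded numerator
  factors.\<close>

lemma mobius_identity:
  assumes "norm a < 1" "norm z \<le> 1" "norm w \<le> 1"
  shows "1 - cdot (mobius a z) (mobius a w) =
    of_real (1 - (norm a)\<^sup>2) * (1 - cdot z w) / ((1 - cdot z a) * (1 - cdot a w))"
proof (cases "a = 0")
  case False
  define s where "s = sqrt (1 - (norm a)\<^sup>2)"
  have s2: "complex_of_real s * complex_of_real s = 1 - of_real ((norm a)\<^sup>2)"
  proof -
    have "sqrt (1 - (norm a)\<^sup>2) * sqrt (1 - (norm a)\<^sup>2) = 1 - (norm a)\<^sup>2"
      using assms(1) by (simp add: abs_square_le_1)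
    then show ?thesis unfolding s_def by (metis of_real_mult of_real_diff of_real_1)
  qed
  define r where "r = complex_of_real ((norm a)\<^sup>2)"
  have r0: "r \<noteq> 0" using False by (simp add: r_def)
  have raa: "cdot a a = r" by (simp add: r_def cdot_self)
  have d: "1 - cdot z a \<noteq> 0" "1 - cdot a w \<noteq> 0"
    using one_minus_cdot_bounds[OF assms(1)] assms(2,3) by auto
  have cr: "cnj r = r" by (simp add: r_def)
  have caw: "cnj (cdot w a) = cdot a w" by (metis cdot_commute)
  define A where "A = (\<lambda>z. (cdot z a / r) *s a + s *\<^sub>R (z - (cdot z a / r) *s a))"
  have m: "mobius a z = (1 / (1 - cdot z a)) *s (a - A z)" for z
    using False by (simp add: mobius_def Let_def A_def s_def r_def algebra_simps)
  have Az: "cdot (A z) a = cdot z a" for z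
    using r0 by (simp add: A_def cdot_add_left cdot_diff_left cdot_scale_left cdot_scaleR_left raa)
  have Aw: "cdot a (A w) = cdot a w"
    by (metis Az cdot_commute)
  have "cdot (A z) (A w) = cdot z a * cdot a w / r +
     of_real s * of_real s * (cdot z w - cdot z a * cdot a w / r)"
    using r0 by (simp add: A_def cdot_add_left cdot_diff_left cdot_scale_left cdot_scaleR_left raa
      cdot_add_right cdot_diff_right cdot_scale_right cdot_scaleR_right cr caw)
  also have "\<dots> = (1 - r) * cdot z w + cdot z a * cdot a w"
    unfolding s2 r_def[symmetric] using r0 by (simp add: field_simps)
  finally have AA: "cdot (A z) (A w) = (1 - r) * cdot z w + cdot z a * cdot a w" .
  have "cdot (mobius a z) (mobius a w) =
      (r - cdot z a - cdot a w + ((1 - r) * cdot z w + cdot z a * cdot a w)) / ((1 - cdot z a) * (1 - cdot a w))"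
    unfolding m cdot_scale_left cdot_scale_right cdot_diff_left cdot_diff_right raa Az Aw AA
    using d by (simp add: caw divide_simps)
  then show ?thesis using d unfolding r_def[symmetric] of_real_diff of_real_1
    by (simp add: divide_simps) (simp add: algebra_simps)
qed (simp add: cdot_minus)

lemma mobius_0_right [simp]: "mobius a 0 = a"
  by (simp add: mobius_def)

lemma mobius_identity_1:
  assumes "norm a < 1" "norm z \<le> 1"
  shows "1 - cdot (mobius a z) a = of_real (1 - (norm a)\<^sup>2) / (1 - cdot z a)"
  using mobius_identity[OF assms, of 0] by simp

lemma mobius_norm:
  assumes "norm a < 1" "norm z \<le> 1"
  shows "1 - (norm (mobius a z))\<^sup>2 = (1 - (norm a)\<^sup>2) * (1 - (norm z)\<^sup>2) / (cmod (1 - cdot z a))\<^sup>2"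
proof -
  have c: "1 - cdot a z = cnj (1 - cdot z a)" by (subst cdot_commute) simp
  have "complex_of_real (1 - (norm (mobius a z))\<^sup>2) =
     of_real ((1 - (norm a)\<^sup>2) * (1 - (norm z)\<^sup>2) / (cmod (1 - cdot z a))\<^sup>2)"
    using mobius_identity[OF assms(1,2,2)] unfolding c cdot_self complex_norm_square[symmetric] by simp
  then show ?thesis by (simp only: of_real_eq_iff)
qed

lemma norm_mobius_less:
  assumes "norm a < 1" "norm z < 1"
  shows "norm (mobius a z) < 1"
proof -
  have "0 < 1 - (norm (mobius a z))\<^sup>2"
    unfolding mobius_norm[OF assms(1) less_imp_le[OF assms(2)]]
    using assms one_minus_cdot_bounds[OF assms(2), of a]
    by (intro divide_pos_pos mult_pos_pos zero_less_power) (auto simp: abs_square_less_1)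
  then show ?thesis by (simp add: abs_square_less_1)
qed

text \<open>For \<open>y = mobius a z\<close> the preceding identity gives 1 - <y,a> = s^2 / (1 -
  <z,a>); with this the second application becomes a rational identity in each coordinate.\<close>

lemma mobius_involution:
  assumes "norm a < 1" "norm z \<le> 1"
  shows "mobius a (mobius a z) = z"
proof (cases "a = 0")
  case False
  define s where "s = complex_of_real (sqrt (1 - (norm a)\<^sup>2))"
  have s2: "s * s = 1 - of_real ((norm a)\<^sup>2)"
  proof -
    have "sqrt (1 - (norm a)\<^sup>2) * sqrt (1 - (norm a)\<^sup>2) = 1 - (norm a)\<^sup>2"
      using assms(1) by (simp add: abs_square_le_1)
    then show ?thesis unfolding s_def by (metis of_real_mult of_real_diff of_real_1)
  qed
  have s20: "s * s \<noteq> 0" using assms(1) unfolding s2 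
    by (metis abs_square_less_1 abs_norm_cancel less_irrefl of_real_1 of_real_eq_iff right_minus_eq)
  define r where "r = complex_of_real ((norm a)\<^sup>2)"
  have r0: "r \<noteq> 0" using False by (simp add: r_def)
  have raa: "cdot a a = r" by (simp add: r_def cdot_self)
  have d: "1 - cdot z a \<noteq> 0" using one_minus_cdot_bounds[OF assms] by auto
  have m: "mobius a z = (1 / (1 - cdot z a)) *s (a - (cdot z a / r) *s a - s *s (z - (cdot z a / r) *s a))" for z
    using False by (simp add: mobius_def Let_def s_def r_def scaleR_eq_scale)
  define y where "y = mobius a z"
  have y: "1 - cdot y a = s * s / (1 - cdot z a)"
    using mobius_identity_1[OF assms] by (simp add: y_def s2)
  then have cy: "cdot y a = 1 - s * s / (1 - cdot z a)" by (simp add: algebra_simps)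
  have "mobius a y $ i = z $ i" for i
  proof -
    have s2': "s * s = 1 - r" by (simp add: s2 r_def)
    have "mobius a y $ i = ((1 - cdot z a) / (1 - r)) * (a $ i - (cdot y a / r) * a $ i - (s * y $ i - s * (cdot y a / r) * a $ i))"
      unfolding m[of y] y s2' using d by (simp add: algebra_simps)
    also have "s * y $ i = (s * a $ i - s * (cdot z a / r) * a $ i - (s * s) * (z $ i - (cdot z a / r) * a $ i)) / (1 - cdot z a)"
      unfolding y_def m[of z] using d r0 by (simp add: divide_simps) (simp add: algebra_simps)
    finally have e: "mobius a y $ i = ((1 - cdot z a) / (1 - r)) * (a $ i - (cdot y a / r) * a $ i - (((s * a $ i - s * (cdot z a / r) * a $ i - (1 - r) * (z $ i - (cdot z a / r) * a $ i)) / (1 - cdot z a)) - s * (cdot y a / r) * a $ i))"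
      unfolding s2' .
    have r1: "1 - r \<noteq> 0" using s20 s2' by simp
    show ?thesis unfolding e cy s2' using d r0 r1
      by (simp add: divide_simps) (simp add: algebra_simps)
  qed
  then show ?thesis by (simp add: vec_eq_iff y_def)
qed simp

section \<open>Real Jacobians of maps on complex vector spaces\<close>

text \<open>The change of variables theorem of the library lives on \<open>real ^ 'm\<close> with a well-ordered
  index type; \<open>'n bit0\<close> is such a type, of size \<open>2 * CARD('n)\<close>.\<close>

definition basis_enum :: "'n::finite bit0 \<Rightarrow> complex ^ 'n" where
  "basis_enum = (SOME f. bij_betw f UNIV Basis)"

lemma bij_basis_enum: "bij_betw (basis_enum :: 'n::finite bit0 \<Rightarrow> complex ^ 'n) UNIV Basis"
proof -
  have "card (UNIV :: 'n bit0 set) = card (Basis :: (complex ^ 'n) set)"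
    by simp
  then have "\<exists>f :: 'n bit0 \<Rightarrow> complex ^ 'n. bij_betw f UNIV Basis"
    by (intro finite_same_card_bij) auto
  then show ?thesis unfolding basis_enum_def by (rule someI_ex)
qed

lemma basis_enum_in [simp]: "basis_enum k \<in> Basis"
  using bij_basis_enum bij_betwE by blast

lemma inner_basis_enum:
  "inner (basis_enum j :: complex ^ 'n) (basis_enum k) = (if j = k then 1 else 0)"
  using bij_basis_enum[where 'n = 'n, THEN bij_betw_imp_inj_on] by (auto simp: inner_Basis inj_on_eq_iff)

definition of_rvec :: "real ^ ('n::finite bit0) \<Rightarrow> complex ^ 'n" where
  "of_rvec x = (\<Sum>k\<in>UNIV. (x $ k) *\<^sub>R basis_enum k)"

definition to_rvec :: "complex ^ 'n \<Rightarrow> real ^ ('n::finite bit0)" where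
  "to_rvec z = (\<chi> k. inner z (basis_enum k))"

lemma to_of_rvec [simp]: "to_rvec (of_rvec x) = x"
  by (simp add: vec_eq_iff to_rvec_def of_rvec_def inner_sum_left inner_basis_enum if_distrib cong: if_cong)

lemma of_to_rvec [simp]: "of_rvec (to_rvec z) = z"
proof -
  have "of_rvec (to_rvec z) = (\<Sum>b\<in>Basis. inner z b *\<^sub>R b)"
    unfolding of_rvec_def to_rvec_def by (simp add: sum.reindex_bij_betw[OF bij_basis_enum, of "\<lambda>b. inner z b *\<^sub>R b"])
  then show ?thesis by (simp add: euclidean_representation)
qed

lemma linear_of_rvec: "linear of_rvec"
  by (auto intro!: linearI simp: of_rvec_def scaleR_add_left sum.distrib scaleR_sum_right)

lemma linear_to_rvec: "linear to_rvec"
  by (auto intro!: linearI simp: to_rvec_def vec_eq_iff inner_add_left)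

lemma inner_of_rvec: "inner (of_rvec x) (of_rvec y) = inner x y"
proof -
  have "inner (of_rvec x) (of_rvec y) = (\<Sum>k\<in>UNIV. x $ k * y $ k)"
    unfolding of_rvec_def
    by (simp add: mult.commute inner_sum_left inner_sum_right inner_basis_enum if_distrib cong: if_cong)
  then show ?thesis by (simp add: inner_vec_def)
qed

lemma inner_to_rvec: "inner (to_rvec x) (to_rvec y) = inner x y"
  by (metis inner_of_rvec of_to_rvec)

lemma norm_of_rvec [simp]: "norm (of_rvec x) = norm x"
  by (simp add: norm_eq_sqrt_inner inner_of_rvec)

lemma norm_to_rvec [simp]: "norm (to_rvec x) = norm x"
  by (simp add: norm_eq_sqrt_inner inner_to_rvec)

lemma measurable_of_rvec [measurable]: "of_rvec \<in> borel_measurable borel"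
  by (intro borel_measurable_continuous_onI linear_continuous_on linear_conv_bounded_linear[THEN iffD1] linear_of_rvec)

text \<open>Lebesgue measure is determined by boxes, and \<open>of_rvec\<close> matches boxes with
  boxes of the same side lengths because \<open>basis_enum\<close> enumerates
  \<open>Basis\<close>.\<close>

lemma distr_lborel_of_rvec: "distr lborel borel (of_rvec :: _ \<Rightarrow> complex ^ 'n) = lborel"
proof (rule lborel_eqI[symmetric])
  fix l u :: "complex ^ 'n"
  assume le: "\<And>b. b \<in> Basis \<Longrightarrow> inner l b \<le> inner u b"
  have x: "inner (of_rvec x) (basis_enum k) = x $ k" for x :: "real ^ 'n bit0" and k
    by (simp add: of_rvec_def inner_sum_left inner_basis_enum if_distrib cong: if_cong)
  have B: "Basis = range (basis_enum :: 'n bit0 \<Rightarrow> complex ^ 'n)"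
    using bij_basis_enum bij_betw_imp_surj_on by blast
  have "of_rvec -` box l u = box (to_rvec l) (to_rvec u)"
    by (simp add: set_eq_iff mem_box_cart) (simp add: mem_box B x to_rvec_def)
  moreover have "emeasure lborel (box (to_rvec l) (to_rvec u)) = (\<Prod>k\<in>UNIV. inner (u - l) (basis_enum k))"
    using le[OF basis_enum_in]
    by (simp add: emeasure_lborel_box_eq Basis_vec_def cart_eq_inner_axis[symmetric] to_rvec_def
        axis_eq_axis inner_diff_left)
       (auto simp: UNION_singleton_eq_range prod.reindex inj_on_def axis_eq_axis cart_eq_inner_axis[symmetric] intro!: prod.cong)
  ultimately show "emeasure (distr lborel borel of_rvec) (box l u) = (\<Prod>b\<in>Basis. inner (u - l) b)"
    by (simp add: emeasure_distr prod.reindex_bij_betw[OF bij_basis_enum, of "inner (u - l)"])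
qed simp

text \<open>The modulus of the real Jacobian determinant. It is computed below from multiplicativity
  and from three kinds of maps: isometries, homotheties and stretches along one real
  direction.\<close>

definition rdet :: "(complex ^ 'n \<Rightarrow> complex ^ 'n) \<Rightarrow> real" where
  "rdet L = \<bar>det (matrix (to_rvec \<circ> L \<circ> of_rvec))\<bar>"

lemma linear_conj_rvec: "linear L \<Longrightarrow> linear (to_rvec \<circ> L \<circ> of_rvec)"
  by (intro linear_compose linear_of_rvec linear_to_rvec)

lemma rdet_compose:
  assumes "linear L" "linear M"
  shows "rdet (L \<circ> M) = rdet L * rdet M"
proof -
  have "to_rvec \<circ> (L \<circ> M) \<circ> of_rvec = (to_rvec \<circ> L \<circ> of_rvec) \<circ> (to_rvec \<circ> M \<circ> of_rvec)"
    by (simp add: fun_eq_iff)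
  then show ?thesis
    unfolding rdet_def by (simp add: matrix_compose linear_conj_rvec assms det_mul abs_mult)
qed

lemma rdet_isometry:
  assumes "linear L" "\<And>x. norm (L x) = norm x"
  shows "rdet L = 1"
proof -
  have "orthogonal_transformation (to_rvec \<circ> L \<circ> of_rvec)"
    unfolding orthogonal_transformation using assms by (simp add: linear_conj_rvec)
  then have "orthogonal_matrix (matrix (to_rvec \<circ> L \<circ> of_rvec))"
    by (simp add: orthogonal_transformation_matrix)
  then show ?thesis unfolding rdet_def using det_orthogonal_matrix by fastforce
qed

lemma rdet_scaleR: "rdet (\<lambda>x :: complex ^ 'n. c *\<^sub>R x) = \<bar>c\<bar> ^ (2 * CARD('n))"
proof -
  have "to_rvec \<circ> (\<lambda>x :: complex ^ 'n. c *\<^sub>R x) \<circ> of_rvec = (\<lambda>x. c *\<^sub>R x)"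
    by (simp add: fun_eq_iff linear_cmul[OF linear_to_rvec])
  then show ?thesis unfolding rdet_def by (simp add: det_matrix_scaleR power_abs)
qed

text \<open>For a unit vector \<open>u\<close> this multiplies the component along \<open>u\<close>
  by \<open>c\<close> and fixes the orthogonal complement. Stretching a complex line takes two of
  them, along \<open>u\<close> and along \<open>\<i> *s u\<close>.\<close>

definition stretch :: "'a::real_inner \<Rightarrow> real \<Rightarrow> 'a \<Rightarrow> 'a" where
  "stretch u c x = x + ((c - 1) * inner x u) *\<^sub>R u"

lemma linear_stretch: "linear (stretch u c)"
  by (auto intro!: linearI simp: stretch_def algebra_simps inner_add_left)

lemma det_stretch_axis: "det (matrix (stretch (axis k 1 :: real ^ 'm::finite) c)) = c"
proof -
  have "matrix (stretch (axis k 1 :: real ^ 'm) c) $ i $ j = (if i = j then (if i = k then c else 1) else 0)" for i j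
    by (simp add: matrix_def stretch_def inner_axis_axis) (simp add: axis_def)
  then have "det (matrix (stretch (axis k 1 :: real ^ 'm) c)) = (\<Prod>i\<in>UNIV. if i = k then c else 1)"
    by (subst det_diagonal) auto
  then show ?thesis by simp
qed

text \<open>An orthogonal map carrying a coordinate axis to \<open>u\<close> conjugates this to the
  diagonal case.\<close>

lemma det_stretch:
  fixes u :: "real ^ 'm::finite"
  assumes "norm u = 1"
  shows "det (matrix (stretch u c)) = c"
proof -
  obtain k :: 'm where True by simp
  have "norm (axis k 1 :: real ^ 'm) = norm u" using assms by simp
  then obtain O' :: "real ^ 'm \<Rightarrow> real ^ 'm" where O: "orthogonal_transformation O'" "O' (axis k 1) = u"
    by (rule orthogonal_transformation_exists)
  have lin: "linear O'" using O(1) by (simp add: orthogonal_transformation)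
  have "stretch u c \<circ> O' = O' \<circ> stretch (axis k 1) c"
  proof
    fix x
    have "inner (O' x) u = inner x (axis k 1)"
      using O by (metis orthogonal_transformation_def)
    then show "(stretch u c \<circ> O') x = (O' \<circ> stretch (axis k 1) c) x"
      by (simp add: stretch_def linear_add[OF lin] linear_cmul[OF lin] O(2))
  qed
  then have "matrix (stretch u c) ** matrix O' = matrix O' ** matrix (stretch (axis k 1) c)"
    by (metis lin linear_stretch matrix_compose)
  then have "det (matrix (stretch u c)) * det (matrix O') = det (matrix O') * c"
    by (metis det_mul det_stretch_axis)
  moreover have "det (matrix O') \<noteq> 0"
    using O(1) det_orthogonal_matrix[of "matrix O'"] by (auto simp: orthogonal_transformation_matrix)
  ultimately show ?thesis by simp
qed

lemma rdet_stretch: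
  fixes u :: "complex ^ 'n"
  assumes "norm u = 1"
  shows "rdet (stretch u c) = \<bar>c\<bar>"
proof -
  have "to_rvec \<circ> stretch u c \<circ> of_rvec = stretch (to_rvec u) c"
  proof
    fix x
    have "inner (of_rvec x) u = inner x (to_rvec u)"
      by (metis inner_of_rvec of_to_rvec)
    then show "(to_rvec \<circ> stretch u c \<circ> of_rvec) x = stretch (to_rvec u) c x"
      by (simp add: stretch_def linear_add[OF linear_to_rvec] linear_cmul[OF linear_to_rvec])
  qed
  then show ?thesis unfolding rdet_def by (simp add: det_stretch assms)
qed

section \<open>The change of variables formula\<close>

text \<open>Transport by \<open>of_rvec\<close>, which preserves Lebesgue measure, reduces the claim
  to real coordinates. Boundedness of the image makes its measure a real number, so that the gauge
  integral of the Jacobian can be turned into a nonnegative Lebesgue integral.\<close>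

lemma emeasure_image_rdet:
  fixes f :: "complex ^ 'n \<Rightarrow> complex ^ 'n"
  assumes S: "S \<in> sets borel" and fS: "f ` S \<in> sets borel" "bounded (f ` S)" and inj: "inj_on f S"
    and f': "\<And>x. x \<in> S \<Longrightarrow> (f has_derivative f' x) (at x within S)"
    and J: "\<And>x. x \<in> S \<Longrightarrow> rdet (f' x) = J x" and [measurable]: "J \<in> borel_measurable borel"
  shows "emeasure lborel (f ` S) = (\<integral>\<^sup>+ x. ennreal (J x) * indicator S x \<partial>lborel)"
proof -
  note [measurable] = S fS(1)
  define T where "T = to_rvec ` S"
  have T: "T = of_rvec -` S" unfolding T_def by (auto simp: image_iff) (metis to_of_rvec)
  define g where "g = to_rvec \<circ> f \<circ> of_rvec"
  have gT: "g ` T = of_rvec -` (f ` S)"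
    unfolding T_def g_def by (auto simp: image_iff) (metis to_of_rvec)
  have [measurable]: "T \<in> sets borel"
    unfolding T by (rule measurable_sets_borel[OF measurable_of_rvec S])
  have [measurable]: "g ` T \<in> sets borel"
    unfolding gT by (rule measurable_sets_borel[OF measurable_of_rvec fS(1)])
  have bdd: "bounded (g ` T)"
    using fS(2) unfolding gT bounded_iff by (metis norm_of_rvec vimageD)
  have lm: "g ` T \<in> lmeasurable"
    by (intro bounded_set_imp_lmeasurable bdd) auto
  have der: "(g has_derivative (to_rvec \<circ> f' (of_rvec x) \<circ> of_rvec)) (at x within T)" if "x \<in> T" for x
  proof -
    have "of_rvec ` T = S" unfolding T_def by force
    moreover have "of_rvec x \<in> S" using that T by auto
    ultimately have *: "(f has_derivative f' (of_rvec x)) (at (of_rvec x) within of_rvec ` T)"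
      using f' by simp
    have "(f \<circ> of_rvec has_derivative f' (of_rvec x) \<circ> of_rvec) (at x within T)"
      by (rule diff_chain_within[OF linear_imp_has_derivative[OF linear_of_rvec] *])
    from diff_chain_within[OF this linear_imp_has_derivative[OF linear_to_rvec]]
    show ?thesis by (simp add: g_def o_assoc)
  qed
  have injg: "inj_on g T"
    unfolding g_def T_def using inj by (auto simp: inj_on_def) (metis of_to_rvec)
  have TL: "T \<in> sets lebesgue" by simp
  have "((\<lambda>x. \<bar>det (matrix (to_rvec \<circ> f' (of_rvec x) \<circ> of_rvec))\<bar>) has_integral measure lebesgue (g ` T)) T"
    using has_measure_differentiable_image[OF TL der injg, of "measure lebesgue (g ` T)"] lm by simp
  then have "((\<lambda>x. J (of_rvec x)) has_integral measure lebesgue (g ` T)) T"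
    by (rule has_integral_eq[rotated]) (simp add: J[symmetric] T rdet_def)
  then have I: "(\<integral>\<^sup>+ x. ennreal (J (of_rvec x)) * indicator T x \<partial>lborel) = ennreal (measure lebesgue (g ` T))"
    by (rule nn_integral_has_integral_lebesgue'[rotated]) (simp add: T J[symmetric] rdet_def)
  have "emeasure lborel (f ` S) = emeasure lborel (g ` T)"
    by (subst distr_lborel_of_rvec[symmetric], subst emeasure_distr) (auto simp: gT)
  also have "\<dots> = ennreal (measure lebesgue (g ` T))"
    using emeasure_eq_measure2[OF lm] by simp
  also have "\<dots> = (\<integral>\<^sup>+ x. ennreal (J x) * indicator S x \<partial>lborel)"
  proof -
    have "(\<integral>\<^sup>+ x. ennreal (J x) * indicator S x \<partial>lborel) =
        (\<integral>\<^sup>+ x. ennreal (J x) * indicator S x \<partial>distr lborel borel of_rvec)"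
      by (simp add: distr_lborel_of_rvec)
    also have "\<dots> = (\<integral>\<^sup>+ x. ennreal (J (of_rvec x)) * indicator T x \<partial>lborel)"
      by (subst nn_integral_distr) (auto simp: T indicator_def)
    finally show ?thesis using I by simp
  qed
  finally show ?thesis .
qed

text \<open>It is an identity between the image of a density and the measure restricted to the image
  of \<open>S\<close>. On a Borel set \<open>A\<close> it follows from the volume formula for
  \<open>S\<close> cut by the preimage of \<open>A\<close>, whose image is the image of
  \<open>S\<close> cut by \<open>A\<close>.\<close>

lemma nn_integral_rdet:
  fixes f :: "complex ^ 'n \<Rightarrow> complex ^ 'n"
  assumes S[measurable]: "S \<in> sets borel" and fS[measurable]: "f ` S \<in> sets borel" and bdd: "bounded (f ` S)" and inj: "inj_on f S"
    and fm[measurable]: "f \<in> borel_measurable borel"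
    and f': "\<And>x. x \<in> S \<Longrightarrow> (f has_derivative f' x) (at x within S)"
    and J: "\<And>x. x \<in> S \<Longrightarrow> rdet (f' x) = J x" and [measurable]: "J \<in> borel_measurable borel"
    and [measurable]: "h \<in> borel_measurable borel"
  shows "(\<integral>\<^sup>+ x. ennreal (J x) * indicator S x * h (f x) \<partial>lborel) = (\<integral>\<^sup>+ x. indicator (f ` S) x * h x \<partial>lborel)"
proof -
  have "distr (density lborel (\<lambda>x. ennreal (J x) * indicator S x)) borel f = density lborel (indicator (f ` S))"
  proof (rule measure_eqI)
    fix A assume "A \<in> sets (distr (density lborel (\<lambda>x. ennreal (J x) * indicator S x)) borel f)"
    then have A[measurable]: "A \<in> sets borel" by simp
    have im: "f ` (S \<inter> f -` A) = f ` S \<inter> A" by auto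
    have "emeasure (distr (density lborel (\<lambda>x. ennreal (J x) * indicator S x)) borel f) A =
        (\<integral>\<^sup>+ x. ennreal (J x) * indicator S x * indicator (f -` A) x \<partial>lborel)"
      using measurable_sets_borel[OF fm A] by (simp add: emeasure_distr emeasure_density)
    also have "\<dots> = (\<integral>\<^sup>+ x. ennreal (J x) * indicator (S \<inter> f -` A) x \<partial>lborel)"
      by (intro nn_integral_cong) (auto simp: indicator_def)
    also have "\<dots> = emeasure lborel (f ` (S \<inter> f -` A))"
    proof (rule emeasure_image_rdet[symmetric])
      show "(f has_derivative f' x) (at x within S \<inter> f -` A)" if "x \<in> S \<inter> f -` A" for x
        using f' that by (blast intro: has_derivative_subset)
      show "bounded (f ` (S \<inter> f -` A))"
        using bdd by (rule bounded_subset) auto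
      show "S \<inter> f -` A \<in> sets borel" by measurable
      show "f ` (S \<inter> f -` A) \<in> sets borel" unfolding im by measurable
      show "inj_on f (S \<inter> f -` A)" using inj by (rule inj_on_subset) auto
    qed (use J in auto)
    also have "\<dots> = emeasure (density lborel (indicator (f ` S))) A"
      unfolding im by (simp add: emeasure_density nn_integral_indicator flip: indicator_inter_arith)
    finally show "emeasure (distr (density lborel (\<lambda>x. ennreal (J x) * indicator S x)) borel f) A =
       emeasure (density lborel (indicator (f ` S))) A" .
  qed simp
  then have "(\<integral>\<^sup>+ x. h x \<partial>distr (density lborel (\<lambda>x. ennreal (J x) * indicator S x)) borel f) =
      (\<integral>\<^sup>+ x. h x \<partial>density lborel (indicator (f ` S)))" by simp
  then show ?thesis
    by (simp add: nn_integral_distr nn_integral_density)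
qed

section \<open>The Jacobian of the automorphisms\<close>

lemma bounded_bilinear_scale: "bounded_bilinear (\<lambda>c (x :: complex ^ 'n). c *s x)"
proof (rule bounded_bilinear.intro)
  show "\<exists>K. \<forall>c (x :: complex ^ 'n). norm (c *s x) \<le> norm c * norm x * K"
    by (rule exI[of _ 1]) (simp add: norm_scale)
qed (simp_all add: vec_eq_iff algebra_simps)

lemma continuous_on_scale [continuous_intros]:
  fixes g :: "'a::topological_space \<Rightarrow> complex ^ 'n"
  assumes "continuous_on S f" "continuous_on S g"
  shows "continuous_on S (\<lambda>x. f x *s g x)"
  using bounded_bilinear.continuous_on[OF bounded_bilinear_scale assms] .

text \<open>The map P + sqrt (1 - |a|^2) Q, with P the projection onto the line of a and Q = I - P.
  It is the identity for \<open>a = 0\<close>, which makes \<open>mobius_eq\<close> valid without a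
  case distinction.\<close>

definition mobius_linear :: "complex ^ 'n \<Rightarrow> complex ^ 'n \<Rightarrow> complex ^ 'n" where
  "mobius_linear a z = (if a = 0 then z else
     (cdot z a / of_real ((norm a)\<^sup>2)) *s a +
     sqrt (1 - (norm a)\<^sup>2) *\<^sub>R (z - (cdot z a / of_real ((norm a)\<^sup>2)) *s a))"

lemma mobius_eq: "mobius a z = inverse (1 - cdot z a) *s (a - mobius_linear a z)"
proof (cases "a = 0")
  case False
  then show ?thesis by (simp add: mobius_def mobius_linear_def Let_def divide_inverse diff_diff_eq)
qed (simp add: mobius_linear_def)

lemma linear_mobius_linear: "linear (mobius_linear a)"
  by (auto intro!: linearI
      simp: mobius_linear_def cdot_add_left cdot_scaleR_left vec_eq_iff algebra_simps add_divide_distrib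
        scaleR_conv_of_real[where 'a = complex])

lemma mobius_has_derivative:
  assumes "1 - cdot z a \<noteq> 0"
  shows "(mobius a has_derivative (\<lambda>v. inverse (1 - cdot z a) *s (- mobius_linear a v) +
     (inverse (1 - cdot z a) * cdot v a * inverse (1 - cdot z a)) *s (a - mobius_linear a z))) (at z)"
proof -
  have 1: "((\<lambda>z. inverse (1 - cdot z a)) has_derivative
      (\<lambda>v. inverse (1 - cdot z a) * cdot v a * inverse (1 - cdot z a))) (at z)"
    using assms
    by (auto intro!: derivative_eq_intros bounded_linear_imp_has_derivative[OF bounded_linear_cdot_left])
  have 2: "((\<lambda>z. a - mobius_linear a z) has_derivative (\<lambda>v. - mobius_linear a v)) (at z)"
    by (auto intro!: derivative_eq_intros linear_imp_has_derivative[OF linear_mobius_linear])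
  show ?thesis
    unfolding mobius_eq[abs_def] using bounded_bilinear.FDERIV[OF bounded_bilinear_scale 1 2] .
qed

lemma mobius_differentiable:
  assumes "norm a < 1" "norm z \<le> 1"
  shows "(mobius a has_derivative frechet_derivative (mobius a) (at z)) (at z)"
proof -
  have "1 - cdot z a \<noteq> 0" using one_minus_cdot_bounds(6)[OF assms] .
  from mobius_has_derivative[OF this] show ?thesis
    unfolding frechet_derivative_works[symmetric] by (rule differentiableI)
qed

lemma borel_measurable_cdot [measurable (raw)]:
  assumes [measurable]: "f \<in> borel_measurable M" "g \<in> borel_measurable M"
  shows "(\<lambda>x. cdot (f x) (g x)) \<in> borel_measurable M"
proof -
  have "(\<lambda>p. cdot (fst p) (snd p)) \<in> borel_measurable (borel :: ((complex ^ 'b) \<times> (complex ^ 'b)) measure)"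
    by (intro borel_measurable_continuous_onI continuous_intros)
  from measurable_compose[OF _ this, of "\<lambda>x. (f x, g x)" M] show ?thesis
    by (simp add: borel_prod[symmetric])
qed

lemma borel_measurable_scale [measurable (raw)]:
  fixes g :: "'a \<Rightarrow> complex ^ 'n"
  assumes [measurable]: "f \<in> borel_measurable M" "g \<in> borel_measurable M"
  shows "(\<lambda>x. f x *s g x) \<in> borel_measurable M"
proof -
  have "(\<lambda>p. fst p *s snd p) \<in> borel_measurable (borel :: (complex \<times> (complex ^ 'n)) measure)"
    by (intro borel_measurable_continuous_onI continuous_intros)
  from measurable_compose[OF _ this, of "\<lambda>x. (f x, g x)" M] show ?thesis
    by (simp add: borel_prod[symmetric])
qed

lemma borel_measurable_mobius_linear: "mobius_linear a \<in> borel_measurable borel"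
  by (intro borel_measurable_continuous_onI linear_continuous_on
      linear_conv_bounded_linear[THEN iffD1] linear_mobius_linear)

lemma borel_measurable_mobius [measurable (raw)]: 
  assumes [measurable]: "f \<in> borel_measurable M"
  shows "(\<lambda>x. mobius a (f x)) \<in> borel_measurable M"
proof -
  note [measurable] = measurable_compose[OF assms borel_measurable_mobius_linear]
  show ?thesis unfolding mobius_eq by measurable
qed

definition mobius_jac :: "complex ^ 'n \<Rightarrow> complex ^ 'n \<Rightarrow> real" where
  "mobius_jac a z = rdet (frechet_derivative (mobius a) (at z))"

text \<open>With s^2 = 1 - |a|^2 the derivative at the origin is - s (s P + Q). The homothety
  contributes s^(2n) and the stretch of the complex line of a, of real dimension two, contributes
  s^2.\<close>

lemma mobius_jac_0:
  fixes a :: "complex ^ 'n"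
  assumes a: "norm a < 1"
  shows "mobius_jac a 0 = (1 - (norm a)\<^sup>2) ^ (CARD('n) + 1)"
proof -
  have "(mobius a has_derivative (\<lambda>v. - mobius_linear a v + cdot v a *s (a - mobius_linear a 0))) (at 0)"
    using mobius_has_derivative[of 0 a] by simp
  then have D: "frechet_derivative (mobius a) (at 0) = (\<lambda>v. - mobius_linear a v + cdot v a *s a)"
    using frechet_derivative_at by (fastforce simp: linear_0[OF linear_mobius_linear])
  define s where "s = sqrt (1 - (norm a)\<^sup>2)"
  have s0: "s \<ge> 0" and s2: "s\<^sup>2 = 1 - (norm a)\<^sup>2"
    using a by (auto simp: s_def abs_square_le_1)
  have "rdet (\<lambda>v. - mobius_linear a v + cdot v a *s a) = s ^ (2 * CARD('n) + 2)"
  proof (cases "a = 0")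
    case True
    have "rdet (\<lambda>v :: complex ^ 'n. (-1) *\<^sub>R v) = 1"
      unfolding rdet_scaleR by simp
    then show ?thesis using True by (simp add: mobius_linear_def s_def)
  next
    case False
    define u where "u = (1 / of_real (norm a)) *s a"
    have nu: "norm u = 1" using False by (simp add: u_def norm_scale norm_divide)
    have niu: "norm (\<i> *s u) = 1" by (simp add: norm_scale nu)
    have i1: "inner v u = Re (cdot v u)" for v by (simp add: Re_cdot)
    have i2: "inner v (\<i> *s u) = Im (cdot v u)" for v by (simp add: Re_cdot[symmetric] cdot_scale_right)
    have uu: "cdot u u = 1" by (simp add: cdot_self nu)
    \<comment> \<open>The real projections onto \<open>u\<close> and \<open>\<i> *s u\<close> add up
      to the complex projection onto the line of \<open>u\<close>.\<close>
    have P: "inner v u *\<^sub>R u + inner v (\<i> *s u) *\<^sub>R (\<i> *s u) = cdot v u *s u" for v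
    proof -
      have "cdot v u *s u = (of_real (Re (cdot v u)) + \<i> * of_real (Im (cdot v u))) *s u"
        by (rule arg_cong[where f = "\<lambda>c. c *s u", OF complex_eq])
      then show ?thesis unfolding i1 i2 
        by (simp add: vec_eq_iff algebra_simps scaleR_conv_of_real[where 'a = complex])
    qed
    have aeq: "a = of_real (norm a) *s u" and na: "norm a \<noteq> 0"
      using False by (simp_all add: u_def vector_smult_assoc)
    have ca: "cdot v a = of_real (norm a) * cdot v u" for v
      by (subst aeq) (simp add: cdot_scale_right)
    have au: "cdot v a *s a = (of_real ((norm a)\<^sup>2) * cdot v u) *s u" for v
      by (subst aeq) (simp add: ca vector_smult_assoc power2_eq_square mult_ac)
    have Pa: "(cdot v a / of_real ((norm a)\<^sup>2)) *s a = cdot v u *s u" for v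
      using na by (subst aeq) (simp add: ca vector_smult_assoc power2_eq_square mult_ac)
    have S: "stretch u s (stretch (\<i> *s u) s v) = v + (s - 1) *\<^sub>R (cdot v u *s u)" for v
    proof -
      have "inner (\<i> *s u) u = 0" by (simp add: i1 cdot_scale_left uu)
      then show ?thesis unfolding P[symmetric] stretch_def inner_add_left
        by (simp add: scaleR_add_right)
    qed
    have "(\<lambda>v. - mobius_linear a v + cdot v a *s a) =
        (\<lambda>v. (- s) *\<^sub>R v) \<circ> (stretch u s \<circ> stretch (\<i> *s u) s)"
    proof
      fix v
      have "complex_of_real ((norm a)\<^sup>2) = complex_of_real (1 - s * s)"
        using s2 by (simp add: power2_eq_square)
      then have au': "cdot v a *s a = ((1 - of_real s * of_real s) * cdot v u) *s u"
        unfolding au by simp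
      have ml: "mobius_linear a v = cdot v u *s u + s *\<^sub>R (v - cdot v u *s u)"
        using False unfolding mobius_linear_def Pa s_def by simp
      show "- mobius_linear a v + cdot v a *s a =
          ((\<lambda>v. (- s) *\<^sub>R v) \<circ> (stretch u s \<circ> stretch (\<i> *s u) s)) v"
        unfolding o_def S au' ml
        by (simp add: vec_eq_iff scaleR_conv_of_real[where 'a = complex]) (simp add: algebra_simps)
    qed
    note E = this
    have "rdet (\<lambda>v. - mobius_linear a v + cdot v a *s a) = s ^ (2 * CARD('n)) * (s * s)"
      using s0 unfolding E rdet_compose[OF linear_scale_self linear_compose[OF linear_stretch linear_stretch]]
          rdet_compose[OF linear_stretch linear_stretch] rdet_stretch[OF nu] rdet_stretch[OF niu] rdet_scaleR
      by simp
    then show ?thesis by (simp add: power_add power2_eq_square)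
  qed
  also have "\<dots> = (s\<^sup>2) ^ (CARD('n) + 1)" unfolding power_mult[symmetric] by simp
  finally show ?thesis by (simp add: mobius_jac_def D s2)
qed

lemma linear_frechet_mobius:
  assumes "norm a < 1" "norm z \<le> 1"
  shows "linear (frechet_derivative (mobius a) (at z))"
  using mobius_differentiable[OF assms] has_derivative_linear by blast

text \<open>This is the chain rule for the involution at the origin, which \<open>mobius b\<close>
  exchanges with b.\<close>

lemma mobius_jac_inverse:
  fixes b :: "complex ^ 'n"
  assumes b: "norm b < 1"
  shows "mobius_jac b b * mobius_jac b 0 = 1"
proof -
  have "((mobius b \<circ> mobius b) has_derivative
      (frechet_derivative (mobius b) (at b) \<circ> frechet_derivative (mobius b) (at 0))) (at 0)"
    using diff_chain_at[OF mobius_differentiable[OF b, of 0], of "mobius b"]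
      mobius_differentiable[OF b, of b] b by simp
  moreover have "((mobius b \<circ> mobius b) has_derivative id) (at 0)"
    by (rule has_derivative_transform_within_open[OF has_derivative_id, where s = "ball 0 1"])
       (use mobius_involution[OF b] in auto)
  ultimately have "frechet_derivative (mobius b) (at b) \<circ> frechet_derivative (mobius b) (at 0) = id"
    by (rule has_derivative_unique)
  moreover have "rdet (id :: complex ^ 'n \<Rightarrow> complex ^ 'n) = 1" by (rule rdet_isometry) (auto simp: linear_id)
  moreover have "rdet (frechet_derivative (mobius b) (at b) \<circ> frechet_derivative (mobius b) (at 0)) =
      mobius_jac b b * mobius_jac b 0"
    unfolding mobius_jac_def using b by (intro rdet_compose linear_frechet_mobius) auto
  ultimately show ?thesis by simp
qed

text \<open>With \<open>b = mobius a z\<close>, the composition of the automorphisms of \<open>z\<close>, \<open>a\<close> and \<open>b\<close> fixes the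
  origin, so it is an isometry; this reduces the Jacobian at \<open>z\<close> to Jacobians at the origin.\<close>

lemma mobius_jac_eq:
  fixes a z :: "complex ^ 'n"
  assumes a: "norm a < 1" and z: "norm z < 1"
  shows "mobius_jac a z = ((1 - (norm a)\<^sup>2) / (cmod (1 - cdot z a))\<^sup>2) ^ (CARD('n) + 1)"
proof -
  define b where "b = mobius a z"
  have b: "norm b < 1" unfolding b_def by (rule norm_mobius_less[OF a z])
  define U where "U = mobius b \<circ> (mobius a \<circ> mobius z)"
  have U0: "U 0 = 0"
    using mobius_involution[OF b, of 0] by (simp add: U_def b_def)
  \<comment> \<open>The formula for 1 - |mobius|^2 is applied three times; the denominators cancel
    against each other by the identities for \<open>P\<close> and
    \<open>1 - cdot y z\<close>.\<close>
  have nU: "norm (U x) = norm x" if x: "norm x < 1" for x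
  proof -
    define y where "y = mobius z x"
    have y: "norm y < 1" unfolding y_def by (rule norm_mobius_less[OF z x])
    define w where "w = mobius a y"
    have w: "norm w < 1" unfolding w_def by (rule norm_mobius_less[OF a y])
    have Ux: "U x = mobius b w" by (simp add: U_def y_def w_def)
    have le: "norm x \<le> 1" "norm y \<le> 1" "norm w \<le> 1" "norm z \<le> 1" "norm b \<le> 1" "norm a \<le> 1"
      using x y w z b a by auto
    define P where "P = 1 - cdot w b"
    define Q where "Q = 1 - cdot y a"
    define R where "R = 1 - cdot x z"
    have eP: "P = of_real (1 - (norm a)\<^sup>2) * (1 - cdot y z) / (Q * (1 - cdot a z))"
      using mobius_identity[OF a le(2,4)] by (simp add: P_def Q_def w_def b_def)
    have eyz: "1 - cdot y z = of_real (1 - (norm z)\<^sup>2) / R"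
      using mobius_identity_1[OF z le(1)] by (simp add: R_def y_def)
    have nz: "R \<noteq> 0" "Q \<noteq> 0" "1 - cdot a z \<noteq> 0"
      using one_minus_cdot_bounds[OF z le(1)] one_minus_cdot_bounds[OF a le(2)] 
        one_minus_cdot_bounds[OF a le(4)] by (auto simp: R_def Q_def)
    have pos: "1 - (norm a)\<^sup>2 > 0" "1 - (norm z)\<^sup>2 > 0" "1 - (norm b)\<^sup>2 > 0"
      using a z b by (auto simp: abs_square_less_1)
    have "cmod P = (1 - (norm a)\<^sup>2) * (1 - (norm z)\<^sup>2) / (cmod R * cmod Q * cmod (1 - cdot a z))"
      using pos by (simp add: eP eyz norm_mult norm_divide del: of_real_diff)
    also have "cmod (1 - cdot a z) = cmod (1 - cdot z a)"
      by (subst cdot_commute) (metis complex_cnj_diff complex_cnj_one complex_mod_cnj)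
    finally have cP: "cmod P = (1 - (norm a)\<^sup>2) * (1 - (norm z)\<^sup>2) / (cmod R * cmod Q * cmod (1 - cdot z a))" .
    have nz': "cmod (1 - cdot z a) \<noteq> 0" using one_minus_cdot_bounds[OF z le(6)] by simp
    have "1 - (norm (U x))\<^sup>2 = (1 - (norm b)\<^sup>2) * (1 - (norm w)\<^sup>2) / (cmod P)\<^sup>2"
      using mobius_norm[OF b le(3)] by (simp add: Ux P_def)
    also have "1 - (norm w)\<^sup>2 = (1 - (norm a)\<^sup>2) * (1 - (norm y)\<^sup>2) / (cmod Q)\<^sup>2"
      using mobius_norm[OF a le(2)] by (simp add: w_def Q_def)
    also have "1 - (norm y)\<^sup>2 = (1 - (norm z)\<^sup>2) * (1 - (norm x)\<^sup>2) / (cmod R)\<^sup>2"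
      using mobius_norm[OF z le(1)] by (simp add: y_def R_def)
    also have "1 - (norm b)\<^sup>2 = (1 - (norm a)\<^sup>2) * (1 - (norm z)\<^sup>2) / (cmod (1 - cdot z a))\<^sup>2"
      using mobius_norm[OF a le(4)] by (simp add: b_def)
    finally have "1 - (norm (U x))\<^sup>2 = 1 - (norm x)\<^sup>2"
      unfolding cP using nz nz' pos by (simp add: power_divide power_mult_distrib) (simp add: divide_simps power2_eq_square)
    then show ?thesis by simp
  qed
  define D where "D = frechet_derivative (mobius b) (at b) \<circ> (frechet_derivative (mobius a) (at z) \<circ> frechet_derivative (mobius z) (at 0))"
  have UD: "(U has_derivative D) (at 0)"
    unfolding U_def D_def
    using mobius_differentiable[OF z, of 0] mobius_differentiable[OF a, of z] mobius_differentiable[OF b, of b] z b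
    by (intro diff_chain_at) (auto simp: b_def)
  have lin: "linear D" using UD has_derivative_linear by blast
  \<comment> \<open>The derivative inherits norm preservation: |h| times the gap between |v| and |D
    v| is at most |U (h v) - D (h v)|, which is o(h).\<close>
  have nD: "norm (D v) = norm v" for v
  proof (cases "v = 0")
    case False
    have "(U has_derivative D) (at (0 *\<^sub>R v))" using UD by simp
    then have "(U has_derivative D) (at (0 *\<^sub>R v) within (\<lambda>t. t *\<^sub>R v) ` UNIV)"
      by (rule has_derivative_at_withinI)
    moreover have "((\<lambda>t :: real. t *\<^sub>R v) has_derivative (\<lambda>t. t *\<^sub>R v)) (at 0 within UNIV)"
      by (auto intro!: derivative_eq_intros)
    ultimately have "((U \<circ> (\<lambda>t. t *\<^sub>R v)) has_derivative (D \<circ> (\<lambda>t. t *\<^sub>R v))) (at 0 within UNIV)"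
      by (intro diff_chain_within)
    then have lim: "((\<lambda>h :: real. norm (U (h *\<^sub>R v) - D (h *\<^sub>R v)) / norm h) \<longlongrightarrow> 0) (at 0)"
      by (simp add: has_derivative_at U0)
    have "\<forall>\<^sub>F h :: real in at 0. \<bar>norm v - norm (D v)\<bar> \<le> norm (U (h *\<^sub>R v) - D (h *\<^sub>R v)) / norm h"
      unfolding eventually_at
    proof (intro exI[of _ "1 / norm v"] conjI ballI impI)
      fix h :: real assume h: "h \<noteq> 0 \<and> dist h 0 < 1 / norm v"
      then have "norm (h *\<^sub>R v) < 1" using False by (simp add: field_simps)
      from nU[OF this] have "\<bar>h\<bar> * \<bar>norm v - norm (D v)\<bar> = \<bar>norm (U (h *\<^sub>R v)) - norm (D (h *\<^sub>R v))\<bar>"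
        by (simp add: linear_cmul[OF lin] abs_mult[symmetric] right_diff_distrib[symmetric] del: abs_mult)
      also have "\<dots> \<le> norm (U (h *\<^sub>R v) - D (h *\<^sub>R v))" by (rule norm_triangle_ineq3)
      finally show "\<bar>norm v - norm (D v)\<bar> \<le> norm (U (h *\<^sub>R v) - D (h *\<^sub>R v)) / norm h"
        using h by (simp add: field_simps)
    qed (use False in auto)
    from tendsto_lowerbound[OF lim this] show ?thesis by simp
  qed (simp add: linear_0[OF lin])
  have "rdet D = 1" by (rule rdet_isometry[OF lin nD])
  moreover have "rdet D = mobius_jac b b * (mobius_jac a z * mobius_jac z 0)"
  proof -
    have l: "linear (frechet_derivative (mobius b) (at b))" "linear (frechet_derivative (mobius a) (at z))"
      "linear (frechet_derivative (mobius z) (at 0))"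
      using z b a by (auto intro!: linear_frechet_mobius)
    show ?thesis
      unfolding D_def mobius_jac_def rdet_compose[OF l(1) linear_compose[OF l(3,2)]] rdet_compose[OF l(2,3)] ..
  qed
  ultimately have 1: "mobius_jac b b * (mobius_jac a z * mobius_jac z 0) = 1" by simp
  \<comment> \<open>Both the product of three Jacobians and the product
    \<open>mobius_jac b b * mobius_jac b 0\<close> are 1; eliminating \<open>mobius_jac b b\<close>
    leaves Jacobians at the origin on all sides but one.\<close>
  have "mobius_jac b 0 = (mobius_jac b b * mobius_jac b 0) * (mobius_jac a z * mobius_jac z 0)"
    using 1 by (metis mult.commute mult.left_commute mult.right_neutral)
  then have "mobius_jac a z * mobius_jac z 0 = mobius_jac b 0"
    by (simp add: mobius_jac_inverse[OF b])
  then have e: "mobius_jac a z * (1 - (norm z)\<^sup>2) ^ (CARD('n) + 1) = (1 - (norm b)\<^sup>2) ^ (CARD('n) + 1)"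
    by (simp only: mobius_jac_0 z b)
  have pos: "1 - (norm z)\<^sup>2 > 0" using z by (auto simp: abs_square_less_1)
  have "mobius_jac a z = ((1 - (norm b)\<^sup>2) / (1 - (norm z)\<^sup>2)) ^ (CARD('n) + 1)"
    unfolding power_divide e[symmetric] using pos by simp
  also have "(1 - (norm b)\<^sup>2) / (1 - (norm z)\<^sup>2) = (1 - (norm a)\<^sup>2) / (cmod (1 - cdot z a))\<^sup>2"
    using mobius_norm[OF a less_imp_le[OF z]] pos by (simp add: b_def)
  finally show ?thesis .
qed

section \<open>The weighted measure on the ball\<close>

lemma dyadic_bracket:
  fixes y :: real
  assumes "0 < y" "y \<le> 1"
  obtains k :: nat where "(1/2) ^ Suc k < y" "y \<le> (1/2) ^ k"
proof -
  obtain m where m: "(1/2) ^ m < y" using real_arch_pow_inv[of y "1/2"] assms by auto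
  define k where "k = (LEAST k. (1/2 :: real) ^ Suc k < y)"
  have ex: "(1/2 :: real) ^ Suc m < y" using m assms by simp
  have 1: "(1/2) ^ Suc k < y" unfolding k_def by (rule LeastI[of "\<lambda>k. (1/2 :: real) ^ Suc k < y", OF ex])
  have 2: "y \<le> (1/2) ^ k"
  proof (cases k)
    case (Suc j)
    then have "\<not> (1/2 :: real) ^ Suc j < y" unfolding k_def by (intro not_less_Least) auto
    then show ?thesis using Suc by simp
  qed (use assms in simp)
  show ?thesis by (rule that[OF 1 2])
qed

text \<open>Bernoulli's inequality, 1 - (1 - t)^d \<le> d t for t = 2^(-k), with d the real
  dimension.\<close>

lemma emeasure_annulus_le:
  fixes k :: nat
  shows "emeasure lborel (ball (0 :: 'a::euclidean_space) 1 - ball 0 (1 - (1/2) ^ k)) \<le>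
    ennreal (measure lborel (ball (0 :: 'a) 1) * (DIM('a) * (1/2) ^ k))"
proof -
  define r :: real where "r = 1 - (1/2) ^ k"
  have r: "0 \<le> r" "r \<le> 1" by (auto simp: r_def power_le_one)
  have "emeasure lborel (ball (0 :: 'a) 1 - ball 0 r) = emeasure lborel (ball (0 :: 'a) 1) - emeasure lborel (ball (0 :: 'a) r)"
    using r emeasure_bounded_finite[of "ball (0 :: 'a) r"] by (intro emeasure_Diff) auto
  also have "\<dots> = ennreal (measure lborel (ball (0 :: 'a) 1)) - ennreal (measure lborel (ball (0 :: 'a) r))"
    using emeasure_bounded_finite[of "ball (0 :: 'a) r"] emeasure_bounded_finite[of "ball (0 :: 'a) 1"]
    by (simp add: emeasure_eq_ennreal_measure)
  also have "\<dots> = ennreal (measure lborel (ball (0 :: 'a) 1) * (1 - r ^ DIM('a)))"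
    unfolding content_ball_conv_unit_ball[of r "0 :: 'a", OF r(1)] by (subst ennreal_minus) (auto simp: algebra_simps r(1))
  also have "\<dots> \<le> ennreal (measure lborel (ball (0 :: 'a) 1) * (DIM('a) * (1/2) ^ k))"
  proof (intro ennreal_leI mult_left_mono)
    have "1 + real DIM('a) * (- ((1/2) ^ k)) \<le> (1 + - ((1/2) ^ k)) ^ DIM('a)"
      by (rule Bernoulli_inequality) (simp add: power_le_one)
    then show "1 - r ^ DIM('a) \<le> real DIM('a) * (1/2) ^ k" by (simp add: r_def)
  qed simp
  finally show ?thesis by (simp add: r_def)
qed

lemma pred_mem_ball [measurable]: "Measurable.pred borel (\<lambda>x :: 'a::euclidean_space. x \<in> ball a r)"
proof -
  have "ball a r \<in> sets (borel :: 'a measure)" by simp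
  then show ?thesis unfolding pred_def by simp
qed

text \<open>For \<alpha> < 0 the ball is covered according to the dyadic size of 1 - |z|. The shell
  of thickness 2^(-k) has volume O(2^(-k)) and the weight there is O(2^(-k \<alpha>)), which gives a
  geometric series of ratio 2^(-(1 + \<alpha>)) < 1.\<close>

lemma nn_integral_weight_finite:
  fixes \<alpha> :: real
  assumes "\<alpha> > -1"
  shows "(\<integral>\<^sup>+ z. ennreal (indicator (ball (0 :: 'a::euclidean_space) 1) z * (1 - (norm z)\<^sup>2) powr \<alpha>) \<partial>lborel) < \<infinity>"
proof (cases "\<alpha> \<ge> 0")
  case True
  have "(\<integral>\<^sup>+ z. ennreal (indicator (ball (0 :: 'a) 1) z * (1 - (norm z)\<^sup>2) powr \<alpha>) \<partial>lborel) \<le>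
      (\<integral>\<^sup>+ z. indicator (ball (0 :: 'a) 1) z \<partial>lborel)"
  proof (rule nn_integral_mono)
    fix z :: 'a
    have "z \<in> ball 0 1 \<Longrightarrow> (1 - (norm z)\<^sup>2) powr \<alpha> \<le> 1 powr \<alpha>"
      using True by (intro powr_mono2) (auto simp: abs_square_le_1 less_imp_le)
    then show "ennreal (indicator (ball 0 1) z * (1 - (norm z)\<^sup>2) powr \<alpha>) \<le> indicator (ball 0 1) z"
      by (auto simp: indicator_def ennreal_le_1)
  qed
  also have "\<dots> < \<infinity>" using emeasure_bounded_finite[of "ball (0 :: 'a) 1"] by simp
  finally show ?thesis .
next
  case False
  define V where "V = measure lborel (ball (0 :: 'a) 1)"
  define S where "S = (\<lambda>k. ball (0 :: 'a) 1 - ball 0 (1 - (1/2) ^ k))"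
  define c where "c = (\<lambda>k :: nat. ((1/2 :: real) ^ Suc k) powr \<alpha>)"
  have "(\<integral>\<^sup>+ z. ennreal (indicator (ball (0 :: 'a) 1) z * (1 - (norm z)\<^sup>2) powr \<alpha>) \<partial>lborel) \<le>
      (\<integral>\<^sup>+ z. (\<Sum>k. ennreal (c k) * indicator (S k) z) \<partial>lborel)"
  proof (rule nn_integral_mono)
    fix z :: 'a
    show "ennreal (indicator (ball 0 1) z * (1 - (norm z)\<^sup>2) powr \<alpha>) \<le> (\<Sum>k. ennreal (c k) * indicator (S k) z)"
    proof (cases "z \<in> ball 0 1")
      case True
      then have z: "0 < 1 - norm z" "1 - norm z \<le> 1" by auto
      obtain k where k: "(1/2) ^ Suc k < 1 - norm z" "1 - norm z \<le> (1/2) ^ k"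
        using dyadic_bracket[OF z] .
      have "1 - norm z \<le> 1 - (norm z)\<^sup>2"
        using z by (simp add: power2_eq_square mult_left_le)
      then have "(1 - (norm z)\<^sup>2) powr \<alpha> \<le> c k"
        unfolding c_def using k(1) False by (intro powr_mono2') auto
      moreover have "z \<in> S k" using k(2) True by (auto simp: S_def)
      ultimately have "ennreal (indicator (ball 0 1) z * (1 - (norm z)\<^sup>2) powr \<alpha>) \<le> ennreal (c k) * indicator (S k) z"
        using True by (simp add: ennreal_leI)
      also have "\<dots> = sum (\<lambda>j. ennreal (c j) * indicator (S j) z) {k}" by (simp only: sum.insert_remove finite.emptyI) simp
      also have "\<dots> \<le> (\<Sum>k. ennreal (c k) * indicator (S k) z)" by (rule sum_le_suminf) auto
      finally show ?thesis .
    qed simp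
  qed
  also have "\<dots> = (\<Sum>k. ennreal (c k) * emeasure lborel (S k))"
    by (subst nn_integral_suminf) (auto simp: S_def nn_integral_cmult)
  also have "\<dots> \<le> (\<Sum>k. ennreal (2 powr (-\<alpha>) * V * DIM('a) * ((1/2) powr (1 + \<alpha>)) ^ k))"
  proof (intro suminf_le summableI)
    fix k
    have "ennreal (c k) * emeasure lborel (S k) \<le> ennreal (c k) * ennreal (V * (DIM('a) * (1/2) ^ k))"
      unfolding S_def V_def by (intro mult_left_mono emeasure_annulus_le) auto
    also have "\<dots> = ennreal (c k * (V * (DIM('a) * (1/2) ^ k)))"
      by (simp add: ennreal_mult V_def c_def)
    also have "c k * (V * (DIM('a) * (1/2) ^ k)) = 2 powr (-\<alpha>) * V * DIM('a) * ((1/2) powr (1 + \<alpha>)) ^ k"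
    proof -
      have "c k = (1/2) powr (real (Suc k) * \<alpha>)"
        unfolding c_def by (subst powr_realpow[symmetric]) (simp_all add: powr_powr)
      also have "\<dots> = 2 powr (-\<alpha>) * ((1/2) powr \<alpha>) ^ k"
        by (simp add: algebra_simps powr_add powr_powr powr_minus powr_divide flip: powr_realpow) (simp add: divide_inverse)
      finally show ?thesis by (simp add: powr_add power_mult_distrib power_divide)
    qed
    finally show "ennreal (c k) * emeasure lborel (S k) \<le> ennreal (2 powr (-\<alpha>) * V * DIM('a) * ((1/2) powr (1 + \<alpha>)) ^ k)" .
  qed
  also have "\<dots> < \<infinity>"
  proof -
    have "(1/2 :: real) powr (1 + \<alpha>) < (1/2) powr 0"
      using assms by (intro powr_less_mono') auto
    then have "summable (\<lambda>k. 2 powr (-\<alpha>) * V * DIM('a) * ((1/2) powr (1 + \<alpha>)) ^ k)"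
      by (intro summable_mult summable_geometric) auto
    then have "(\<Sum>k. ennreal (2 powr (-\<alpha>) * V * DIM('a) * ((1/2) powr (1 + \<alpha>)) ^ k)) =
        ennreal (\<Sum>k. 2 powr (-\<alpha>) * V * DIM('a) * ((1/2) powr (1 + \<alpha>)) ^ k)"
      by (intro suminf_ennreal2) (auto simp: V_def)
    then show ?thesis by simp
  qed
  finally show ?thesis .
qed

section \<open>The Borel version of the measure and its total mass\<close>

definition bweight :: "'n::finite itself \<Rightarrow> real \<Rightarrow> complex ^ 'n \<Rightarrow> real" where
  "bweight _ \<alpha> z = indicator (ball 0 1) z * (c_const TYPE('n) \<alpha> * (1 - (norm z)\<^sup>2) powr \<alpha>)"

text \<open>The restriction of \<open>nu\<close> to the Borel sets, extended by zero off the ball.\<close>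

definition bnu :: "real \<Rightarrow> (complex ^ 'n) measure" where
  "bnu \<alpha> = density lborel (\<lambda>z. ennreal (bweight TYPE('n) \<alpha> z))"

lemma space_bnu [simp]: "space (bnu \<alpha>) = UNIV" and sets_bnu [simp, measurable_cong]: "sets (bnu \<alpha>) = sets borel"
  by (simp_all add: bnu_def)

lemma bweight_measurable [measurable]: "bweight TYPE('n::finite) \<alpha> \<in> borel_measurable borel"
  unfolding bweight_def[abs_def] by measurable

lemma integrable_weight:
  fixes \<alpha> :: real
  assumes "\<alpha> > -1"
  shows "integrable lborel (\<lambda>z :: 'a::euclidean_space. indicator (ball 0 1) z * (1 - (norm z)\<^sup>2) powr \<alpha>)"
  using nn_integral_weight_finite[OF assms, where 'a = 'a]
  by (intro integrableI_nonneg) auto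

lemma c_const_eq:
  "c_const TYPE('n::finite) \<alpha> = 1 / (\<integral>z. indicator (ball 0 1) z * (1 - (norm z)\<^sup>2) powr \<alpha> \<partial>(lborel :: (complex ^ 'n) measure))"
proof -
  have "integral\<^sup>L (lebesgue_on (ball 0 1 :: (complex ^ 'n) set)) (\<lambda>z. (1 - (norm z)\<^sup>2) powr \<alpha>) =
      integral\<^sup>L lebesgue (\<lambda>z :: complex ^ 'n. indicator (ball 0 1) z *\<^sub>R (1 - (norm z)\<^sup>2) powr \<alpha>)"
    by (rule integral_restrict_space) simp
  also have "\<dots> = integral\<^sup>L lborel (\<lambda>z :: complex ^ 'n. indicator (ball 0 1) z *\<^sub>R (1 - (norm z)\<^sup>2) powr \<alpha>)"
    by (rule integral_completion) simp
  finally show ?thesis by (simp add: c_const_def)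
qed

lemma c_const_pos:
  assumes "\<alpha> > -1"
  shows "c_const TYPE('n::finite) \<alpha> > 0"
proof -
  let ?f = "\<lambda>z :: complex ^ 'n. indicator (ball 0 1) z * (1 - (norm z)\<^sup>2) powr \<alpha>"
  have "integral\<^sup>L lborel ?f \<noteq> 0"
  proof
    assume "integral\<^sup>L lborel ?f = 0"
    then have "AE z in lborel. ?f z = 0"
      using integral_nonneg_eq_0_iff_AE[OF integrable_weight[OF assms, where 'a = "complex ^ 'n"]] by simp
    then have "AE z in lborel. z \<notin> ball (0 :: complex ^ 'n) 1"
      by eventually_elim (auto simp: indicator_def abs_square_eq_1 split: if_splits)
    then have "ball (0 :: complex ^ 'n) 1 \<in> null_sets lborel"
      by (subst (asm) AE_iff_null_sets[symmetric]) auto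
    then have "measure lborel (ball (0 :: complex ^ 'n) 1) = 0"
      by (simp add: null_sets_def measure_def)
    then show False using content_ball_pos[of 1 "0 :: complex ^ 'n"] by simp
  qed
  moreover have "integral\<^sup>L lborel ?f \<ge> 0" by (intro Bochner_Integration.integral_nonneg) auto
  ultimately show ?thesis unfolding c_const_eq by (simp only: zero_less_divide_1_iff)
qed

lemma bweight_nonneg: "\<alpha> > -1 \<Longrightarrow> bweight TYPE('n::finite) \<alpha> z \<ge> 0"
  using c_const_pos[of \<alpha>, where 'n = 'n] by (auto simp: bweight_def)

lemma emeasure_bnu_UNIV:
  assumes "\<alpha> > -1"
  shows "emeasure (bnu \<alpha> :: (complex ^ 'n) measure) UNIV = 1"
proof -
  let ?f = "\<lambda>z :: complex ^ 'n. indicator (ball 0 1) z * (1 - (norm z)\<^sup>2) powr \<alpha>"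
  have "emeasure (bnu \<alpha> :: (complex ^ 'n) measure) UNIV = (\<integral>\<^sup>+ z. ennreal (c_const TYPE('n) \<alpha> * ?f z) \<partial>lborel)"
    unfolding bnu_def by (simp add: emeasure_density bweight_def mult_ac)
  also have "\<dots> = ennreal (\<integral>z. c_const TYPE('n) \<alpha> * ?f z \<partial>lborel)"
    using c_const_pos[OF assms, where 'n = 'n] integrable_weight[OF assms, where 'a = "complex ^ 'n"]
    by (intro nn_integral_eq_integral) auto
  also have "(\<integral>z. c_const TYPE('n) \<alpha> * ?f z \<partial>lborel) = 1"
    using c_const_pos[OF assms, where 'n = 'n] by (simp add: c_const_eq)
  finally show ?thesis by simp
qed

lemma AE_bnu_ball: "AE z in (bnu \<alpha> :: (complex ^ 'n) measure). z \<in> ball 0 1"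
proof -
  have "AE z in lborel. 0 < ennreal (bweight TYPE('n) \<alpha> z) \<longrightarrow> z \<in> ball 0 1"
    by (intro AE_I2) (auto simp: bweight_def indicator_def)
  then show ?thesis unfolding bnu_def by (subst AE_density) auto
qed

section \<open>Comparison of \<open>nu\<close> with \<open>bnu\<close>\<close>

lemma nn_integral_bnu:
  fixes f :: "complex ^ 'n \<Rightarrow> ennreal"
  assumes [measurable]: "f \<in> borel_measurable borel"
  shows "(\<integral>\<^sup>+ z. f z \<partial>bnu \<alpha>) = (\<integral>\<^sup>+ z. ennreal (bweight TYPE('n) \<alpha> z) * f z \<partial>lborel)"
  unfolding bnu_def by (simp add: nn_integral_density)

lemma nn_integral_nu_lebesgue:
  fixes f :: "complex ^ 'n \<Rightarrow> ennreal"
  assumes [measurable]: "f \<in> borel_measurable (lebesgue_on (ball 0 1))"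
  shows "(\<integral>\<^sup>+ z. f z \<partial>nu \<alpha>) = (\<integral>\<^sup>+ z. ennreal (bweight TYPE('n) \<alpha> z) * f z \<partial>lebesgue)"
proof -
  have [measurable]: "(\<lambda>z. (1 - (norm z)\<^sup>2) powr \<alpha>) \<in> borel_measurable (lebesgue_on (ball 0 1 :: (complex ^ 'n) set))"
    by (intro measurable_restrict_space1 measurable_completion) simp
  have "(\<integral>\<^sup>+ z. f z \<partial>nu \<alpha>) =
      (\<integral>\<^sup>+ z. ennreal (c_const TYPE('n) \<alpha> * (1 - (norm z)\<^sup>2) powr \<alpha>) * f z \<partial>lebesgue_on (ball 0 1))"
    unfolding nu_def by (rule nn_integral_density) measurable
  also have "\<dots> = (\<integral>\<^sup>+ z. ennreal (c_const TYPE('n) \<alpha> * (1 - (norm z)\<^sup>2) powr \<alpha>) * f z * indicator (ball 0 1) z \<partial>lebesgue)"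
    by (rule nn_integral_restrict_space) simp
  also have "\<dots> = (\<integral>\<^sup>+ z. ennreal (bweight TYPE('n) \<alpha> z) * f z \<partial>lebesgue)"
    by (intro nn_integral_cong) (auto simp: bweight_def indicator_def)
  finally show ?thesis .
qed

lemma nn_integral_nu:
  fixes f :: "complex ^ 'n \<Rightarrow> ennreal"
  assumes [measurable]: "f \<in> borel_measurable borel"
  shows "(\<integral>\<^sup>+ z. f z \<partial>nu \<alpha>) = (\<integral>\<^sup>+ z. f z \<partial>bnu \<alpha>)"
proof -
  have "f \<in> borel_measurable (lebesgue_on (ball 0 1))"
    by (intro measurable_restrict_space1 measurable_completion) simp
  then show ?thesis
    by (simp add: nn_integral_nu_lebesgue nn_integral_bnu nn_integral_completion)
qed

text \<open>The density of \<open>nu\<close> is positive on the ball, so its null sets are those of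
  Lebesgue measure there.\<close>

lemma AE_nu_iff:
  fixes P :: "complex ^ 'n \<Rightarrow> bool"
  assumes "\<alpha> > -1"
  shows "(AE z in nu \<alpha>. P z) \<longleftrightarrow> (AE z in lebesgue. z \<in> ball 0 1 \<longrightarrow> P z)"
proof -
  have [measurable]: "(\<lambda>z. (1 - (norm z)\<^sup>2) powr \<alpha>) \<in> borel_measurable (lebesgue_on (ball 0 1 :: (complex ^ 'n) set))"
    by (intro measurable_restrict_space1 measurable_completion) simp
  have "(AE z in nu \<alpha>. P z) \<longleftrightarrow> 
     (AE z in lebesgue_on (ball 0 1). 0 < ennreal (c_const TYPE('n) \<alpha> * (1 - (norm z)\<^sup>2) powr \<alpha>) \<longrightarrow> P z)"
    unfolding nu_def by (rule AE_density) measurable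
  also have "\<dots> \<longleftrightarrow> (AE z in lebesgue. z \<in> ball 0 1 \<longrightarrow> 0 < ennreal (c_const TYPE('n) \<alpha> * (1 - (norm z)\<^sup>2) powr \<alpha>) \<longrightarrow> P z)"
    by (rule AE_restrict_space_iff) simp
  also have "\<dots> \<longleftrightarrow> (AE z in lebesgue. z \<in> ball 0 1 \<longrightarrow> P z)"
    using c_const_pos[OF assms, where 'n = 'n]
    by (intro AE_cong) (auto simp: abs_square_eq_1 abs_square_less_1)
  finally show ?thesis .
qed

lemma sets_nu [measurable_cong]: "sets (nu \<alpha>) = sets (lebesgue_on (ball 0 1))"
  by (simp add: nu_def)

lemma space_nu: "space (nu \<alpha>) = ball 0 1"
  by (simp add: nu_def space_restrict_space)

lemma measurable_nu_borel: "f \<in> borel_measurable borel \<Longrightarrow> f \<in> borel_measurable (nu \<alpha>)"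
  unfolding measurable_cong_sets[OF sets_nu refl] by (intro measurable_restrict_space1 measurable_completion) simp

lemma integral_nu:
  fixes f :: "complex ^ 'n \<Rightarrow> 'b::{banach, second_countable_topology}"
  assumes \<alpha>: "\<alpha> > -1" and f[measurable]: "f \<in> borel_measurable borel"
  shows "integral\<^sup>L (nu \<alpha>) f = integral\<^sup>L (bnu \<alpha>) f"
proof -
  have [measurable]: "f \<in> borel_measurable (lebesgue_on (ball 0 1))" 
    "(\<lambda>z. (1 - (norm z)\<^sup>2) powr \<alpha>) \<in> borel_measurable (lebesgue_on (ball 0 1 :: (complex ^ 'n) set))"
    by (auto intro!: measurable_restrict_space1 measurable_completion)
  have "integral\<^sup>L (nu \<alpha>) f = (\<integral>z. (c_const TYPE('n) \<alpha> * (1 - (norm z)\<^sup>2) powr \<alpha>) *\<^sub>R f z \<partial>lebesgue_on (ball 0 1))"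
    unfolding nu_def using c_const_pos[OF \<alpha>, where 'n = 'n] by (intro integral_density) auto
  also have "\<dots> = (\<integral>z. indicator (ball 0 1) z *\<^sub>R (c_const TYPE('n) \<alpha> * (1 - (norm z)\<^sup>2) powr \<alpha>) *\<^sub>R f z \<partial>lebesgue)"
    by (rule integral_restrict_space) simp
  also have "\<dots> = (\<integral>z. bweight TYPE('n) \<alpha> z *\<^sub>R f z \<partial>lebesgue)"
    by (simp add: bweight_def)
  also have "\<dots> = (\<integral>z. bweight TYPE('n) \<alpha> z *\<^sub>R f z \<partial>lborel)"
    by (rule integral_completion) simp
  also have "\<dots> = integral\<^sup>L (bnu \<alpha>) f"
    unfolding bnu_def using bweight_nonneg[OF \<alpha>] by (intro integral_density[symmetric]) auto
  finally show ?thesis .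
qed

section \<open>Change of variables for the weighted measure\<close>

text \<open>This is the squared modulus of the normalized kernel at a. It is also the density that
  the substitution by \<open>mobius a\<close> produces, which is why a Berezin transform at a is a
  plain average after composition with \<open>mobius a\<close>.\<close>

definition mobius_density :: "real \<Rightarrow> complex ^ 'n \<Rightarrow> complex ^ 'n \<Rightarrow> real" where
  "mobius_density \<alpha> a w = ((1 - (norm a)\<^sup>2) / (cmod (1 - cdot w a))\<^sup>2) powr (real CARD('n) + 1 + \<alpha>)"

lemma mobius_density_measurable [measurable (raw)]:
  assumes [measurable]: "f \<in> borel_measurable M" "g \<in> borel_measurable M"
  shows "(\<lambda>x. mobius_density \<alpha> (f x) (g x)) \<in> borel_measurable M"
  unfolding mobius_density_def[abs_def] by (intro powr_real_measurable) measurable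

lemma mobius_density_nonneg [simp]: "mobius_density \<alpha> a w \<ge> 0"
  by (simp add: mobius_density_def)

lemma mobius_image_ball:
  fixes a :: "complex ^ 'n"
  assumes "norm a < 1"
  shows "mobius a ` ball 0 1 = ball 0 1"
proof
  show "mobius a ` ball 0 1 \<subseteq> ball 0 1" using norm_mobius_less[OF assms] by auto
  show "ball 0 1 \<subseteq> mobius a ` ball 0 1"
  proof
    fix y :: "complex ^ 'n" assume "y \<in> ball 0 1"
    then have "norm y < 1" by simp
    then show "y \<in> mobius a ` ball 0 1"
      using mobius_involution[OF assms, of y] norm_mobius_less[OF assms, of y]
      by (intro image_eqI[of y "mobius a" "mobius a y"]) auto
  qed
qed

lemma inj_on_mobius: "norm a < 1 \<Longrightarrow> inj_on (mobius a) (ball 0 1)"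
  by (rule inj_on_inverseI[of _ "mobius a"]) (simp add: mobius_involution less_imp_le)

text \<open>With K = (1 - |a|^2) / |1 - <w,a>|^2 the Jacobian contributes K^(n+1), and the weight at
  the image point is K^\<alpha> times the weight at w because 1 - |mobius a w|^2 = K (1 -
  |w|^2).\<close>

lemma nn_integral_bnu_mobius:
  fixes h :: "complex ^ 'n \<Rightarrow> ennreal"
  assumes \<alpha>: "\<alpha> > -1" and a: "norm a < 1" and [measurable]: "h \<in> borel_measurable borel"
  shows "(\<integral>\<^sup>+ w. ennreal (mobius_density \<alpha> a w) * h (mobius a w) \<partial>bnu \<alpha>) = (\<integral>\<^sup>+ w. h w \<partial>bnu \<alpha>)"
proof -
  define J where "J = (\<lambda>w :: complex ^ 'n. ((1 - (norm a)\<^sup>2) / (cmod (1 - cdot w a))\<^sup>2) ^ (CARD('n) + 1))"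
  have [measurable]: "J \<in> borel_measurable borel" unfolding J_def by measurable
  have "(\<integral>\<^sup>+ w. h w \<partial>bnu \<alpha>) = (\<integral>\<^sup>+ w. ennreal (bweight TYPE('n) \<alpha> w) * h w \<partial>lborel)"
    by (simp add: nn_integral_bnu)
  also have "\<dots> = (\<integral>\<^sup>+ w. indicator (mobius a ` ball 0 1) w * (ennreal (bweight TYPE('n) \<alpha> w) * h w) \<partial>lborel)"
    unfolding mobius_image_ball[OF a] by (intro nn_integral_cong) (auto simp: bweight_def indicator_def)
  also have "\<dots> = (\<integral>\<^sup>+ w. ennreal (J w) * indicator (ball 0 1) w * (ennreal (bweight TYPE('n) \<alpha> (mobius a w)) * h (mobius a w)) \<partial>lborel)"
  proof (rule nn_integral_rdet[symmetric, where f' = "\<lambda>z. frechet_derivative (mobius a) (at z)"])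
    show "(mobius a has_derivative frechet_derivative (mobius a) (at x)) (at x within ball 0 1)"
      if "x \<in> ball 0 1" for x
      using mobius_differentiable[OF a, of x] that by (auto intro: has_derivative_at_withinI)
    show "rdet (frechet_derivative (mobius a) (at x)) = J x" if "x \<in> ball 0 1" for x
      using mobius_jac_eq[OF a, of x] that by (simp add: J_def mobius_jac_def)
  qed (auto simp: mobius_image_ball[OF a] inj_on_mobius[OF a])
  also have "\<dots> = (\<integral>\<^sup>+ w. ennreal (bweight TYPE('n) \<alpha> w) * (ennreal (mobius_density \<alpha> a w) * h (mobius a w)) \<partial>lborel)"
  proof (rule nn_integral_cong)
    fix w :: "complex ^ 'n"
    show "ennreal (J w) * indicator (ball 0 1) w * (ennreal (bweight TYPE('n) \<alpha> (mobius a w)) * h (mobius a w)) =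
        ennreal (bweight TYPE('n) \<alpha> w) * (ennreal (mobius_density \<alpha> a w) * h (mobius a w))"
    proof (cases "w \<in> ball 0 1")
      case True
      then have w: "norm w < 1" by simp
      define K where "K = (1 - (norm a)\<^sup>2) / (cmod (1 - cdot w a))\<^sup>2"
      have K: "K > 0" using one_minus_cdot_bounds[OF w less_imp_le[OF a]] a
        by (auto simp: K_def abs_square_less_1)
      have 1: "1 - (norm (mobius a w))\<^sup>2 = K * (1 - (norm w)\<^sup>2)"
        using mobius_norm[OF a less_imp_le[OF w]] by (simp add: K_def)
      have "J w = K powr (real CARD('n) + 1)"
        using K powr_realpow[of K "CARD('n) + 1"] by (simp add: J_def K_def add.commute)
      then have "J w * bweight TYPE('n) \<alpha> (mobius a w) = bweight TYPE('n) \<alpha> w * mobius_density \<alpha> a w"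
        using True norm_mobius_less[OF a w] w K unfolding bweight_def mobius_density_def 1 K_def[symmetric]
        by (simp add: powr_mult abs_square_le_1 powr_add)
      moreover have "J w \<ge> 0" "bweight TYPE('n) \<alpha> (mobius a w) \<ge> 0" "bweight TYPE('n) \<alpha> w \<ge> 0"
        using bweight_nonneg[OF \<alpha>] K unfolding J_def K_def[symmetric] by auto
      ultimately have "ennreal (J w) * ennreal (bweight TYPE('n) \<alpha> (mobius a w)) =
          ennreal (bweight TYPE('n) \<alpha> w) * ennreal (mobius_density \<alpha> a w)"
        by (simp flip: ennreal_mult)
      then show ?thesis using True by (simp add: mult.assoc[symmetric])
    qed (simp add: bweight_def)
  qed
  also have "\<dots> = (\<integral>\<^sup>+ w. ennreal (mobius_density \<alpha> a w) * h (mobius a w) \<partial>bnu \<alpha>)"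
    by (simp add: nn_integral_bnu)
  finally show ?thesis by simp
qed

text \<open>Stated for measures, the substitution rule carries over to Bochner integrals,
  integrability included.\<close>

lemma distr_mobius:
  fixes a :: "complex ^ 'n"
  assumes \<alpha>: "\<alpha> > -1" and a: "norm a < 1"
  shows "distr (density (bnu \<alpha>) (\<lambda>w. ennreal (mobius_density \<alpha> a w))) borel (mobius a) = bnu \<alpha>"
proof (rule measure_eqI)
  fix A assume "A \<in> sets (distr (density (bnu \<alpha>) (\<lambda>w. ennreal (mobius_density \<alpha> a w))) borel (mobius a))"
  then have A[measurable]: "A \<in> sets borel" by simp
  have m: "mobius a -` A \<in> sets borel"
    by (rule measurable_sets_borel[OF _ A]) measurable
  have "emeasure (distr (density (bnu \<alpha>) (\<lambda>w. ennreal (mobius_density \<alpha> a w))) borel (mobius a)) A =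
      (\<integral>\<^sup>+ w. ennreal (mobius_density \<alpha> a w) * indicator A (mobius a w) \<partial>bnu \<alpha>)"
    using m by (subst emeasure_distr) (auto simp: emeasure_density indicator_vimage[symmetric] indicator_def intro!: nn_integral_cong)
  also have "\<dots> = emeasure (bnu \<alpha>) A"
    by (subst nn_integral_bnu_mobius[OF \<alpha> a]) auto
  finally show "emeasure (distr (density (bnu \<alpha>) (\<lambda>w. ennreal (mobius_density \<alpha> a w))) borel (mobius a)) A = emeasure (bnu \<alpha>) A" .
qed simp

lemma integral_bnu_mobius:
  fixes f :: "complex ^ 'n \<Rightarrow> 'b::{banach, second_countable_topology}"
  assumes \<alpha>: "\<alpha> > -1" and a: "norm a < 1" and f[measurable]: "f \<in> borel_measurable borel"
  shows "integrable (bnu \<alpha>) (\<lambda>w. mobius_density \<alpha> a w *\<^sub>R f (mobius a w)) \<longleftrightarrow> integrable (bnu \<alpha>) f"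
    and "(\<integral>w. mobius_density \<alpha> a w *\<^sub>R f (mobius a w) \<partial>bnu \<alpha>) = (\<integral>w. f w \<partial>bnu \<alpha>)"
proof -
  have "(\<integral>w. f w \<partial>bnu \<alpha>) = (\<integral>w. f w \<partial>distr (density (bnu \<alpha>) (\<lambda>w. ennreal (mobius_density \<alpha> a w))) borel (mobius a))"
    by (simp add: distr_mobius[OF \<alpha> a])
  also have "\<dots> = (\<integral>w. mobius_density \<alpha> a w *\<^sub>R f (mobius a w) \<partial>bnu \<alpha>)"
    by (subst integral_distr, measurable) (subst integral_density, auto)
  finally show "(\<integral>w. mobius_density \<alpha> a w *\<^sub>R f (mobius a w) \<partial>bnu \<alpha>) = (\<integral>w. f w \<partial>bnu \<alpha>)" ..
  have "integrable (bnu \<alpha>) f \<longleftrightarrow>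
      integrable (distr (density (bnu \<alpha>) (\<lambda>w. ennreal (mobius_density \<alpha> a w))) borel (mobius a)) f"
    by (simp add: distr_mobius[OF \<alpha> a])
  also have "\<dots> \<longleftrightarrow> integrable (bnu \<alpha>) (\<lambda>w. mobius_density \<alpha> a w *\<^sub>R f (mobius a w))"
    by (subst integrable_distr_eq, measurable) (subst integrable_density, auto)
  finally show "integrable (bnu \<alpha>) (\<lambda>w. mobius_density \<alpha> a w *\<^sub>R f (mobius a w)) \<longleftrightarrow> integrable (bnu \<alpha>) f" ..
qed

text \<open>A unimodular scalar acts as an isometry with Jacobian 1, and the weight is radial. The
  invariance is what turns integrals over the ball into circle averages.\<close>

lemma distr_rotation:
  assumes g: "cmod g = 1"
  shows "distr (bnu \<alpha>) borel (\<lambda>w :: complex ^ 'n. g *s w) = bnu \<alpha>"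
proof (rule measure_eqI)
  fix A assume "A \<in> sets (distr (bnu \<alpha>) borel (\<lambda>w :: complex ^ 'n. g *s w))"
  then have A[measurable]: "A \<in> sets borel" by simp
  have lin: "linear (\<lambda>w :: complex ^ 'n. g *s w)"
    by (auto intro!: linearI simp: vec_eq_iff algebra_simps)
  have g0: "g \<noteq> 0" using g by auto
  have im: "(\<lambda>w :: complex ^ 'n. g *s w) ` ball 0 1 = ball 0 1"
  proof
    show "(\<lambda>w :: complex ^ 'n. g *s w) ` ball 0 1 \<subseteq> ball 0 1" using g by (auto simp: norm_scale)
    show "ball 0 1 \<subseteq> (\<lambda>w :: complex ^ 'n. g *s w) ` ball 0 1"
    proof
      fix y :: "complex ^ 'n" assume "y \<in> ball 0 1"
      then show "y \<in> (\<lambda>w :: complex ^ 'n. g *s w) ` ball 0 1"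
        using g g0 by (intro image_eqI[of _ _ "inverse g *s y"]) (auto simp: vector_smult_assoc norm_scale norm_inverse)
    qed
  qed
  have m: "(\<lambda>w :: complex ^ 'n. g *s w) -` A \<in> sets borel"
    by (rule measurable_sets_borel[OF _ A]) measurable
  have "emeasure (distr (bnu \<alpha>) borel (\<lambda>w :: complex ^ 'n. g *s w)) A = (\<integral>\<^sup>+ w. indicator A (g *s w) \<partial>bnu \<alpha>)"
    using m by (subst emeasure_distr) (auto simp: indicator_vimage[symmetric] nn_integral_indicator[symmetric] indicator_def simp del: nn_integral_indicator intro!: nn_integral_cong)
  also have "\<dots> = (\<integral>\<^sup>+ w. ennreal 1 * indicator (ball 0 1) w * (ennreal (bweight TYPE('n) \<alpha> (g *s w)) * indicator A (g *s w)) \<partial>lborel)"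
    by (subst nn_integral_bnu) (auto intro!: nn_integral_cong simp: bweight_def norm_scale g indicator_def)
  also have "\<dots> = (\<integral>\<^sup>+ w. indicator ((\<lambda>w :: complex ^ 'n. g *s w) ` ball 0 1) w * (ennreal (bweight TYPE('n) \<alpha> w) * indicator A w) \<partial>lborel)"
  proof (rule nn_integral_rdet[where f' = "\<lambda>_ w. g *s w"])
    show "((\<lambda>w :: complex ^ 'n. g *s w) has_derivative (\<lambda>w. g *s w)) (at x within ball 0 1)" for x
      by (rule linear_imp_has_derivative[OF lin])
    show "rdet (\<lambda>w :: complex ^ 'n. g *s w) = 1"
      by (rule rdet_isometry[OF lin]) (simp add: norm_scale g)
    show "inj_on (\<lambda>w :: complex ^ 'n. g *s w) (ball 0 1)"
      using g0 by (auto simp: inj_on_def vec_eq_iff)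
  qed (auto simp: im)
  also have "\<dots> = (\<integral>\<^sup>+ w. ennreal (bweight TYPE('n) \<alpha> w) * indicator A w \<partial>lborel)"
    unfolding im by (intro nn_integral_cong) (auto simp: bweight_def indicator_def)
  also have "\<dots> = emeasure (bnu \<alpha>) A"
    by (simp add: bnu_def emeasure_density)
  finally show "emeasure (distr (bnu \<alpha>) borel (\<lambda>w :: complex ^ 'n. g *s w)) A = emeasure (bnu \<alpha>) A" .
qed simp

section \<open>Forelli--Rudin estimates\<close>

text \<open>The extra power only shifts the exponent of the weight from \<alpha> to \<alpha> -
  a.\<close>

lemma nn_integral_bnu_weight_finite:
  fixes a \<alpha> :: real
  assumes "\<alpha> > -1" "\<alpha> - a > -1"
  shows "(\<integral>\<^sup>+ w. ennreal ((1 - (norm w)\<^sup>2) powr (-a)) \<partial>(bnu \<alpha> :: (complex ^ 'n) measure)) < \<infinity>"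
proof -
  let ?c = "c_const TYPE('n) \<alpha>"
  have "(\<integral>\<^sup>+ w. ennreal ((1 - (norm w)\<^sup>2) powr (-a)) \<partial>(bnu \<alpha> :: (complex ^ 'n) measure)) =
      (\<integral>\<^sup>+ w. ennreal ?c * ennreal (indicator (ball (0 :: complex ^ 'n) 1) w * (1 - (norm w)\<^sup>2) powr (\<alpha> - a)) \<partial>lborel)"
    using c_const_pos[OF assms(1), where 'n = 'n] bweight_nonneg[OF assms(1), where 'n = 'n]
    by (subst nn_integral_bnu, measurable)
       (auto intro!: nn_integral_cong simp: bweight_def indicator_def powr_diff powr_minus divide_inverse mult_ac simp flip: ennreal_mult)
  also have "\<dots> = ennreal ?c * (\<integral>\<^sup>+ w. ennreal (indicator (ball (0 :: complex ^ 'n) 1) w * (1 - (norm w)\<^sup>2) powr (\<alpha> - a)) \<partial>lborel)"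
    by (rule nn_integral_cmult) measurable
  also have "\<dots> < \<infinity>"
    using nn_integral_weight_finite[OF assms(2), where 'a = "complex ^ 'n"] by (simp add: ennreal_mult_less_top)
  finally show ?thesis .
qed

text \<open>The automorphism of the point \<open>(1 - d) *\<^sub>R z\<close> blows the region \<open>\<bar>1 - \<langle>w, z\<rangle>\<bar> \<le> d\<close>
  up to unit size.\<close>

lemma nn_integral_region_le:
  fixes z :: "complex ^ 'n" and a \<alpha> d :: real
  assumes \<alpha>: "\<alpha> > -1" and a: "a \<ge> 0" and z: "norm z < 1" and d: "0 < d" "d \<le> 1"
  shows "(\<integral>\<^sup>+ w. ennreal ((1 - (norm w)\<^sup>2) powr (-a)) * indicator {w. cmod (1 - cdot w z) \<le> d} w \<partial>bnu \<alpha>) \<le>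
    ennreal ((4 * d) powr (real CARD('n) + 1 + \<alpha>) * (d / 2) powr (-a)) *
      (\<integral>\<^sup>+ w. ennreal ((1 - (norm w)\<^sup>2) powr (-a)) \<partial>(bnu \<alpha> :: (complex ^ 'n) measure))"
proof -
  define N where "N = real CARD('n) + 1 + \<alpha>"
  have N: "N > 0" using \<alpha> by (simp add: N_def)
  define c where "c = (1 - d) *\<^sub>R z"
  have nc: "norm c \<le> 1 - d" using z d by (simp add: c_def mult_left_le)
  then have c: "norm c < 1" using d by simp
  define h where "h = (\<lambda>w. ennreal ((1 - (norm w)\<^sup>2) powr (-a)) * indicator {w. cmod (1 - cdot w z) \<le> d} w)"
  have [measurable]: "h \<in> borel_measurable borel" unfolding h_def by measurable
  have "(\<integral>\<^sup>+ w. h w \<partial>bnu \<alpha>) = (\<integral>\<^sup>+ y. ennreal (mobius_density \<alpha> c y) * h (mobius c y) \<partial>bnu \<alpha>)"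
    by (rule nn_integral_bnu_mobius[OF \<alpha> c, symmetric]) measurable
  also have "\<dots> \<le> (\<integral>\<^sup>+ y. ennreal ((4 * d) powr N * (d / 2) powr (-a)) * ennreal ((1 - (norm y)\<^sup>2) powr (-a)) \<partial>(bnu \<alpha> :: (complex ^ 'n) measure))"
  proof (rule nn_integral_mono_AE, use AE_bnu_ball in eventually_elim)
    fix y :: "complex ^ 'n" assume "y \<in> ball 0 1"
    then have y: "norm y < 1" by simp
    define w where "w = mobius c y"
    have w: "norm w < 1" unfolding w_def by (rule norm_mobius_less[OF c y])
    show "ennreal (mobius_density \<alpha> c y) * h (mobius c y) \<le>
        ennreal ((4 * d) powr N * (d / 2) powr (-a)) * ennreal ((1 - (norm y)\<^sup>2) powr (-a))"
    proof (cases "cmod (1 - cdot w z) \<le> d")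
      case True
      \<comment> \<open>On the region K lies between d/2 and 4 d. It equals u^2 / (1 - |c|^2), and
        both bounds come from 1 - |c| \<le> u \<le> 2 d, d \<le> 1 - |c| and 1 - |c| \<le> 1 - |c|^2
        \<le> 2 (1 - |c|).\<close>
      define K where "K = (1 - (norm c)\<^sup>2) / (cmod (1 - cdot y c))\<^sup>2"
      define u where "u = cmod (1 - cdot w c)"
      have s: "1 - (norm c)\<^sup>2 > 0" using c by (simp add: abs_square_less_1)
      have q: "cmod (1 - cdot y c) \<noteq> 0" using one_minus_cdot_bounds(6)[OF c, of y] y by simp
      have ueq: "u = (1 - (norm c)\<^sup>2) / cmod (1 - cdot y c)"
        using mobius_identity_1[OF c less_imp_le[OF y]] s unfolding u_def w_def
        by (simp add: norm_divide del: of_real_diff)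
      have K: "K = u\<^sup>2 / (1 - (norm c)\<^sup>2)"
        unfolding K_def ueq using s q by (simp add: divide_simps power2_eq_square)
      have "1 - cdot w c = of_real (1 - d) * (1 - cdot w z) + of_real d"
        unfolding c_def cdot_scaleR_right by (simp add: algebra_simps)
      then have "u \<le> cmod (of_real (1 - d) * (1 - cdot w z)) + cmod (of_real d)"
        unfolding u_def by (metis norm_triangle_ineq)
      also have "\<dots> \<le> 1 * cmod (1 - cdot w z) + d"
        using d unfolding norm_mult norm_of_real by (intro add_mono mult_right_mono) auto
      finally have u2: "u \<le> 2 * d" using True by simp
      have u0: "u \<ge> 1 - norm c" unfolding u_def using one_minus_cdot_bounds(4)[OF c, of w] w by simp
      have "(norm c)\<^sup>2 \<le> norm c" using c by (simp add: power2_eq_square mult_left_le)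
      then have s1: "1 - (norm c)\<^sup>2 \<ge> d" using nc by simp
      have "u\<^sup>2 \<le> (2 * d)\<^sup>2" using u2 u0 c by (intro power_mono) auto
      then have "u\<^sup>2 \<le> 4 * d * d" by (simp add: power2_eq_square)
      also have "\<dots> \<le> 4 * d * (1 - (norm c)\<^sup>2)" using s1 d by (intro mult_left_mono) auto
      finally have K4: "K \<le> 4 * d" unfolding K using s by (simp add: divide_le_eq)
      have "1 - (norm c)\<^sup>2 = (1 - norm c) * (1 + norm c)" by (simp add: power2_eq_square algebra_simps)
      also have "\<dots> \<le> (1 - norm c) * 2" using c by (intro mult_left_mono) auto
      finally have s2: "1 - (norm c)\<^sup>2 \<le> 2 * (1 - norm c)" by simp
      have "d / 2 * (1 - (norm c)\<^sup>2) \<le> (1 - norm c) / 2 * (2 * (1 - norm c))"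
        using s2 nc d c s by (intro mult_mono) auto
      also have "\<dots> = (1 - norm c)\<^sup>2" by (simp add: power2_eq_square)
      also have "\<dots> \<le> u\<^sup>2" using u0 c by (intro power_mono) auto
      finally have K2: "d / 2 \<le> K" unfolding K using s by (simp add: le_divide_eq)
      have w1: "1 - (norm w)\<^sup>2 = K * (1 - (norm y)\<^sup>2)"
        using mobius_norm[OF c less_imp_le[OF y]] by (simp add: w_def K_def)
      have "mobius_density \<alpha> c y \<le> (4 * d) powr N"
        unfolding mobius_density_def N_def[symmetric] K_def[symmetric]
        using K4 K2 d N by (intro powr_mono2) auto
      moreover have "(1 - (norm w)\<^sup>2) powr (-a) \<le> (d / 2) powr (-a) * (1 - (norm y)\<^sup>2) powr (-a)"
      proof -
        have "(1 - (norm w)\<^sup>2) powr (-a) = K powr (-a) * (1 - (norm y)\<^sup>2) powr (-a)"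
          unfolding w1 using K2 d y by (simp add: powr_mult abs_square_le_1)
        also have "\<dots> \<le> (d / 2) powr (-a) * (1 - (norm y)\<^sup>2) powr (-a)"
          using K2 d a by (intro mult_right_mono powr_mono2') auto
        finally show ?thesis .
      qed
      ultimately have "mobius_density \<alpha> c y * (1 - (norm w)\<^sup>2) powr (-a) \<le>
          (4 * d) powr N * ((d / 2) powr (-a) * (1 - (norm y)\<^sup>2) powr (-a))"
        by (intro mult_mono) auto
      then show ?thesis using True by (simp add: h_def w_def[symmetric] mult.assoc ennreal_leI flip: ennreal_mult)
    qed (simp add: h_def w_def)
  qed
  also have "\<dots> = ennreal ((4 * d) powr N * (d / 2) powr (-a)) * (\<integral>\<^sup>+ w. ennreal ((1 - (norm w)\<^sup>2) powr (-a)) \<partial>(bnu \<alpha> :: (complex ^ 'n) measure))"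
    by (rule nn_integral_cmult) measurable
  finally show ?thesis unfolding h_def N_def .
qed

text \<open>Below the critical exponent the integral stays bounded. Writing N = n + 1 + \<alpha>,
  the region where |1 - <w,z>| is about 2^(-k) contributes 2^(k p) times 2^(-k (N - a)), and the
  ratio 2^(-(N - a - p)) is less than 1.\<close>

lemma forelli_rudin_bounded:
  fixes a p \<alpha> :: real
  assumes \<alpha>: "\<alpha> > -1" and a: "0 \<le> a" "\<alpha> - a > -1" and p: "0 \<le> p" "p < real CARD('n) + 1 + \<alpha> - a"
  obtains C where "C \<ge> 0" "\<And>z :: complex ^ 'n. norm z < 1 \<Longrightarrow>
    (\<integral>\<^sup>+ w. ennreal ((1 - (norm w)\<^sup>2) powr (-a) * cmod (1 - cdot w z) powr (-p)) \<partial>bnu \<alpha>) \<le> ennreal C"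
proof -
  define N where "N = real CARD('n) + 1 + \<alpha>"
  define I where "I = enn2real (\<integral>\<^sup>+ w. ennreal ((1 - (norm w)\<^sup>2) powr (-a)) \<partial>(bnu \<alpha> :: (complex ^ 'n) measure))"
  have I: "(\<integral>\<^sup>+ w. ennreal ((1 - (norm w)\<^sup>2) powr (-a)) \<partial>(bnu \<alpha> :: (complex ^ 'n) measure)) = ennreal I"
    using nn_integral_bnu_weight_finite[OF \<alpha> a(2), where 'n = 'n] unfolding I_def by simp
  have I0: "I \<ge> 0" by (simp add: I_def)
  define A where "A = 2 powr p * (4 powr N * 2 powr a) * I"
  define r where "r = (1/2 :: real) powr (N - a - p)"
  have "r < (1/2) powr 0" unfolding r_def using p by (intro powr_less_mono') (auto simp: N_def)
  then have r: "0 \<le> r" "r < 1" by (auto simp: r_def)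
  \<comment> \<open>The summand \<open>I\<close> covers the points with |1 - <w,z>| > 1, where the
    kernel power is at most 1.\<close>
  define C where "C = I + A * (\<Sum>k. r ^ k)"
  have A0: "A \<ge> 0" using I0 by (simp add: A_def)
  show ?thesis
  proof (rule that[of C])
    show "C \<ge> 0" unfolding C_def using I0 A0 r by (intro add_nonneg_nonneg mult_nonneg_nonneg suminf_nonneg summable_geometric) auto
    fix z :: "complex ^ 'n" assume z: "norm z < 1"
    define R where "R = (\<lambda>k. {w. cmod (1 - cdot w z) \<le> (1/2 :: real) ^ k})"
    define c where "c = (\<lambda>k :: nat. ((1/2 :: real) ^ Suc k) powr (-p))"
    have "(\<integral>\<^sup>+ w. ennreal ((1 - (norm w)\<^sup>2) powr (-a) * cmod (1 - cdot w z) powr (-p)) \<partial>bnu \<alpha>) \<le>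
        (\<integral>\<^sup>+ w. ennreal ((1 - (norm w)\<^sup>2) powr (-a)) + (\<Sum>k. ennreal (c k) * (ennreal ((1 - (norm w)\<^sup>2) powr (-a)) * indicator (R k) w)) \<partial>bnu \<alpha>)"
    proof (rule nn_integral_mono_AE, use AE_bnu_ball in eventually_elim)
      fix w :: "complex ^ 'n" assume "w \<in> ball 0 1"
      then have w: "norm w < 1" by simp
      define y where "y = cmod (1 - cdot w z)"
      define W where "W = (1 - (norm w)\<^sup>2) powr (-a)"
      have W: "W \<ge> 0" by (simp add: W_def)
      have y: "y > 0" using one_minus_cdot_bounds(5)[OF w, of z] z by (simp add: y_def)
      have "ennreal (W * y powr (-p)) \<le> ennreal W + (\<Sum>k. ennreal (c k) * (ennreal W * indicator (R k) w))"
      proof (cases "y \<le> 1")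
        case False
        then have "y powr (-p) \<le> 1" using p powr_mono2'[of "-p" 1 y] by simp
        then have "W * y powr (-p) \<le> W" using W by (simp add: mult_left_le)
        then have "ennreal (W * y powr (-p)) \<le> ennreal W + 0" by (simp add: ennreal_leI)
        also have "\<dots> \<le> ennreal W + (\<Sum>k. ennreal (c k) * (ennreal W * indicator (R k) w))"
          by (intro add_left_mono) simp
        finally show ?thesis .
      next
        case True
        obtain k where k: "(1/2) ^ Suc k < y" "y \<le> (1/2) ^ k" using dyadic_bracket[OF y True] .
        have "y powr (-p) \<le> c k" unfolding c_def using k(1) p by (intro powr_mono2') auto
        then have "W * y powr (-p) \<le> c k * W" using W by (simp add: mult_right_mono mult.commute[of W])
        then have "ennreal (W * y powr (-p)) \<le> ennreal (c k) * (ennreal W * indicator (R k) w)"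
          using k(2) W by (simp add: R_def y_def[symmetric] c_def ennreal_leI flip: ennreal_mult)
        also have "\<dots> = sum (\<lambda>k. ennreal (c k) * (ennreal W * indicator (R k) w)) {k}"
          by (simp only: sum.insert_remove finite.emptyI) simp
        also have "\<dots> \<le> (\<Sum>k. ennreal (c k) * (ennreal W * indicator (R k) w))" by (rule sum_le_suminf) auto
        also have "\<dots> \<le> ennreal W + \<dots>" by simp
        finally show ?thesis .
      qed
      then show "ennreal ((1 - (norm w)\<^sup>2) powr (-a) * cmod (1 - cdot w z) powr (-p)) \<le>
          ennreal ((1 - (norm w)\<^sup>2) powr (-a)) + (\<Sum>k. ennreal (c k) * (ennreal ((1 - (norm w)\<^sup>2) powr (-a)) * indicator (R k) w))"
        by (simp add: W_def y_def)
    qed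
    also have "\<dots> = ennreal I + (\<Sum>k. ennreal (c k) * (\<integral>\<^sup>+ w. ennreal ((1 - (norm w)\<^sup>2) powr (-a)) * indicator (R k) w \<partial>bnu \<alpha>))"
    proof -
      have [measurable]: "R k \<in> sets borel" for k unfolding R_def by measurable
      show ?thesis by (subst nn_integral_add) (auto simp: I nn_integral_suminf nn_integral_cmult)
    qed
    also have "\<dots> \<le> ennreal I + (\<Sum>k. ennreal (A * r ^ k))"
    proof (intro add_left_mono suminf_le summableI)
      fix k
      define d where "d = (1/2 :: real) ^ k"
      have d: "0 < d" "d \<le> 1" by (auto simp: d_def power_le_one)
      have "ennreal (c k) * (\<integral>\<^sup>+ w. ennreal ((1 - (norm w)\<^sup>2) powr (-a)) * indicator (R k) w \<partial>bnu \<alpha>) \<le>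
          ennreal (c k) * (ennreal ((4 * d) powr N * (d / 2) powr (-a)) * ennreal I)"
        unfolding R_def d_def[symmetric] N_def I[symmetric]
        by (intro mult_left_mono nn_integral_region_le \<alpha> a z d) auto
      also have "\<dots> = ennreal (c k * ((4 * d) powr N * (d / 2) powr (-a) * I))"
        using I0 by (simp add: c_def mult.assoc flip: ennreal_mult)
      also have "c k * ((4 * d) powr N * (d / 2) powr (-a) * I) = A * r ^ k"
      proof -
        have "c k = 2 powr p * d powr (-p)"
          unfolding c_def d_def by (simp add: powr_divide powr_mult powr_minus field_simps)
        moreover have "(4 * d) powr N = 4 powr N * d powr N" using d by (simp add: powr_mult)
        moreover have "(d / 2) powr (-a) = 2 powr a * d powr (-a)" 
          using d by (simp add: powr_divide powr_minus field_simps)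
        moreover have "r ^ k = d powr (-p) * (d powr N * d powr (-a))"
        proof -
          have "r ^ k = d powr (N - a - p)"
            unfolding r_def d_def by (simp add: powr_powr mult.commute flip: powr_realpow)
          then show ?thesis by (simp flip: powr_add)
        qed
        ultimately show ?thesis by (simp add: A_def mult_ac)
      qed
      finally show "ennreal (c k) * (\<integral>\<^sup>+ w. ennreal ((1 - (norm w)\<^sup>2) powr (-a)) * indicator (R k) w \<partial>bnu \<alpha>) \<le> ennreal (A * r ^ k)" .
    qed
    also have "(\<Sum>k. ennreal (A * r ^ k)) = ennreal (A * (\<Sum>k. r ^ k))"
      using A0 r by (subst suminf_ennreal2) (auto simp: suminf_mult summable_geometric summable_mult)
    also have "ennreal I + ennreal (A * (\<Sum>k. r ^ k)) = ennreal C"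
      unfolding C_def using I0 A0 r by (intro ennreal_plus[symmetric] mult_nonneg_nonneg suminf_nonneg summable_geometric) auto
    finally show "(\<integral>\<^sup>+ w. ennreal ((1 - (norm w)\<^sup>2) powr (-a) * cmod (1 - cdot w z) powr (-p)) \<partial>bnu \<alpha>) \<le> ennreal C" .
  qed
qed

text \<open>The substitution by \<open>mobius z\<close> extracts the factor (1 - |z|^2)^(-a) and
  lowers the exponent from N = n + 1 + \<alpha> to N - 2 a. This is subcritical because N - 2 a + a
  < N.\<close>

lemma forelli_rudin:
  fixes a \<alpha> :: real
  assumes \<alpha>: "\<alpha> > -1" and a: "0 < a" "\<alpha> - a > -1" "2 * a \<le> real CARD('n) + 1 + \<alpha>"
  obtains C where "C \<ge> 0" "\<And>z :: complex ^ 'n. norm z < 1 \<Longrightarrow>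
    (\<integral>\<^sup>+ w. ennreal ((1 - (norm w)\<^sup>2) powr (-a) * cmod (1 - cdot w z) powr (- (real CARD('n) + 1 + \<alpha>))) \<partial>bnu \<alpha>)
      \<le> ennreal (C * (1 - (norm z)\<^sup>2) powr (-a))"
proof -
  define N where "N = real CARD('n) + 1 + \<alpha>"
  obtain C where C: "C \<ge> 0" "\<And>z :: complex ^ 'n. norm z < 1 \<Longrightarrow>
    (\<integral>\<^sup>+ w. ennreal ((1 - (norm w)\<^sup>2) powr (-a) * cmod (1 - cdot w z) powr (-(N - 2 * a))) \<partial>bnu \<alpha>) \<le> ennreal C"
    using forelli_rudin_bounded[OF \<alpha> less_imp_le[OF a(1)] a(2), of "N - 2 * a", where 'n = 'n] a unfolding N_def by auto
  show ?thesis
  proof (rule that[OF C(1)])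
    fix z :: "complex ^ 'n" assume z: "norm z < 1"
    define h where "h = (\<lambda>w. ennreal ((1 - (norm w)\<^sup>2) powr (-a) * cmod (1 - cdot w z) powr (-N)))"
    define s where "s = 1 - (norm z)\<^sup>2"
    have s: "s > 0" using z by (simp add: s_def abs_square_less_1)
    have [measurable]: "h \<in> borel_measurable borel" unfolding h_def by measurable
    have "(\<integral>\<^sup>+ w. h w \<partial>bnu \<alpha>) = (\<integral>\<^sup>+ y. ennreal (mobius_density \<alpha> z y) * h (mobius z y) \<partial>bnu \<alpha>)"
      by (rule nn_integral_bnu_mobius[OF \<alpha> z, symmetric]) measurable
    also have "\<dots> = (\<integral>\<^sup>+ y. ennreal (s powr (-a)) * ennreal ((1 - (norm y)\<^sup>2) powr (-a) * cmod (1 - cdot y z) powr (-(N - 2 * a))) \<partial>bnu \<alpha>)"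
    proof (rule nn_integral_cong_AE, use AE_bnu_ball in eventually_elim)
      fix y :: "complex ^ 'n" assume "y \<in> ball 0 1"
      then have y: "norm y < 1" by simp
      define q where "q = cmod (1 - cdot y z)"
      define t where "t = 1 - (norm y)\<^sup>2"
      have t: "t > 0" using y by (simp add: t_def abs_square_less_1)
      have q: "q > 0" using one_minus_cdot_bounds(5)[OF y, of z] z by (simp add: q_def)
      have 1: "cmod (1 - cdot (mobius z y) z) = s / q"
        using mobius_identity_1[OF z less_imp_le[OF y]] s unfolding s_def q_def
        by (simp add: norm_divide del: of_real_diff)
      have 2: "1 - (norm (mobius z y))\<^sup>2 = s * t / q\<^sup>2"
        using mobius_norm[OF z less_imp_le[OF y]] by (simp add: s_def q_def t_def)
      have 3: "mobius_density \<alpha> z y = (s / q\<^sup>2) powr N"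
        by (simp add: mobius_density_def s_def q_def N_def)
      have q2: "q\<^sup>2 = q powr 2" using q by simp
      have "(s / q\<^sup>2) powr N * ((s * t / q\<^sup>2) powr (-a) * (s / q) powr (-N)) = s powr (-a) * (t powr (-a) * q powr (-(N - 2 * a)))"
        using s t q unfolding q2
        by (simp add: powr_mult powr_divide powr_powr powr_minus powr_diff powr_add field_simps del: powr_numeral)
           (simp add: mult.commute flip: powr_add)
      then show "ennreal (mobius_density \<alpha> z y) * h (mobius z y) =
         ennreal (s powr (-a)) * ennreal ((1 - (norm y)\<^sup>2) powr (-a) * cmod (1 - cdot y z) powr (-(N - 2 * a)))"
        unfolding h_def 1 2 3 t_def[symmetric] q_def[symmetric] by (simp flip: ennreal_mult)
    qed
    also have "\<dots> = ennreal (s powr (-a)) * (\<integral>\<^sup>+ y. ennreal ((1 - (norm y)\<^sup>2) powr (-a) * cmod (1 - cdot y z) powr (-(N - 2 * a))) \<partial>bnu \<alpha>)"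
      by (rule nn_integral_cmult) measurable
    also have "\<dots> \<le> ennreal (s powr (-a)) * ennreal C"
      using C(2)[OF z] by (intro mult_left_mono) auto
    also have "\<dots> = ennreal (C * (1 - (norm z)\<^sup>2) powr (-a))"
      using C(1) by (simp add: s_def mult.commute flip: ennreal_mult)
    finally show "(\<integral>\<^sup>+ w. ennreal ((1 - (norm w)\<^sup>2) powr (-a) * cmod (1 - cdot w z) powr (- (real CARD('n) + 1 + \<alpha>))) \<partial>bnu \<alpha>)
      \<le> ennreal (C * (1 - (norm z)\<^sup>2) powr (-a))" unfolding h_def N_def .
  qed
qed

section \<open>Carleson measures\<close>

definition kmod :: "real \<Rightarrow> complex ^ 'n \<Rightarrow> complex ^ 'n \<Rightarrow> real" where
  "kmod \<alpha> z w = cmod (1 - cdot w z) powr (- (real CARD('n) + 1 + \<alpha>))"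

text \<open>For points of the ball this is 1 - |mobius u v|^2. The rational form is symmetric and
  jointly measurable in \<open>u\<close> and \<open>v\<close>; the pseudohyperbolic ball of radius
  1/2 becomes the set where it exceeds 3/4.\<close>

definition mobius_defect :: "complex ^ 'n \<Rightarrow> complex ^ 'n \<Rightarrow> real" where
  "mobius_defect u v = (1 - (norm u)\<^sup>2) * (1 - (norm v)\<^sup>2) / (cmod (1 - cdot v u))\<^sup>2"

lemma kmod_measurable [measurable (raw)]:
  assumes [measurable]: "f \<in> borel_measurable M" "g \<in> borel_measurable M"
  shows "(\<lambda>x. kmod \<alpha> (f x) (g x)) \<in> borel_measurable M"
  unfolding kmod_def[abs_def] by (intro powr_real_measurable) measurable

lemma mobius_defect_measurable [measurable (raw)]:
  assumes [measurable]: "f \<in> borel_measurable M" "g \<in> borel_measurable M"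
  shows "(\<lambda>x. mobius_defect (f x) (g x)) \<in> borel_measurable M"
  unfolding mobius_defect_def[abs_def] by measurable

lemma cmod_one_minus_cdot_commute: "cmod (1 - cdot x y) = cmod (1 - cdot y x)"
  by (subst cdot_commute) (metis complex_cnj_diff complex_cnj_one complex_mod_cnj)

lemma kmod_commute: "kmod \<alpha> z w = kmod \<alpha> w z"
  by (simp add: kmod_def cmod_one_minus_cdot_commute[of w z])

lemma kmod_nonneg [simp]: "kmod \<alpha> z w \<ge> 0"
  by (simp add: kmod_def)

lemma mobius_defect_commute: "mobius_defect u v = mobius_defect v u"
  by (simp add: mobius_defect_def cmod_one_minus_cdot_commute[of v u] mult.commute)

lemma mobius_defect_eq: "norm u < 1 \<Longrightarrow> norm v \<le> 1 \<Longrightarrow> 1 - (norm (mobius u v))\<^sup>2 = mobius_defect u v"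
  by (simp add: mobius_norm mobius_defect_def)

lemma norm_mobius_less_half_iff:
  "norm u < 1 \<Longrightarrow> norm v \<le> 1 \<Longrightarrow> norm (mobius u v) < 1 / 2 \<longleftrightarrow> mobius_defect u v > 3 / 4"
proof -
  assume "norm u < 1" "norm v \<le> 1"
  from mobius_defect_eq[OF this] have "mobius_defect u v > 3 / 4 \<longleftrightarrow> (norm (mobius u v))\<^sup>2 < (1 / 2)\<^sup>2"
    by (auto simp: power2_eq_square)
  also have "\<dots> \<longleftrightarrow> norm (mobius u v) < 1 / 2"
  proof
    show "(norm (mobius u v))\<^sup>2 < (1 / 2)\<^sup>2 \<Longrightarrow> norm (mobius u v) < 1 / 2"
      by (rule power2_less_imp_less) simp_all
    show "norm (mobius u v) < 1 / 2 \<Longrightarrow> (norm (mobius u v))\<^sup>2 < (1 / 2)\<^sup>2"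
      by (rule power_strict_mono) simp_all
  qed
  finally show ?thesis ..
qed

text \<open>With z = \<open>mobius u y\<close> the quotient of the two sides without the factor is
  |1 - <x,u>| / |1 - <x,y>|. The numerator is at most 3/2 and the denominator at least 1/2, whence
  the 3.\<close>

lemma cmod_one_minus_cdot_mobius_le:
  assumes u: "norm u < 1" and x: "norm x \<le> 1 / 2" and z: "norm z < 1"
  shows "cmod (1 - cdot u z) \<le> 3 * cmod (1 - cdot (mobius u x) z)"
proof -
  define y where "y = mobius u z"
  have y: "norm y < 1" unfolding y_def by (rule norm_mobius_less[OF u z])
  have zy: "z = mobius u y" unfolding y_def using mobius_involution[OF u less_imp_le[OF z]] by simp
  have x1: "norm x < 1" "norm x \<le> 1" using x by auto
  define s where "s = 1 - (norm u)\<^sup>2"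
  have s: "s > 0" using u by (simp add: s_def abs_square_less_1)
  have e1: "cmod (1 - cdot (mobius u x) z) = s * cmod (1 - cdot x y) / (cmod (1 - cdot x u) * cmod (1 - cdot u y))"
    unfolding zy mobius_identity[OF u x1(2) less_imp_le[OF y]] using s unfolding s_def
    by (simp add: norm_mult norm_divide del: of_real_diff)
  have e2: "cmod (1 - cdot u z) = s / cmod (1 - cdot u y)"
    using mobius_identity[OF u, of 0 y] y s unfolding zy s_def by (simp add: norm_divide del: of_real_diff)
  have "cmod (1 - cdot x u) \<le> 1 + cmod (cdot x u)" using norm_triangle_ineq4[of 1 "cdot x u"] by simp
  also have "cmod (cdot x u) \<le> 1 / 2 * 1"
    using cmod_cdot_le[of x u] mult_mono[OF x less_imp_le[OF u]] by auto
  finally have 1: "cmod (1 - cdot x u) \<le> 3 / 2" by simp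
  have 2: "1 / 2 \<le> cmod (1 - cdot x y)" using one_minus_cdot_bounds(3)[OF x1(1), of y] x y by simp
  have uy: "cmod (1 - cdot u y) > 0" using one_minus_cdot_bounds(5)[OF u, of y] y by simp
  have xu: "cmod (1 - cdot x u) > 0" using one_minus_cdot_bounds(5)[OF x1(1), of u] u by simp
  have "cmod (1 - cdot x u) \<le> 3 * cmod (1 - cdot x y)" using 1 2 by simp
  then show ?thesis unfolding e1 e2 using s uy xu by (simp add: field_simps)
qed

text \<open>The kernel is nearly constant on pseudohyperbolic balls; this is the property of the
  integrand on which the Carleson embedding rests.\<close>

lemma kmod_mobius_le:
  fixes u :: "complex ^ 'n"
  assumes "\<alpha> > -1" "norm u < 1" "norm x \<le> 1 / 2" "norm z < 1"
  shows "kmod \<alpha> z (mobius u x) \<le> 3 powr (real CARD('n) + 1 + \<alpha>) * kmod \<alpha> z u"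
proof -
  define N where "N = real CARD('n) + 1 + \<alpha>"
  define p where "p = cmod (1 - cdot u z)"
  define q where "q = cmod (1 - cdot (mobius u x) z)"
  have "p \<le> 3 * q" unfolding p_def q_def by (rule cmod_one_minus_cdot_mobius_le[OF assms(2-4)])
  moreover have "p > 0" using one_minus_cdot_bounds(5)[OF assms(2), of z] assms(4) by (simp add: p_def)
  ultimately have "q powr (-N) \<le> (p / 3) powr (-N)" "p > 0"
    using assms(1) by (auto intro!: powr_mono2' simp: N_def)
  then show ?thesis unfolding kmod_def N_def[symmetric] p_def[symmetric] q_def[symmetric]
    by (simp add: powr_divide powr_minus field_simps)
qed

lemma emeasure_bnu_half_ball_pos:
  assumes \<alpha>: "\<alpha> > -1"
  shows "emeasure (bnu \<alpha>) (ball (0 :: complex ^ 'n) (1/2)) > 0"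
proof -
  have "emeasure (bnu \<alpha>) (ball (0 :: complex ^ 'n) (1/2)) \<noteq> 0"
  proof
    assume "emeasure (bnu \<alpha>) (ball (0 :: complex ^ 'n) (1/2)) = 0"
    then have "ball (0 :: complex ^ 'n) (1/2) \<in> null_sets (density lborel (\<lambda>z. ennreal (bweight TYPE('n) \<alpha> z)))"
      by (simp add: null_sets_def bnu_def)
    then have "AE z in lborel. z \<in> ball (0 :: complex ^ 'n) (1/2) \<longrightarrow> ennreal (bweight TYPE('n) \<alpha> z) = 0"
      by (subst (asm) null_sets_density_iff) auto
    then have "AE z in lborel. z \<notin> ball (0 :: complex ^ 'n) (1/2)"
    proof eventually_elim
      case (elim z)
      show ?case
      proof
        assume z: "z \<in> ball 0 (1/2)"
        then have "norm z < 1" by simp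
        then have "bweight TYPE('n) \<alpha> z > 0"
          using c_const_pos[OF \<alpha>, where 'n = 'n] by (auto simp: bweight_def abs_square_less_1 abs_square_eq_1)
        then show False using elim z by simp
      qed
    qed
    then have "ball (0 :: complex ^ 'n) (1/2) \<in> null_sets lborel"
      by (subst (asm) AE_iff_null_sets[symmetric]) auto
    then have "measure lborel (ball (0 :: complex ^ 'n) (1/2)) = 0"
      by (simp add: null_sets_def measure_def)
    then show False using content_ball_pos[of "1/2" "0 :: complex ^ 'n"] by simp
  qed
  then show ?thesis by (simp add: zero_less_iff_neq_zero)
qed

lemma finite_measure_bnu: "\<alpha> > -1 \<Longrightarrow> finite_measure (bnu \<alpha>)"
  by (rule finite_measureI) (simp add: emeasure_bnu_UNIV)

lemma sigma_finite_bnu: "\<alpha> > -1 \<Longrightarrow> sigma_finite_measure (bnu \<alpha>)"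
  by (rule finite_measure.axioms(1)[OF finite_measure_bnu])

text \<open>The densities of an involution at a point and at its image are reciprocal.\<close>

lemma mobius_density_mult:
  assumes u: "norm u < 1" and y: "norm y < 1"
  shows "mobius_density \<alpha> u y * mobius_density \<alpha> u (mobius u y) = 1"
proof -
  define s where "s = 1 - (norm u)\<^sup>2"
  define q where "q = cmod (1 - cdot y u)"
  have s: "s > 0" using u by (simp add: s_def abs_square_less_1)
  have q: "q > 0" using one_minus_cdot_bounds(5)[OF y, of u] u by (simp add: q_def)
  have "cmod (1 - cdot (mobius u y) u) = s / q"
    using mobius_identity_1[OF u less_imp_le[OF y]] s unfolding s_def q_def
    by (simp add: norm_divide del: of_real_diff)
  then show ?thesis
    unfolding mobius_density_def s_def[symmetric] q_def[symmetric] using s q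
    by (simp add: powr_mult[symmetric] power_divide) (simp add: power2_eq_square)
qed

text \<open>The substitution by \<open>mobius u\<close> sends the pseudohyperbolic ball around u to
  the fixed ball of radius 1/2 and cancels the density. The value does not depend on u, so this
  weight can be inserted as an average under any integral over u.\<close>

lemma nn_integral_pseudo_ball:
  fixes u :: "complex ^ 'n"
  assumes \<alpha>: "\<alpha> > -1" and u: "norm u < 1"
  shows "(\<integral>\<^sup>+ v. ennreal (mobius_density \<alpha> u v) * indicator {v. mobius_defect u v > 3/4} v \<partial>bnu \<alpha>) =
    emeasure (bnu \<alpha>) (ball (0 :: complex ^ 'n) (1/2))"
proof -
  define h where "h = (\<lambda>v. ennreal (mobius_density \<alpha> u v) * indicator {v. mobius_defect u v > 3/4} v)"
  have [measurable]: "h \<in> borel_measurable borel" unfolding h_def by measurable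
  have "(\<integral>\<^sup>+ v. h v \<partial>bnu \<alpha>) = (\<integral>\<^sup>+ y. ennreal (mobius_density \<alpha> u y) * h (mobius u y) \<partial>bnu \<alpha>)"
    by (rule nn_integral_bnu_mobius[OF \<alpha> u, symmetric]) measurable
  also have "\<dots> = (\<integral>\<^sup>+ y. indicator (ball (0 :: complex ^ 'n) (1/2)) y \<partial>bnu \<alpha>)"
  proof (rule nn_integral_cong_AE, use AE_bnu_ball in eventually_elim)
    fix y :: "complex ^ 'n" assume "y \<in> ball 0 1"
    then have y: "norm y < 1" by simp
    have m: "norm (mobius u y) < 1" by (rule norm_mobius_less[OF u y])
    have "mobius_defect u (mobius u y) > 3/4 \<longleftrightarrow> y \<in> ball 0 (1/2)"
      using norm_mobius_less_half_iff[OF u, of "mobius u y"] m mobius_involution[OF u, of y] y by simp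
    then show "ennreal (mobius_density \<alpha> u y) * h (mobius u y) = indicator (ball 0 (1/2)) y"
      using mobius_density_mult[OF u y, of \<alpha>]
      by (auto simp: h_def indicator_def simp flip: ennreal_mult)
  qed
  finally show ?thesis by (simp add: h_def)
qed

text \<open>The Carleson embedding. An average over the pseudohyperbolic ball around
  \<open>u\<close> is inserted; there \<open>G u\<close> is replaced by \<open>A\<close> times
  \<open>G v\<close> and the density at \<open>u\<close> by 4^N times the density at
  \<open>v\<close>. After Fubini the integral over \<open>u\<close> is the quantity bounded by
  \<open>M\<close>.\<close>

lemma carleson_nn_integral:
  fixes \<sigma> G :: "complex ^ 'n \<Rightarrow> ennreal"
  assumes \<alpha>: "\<alpha> > -1" and [measurable]: "\<sigma> \<in> borel_measurable borel" "G \<in> borel_measurable borel"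
    and AM: "0 \<le> A \<and> 0 \<le> M"
    and M: "\<And>z. norm z < 1 \<Longrightarrow> (\<integral>\<^sup>+ u. \<sigma> u * ennreal (mobius_density \<alpha> z u) \<partial>bnu \<alpha>) \<le> ennreal M"
    and G: "\<And>u x. norm u < 1 \<Longrightarrow> norm x \<le> 1/2 \<Longrightarrow> G (mobius u x) \<le> ennreal A * G u"
  shows "(\<integral>\<^sup>+ u. \<sigma> u * G u \<partial>bnu \<alpha>) \<le>
    ennreal (A * 4 powr (real CARD('n) + 1 + \<alpha>) * M / measure (bnu \<alpha>) (ball (0 :: complex ^ 'n) (1/2))) * (\<integral>\<^sup>+ u. G u \<partial>bnu \<alpha>)"
proof -
  define N where "N = real CARD('n) + 1 + \<alpha>"
  define k where "k = measure (bnu \<alpha>) (ball (0 :: complex ^ 'n) (1/2))"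
  have ek: "emeasure (bnu \<alpha>) (ball (0 :: complex ^ 'n) (1/2)) = ennreal k"
    unfolding k_def by (rule finite_measure.emeasure_eq_measure[OF finite_measure_bnu[OF \<alpha>]])
  then have k: "k > 0" using emeasure_bnu_half_ball_pos[OF \<alpha>, where 'n = 'n] by simp
  interpret S: sigma_finite_measure "bnu \<alpha> :: (complex ^ 'n) measure" by (rule sigma_finite_bnu[OF \<alpha>])
  interpret P: pair_sigma_finite "bnu \<alpha> :: (complex ^ 'n) measure" "bnu \<alpha> :: (complex ^ 'n) measure" ..
  have "ennreal k * (\<integral>\<^sup>+ u. \<sigma> u * G u \<partial>bnu \<alpha>) = (\<integral>\<^sup>+ u. \<sigma> u * G u * ennreal k \<partial>bnu \<alpha>)"
    by (simp add: nn_integral_multc mult.commute[of "ennreal k"])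
  also have "\<dots> = (\<integral>\<^sup>+ u. (\<integral>\<^sup>+ v. \<sigma> u * G u * (ennreal (mobius_density \<alpha> u v) * indicator {v. mobius_defect u v > 3/4} v) \<partial>bnu \<alpha>) \<partial>bnu \<alpha>)"
  proof (rule nn_integral_cong_AE, use AE_bnu_ball in eventually_elim)
    fix u :: "complex ^ 'n" assume "u \<in> ball 0 1"
    then have "norm u < 1" by simp
    from nn_integral_pseudo_ball[OF \<alpha> this]
    show "\<sigma> u * G u * ennreal k = (\<integral>\<^sup>+ v. \<sigma> u * G u * (ennreal (mobius_density \<alpha> u v) * indicator {v. mobius_defect u v > 3/4} v) \<partial>bnu \<alpha>)"
      by (simp add: nn_integral_cmult ek)
  qed
  also have "\<dots> \<le> (\<integral>\<^sup>+ u. (\<integral>\<^sup>+ v. ennreal (A * 4 powr N) * (G v * (\<sigma> u * ennreal (mobius_density \<alpha> v u))) \<partial>bnu \<alpha>) \<partial>bnu \<alpha>)"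
  proof (rule nn_integral_mono_AE, use AE_bnu_ball in eventually_elim, rule nn_integral_mono_AE, use AE_bnu_ball in eventually_elim)
    fix u v :: "complex ^ 'n" assume "u \<in> ball 0 1" "v \<in> ball 0 1"
    then have u: "norm u < 1" and v: "norm v < 1" by auto
    show "\<sigma> u * G u * (ennreal (mobius_density \<alpha> u v) * indicator {v. mobius_defect u v > 3/4} v) \<le>
        ennreal (A * 4 powr N) * (G v * (\<sigma> u * ennreal (mobius_density \<alpha> v u)))"
    proof (cases "mobius_defect u v > 3/4")
      case d: True
      define x where "x = mobius v u"
      have x: "norm x < 1/2" unfolding x_def using norm_mobius_less_half_iff[OF v less_imp_le[OF u]] d
        by (simp add: mobius_defect_commute)
      have ux: "u = mobius v x" unfolding x_def using mobius_involution[OF v less_imp_le[OF u]] by simp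
      have Gu: "G u \<le> ennreal A * G v" unfolding ux using G[OF v, of x] x by simp
      \<comment> \<open>The factor 4 comes from |1 - <x,v>| \<ge> 1/2 for |x| \<le> 1/2.\<close>
      have "1 - (norm u)\<^sup>2 = (1 - (norm v)\<^sup>2) * (1 - (norm x)\<^sup>2) / (cmod (1 - cdot x v))\<^sup>2"
        unfolding ux using mobius_norm[OF v, of x] x by simp
      also have "\<dots> \<le> (1 - (norm v)\<^sup>2) * 1 / (1/2)\<^sup>2"
        using v x one_minus_cdot_bounds(3)[of x v]
        by (intro frac_le mult_mono power_mono) (auto simp: abs_square_le_1)
      finally have *: "1 - (norm u)\<^sup>2 \<le> 4 * (1 - (norm v)\<^sup>2)" by (simp add: power2_eq_square)
      have q: "cmod (1 - cdot u v) > 0" using one_minus_cdot_bounds(5)[OF u, of v] v by simp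
      have "mobius_density \<alpha> u v \<le> (4 * ((1 - (norm v)\<^sup>2) / (cmod (1 - cdot u v))\<^sup>2)) powr N"
        unfolding mobius_density_def N_def[symmetric] cmod_one_minus_cdot_commute[of v u]
        using u v * q \<alpha> by (intro powr_mono2) (auto simp: N_def abs_square_le_1 divide_right_mono)
      also have "\<dots> = 4 powr N * mobius_density \<alpha> v u"
        unfolding mobius_density_def N_def[symmetric] using v by (subst powr_mult) (auto simp: abs_square_le_1)
      finally have D: "ennreal (mobius_density \<alpha> u v) \<le> ennreal (4 powr N) * ennreal (mobius_density \<alpha> v u)"
        by (simp add: ennreal_leI flip: ennreal_mult)
      have "\<sigma> u * G u * ennreal (mobius_density \<alpha> u v) \<le> \<sigma> u * (ennreal A * G v) * (ennreal (4 powr N) * ennreal (mobius_density \<alpha> v u))"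
        by (intro mult_mono Gu D) auto
      then show ?thesis using d AM by (simp add: ennreal_mult mult_ac)
    qed simp
  qed
  also have "\<dots> = (\<integral>\<^sup>+ v. (\<integral>\<^sup>+ u. ennreal (A * 4 powr N) * (G v * (\<sigma> u * ennreal (mobius_density \<alpha> v u))) \<partial>bnu \<alpha>) \<partial>bnu \<alpha>)"
    by (rule P.Fubini'[symmetric]) measurable
  also have "\<dots> = (\<integral>\<^sup>+ v. ennreal (A * 4 powr N) * (G v * (\<integral>\<^sup>+ u. \<sigma> u * ennreal (mobius_density \<alpha> v u) \<partial>bnu \<alpha>)) \<partial>bnu \<alpha>)"
    by (simp add: nn_integral_cmult)
  also have "\<dots> \<le> (\<integral>\<^sup>+ v. ennreal (A * 4 powr N) * (G v * ennreal M) \<partial>bnu \<alpha>)"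
    by (rule nn_integral_mono_AE, use AE_bnu_ball in eventually_elim) (auto intro!: mult_left_mono M)
  also have "\<dots> = ennreal (A * 4 powr N * M) * (\<integral>\<^sup>+ v. G v \<partial>bnu \<alpha>)"
    using AM by (simp add: nn_integral_cmult nn_integral_multc ennreal_mult mult_ac)
  finally have *: "ennreal k * (\<integral>\<^sup>+ u. \<sigma> u * G u \<partial>bnu \<alpha>) \<le> ennreal (A * 4 powr N * M) * (\<integral>\<^sup>+ v. G v \<partial>bnu \<alpha>)" .
  have "(\<integral>\<^sup>+ u. \<sigma> u * G u \<partial>bnu \<alpha>) = ennreal (1 / k) * (ennreal k * (\<integral>\<^sup>+ u. \<sigma> u * G u \<partial>bnu \<alpha>))"
    using k by (simp add: mult.assoc[symmetric] flip: ennreal_mult)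
  also have "\<dots> \<le> ennreal (1 / k) * (ennreal (A * 4 powr N * M) * (\<integral>\<^sup>+ v. G v \<partial>bnu \<alpha>))"
    by (intro mult_left_mono *) auto
  also have "\<dots> = ennreal (A * 4 powr N * M / k) * (\<integral>\<^sup>+ v. G v \<partial>bnu \<alpha>)"
    using k AM by (simp add: mult.assoc[symmetric] flip: ennreal_mult)
  finally show ?thesis unfolding k_def N_def .
qed

section \<open>Scalar multiplication and coordinates in \<open>ell2\<close>\<close>

lemma scaleC_add_right: "c *\<^sub>C (x + y) = c *\<^sub>C x + c *\<^sub>C y"
  by (rule ell2_eqI) (simp add: algebra_simps)

lemma scaleC_add_left: "(c + d) *\<^sub>C x = c *\<^sub>C x + d *\<^sub>C x"
  by (rule ell2_eqI) (simp add: algebra_simps)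

lemma scaleC_scaleC [simp]: "c *\<^sub>C d *\<^sub>C x = (c * d) *\<^sub>C x"
  by (rule ell2_eqI) simp

lemma scaleC_zero [simp]: "c *\<^sub>C 0 = 0"
  by (rule ell2_eqI) simp

lemma scaleR_eq_scaleC: "r *\<^sub>R (x :: ell2) = complex_of_real r *\<^sub>C x"
  by (rule ell2_eqI) simp

lemma norm_scaleC: "norm (c *\<^sub>C x) = cmod c * norm x"
proof -
  have "(norm (c *\<^sub>C x))\<^sup>2 = (cmod c * norm x)\<^sup>2"
    unfolding norm_ell2_sq power_mult_distrib
    by (simp add: norm_mult power_mult_distrib suminf_mult summable_coord)
  then show ?thesis by (simp add: power2_eq_iff_nonneg)
qed

lemma bounded_bilinear_scaleC: "bounded_bilinear (*\<^sub>C)"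
proof (rule bounded_bilinear.intro)
  show "\<exists>K. \<forall>c x. norm (c *\<^sub>C x) \<le> norm c * norm x * K"
    by (rule exI[of _ 1]) (simp add: norm_scaleC)
qed (rule ell2_eqI, simp add: algebra_simps scaleR_conv_of_real[where 'a = complex])+

lemma bounded_linear_scaleC_right: "bounded_linear (\<lambda>x. c *\<^sub>C x)"
  by (rule bounded_bilinear.bounded_linear_right[OF bounded_bilinear_scaleC])

lemma borel_measurable_scaleC [measurable (raw)]:
  assumes [measurable]: "f \<in> borel_measurable M" "g \<in> borel_measurable M"
  shows "(\<lambda>x. f x *\<^sub>C g x) \<in> borel_measurable M"
proof -
  have "(\<lambda>p. fst p *\<^sub>C snd p) \<in> borel_measurable (borel :: (complex \<times> ell2) measure)"
    by (intro borel_measurable_continuous_onI bounded_bilinear.continuous_on[OF bounded_bilinear_scaleC] continuous_intros)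
  from measurable_compose[OF _ this, of "\<lambda>x. (f x, g x)" M] show ?thesis
    by (simp add: borel_prod[symmetric])
qed

lemma bounded_linear_coord: "bounded_linear (\<lambda>x. coord x i)"
  by (rule bounded_linear_intro[where K = 1])
     (auto simp: coord_le_norm scaleR_conv_of_real[where 'a = complex])

lemma coord_integral: "integrable M f \<Longrightarrow> coord (\<integral>x. f x \<partial>M) i = (\<integral>x. coord (f x) i \<partial>M)"
  using integral_bounded_linear[OF bounded_linear_coord, of M f i] by simp

section \<open>The Bergman kernel\<close>

lemma bergman_kernel_measurable [measurable (raw)]:
  assumes [measurable]: "f \<in> borel_measurable M" "g \<in> borel_measurable M"
  shows "(\<lambda>x. bergman_kernel \<alpha> (f x) (g x)) \<in> borel_measurable M"
  unfolding bergman_kernel_def[abs_def] by measurable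

lemma cmod_bergman_kernel: "cmod (bergman_kernel \<alpha> z w) = kmod \<alpha> z w"
  unfolding bergman_kernel_def kmod_def by (simp add: norm_powr_real_powr')

lemma cnj_powr_real:
  assumes "Re z > 0"
  shows "cnj (z powr complex_of_real a) = cnj z powr complex_of_real a"
  using cnj_powr[of z "complex_of_real a"] assms by auto

text \<open>Principal powers with real exponent commute with conjugation in the right half-plane,
  which contains 1 - <w,z>.\<close>

lemma cnj_bergman_kernel:
  assumes "norm z < 1" "norm w < 1"
  shows "cnj (bergman_kernel \<alpha> z w) = bergman_kernel \<alpha> w z"
proof -
  have "cnj (1 - cdot w z) = 1 - cdot z w" by (subst cdot_commute) simp
  moreover have "Re (1 - cdot w z) > 0" using one_minus_cdot_bounds[of w z] assms by simp
  ultimately show ?thesis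
    unfolding bergman_kernel_def of_real_minus[symmetric] by (simp only: cnj_powr_real)
qed

lemma normalized_kernel_sq:
  assumes "norm z < 1" "norm w < 1"
  shows "(cmod (normalized_kernel \<alpha> z w))\<^sup>2 = mobius_density \<alpha> z w"
proof -
  define N where "N = real CARD('a) + 1 + \<alpha>"
  define s where "s = 1 - (norm z)\<^sup>2"
  define q where "q = cmod (1 - cdot w z)"
  have s: "s > 0" using assms by (simp add: s_def abs_square_less_1)
  have q: "q > 0" using one_minus_cdot_bounds(5)[OF assms(2), of z] assms by (simp add: q_def)
  have "(cmod (normalized_kernel \<alpha> z w))\<^sup>2 = (s powr (N / 2) * q powr (-N))\<^sup>2"
    unfolding normalized_kernel_def norm_mult cmod_bergman_kernel kmod_def N_def s_def q_def by simp
  also have "\<dots> = s powr N * (q powr (-N))\<^sup>2"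
    unfolding power_mult_distrib using s by (simp add: powr_powr flip: powr_realpow powr_numeral)
  also have "\<dots> = (s / q\<^sup>2) powr N"
    using s q by (simp add: powr_divide powr_minus power2_eq_square powr_mult) (simp add: field_simps)
  finally show ?thesis unfolding mobius_density_def s_def q_def N_def .
qed

lemma kmod_le:
  fixes z w :: "complex ^ 'n"
  assumes "\<alpha> > -1" "norm z \<le> r" "r < 1" "norm w < 1"
  shows "kmod \<alpha> z w \<le> (1 - r) powr (- (real CARD('n) + 1 + \<alpha>))"
proof -
  have "1 - r \<le> cmod (1 - cdot w z)"
    using one_minus_cdot_bounds(4)[of z w] assms by simp
  then show ?thesis unfolding kmod_def using assms by (intro powr_mono2') auto
qed

text \<open>Multiplied by <v,w> this is the derivative at z, in the direction v, of the holomorphic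
  function that sends z to the conjugate of K_z(w).\<close>

definition dkernel :: "real \<Rightarrow> complex ^ 'n \<Rightarrow> complex ^ 'n \<Rightarrow> complex" where
  "dkernel \<alpha> z w = of_real (real CARD('n) + 1 + \<alpha>) * (1 - cdot z w) powr (- complex_of_real (real CARD('n) + 1 + \<alpha>) - 1)"

lemma dkernel_measurable [measurable (raw)]:
  assumes [measurable]: "f \<in> borel_measurable M" "g \<in> borel_measurable M"
  shows "(\<lambda>x. dkernel \<alpha> (f x) (g x)) \<in> borel_measurable M"
  unfolding dkernel_def[abs_def] by measurable

text \<open>For |z| \<le> r all values 1 - <z,w> lie in the half-plane Re \<ge> 1 - r. It is convex,
  and the first two derivatives of x^(-N) are bounded on it, so that Taylor's formula holds with
  constants independent of w.\<close>

lemma bergman_kernel_taylor: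
  fixes \<alpha> r :: real
  assumes \<alpha>: "\<alpha> > -1" and r: "r < 1"
  obtains B where "B \<ge> 0"
    "\<And>z w :: complex ^ 'n. norm z \<le> r \<Longrightarrow> norm w < 1 \<Longrightarrow> cmod (dkernel \<alpha> z w) \<le> B"
    "\<And>z y w :: complex ^ 'n. norm z \<le> r \<Longrightarrow> norm y \<le> r \<Longrightarrow> norm w < 1 \<Longrightarrow>
      cmod (cnj (bergman_kernel \<alpha> y w) - cnj (bergman_kernel \<alpha> z w)) \<le> B * norm (y - z)"
    "\<And>z y w :: complex ^ 'n. norm z \<le> r \<Longrightarrow> norm y \<le> r \<Longrightarrow> norm w < 1 \<Longrightarrow>
      cmod (cnj (bergman_kernel \<alpha> y w) - cnj (bergman_kernel \<alpha> z w) - dkernel \<alpha> z w * cdot (y - z) w) \<le> B * (norm (y - z))\<^sup>2"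
proof -
  define N where "N = real CARD('n) + 1 + \<alpha>"
  have N: "N > 0" using \<alpha> by (simp add: N_def)
  define S where "S = {x :: complex. Re x \<ge> 1 - r}"
  have cS: "convex S" unfolding S_def by (rule convex_halfspace_Re_ge)
  \<comment> \<open>\<open>g 0\<close>, \<open>g 1\<close> and \<open>g 2\<close> are x^(-N) and its
    first two derivatives.\<close>
  define g :: "nat \<Rightarrow> complex \<Rightarrow> complex" where "g = (\<lambda>i x. if i = 0 then x powr (- of_real N)
     else if i = 1 then - of_real N * x powr (- of_real N - 1) else - of_real N * (- of_real N - 1) * x powr (- of_real N - 1 - 1))"
  have nS: "x \<notin> \<real>\<^sub>\<le>\<^sub>0" "x \<noteq> 0" "1 - r \<le> cmod x" if "x \<in> S" for x
    using that r complex_Re_le_cmod[of x] by (auto simp: S_def complex_nonpos_Reals_iff)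
  have der: "(g i has_field_derivative g (Suc i) x) (at x within S)" if x: "x \<in> S" and i: "i \<le> 1" for i x
  proof -
    consider "i = 0" | "i = 1" using i by force
    then show ?thesis
    proof cases
      case 1
      then show ?thesis using nS[OF x] unfolding g_def by (auto intro!: derivative_eq_intros)
    next
      case 2
      then show ?thesis using nS[OF x] unfolding g_def by (auto intro!: derivative_eq_intros simp: algebra_simps)
    qed
  qed
  define B1 where "B1 = N * (1 - r) powr (-N - 1)"
  define B2 where "B2 = N * (N + 1) * (1 - r) powr (-N - 2)"
  have b1: "cmod (g 1 x) \<le> B1" if "x \<in> S" for x
  proof -
    have "cmod (g 1 x) = N * cmod x powr (-N - 1)"
      using N norm_powr_real_powr'[of "-N - 1" x] by (simp add: g_def norm_mult)
    also have "\<dots> \<le> B1" unfolding B1_def using nS[OF that] r N by (intro mult_left_mono powr_mono2') auto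
    finally show ?thesis .
  qed
  have b2: "cmod (g 2 x) \<le> B2" if "x \<in> S" for x
  proof -
    have "cmod (- of_real N - 1 :: complex) = N + 1"
      using N by (metis abs_of_pos add.commute add_pos_pos norm_minus_cancel norm_of_real minus_diff_eq of_real_1 of_real_add zero_less_one diff_minus_eq_add uminus_add_conv_diff minus_add_distrib)
    moreover have "cmod (x powr (- complex_of_real N - 1 - 1)) = cmod x powr (-N - 2)"
    proof -
      have "- complex_of_real N - 1 - 1 = of_real (- N - 2)" by simp
      then show ?thesis by (simp only: norm_powr_real_powr' Reals_of_real Re_complex_of_real)
    qed
    ultimately have "cmod (g 2 x) = N * (N + 1) * cmod x powr (-N - 2)"
      using N by (simp add: g_def norm_mult)
    also have "\<dots> \<le> B2" unfolding B2_def using nS[OF that] r N by (intro mult_left_mono powr_mono2') auto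
    finally show ?thesis .
  qed
  have pos: "B1 \<ge> 0" "B2 \<ge> 0" using N by (auto simp: B1_def B2_def)
  have inS: "1 - cdot z w \<in> S" if "norm z \<le> r" "norm w < 1" for z w :: "complex ^ 'n"
  proof -
    have "Re (cdot z w) \<le> cmod (cdot z w)" by (rule complex_Re_le_cmod)
    also have "\<dots> \<le> norm z * norm w" by (rule cmod_cdot_le)
    also have "\<dots> \<le> r" using that mult_left_le[of "norm w" "norm z"] by simp
    finally show ?thesis by (simp add: S_def)
  qed
  have K: "cnj (bergman_kernel \<alpha> z w) = g 0 (1 - cdot z w)" if "norm z \<le> r" "norm w < 1" for z w :: "complex ^ 'n"
    using cnj_bergman_kernel[of z w \<alpha>] that r by (simp add: bergman_kernel_def g_def N_def)
  have dK: "dkernel \<alpha> z w = - g 1 (1 - cdot z w)" for z w :: "complex ^ 'n"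
    unfolding dkernel_def g_def N_def[symmetric] by simp
  have d: "cmod (cdot (y - z) w) \<le> norm (y - z)" if "norm w < 1" for y z w :: "complex ^ 'n"
    using cmod_cdot_le[of "y - z" w] mult_left_le[of "norm w" "norm (y - z)"] that by simp
  show ?thesis
  proof (rule that[of "B1 + B2"])
    show "B1 + B2 \<ge> 0" using pos by simp
    fix z y w :: "complex ^ 'n" assume z: "norm z \<le> r" and w: "norm w < 1"
    show "cmod (dkernel \<alpha> z w) \<le> B1 + B2"
      unfolding dK using b1[OF inS[OF z w]] pos by simp
    assume y: "norm y \<le> r"
    have e: "(1 - cdot y w) - (1 - cdot z w) = - cdot (y - z) w" by (simp add: cdot_diff_left)
    have "cmod (g 0 (1 - cdot y w) - g 0 (1 - cdot z w)) \<le> B1 * cmod ((1 - cdot y w) - (1 - cdot z w))"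
      by (rule field_differentiable_bound[OF cS, where f' = "g 1"]) (use der[of _ 0] b1 inS z y w in auto)
    also have "\<dots> \<le> (B1 + B2) * norm (y - z)"
      unfolding e using d[OF w, of y z] pos by (intro mult_mono) auto
    finally show "cmod (cnj (bergman_kernel \<alpha> y w) - cnj (bergman_kernel \<alpha> z w)) \<le> (B1 + B2) * norm (y - z)"
      using K z y w by simp
    have "cmod (g 0 (1 - cdot y w) - (\<Sum>i\<le>1. g i (1 - cdot z w) * ((1 - cdot y w) - (1 - cdot z w)) ^ i / fact i))
       \<le> B2 * cmod ((1 - cdot y w) - (1 - cdot z w)) ^ (Suc 1) / fact 1"
      by (rule complex_Taylor[OF cS, where f = g]) (use der b2 inS z y w in \<open>auto simp: numeral_2_eq_2\<close>)
    also have "(\<Sum>i\<le>1. g i (1 - cdot z w) * ((1 - cdot y w) - (1 - cdot z w)) ^ i / fact i) =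
      g 0 (1 - cdot z w) + dkernel \<alpha> z w * cdot (y - z) w"
      unfolding e dK by simp
    also have "B2 * cmod ((1 - cdot y w) - (1 - cdot z w)) ^ (Suc 1) / fact 1 \<le> (B1 + B2) * (norm (y - z))\<^sup>2"
      unfolding e using d[OF w, of y z] pos by (auto intro!: mult_mono power_mono simp: numeral_2_eq_2)
    finally show "cmod (cnj (bergman_kernel \<alpha> y w) - cnj (bergman_kernel \<alpha> z w) - dkernel \<alpha> z w * cdot (y - z) w) \<le> (B1 + B2) * (norm (y - z))\<^sup>2"
      using K z y w by (simp add: diff_diff_eq)
  qed
qed

section \<open>Integrals against the kernel\<close>

lemma borel_measurable_cnj [measurable (raw)]:
  assumes [measurable]: "f \<in> borel_measurable M"
  shows "(\<lambda>x. cnj (f x)) \<in> borel_measurable M"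
  by (rule borel_measurable_continuous_on[OF _ assms]) (intro continuous_intros)

lemma integrable_kernel_scaleC:
  fixes \<phi> :: "complex ^ 'n \<Rightarrow> ell2"
  assumes \<phi>: "integrable (bnu \<alpha>) \<phi>" and [measurable]: "k \<in> borel_measurable borel"
    and k: "\<And>w. norm w < 1 \<Longrightarrow> cmod (k w) \<le> B"
  shows "integrable (bnu \<alpha>) (\<lambda>w. k w *\<^sub>C \<phi> w)"
proof (rule Bochner_Integration.integrable_bound)
  have [measurable]: "\<phi> \<in> borel_measurable borel" using borel_measurable_integrable[OF \<phi>] by simp
  show "integrable (bnu \<alpha>) (\<lambda>w. B *\<^sub>R norm (\<phi> w))" using \<phi> by simp
  show "(\<lambda>w. k w *\<^sub>C \<phi> w) \<in> borel_measurable (bnu \<alpha>)" by measurable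
  show "AE w in bnu \<alpha>. norm (k w *\<^sub>C \<phi> w) \<le> norm (B *\<^sub>R norm (\<phi> w))"
    using AE_bnu_ball
  proof eventually_elim
    case (elim w)
    then have "cmod (k w) \<le> B" using k by simp
    then show ?case by (simp add: norm_scaleC mult_right_mono order_trans[OF _ abs_ge_self])
  qed
qed

lemma integrable_kernel:
  fixes \<phi> :: "complex ^ 'n \<Rightarrow> ell2"
  assumes "\<alpha> > -1" "integrable (bnu \<alpha>) \<phi>" "norm z < 1"
  shows "integrable (bnu \<alpha>) (\<lambda>w. cnj (bergman_kernel \<alpha> z w) *\<^sub>C \<phi> w)"
proof (rule integrable_kernel_scaleC[OF assms(2)])
  show "(\<lambda>w. cnj (bergman_kernel \<alpha> z w)) \<in> borel_measurable borel" by measurable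
  show "cmod (cnj (bergman_kernel \<alpha> z w)) \<le> (1 - norm z) powr (- (real CARD('n) + 1 + \<alpha>))" if "norm w < 1" for w
    unfolding complex_mod_cnj cmod_bergman_kernel by (rule kmod_le[OF assms(1) order_refl assms(3) that])
qed

lemma norm_integral_scaleC_le:
  fixes \<phi> :: "complex ^ 'n \<Rightarrow> ell2"
  assumes \<phi>: "integrable (bnu \<alpha>) \<phi>" and [measurable]: "k \<in> borel_measurable borel"
    and k: "\<And>w. norm w < 1 \<Longrightarrow> cmod (k w) \<le> B"
  shows "norm (\<integral>w. k w *\<^sub>C \<phi> w \<partial>bnu \<alpha>) \<le> B * (\<integral>w. norm (\<phi> w) \<partial>bnu \<alpha>)"
proof -
  have "norm (\<integral>w. k w *\<^sub>C \<phi> w \<partial>bnu \<alpha>) \<le> (\<integral>w. norm (k w *\<^sub>C \<phi> w) \<partial>bnu \<alpha>)"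
    by (rule integral_norm_bound)
  also have "\<dots> \<le> (\<integral>w. B * norm (\<phi> w) \<partial>bnu \<alpha>)"
  proof (rule integral_mono_AE)
    show "integrable (bnu \<alpha>) (\<lambda>w. norm (k w *\<^sub>C \<phi> w))"
      using integrable_kernel_scaleC[OF assms] by simp
    show "integrable (bnu \<alpha>) (\<lambda>w. B * norm (\<phi> w))" using \<phi> by simp
    show "AE w in bnu \<alpha>. norm (k w *\<^sub>C \<phi> w) \<le> B * norm (\<phi> w)"
      using AE_bnu_ball by eventually_elim (simp add: norm_scaleC mult_right_mono k)
  qed
  finally show ?thesis by simp
qed

text \<open>The Lipschitz constant depends on the density through its L^1 norm alone. Bounded
  families of reproduced functions are therefore equicontinuous on smaller balls.\<close>

lemma kernel_integral_lipschitz: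
  fixes \<alpha> r :: real
  assumes \<alpha>: "\<alpha> > -1" and r: "r < 1"
  obtains B where "B \<ge> 0"
    "\<And>\<phi> z y. integrable (bnu \<alpha>) (\<phi> :: complex ^ 'n \<Rightarrow> ell2) \<Longrightarrow> norm z \<le> r \<Longrightarrow> norm y \<le> r \<Longrightarrow>
      norm ((\<integral>w. cnj (bergman_kernel \<alpha> y w) *\<^sub>C \<phi> w \<partial>bnu \<alpha>) - (\<integral>w. cnj (bergman_kernel \<alpha> z w) *\<^sub>C \<phi> w \<partial>bnu \<alpha>))
        \<le> B * norm (y - z) * (\<integral>w. norm (\<phi> w) \<partial>bnu \<alpha>)"
proof -
  obtain B where B: "B \<ge> 0" "\<And>z y w :: complex ^ 'n. norm z \<le> r \<Longrightarrow> norm y \<le> r \<Longrightarrow> norm w < 1 \<Longrightarrow>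
      cmod (cnj (bergman_kernel \<alpha> y w) - cnj (bergman_kernel \<alpha> z w)) \<le> B * norm (y - z)"
    using bergman_kernel_taylor[OF assms, where 'n = 'n] by metis
  show ?thesis
  proof (rule that[OF B(1)])
    fix \<phi> :: "complex ^ 'n \<Rightarrow> ell2" and z y :: "complex ^ 'n"
    assume \<phi>: "integrable (bnu \<alpha>) \<phi>" and z: "norm z \<le> r" and y: "norm y \<le> r"
    have "(\<integral>w. cnj (bergman_kernel \<alpha> y w) *\<^sub>C \<phi> w \<partial>bnu \<alpha>) - (\<integral>w. cnj (bergman_kernel \<alpha> z w) *\<^sub>C \<phi> w \<partial>bnu \<alpha>) =
        (\<integral>w. cnj (bergman_kernel \<alpha> y w) *\<^sub>C \<phi> w - cnj (bergman_kernel \<alpha> z w) *\<^sub>C \<phi> w \<partial>bnu \<alpha>)"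
      using z y r by (intro Bochner_Integration.integral_diff[symmetric] integrable_kernel \<alpha> \<phi>) auto
    also have "\<dots> = (\<integral>w. (cnj (bergman_kernel \<alpha> y w) - cnj (bergman_kernel \<alpha> z w)) *\<^sub>C \<phi> w \<partial>bnu \<alpha>)"
      by (simp add: bounded_bilinear.diff_left[OF bounded_bilinear_scaleC])
    also have "norm \<dots> \<le> B * norm (y - z) * (\<integral>w. norm (\<phi> w) \<partial>bnu \<alpha>)"
      by (rule norm_integral_scaleC_le[OF \<phi>]) (use B(2) z y in auto)
    finally show "norm ((\<integral>w. cnj (bergman_kernel \<alpha> y w) *\<^sub>C \<phi> w \<partial>bnu \<alpha>) - (\<integral>w. cnj (bergman_kernel \<alpha> z w) *\<^sub>C \<phi> w \<partial>bnu \<alpha>))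
        \<le> B * norm (y - z) * (\<integral>w. norm (\<phi> w) \<partial>bnu \<alpha>)" .
  qed
qed

text \<open>Integrating the first-order expansion of the kernel, whose remainder is quadratic
  uniformly in w, gives the derivative; it is complex-linear because <v,w> is complex-linear in
  v.\<close>

lemma holomorphic_kernel_integral:
  fixes \<phi> :: "complex ^ 'n \<Rightarrow> ell2"
  assumes \<alpha>: "\<alpha> > -1" and \<phi>: "integrable (bnu \<alpha>) \<phi>"
  shows "holomorphic_ball (\<lambda>z. \<integral>w. cnj (bergman_kernel \<alpha> z w) *\<^sub>C \<phi> w \<partial>bnu \<alpha>)"
  unfolding holomorphic_ball_def
proof
  fix z :: "complex ^ 'n" assume "z \<in> ball 0 1"
  then have z1: "norm z < 1" by simp
  define r where "r = (1 + norm z) / 2"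
  have r: "r < 1" "norm z < r" using z1 by (auto simp: r_def)
  obtain B where B: "B \<ge> 0"
    "\<And>z w :: complex ^ 'n. norm z \<le> r \<Longrightarrow> norm w < 1 \<Longrightarrow> cmod (dkernel \<alpha> z w) \<le> B"
    "\<And>z y w :: complex ^ 'n. norm z \<le> r \<Longrightarrow> norm y \<le> r \<Longrightarrow> norm w < 1 \<Longrightarrow>
      cmod (cnj (bergman_kernel \<alpha> y w) - cnj (bergman_kernel \<alpha> z w) - dkernel \<alpha> z w * cdot (y - z) w) \<le> B * (norm (y - z))\<^sup>2"
    using bergman_kernel_taylor[OF \<alpha> r(1), where 'n = 'n] by metis
  define I where "I = (\<integral>w. norm (\<phi> w) \<partial>bnu \<alpha>)"
  define D where "D = (\<lambda>v. \<integral>w. (dkernel \<alpha> z w * cdot v w) *\<^sub>C \<phi> w \<partial>bnu \<alpha>)"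
  have dk: "cmod (dkernel \<alpha> z w * cdot v w) \<le> B * norm v" if "norm w < 1" for v w :: "complex ^ 'n"
    unfolding norm_mult using B(1) B(2)[of z w] r that cmod_cdot_le[of v w] mult_left_le[of "norm w" "norm v"]
    by (intro mult_mono) auto
  have iD: "integrable (bnu \<alpha>) (\<lambda>w. (dkernel \<alpha> z w * cdot v w) *\<^sub>C \<phi> w)" for v
    by (rule integrable_kernel_scaleC[OF \<phi> _ dk]) measurable
  have D_scale: "D (c *s v) = c *\<^sub>C D v" for c v
  proof -
    have "D (c *s v) = (\<integral>w. c *\<^sub>C ((dkernel \<alpha> z w * cdot v w) *\<^sub>C \<phi> w) \<partial>bnu \<alpha>)"
      by (simp add: D_def cdot_scale_left mult_ac)
    also have "\<dots> = c *\<^sub>C D v"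
      unfolding D_def by (rule integral_bounded_linear[OF bounded_linear_scaleC_right iD])
    finally show ?thesis .
  qed
  have "bounded_linear D"
  proof (rule bounded_linear_intro[where K = "B * I"])
    fix x y
    have "D (x + y) = (\<integral>w. (dkernel \<alpha> z w * cdot x w) *\<^sub>C \<phi> w + (dkernel \<alpha> z w * cdot y w) *\<^sub>C \<phi> w \<partial>bnu \<alpha>)"
      by (simp add: D_def cdot_add_left distrib_left scaleC_add_left)
    then show "D (x + y) = D x + D y" unfolding D_def by (simp add: iD)
    show "D (c *\<^sub>R x) = c *\<^sub>R D x" for c by (simp add: scaleR_eq_scale D_scale scaleR_eq_scaleC)
    show "norm (D x) \<le> norm x * (B * I)"
    proof -
      have "norm (D x) \<le> B * norm x * I"
        unfolding D_def I_def by (rule norm_integral_scaleC_le[OF \<phi> _ dk]) measurable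
      then show ?thesis by (simp add: mult_ac)
    qed
  qed
  moreover have "((\<lambda>y. B * norm (y - z) * I) \<longlongrightarrow> B * norm (z - z) * I) (at z)"
    by (intro tendsto_intros)
  then have "((\<lambda>y. B * norm (y - z) * I) \<longlongrightarrow> 0) (at z within UNIV)" by simp
  moreover have "norm ((\<integral>w. cnj (bergman_kernel \<alpha> y w) *\<^sub>C \<phi> w \<partial>bnu \<alpha>) - (\<integral>w. cnj (bergman_kernel \<alpha> z w) *\<^sub>C \<phi> w \<partial>bnu \<alpha>) - D (y - z)) / norm (y - z)
      \<le> B * norm (y - z) * I" if "y \<noteq> z" "dist y z < r - norm z" for y
  proof -
    have y: "norm y \<le> r" using that norm_triangle_ineq2[of y z] by (simp add: dist_norm)
    have "(\<integral>w. cnj (bergman_kernel \<alpha> y w) *\<^sub>C \<phi> w \<partial>bnu \<alpha>) - (\<integral>w. cnj (bergman_kernel \<alpha> z w) *\<^sub>C \<phi> w \<partial>bnu \<alpha>) - D (y - z) =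
       (\<integral>w. cnj (bergman_kernel \<alpha> y w) *\<^sub>C \<phi> w - cnj (bergman_kernel \<alpha> z w) *\<^sub>C \<phi> w - (dkernel \<alpha> z w * cdot (y - z) w) *\<^sub>C \<phi> w \<partial>bnu \<alpha>)"
      unfolding D_def using y r iD integrable_kernel[OF \<alpha> \<phi>] by simp
    also have "\<dots> = (\<integral>w. (cnj (bergman_kernel \<alpha> y w) - cnj (bergman_kernel \<alpha> z w) - dkernel \<alpha> z w * cdot (y - z) w) *\<^sub>C \<phi> w \<partial>bnu \<alpha>)"
      by (simp add: bounded_bilinear.diff_left[OF bounded_bilinear_scaleC])
    also have "norm \<dots> \<le> B * (norm (y - z))\<^sup>2 * I"
      unfolding I_def by (rule norm_integral_scaleC_le[OF \<phi>]) (use B(3) y r in auto)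
    finally show ?thesis using that by (simp add: divide_le_eq power2_eq_square mult_ac)
  qed
  ultimately have "((\<lambda>z. \<integral>w. cnj (bergman_kernel \<alpha> z w) *\<^sub>C \<phi> w \<partial>bnu \<alpha>) has_derivative D) (at z)"
    using r by (intro has_derivativeI_sandwich[where e = "r - norm z" and H = "\<lambda>y. B * norm (y - z) * I"]) auto
  then show "\<exists>D. ((\<lambda>z. \<integral>w. cnj (bergman_kernel \<alpha> z w) *\<^sub>C \<phi> w \<partial>bnu \<alpha>) has_derivative D) (at z) \<and> (\<forall>c v. D (c *s v) = c *\<^sub>C D v)"
    using D_scale by blast
qed

section \<open>The reproducing formula\<close>

lemma circle_mean_value:
  assumes f: "f holomorphic_on S" and S: "open S" "cball 0 1 \<subseteq> S"
  shows "(\<integral>t. indicator {0..1} t *\<^sub>R f (exp (2 * of_real pi * \<i> * of_real t)) \<partial>lborel) = f 0"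
proof -
  have cont: "continuous_on {0..1} (\<lambda>t :: real. f (exp (2 * of_real pi * \<i> * of_real t)))"
    by (rule continuous_on_compose2[OF holomorphic_on_imp_continuous_on[OF f]])
       (use S(2) in \<open>auto intro!: continuous_intros simp: subset_iff norm_exp_eq_Re\<close>)
  have "f holomorphic_on cball 0 1" using f S(2) by (rule holomorphic_on_subset)
  then have "((\<lambda>u. f u / (u - 0)) has_contour_integral (2 * of_real pi * \<i>) * f 0) (circlepath 0 1)"
    by (rule Cauchy_integral_circlepath_simple) simp
  then have "((\<lambda>x. f (circlepath 0 1 x) / (circlepath 0 1 x - 0) * vector_derivative (circlepath 0 1) (at x within {0..1})) has_integral
      (2 * of_real pi * \<i>) * f 0) {0..1}"
    by (simp only: has_contour_integral_def)
  then have "((\<lambda>t. (2 * of_real pi * \<i>) * f (exp (2 * of_real pi * \<i> * of_real t))) has_integral (2 * of_real pi * \<i>) * f 0) {0..1}"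
  proof (rule has_integral_eq[rotated])
    fix t :: real assume "t \<in> {0..1}"
    then have v: "vector_derivative (circlepath 0 1) (at t within {0..1}) = 2 * pi * \<i> * 1 * exp (2 * of_real pi * \<i> * t)"
      using vector_derivative_circlepath01[of t 0 1] by simp
    show "f (circlepath 0 1 t) / (circlepath 0 1 t - 0) * vector_derivative (circlepath 0 1) (at t within {0..1}) =
        (2 * of_real pi * \<i>) * f (exp (2 * of_real pi * \<i> * of_real t))"
      unfolding v unfolding circlepath by simp
  qed
  then have "((\<lambda>t. inverse (2 * of_real pi * \<i>) * ((2 * of_real pi * \<i>) * f (exp (2 * of_real pi * \<i> * of_real t)))) has_integral
      inverse (2 * of_real pi * \<i>) * ((2 * of_real pi * \<i>) * f 0)) {0..1}"
    by (rule has_integral_mult_right)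
  moreover have "inverse c * (c * x) = x" if "c \<noteq> 0" for c x :: complex
    using that by simp
  from this[of "2 * of_real pi * \<i>"]
  have "inverse (2 * of_real pi * \<i>) * ((2 * of_real pi * \<i>) * x) = x" for x :: complex by simp
  ultimately have "((\<lambda>t. f (exp (2 * of_real pi * \<i> * of_real t))) has_integral f 0) {0..1}"
    by (simp only:)
  moreover have "(\<integral>t\<in>{0..1}. f (exp (2 * of_real pi * \<i> * of_real t)) \<partial>lborel) = integral {0..1} (\<lambda>t. f (exp (2 * of_real pi * \<i> * of_real t)))"
    by (rule set_borel_integral_eq_integral(2)[OF borel_integrable_atLeastAtMost'[OF cont]])
  ultimately show ?thesis by (simp add: set_lebesgue_integral_def integral_unique)
qed

text \<open>Rotation invariance allows an extra average over the unit circle. After Fubini it acts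
  on the slices l to h(l w), holomorphic on a disc larger than the closed unit disc, where Cauchy's
  formula gives h(0).\<close>

lemma mean_value_bnu:
  fixes h :: "complex ^ 'n \<Rightarrow> complex"
  assumes \<alpha>: "\<alpha> > -1" and h: "integrable (bnu \<alpha>) h"
    and hol: "\<And>w. norm w < 1 \<Longrightarrow> (\<lambda>l. h (l *s w)) holomorphic_on {l. cmod l * norm w < 1}"
  shows "(\<integral>w. h w \<partial>bnu \<alpha>) = h 0"
proof -
  interpret S: sigma_finite_measure "bnu \<alpha> :: (complex ^ 'n) measure" by (rule sigma_finite_bnu[OF \<alpha>])
  interpret P: pair_sigma_finite "lborel :: real measure" "bnu \<alpha> :: (complex ^ 'n) measure" ..
  have [measurable]: "h \<in> borel_measurable borel" using borel_measurable_integrable[OF h] by simp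
  define g where "g = (\<lambda>t :: real. exp (2 * of_real pi * \<i> * of_real t))"
  have [measurable]: "g \<in> borel_measurable borel" unfolding g_def by measurable
  have g: "cmod (g t) = 1" for t by (simp add: g_def norm_exp_eq_Re)
  have int_rot: "integrable (bnu \<alpha>) (\<lambda>w. h (g t *s w))" "(\<integral>w. h (g t *s w) \<partial>bnu \<alpha>) = (\<integral>w. h w \<partial>bnu \<alpha>)" for t
  proof -
    have "integrable (distr (bnu \<alpha>) borel (\<lambda>w :: complex ^ 'n. g t *s w)) h"
      unfolding distr_rotation[OF g] by (rule h)
    then show "integrable (bnu \<alpha>) (\<lambda>w. h (g t *s w))"
      by (subst (asm) integrable_distr_eq) auto
    have "(\<integral>w. h w \<partial>bnu \<alpha>) = (\<integral>w. h w \<partial>distr (bnu \<alpha>) borel (\<lambda>w :: complex ^ 'n. g t *s w))"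
      unfolding distr_rotation[OF g] ..
    also have "\<dots> = (\<integral>w. h (g t *s w) \<partial>bnu \<alpha>)" by (rule integral_distr) measurable
    finally show "(\<integral>w. h (g t *s w) \<partial>bnu \<alpha>) = (\<integral>w. h w \<partial>bnu \<alpha>)" ..
  qed
  \<comment> \<open>Invariance for the norm of \<open>h\<close> is what integrability on the product
    space requires.\<close>
  have nrot: "(\<integral>w. norm (h (g t *s w)) \<partial>bnu \<alpha>) = (\<integral>w. norm (h w) \<partial>bnu \<alpha>)" for t
  proof -
    have "(\<integral>w. norm (h w) \<partial>bnu \<alpha>) = (\<integral>w. norm (h w) \<partial>distr (bnu \<alpha>) borel (\<lambda>w :: complex ^ 'n. g t *s w))"
      unfolding distr_rotation[OF g] ..
    also have "\<dots> = (\<integral>w. norm (h (g t *s w)) \<partial>bnu \<alpha>)" by (rule integral_distr) measurable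
    finally show ?thesis ..
  qed
  have int: "integrable (lborel \<Otimes>\<^sub>M bnu \<alpha>) (\<lambda>(t, w). indicator {0..1} t *\<^sub>R h (g t *s w))"
  proof (rule P.Fubini_integrable)
    show "(\<lambda>(t, w). indicator {0..1} t *\<^sub>R h (g t *s w)) \<in> borel_measurable (lborel \<Otimes>\<^sub>M bnu \<alpha>)"
      by measurable
    have "(\<lambda>t. \<integral>w. norm (case (t, w) of (t, w) \<Rightarrow> indicator {0..1} t *\<^sub>R h (g t *s w)) \<partial>bnu \<alpha>) =
        (\<lambda>t. indicator {0..1} t *\<^sub>R (\<integral>w. norm (h w) \<partial>bnu \<alpha>))"
      by (simp add: nrot)
    then show "integrable lborel (\<lambda>t. \<integral>w. norm (case (t, w) of (t, w) \<Rightarrow> indicator {0..1} t *\<^sub>R h (g t *s w)) \<partial>bnu \<alpha>)"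
      by (simp add: integrable_indicator_iff)
    show "AE t in lborel. integrable (bnu \<alpha>) (\<lambda>w. case (t, w) of (t, w) \<Rightarrow> indicator {0..1} t *\<^sub>R h (g t *s w))"
      by (auto intro!: AE_I2 int_rot)
  qed
  have "(\<integral>w. h w \<partial>bnu \<alpha>) = (\<integral>t. indicator {0..1} t *\<^sub>R (\<integral>w. h w \<partial>bnu \<alpha>) \<partial>(lborel :: real measure))"
    by simp
  also have "\<dots> = (\<integral>t. (\<integral>w. indicator {0..1} t *\<^sub>R h (g t *s w) \<partial>bnu \<alpha>) \<partial>lborel)"
    by (simp add: int_rot(2))
  also have "\<dots> = (\<integral>w. (\<integral>t. indicator {0..1} t *\<^sub>R h (g t *s w) \<partial>lborel) \<partial>bnu \<alpha>)"
    using P.Fubini_integral[of "\<lambda>t w. indicator {0..1} t *\<^sub>R h (g t *s w)"] int by simp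
  also have "\<dots> = (\<integral>w. h 0 \<partial>(bnu \<alpha> :: (complex ^ 'n) measure))"
  proof (rule integral_cong_AE)
    show "AE w in bnu \<alpha>. (\<integral>t. indicator {0..1} t *\<^sub>R h (g t *s w) \<partial>lborel) = h 0"
      using AE_bnu_ball
    proof eventually_elim
      case (elim w)
      then have w: "norm w < 1" by simp
      have op: "open {l. cmod l * norm w < 1}" by (intro open_Collect_less continuous_intros)
      have sub: "cball 0 1 \<subseteq> {l. cmod l * norm w < 1}"
        using w by (auto intro: le_less_trans[OF mult_right_mono[of _ 1 "norm w"]])
      show ?case using circle_mean_value[OF hol[OF w] op sub] by (simp add: g_def)
    qed
  qed measurable
  also have "\<dots> = h 0"
    using emeasure_bnu_UNIV[OF \<alpha>, where 'n = 'n] by (simp add: measure_def)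
  finally show ?thesis .
qed

lemma mobius_linear_scale: "mobius_linear a (c *s v) = c *s mobius_linear a v"
  by (simp add: mobius_linear_def cdot_scale_left vec_eq_iff algebra_simps scaleR_conv_of_real[where 'a = complex])

text \<open>The derivatives of the curve, of \<open>mobius z\<close> and of f are all
  complex-linear, so the chain rule yields a complex derivative.\<close>

lemma holomorphic_on_mobius_curve:
  fixes f :: "complex ^ 'n \<Rightarrow> complex"
  assumes z: "norm z < 1"
    and f: "\<And>w. norm w < 1 \<Longrightarrow> \<exists>D. (f has_derivative D) (at w) \<and> (\<forall>c v. D (c *s v) = c * D v)"
  shows "(\<lambda>l. f (mobius z (l *s w))) holomorphic_on {l. cmod l * norm w < 1}"
  unfolding holomorphic_on_def
proof
  fix l assume "l \<in> {l. cmod l * norm w < 1}"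
  then have lw: "norm (l *s w) < 1" by (simp add: norm_scale)
  have nz: "1 - cdot (l *s w) z \<noteq> 0" using one_minus_cdot_bounds(5)[OF lw, of z] z by simp
  define M where "M = (\<lambda>v. inverse (1 - cdot (l *s w) z) *s (- mobius_linear z v) +
     (inverse (1 - cdot (l *s w) z) * cdot v z * inverse (1 - cdot (l *s w) z)) *s (z - mobius_linear z (l *s w)))"
  have M: "(mobius z has_derivative M) (at (l *s w))"
    unfolding M_def by (rule mobius_has_derivative[OF nz])
  have Mc: "M (c *s v) = c *s M v" for c v
    by (simp add: M_def mobius_linear_scale cdot_scale_left vec_eq_iff algebra_simps)
  obtain D where D: "(f has_derivative D) (at (mobius z (l *s w)))" "\<And>c v. D (c *s v) = c * D v"
    using f[OF norm_mobius_less[OF z lw]] by blast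
  have "((\<lambda>l. l *s w) has_derivative (\<lambda>m. m *s w)) (at l)"
    by (rule bounded_linear_imp_has_derivative[OF bounded_bilinear.bounded_linear_left[OF bounded_bilinear_scale]])
  from diff_chain_at[OF diff_chain_at[OF this M]] D(1)
  have "((f \<circ> (mobius z \<circ> (\<lambda>l. l *s w))) has_derivative (D \<circ> (M \<circ> (\<lambda>m. m *s w)))) (at l)"
    by simp
  moreover have "D \<circ> (M \<circ> (\<lambda>m. m *s w)) = (*) (D (M w))"
    by (simp add: fun_eq_iff Mc D(2) mult.commute)
  ultimately have "((\<lambda>l. f (mobius z (l *s w))) has_field_derivative D (M w)) (at l)"
    by (simp add: has_field_derivative_def o_def)
  then show "(\<lambda>l. f (mobius z (l *s w))) field_differentiable at l within {l. cmod l * norm w < 1}"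
    using field_differentiable_at_within field_differentiable_def by blast
qed

lemma holomorphic_on_one_minus_mobius_powr:
  assumes z: "norm z < 1" and u: "norm u \<le> 1"
  shows "(\<lambda>l. (1 - cdot (mobius z (l *s w)) u) powr a) holomorphic_on {l. cmod l * norm w < 1}"
proof -
  have "(\<lambda>l. cdot (mobius z (l *s w)) u) holomorphic_on {l. cmod l * norm w < 1}"
  proof (rule holomorphic_on_mobius_curve[OF z])
    fix y
    have "((\<lambda>x. cdot x u) has_derivative (\<lambda>x. cdot x u)) (at y)"
      by (rule bounded_linear_imp_has_derivative[OF bounded_linear_cdot_left])
    then show "\<exists>D. ((\<lambda>x. cdot x u) has_derivative D) (at y) \<and> (\<forall>c v. D (c *s v) = c * D v)"
      by (auto simp: cdot_scale_left)
  qed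
  moreover have "1 - cdot (mobius z (l *s w)) u \<notin> \<real>\<^sub>\<le>\<^sub>0" if "cmod l * norm w < 1" for l
  proof -
    have "norm (mobius z (l *s w)) < 1" using that by (intro norm_mobius_less z) (simp add: norm_scale)
    then show ?thesis using one_minus_cdot_bounds(1)[OF _ u] by (force simp: complex_nonpos_Reals_iff)
  qed
  ultimately show ?thesis by (intro holomorphic_intros) auto
qed

text \<open>The mean value property is applied to \<open>h\<close>, the composition of
  \<open>F\<close> with \<open>mobius z\<close>. The factor (1 - <w,z>)^N in \<open>F\<close> is
  chosen so that \<open>mobius_density\<close> times \<open>F\<close> is a constant multiple of the
  conjugate kernel times f, while h(0) = F(z) is f(z) times the same constant.\<close>

lemma reproducing_scalar:
  fixes f :: "complex ^ 'n \<Rightarrow> complex"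
  assumes \<alpha>: "\<alpha> > -1" and f: "integrable (bnu \<alpha>) f" and z: "norm z < 1"
    and df: "\<And>w. norm w < 1 \<Longrightarrow> \<exists>D. (f has_derivative D) (at w) \<and> (\<forall>c v. D (c *s v) = c * D v)"
  shows "(\<integral>w. cnj (bergman_kernel \<alpha> z w) * f w \<partial>bnu \<alpha>) = f z"
proof -
  define N where "N = real CARD('n) + 1 + \<alpha>"
  have [measurable]: "f \<in> borel_measurable borel" using borel_measurable_integrable[OF f] by simp
  define F where "F = (\<lambda>w. f w * (1 - cdot w z) powr of_real N)"
  have [measurable]: "F \<in> borel_measurable borel" unfolding F_def by measurable
  define h where "h = (\<lambda>w. F (mobius z w))"
  have [measurable]: "h \<in> borel_measurable borel" unfolding h_def by measurable
  define s where "s = 1 - (norm z)\<^sup>2"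
  have s: "s > 0" using z by (simp add: s_def abs_square_less_1)
  have eq: "mobius_density \<alpha> z w *\<^sub>R h (mobius z w) = of_real (s powr N) * (cnj (bergman_kernel \<alpha> z w) * f w)"
    if "w \<in> ball 0 1" for w
  proof -
    have w: "norm w < 1" using that by simp
    define q where "q = 1 - cdot w z"
    have q: "Re q > 0" "q \<noteq> 0" using one_minus_cdot_bounds(1,5)[OF w, of z] z by (auto simp: q_def)
    have hw: "h (mobius z w) = f w * q powr of_real N"
      using mobius_involution[OF z, of w] w by (simp add: h_def F_def q_def)
    define k where "k = q powr (- of_real N)"
    have K: "bergman_kernel \<alpha> z w = k" by (simp add: k_def bergman_kernel_def N_def q_def)
    have "cmod k = cmod q powr (-N)"
      unfolding k_def of_real_minus[symmetric] by (simp only: norm_powr_real_powr' Reals_of_real Re_complex_of_real)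
    then have "mobius_density \<alpha> z w = s powr N * (cmod k)\<^sup>2"
      unfolding mobius_density_def s_def[symmetric] q_def[symmetric] N_def[symmetric] using s q
      by (simp add: powr_divide powr_minus power2_eq_square powr_mult) (simp add: field_simps)
    then have "of_real (mobius_density \<alpha> z w) = of_real (s powr N) * (k * cnj k)"
      by (simp only: of_real_mult complex_norm_square)
    moreover have "k * q powr of_real N = 1" using q by (simp add: k_def powr_minus)
    ultimately show ?thesis unfolding hw K scaleR_conv_of_real by (simp add: mult_ac)
  qed
  have "integrable (bnu \<alpha>) (\<lambda>w. cnj (bergman_kernel \<alpha> z w) * f w)"
  proof (rule Bochner_Integration.integrable_bound)
    show "integrable (bnu \<alpha>) (\<lambda>w. (1 - norm z) powr (- N) *\<^sub>R norm (f w))" using f by simp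
    show "AE w in bnu \<alpha>. norm (cnj (bergman_kernel \<alpha> z w) * f w) \<le> norm ((1 - norm z) powr (- N) *\<^sub>R norm (f w))"
      using AE_bnu_ball
    proof eventually_elim
      case (elim w)
      then have "kmod \<alpha> z w \<le> (1 - norm z) powr (- N)"
        unfolding N_def using z by (intro kmod_le[OF \<alpha> order_refl]) auto
      then show ?case by (simp add: norm_mult cmod_bergman_kernel mult_right_mono)
    qed
  qed measurable
  then have "integrable (bnu \<alpha>) (\<lambda>w. of_real (s powr N) * (cnj (bergman_kernel \<alpha> z w) * f w))"
    by (rule integrable_mult_right)
  moreover have AEeq: "AE w in bnu \<alpha>. of_real (s powr N) * (cnj (bergman_kernel \<alpha> z w) * f w) = mobius_density \<alpha> z w *\<^sub>R h (mobius z w)"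
    using AE_bnu_ball by eventually_elim (simp only: eq)
  ultimately have "integrable (bnu \<alpha>) (\<lambda>w. mobius_density \<alpha> z w *\<^sub>R h (mobius z w))"
    by (subst (asm) integrable_cong_AE) auto
  then have ih: "integrable (bnu \<alpha>) h"
    using integral_bnu_mobius(1)[OF \<alpha> z, of h] by simp
  have "of_real (s powr N) * (\<integral>w. cnj (bergman_kernel \<alpha> z w) * f w \<partial>bnu \<alpha>) =
      (\<integral>w. of_real (s powr N) * (cnj (bergman_kernel \<alpha> z w) * f w) \<partial>bnu \<alpha>)"
    by simp
  also have "\<dots> = (\<integral>w. mobius_density \<alpha> z w *\<^sub>R h (mobius z w) \<partial>bnu \<alpha>)"
    by (rule integral_cong_AE) (use AEeq in auto)
  also have "\<dots> = (\<integral>w. h w \<partial>bnu \<alpha>)" by (rule integral_bnu_mobius(2)[OF \<alpha> z]) measurable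
  also have "\<dots> = h 0"
  proof (rule mean_value_bnu[OF \<alpha> ih])
    fix w :: "complex ^ 'n" assume w: "norm w < 1"
    show "(\<lambda>l. h (l *s w)) holomorphic_on {l. cmod l * norm w < 1}"
      unfolding h_def F_def using z
      by (intro holomorphic_on_mult holomorphic_on_mobius_curve df holomorphic_on_one_minus_mobius_powr) auto
  qed
  also have "\<dots> = f z * of_real (s powr N)"
  proof -
    have "1 - cdot z z = of_real s" by (simp add: cdot_self s_def)
    then show ?thesis using s by (simp add: h_def F_def powr_of_real)
  qed
  finally show ?thesis using s by simp
qed

lemma reproducing_ell2:
  fixes f :: "complex ^ 'n \<Rightarrow> ell2"
  assumes \<alpha>: "\<alpha> > -1" and f: "integrable (bnu \<alpha>) f" and z: "norm z < 1" and hol: "holomorphic_ball f"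
  shows "(\<integral>w. cnj (bergman_kernel \<alpha> z w) *\<^sub>C f w \<partial>bnu \<alpha>) = f z"
proof (rule ell2_eqI)
  fix i
  have "coord (\<integral>w. cnj (bergman_kernel \<alpha> z w) *\<^sub>C f w \<partial>bnu \<alpha>) i = (\<integral>w. cnj (bergman_kernel \<alpha> z w) * coord (f w) i \<partial>bnu \<alpha>)"
    by (simp add: coord_integral[OF integrable_kernel[OF \<alpha> f z]])
  also have "\<dots> = coord (f z) i"
  proof (rule reproducing_scalar[OF \<alpha> _ z])
    show "integrable (bnu \<alpha>) (\<lambda>w. coord (f w) i)"
      by (rule integrable_bounded_linear[OF bounded_linear_coord f])
    fix w :: "complex ^ 'n" assume "norm w < 1"
    then obtain D where D: "(f has_derivative D) (at w)" "\<And>c v. D (c *s v) = c *\<^sub>C D v"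
      using hol unfolding holomorphic_ball_def by (auto simp: Ball_def)
    show "\<exists>D. ((\<lambda>w. coord (f w) i) has_derivative D) (at w) \<and> (\<forall>c v. D (c *s v) = c * D v)"
      using bounded_linear.has_derivative[OF bounded_linear_coord D(1), of i] D(2) by (intro exI conjI) auto
  qed
  finally show "coord (\<integral>w. cnj (bergman_kernel \<alpha> z w) *\<^sub>C f w \<partial>bnu \<alpha>) i = coord (f z) i" .
qed

section \<open>Holomorphic dependence on a parameter\<close>

text \<open>Schwarz's lemma turns the bound \<open>g\<close> on the functions into the bound 2 g / r
  on their difference quotients, so dominated convergence permits differentiation under the integral
  without a hypothesis on the derivatives.\<close>

lemma holomorphic_on_parametric_integral:
  fixes F :: "complex \<Rightarrow> 'a \<Rightarrow> complex"
  assumes U: "open U"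
    and hol: "\<And>x. x \<in> space M \<Longrightarrow> (\<lambda>l. F l x) holomorphic_on U"
    and meas: "\<And>l. l \<in> U \<Longrightarrow> F l \<in> borel_measurable M"
    and g: "integrable M g" and bound: "\<And>l x. l \<in> U \<Longrightarrow> x \<in> space M \<Longrightarrow> cmod (F l x) \<le> g x"
  shows "(\<lambda>l. \<integral>x. F l x \<partial>M) holomorphic_on U"
  unfolding holomorphic_on_open[OF U]
proof
  fix l assume l: "l \<in> U"
  obtain r where r: "r > 0" "cball l r \<subseteq> U" using U l by (meson open_contains_cball)
  define d where "d = (\<lambda>x. deriv (\<lambda>l. F l x) l)"
  have int: "integrable M (F m)" if "m \<in> U" for m
    by (rule Bochner_Integration.integrable_bound[OF g meas[OF that]])
       (auto intro!: AE_I2 order_trans[OF bound[OF that] abs_ge_self])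
  have der: "((\<lambda>l. F l x) has_field_derivative d x) (at l)" if "x \<in> space M" for x
    unfolding d_def by (rule holomorphic_derivI[OF hol[OF that] U l])
  have lip: "cmod (F m x - F l x) \<le> 2 * g x / r * cmod (m - l)" if m: "m \<in> ball l r" and x: "x \<in> space M" for m x
  proof -
    define G where "G = (\<lambda>y. F (l + of_real r * y) x - F l x)"
    have g0: "g x \<ge> 0" using bound[OF l x] norm_ge_zero order_trans by blast
    have inU: "l + of_real r * y \<in> U" if "cmod y \<le> 1" for y
      using r that by (intro subsetD[OF r(2)]) (auto simp: dist_norm norm_mult mult_left_le)
    \<comment> \<open>The term \<open>e\<close> keeps the quotient strictly inside the unit disc,
      also when \<open>g x\<close> is 0; it tends to 0 afterwards.\<close>
    have GH: "(\<lambda>y. G y / of_real (2 * g x + e)) holomorphic_on ball 0 1" if "e > 0" for e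
    proof -
      have "(\<lambda>y. F (l + of_real r * y) x) holomorphic_on ball 0 1"
        by (rule holomorphic_on_compose_gen[OF _ hol[OF x], unfolded o_def])
           (use inU in \<open>auto intro!: holomorphic_intros\<close>)
      moreover have "complex_of_real (2 * g x + e) \<noteq> 0"
        unfolding of_real_eq_0_iff using g0 that by simp
      ultimately show ?thesis unfolding G_def by (intro holomorphic_on_divide holomorphic_on_diff holomorphic_on_const)
    qed
    define y where "y = (m - l) / of_real r"
    have y: "cmod y < 1" using m r by (simp add: y_def norm_divide dist_norm norm_minus_commute)
    have "cmod (F m x - F l x) \<le> 2 * g x * cmod y + e" if e: "e > 0" for e
    proof -
      have C: "2 * g x + e > 0" using g0 e by simp
      have "cmod (G w / of_real (2 * g x + e)) < 1" if w: "cmod w < 1" for w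
      proof -
        have "cmod (G w) \<le> cmod (F (l + of_real r * w) x) + cmod (F l x)"
          unfolding G_def by (rule norm_triangle_ineq4)
        also have "\<dots> \<le> g x + g x" using w by (intro add_mono bound inU l x) auto
        finally have "cmod (G w) < 2 * g x + e" using e by simp
        then show ?thesis using C unfolding norm_divide norm_of_real by simp
      qed
      from Schwarz_Lemma(1)[OF GH[OF e] _ this y]
      have "cmod (G y / of_real (2 * g x + e)) \<le> cmod y" by (simp add: G_def)
      then have "cmod (G y) \<le> (2 * g x + e) * cmod y"
        using C unfolding norm_divide norm_of_real by (simp add: divide_le_eq mult.commute)
      also have "\<dots> \<le> 2 * g x * cmod y + e"
        using y e mult_left_le[of "cmod y" e] by (simp add: distrib_right)
      finally show ?thesis using r(1) by (simp add: G_def y_def)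
    qed
    then have "cmod (F m x - F l x) \<le> 2 * g x * cmod y" by (rule field_le_epsilon)
    then show ?thesis using r(1) by (simp add: y_def norm_divide)
  qed
  \<comment> \<open>The derivative is measurable in \<open>x\<close> as a pointwise limit of
    difference quotients along one sequence.\<close>
  have dmeas: "d \<in> borel_measurable M"
  proof (rule borel_measurable_LIMSEQ_metric)
    define m where "m = (\<lambda>i :: nat. l + of_real (r / real (Suc (Suc i))))"
    have mU: "m i \<in> U" for i
    proof (rule subsetD[OF r(2)])
      have "cmod (of_real (r / real (Suc (Suc i)))) \<le> r"
        unfolding norm_of_real using r(1) by (simp add: divide_le_eq)
      then show "m i \<in> cball l r" unfolding m_def mem_cball dist_norm by simp
    qed
    show "(\<lambda>x. (F (m i) x - F l x) / (m i - l)) \<in> borel_measurable M" for i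
      using meas[OF mU[of i]] meas[OF l] by measurable
    show "(\<lambda>i. (F (m i) x - F l x) / (m i - l)) \<longlonglongrightarrow> d x" if x: "x \<in> space M" for x
    proof -
      have "filterlim m (at l) sequentially"
        unfolding filterlim_at
      proof
        have "r / real (Suc (Suc i)) \<noteq> 0" for i using r(1) by simp
        then have "complex_of_real (r / real (Suc (Suc i))) \<noteq> 0" for i by (simp only: of_real_eq_0_iff not_False_eq_True)
        then show "\<forall>\<^sub>F i in sequentially. m i \<in> UNIV \<and> m i \<noteq> l"
          unfolding m_def by (intro always_eventually allI conjI UNIV_I) (metis add_cancel_right_right)
        have "(\<lambda>i. r / real (Suc (Suc i))) \<longlonglongrightarrow> 0"
          using LIMSEQ_Suc[OF LIMSEQ_Suc[OF lim_const_over_n[of r]]] by simp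
        then have "(\<lambda>i. l + of_real (r / real (Suc (Suc i)))) \<longlonglongrightarrow> l + of_real 0"
          by (intro tendsto_intros)
        then show "m \<longlonglongrightarrow> l" by (simp add: m_def[abs_def])
      qed
      from filterlim_compose[OF der[OF x, unfolded has_field_derivative_iff] this] show ?thesis .
    qed
  qed
  have "((\<lambda>m. ((\<integral>x. F m x \<partial>M) - (\<integral>x. F l x \<partial>M)) / (m - l)) \<longlongrightarrow> (\<integral>x. d x \<partial>M)) (at l)"
    unfolding tendsto_at_iff_sequentially o_def
  proof (intro allI impI)
    fix X :: "nat \<Rightarrow> complex"
    assume X: "\<forall>i. X i \<in> UNIV - {l}" "X \<longlonglongrightarrow> l"
    have ev: "\<forall>\<^sub>F i in sequentially. X i \<in> ball l r"
      using tendstoD[OF X(2) r(1)] by (simp add: dist_commute)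
    then obtain i0 where i0: "\<And>i. i \<ge> i0 \<Longrightarrow> X i \<in> ball l r" by (auto simp: eventually_sequentially)
    have XU: "X (i + i0) \<in> U" for i using i0[of "i + i0"] r by auto
    have "(\<lambda>i. \<integral>x. (F (X (i + i0)) x - F l x) / (X (i + i0) - l) \<partial>M) \<longlonglongrightarrow> (\<integral>x. d x \<partial>M)"
    proof (rule integral_dominated_convergence[where w = "\<lambda>x. 2 * g x / r"])
      show "d \<in> borel_measurable M" by (rule dmeas)
      show "(\<lambda>x. (F (X (i + i0)) x - F l x) / (X (i + i0) - l)) \<in> borel_measurable M" for i
        using meas[OF XU[of i]] meas[OF l] by measurable
      show "integrable M (\<lambda>x. 2 * g x / r)" using g by simp
      show "AE x in M. (\<lambda>i. (F (X (i + i0)) x - F l x) / (X (i + i0) - l)) \<longlonglongrightarrow> d x"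
      proof (rule AE_I2)
        fix x assume x: "x \<in> space M"
        have "filterlim (\<lambda>i. X (i + i0)) (at l) sequentially"
          unfolding filterlim_at using X LIMSEQ_ignore_initial_segment[OF X(2), of i0] by auto
        from filterlim_compose[OF der[OF x, unfolded has_field_derivative_iff] this]
        show "(\<lambda>i. (F (X (i + i0)) x - F l x) / (X (i + i0) - l)) \<longlonglongrightarrow> d x" .
      qed
      show "AE x in M. norm ((F (X (i + i0)) x - F l x) / (X (i + i0) - l)) \<le> 2 * g x / r" for i
      proof (rule AE_I2)
        fix x assume x: "x \<in> space M"
        have "X (i + i0) \<noteq> l" using X(1) by auto
        then show "norm ((F (X (i + i0)) x - F l x) / (X (i + i0) - l)) \<le> 2 * g x / r"
          using lip[OF i0[of "i + i0"] x] by (simp add: norm_divide divide_le_eq)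
      qed
    qed
    also have "(\<lambda>i. \<integral>x. (F (X (i + i0)) x - F l x) / (X (i + i0) - l) \<partial>M) =
       (\<lambda>i. ((\<integral>x. F (X (i + i0)) x \<partial>M) - (\<integral>x. F l x \<partial>M)) / (X (i + i0) - l))"
      using int[OF XU] int[OF l] by simp
    finally show "(\<lambda>i. ((\<integral>x. F (X i) x \<partial>M) - (\<integral>x. F l x \<partial>M)) / (X i - l)) \<longlonglongrightarrow> (\<integral>x. d x \<partial>M)"
      by (rule LIMSEQ_offset)
  qed
  then show "\<exists>f'. ((\<lambda>l. \<integral>x. F l x \<partial>M) has_field_derivative f') (at l)"
    unfolding has_field_derivative_iff by blast
qed

section \<open>From the diagonal to the off-diagonal\<close>

text \<open>Hadamard-type argument: \<open>q l (s\<^sup>2 / l)\<close> is small on \<open>\<bar>l\<bar> = s\<close>, where it lies on the diagonal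
  \<open>m = cnj l\<close>, and bounded on \<open>\<bar>l\<bar> = t\<close>; dividing by \<open>l ^ k\<close> makes it small at \<open>l = 1\<close>.\<close>

lemma off_diagonal_bound:
  fixes q :: "complex \<Rightarrow> complex \<Rightarrow> complex"
  assumes s: "0 < s" "s < 1" and t: "1 < t" "t < \<rho>"
    and h1: "(\<lambda>l. q l (of_real (s\<^sup>2) / l)) holomorphic_on {l. s\<^sup>2 / \<rho> < cmod l \<and> cmod l < \<rho>}"
    and h2: "q 1 holomorphic_on ball 0 \<rho>"
    and C: "\<And>l m. cmod l < \<rho> \<Longrightarrow> cmod m < \<rho> \<Longrightarrow> cmod (q l m) \<le> C"
    and e: "\<And>l. cmod l = s \<Longrightarrow> cmod (q l (cnj l)) \<le> e"
    and d: "d > 0"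
  shows "cmod (q 1 0) \<le> max (e / s ^ k) (C / t ^ k) + (2 * C + d) * s\<^sup>2"
proof -
  have "cmod (q 0 0) \<le> C" using C[of 0 0] t by simp
  then have C0: "C \<ge> 0" by (rule order_trans[OF norm_ge_zero])
  have s2: "s\<^sup>2 < s" using s by (simp add: power2_eq_square)
  have sr: "s\<^sup>2 / \<rho> < s"
  proof -
    have "s\<^sup>2 / \<rho> \<le> s\<^sup>2 / 1" using t by (intro divide_left_mono) auto
    then show ?thesis using s2 by simp
  qed
  define S :: "complex set" where "S = cball 0 t - ball 0 s"
  have clS: "closed S" unfolding S_def by (intro closed_Diff closed_cball open_ball)
  have sub: "S \<subseteq> {l. s\<^sup>2 / \<rho> < cmod l \<and> cmod l < \<rho>}" unfolding S_def using sr t by auto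
  define r where "r = (\<lambda>l. q l (of_real (s\<^sup>2) / l) / l ^ k)"
  have hr: "r holomorphic_on {l. s\<^sup>2 / \<rho> < cmod l \<and> cmod l < \<rho>}"
  proof -
    have "s\<^sup>2 / \<rho> \<ge> 0" using t by simp
    then have "l \<noteq> 0" if "s\<^sup>2 / \<rho> < cmod l" for l :: complex using that by auto
    then show ?thesis unfolding r_def by (intro holomorphic_on_divide h1 holomorphic_intros) auto
  qed
  \<comment> \<open>The maximum principle on the annulus between |l| = s and |l| = t, which contains
    1; its boundary circles give the two terms of the maximum.\<close>
  have "cmod (r 1) \<le> max (e / s ^ k) (C / t ^ k)"
  proof (rule maximum_modulus_frontier[where f = r and S = S and \<xi> = 1])
    show "r holomorphic_on interior S"
      by (rule holomorphic_on_subset[OF hr]) (use sub interior_subset in blast)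
    show "continuous_on (closure S) r"
      unfolding closure_closed[OF clS] by (rule holomorphic_on_imp_continuous_on[OF holomorphic_on_subset[OF hr sub]])
    show "bounded S" unfolding S_def by (rule bounded_subset[OF bounded_cball]) auto
    show "1 \<in> S" using s t by (simp add: S_def)
    fix l assume l: "l \<in> frontier S"
    have "ball 0 t - cball 0 s \<subseteq> interior S"
      by (rule interior_maximal) (auto simp: S_def intro: open_Diff)
    moreover have "l \<in> S" "l \<notin> interior S" using l clS by (auto simp: frontier_def)
    ultimately consider "cmod l = s" | "cmod l = t" unfolding S_def by force
    then show "cmod (r l) \<le> max (e / s ^ k) (C / t ^ k)"
    proof cases
      case 1
      have "l \<noteq> 0" using 1 s by auto
      have "of_real (s\<^sup>2) / l = cnj l"
        using complex_norm_square[of l] \<open>l \<noteq> 0\<close> unfolding 1 by simp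
      then have "cmod (r l) \<le> e / s ^ k"
        unfolding r_def norm_divide norm_power 1 using e[OF 1] s by (simp add: divide_right_mono)
      then show ?thesis by simp
    next
      case 2
      have "cmod (of_real (s\<^sup>2) / l) = s\<^sup>2 / t" by (simp add: norm_divide 2 norm_power)
      also have "\<dots> \<le> s\<^sup>2 / 1" using t by (intro divide_left_mono) auto
      also have "\<dots> < \<rho>" using s2 s t by simp
      finally have b: "cmod (of_real (s\<^sup>2) / l) < \<rho>" .
      have "cmod (q l (of_real (s\<^sup>2) / l)) \<le> C"
        by (rule C[OF _ b]) (use 2 t in simp)
      then have "cmod (r l) \<le> C / t ^ k"
        unfolding r_def norm_divide[of "q _ _"] norm_power[of l] 2 using t by (intro divide_right_mono) auto
      then show ?thesis by simp
    qed
  qed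
  then have 1: "cmod (q 1 (of_real (s\<^sup>2))) \<le> max (e / s ^ k) (C / t ^ k)" by (simp add: r_def)
  \<comment> \<open>Schwarz's lemma in the second variable moves from s^2 to 0. Since |q 1 m - q 1
    0| \<le> 2 C, the summand \<open>d\<close> makes the inequality strict and the denominator
    nonzero.\<close>
  define G where "G = (\<lambda>m. (q 1 m - q 1 0) / of_real (2 * C + d))"
  have nz: "complex_of_real (2 * C + d) \<noteq> 0" unfolding of_real_eq_0_iff using C0 d by simp
  have "G holomorphic_on ball 0 1"
    unfolding G_def using nz t
    by (intro holomorphic_on_divide holomorphic_on_diff holomorphic_on_const holomorphic_on_subset[OF h2]) auto
  moreover have "G 0 = 0" by (simp add: G_def)
  moreover have "cmod (G m) < 1" if "cmod m < 1" for m
  proof -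
    have "cmod (q 1 m - q 1 0) \<le> cmod (q 1 m) + cmod (q 1 0)" by (rule norm_triangle_ineq4)
    also have "\<dots> \<le> C + C" using that t by (intro add_mono C) auto
    finally show ?thesis using C0 d unfolding G_def norm_divide norm_of_real by simp
  qed
  moreover have "cmod (of_real (s\<^sup>2)) < 1" unfolding norm_of_real using s2 s by simp
  ultimately have "cmod (G (of_real (s\<^sup>2))) \<le> cmod (of_real (s\<^sup>2))" by (rule Schwarz_Lemma(1))
  then have "cmod (q 1 (of_real (s\<^sup>2)) - q 1 0) \<le> (2 * C + d) * s\<^sup>2"
    using C0 d unfolding G_def norm_divide norm_of_real by (simp add: divide_le_eq mult.commute)
  moreover have "cmod (q 1 0) \<le> cmod (q 1 (of_real (s\<^sup>2))) + cmod (q 1 (of_real (s\<^sup>2)) - q 1 0)"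
    by (metis add.commute norm_minus_commute norm_triangle_sub)
  ultimately show ?thesis using 1 by linarith
qed

section \<open>The kernel of the Toeplitz operator\<close>

text \<open>The last assumption says that the Berezin transform of the modulus of
  \<open>\<tau>\<close> is bounded by \<open>M\<close>. \<open>N\<close> abbreviates the exponent of
  the Bergman kernel.\<close>

locale carleson_symbol =
  fixes \<alpha> N M :: real and \<tau> :: "complex ^ 'n \<Rightarrow> complex"
  assumes \<alpha>: "\<alpha> > -1" and N_def: "N = real CARD('n) + 1 + \<alpha>" and \<tau>_measurable [measurable]: "\<tau> \<in> borel_measurable borel" and M_nonneg: "M \<ge> 0"
    and M: "\<And>z. norm z < 1 \<Longrightarrow> (\<integral>\<^sup>+ u. ennreal (cmod (\<tau> u)) * ennreal (mobius_density \<alpha> z u) \<partial>bnu \<alpha>) \<le> ennreal M"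
begin

lemma N_pos: "N > 0" using \<alpha> by (simp add: N_def)

lemma integrable_\<tau>: "integrable (bnu \<alpha>) \<tau>"
proof (rule integrableI_bounded)
  have "(\<integral>\<^sup>+ u. ennreal (cmod (\<tau> u)) \<partial>bnu \<alpha>) \<le> ennreal M"
    using M[of 0] by (simp add: mobius_density_def)
  then show "(\<integral>\<^sup>+ u. ennreal (cmod (\<tau> u)) \<partial>bnu \<alpha>) < \<infinity>" by (simp add: le_less_trans)
qed simp

text \<open>This is the Toeplitz operator with symbol \<open>\<tau>\<close> applied to the kernel
  function K_z and evaluated at w, hence the integral kernel of that operator on reproduced
  functions.\<close>

definition H :: "complex ^ 'n \<Rightarrow> complex ^ 'n \<Rightarrow> complex" where
  "H z w = (\<integral>u. \<tau> u * bergman_kernel \<alpha> z u * cnj (bergman_kernel \<alpha> w u) \<partial>bnu \<alpha>)"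

lemma kmod_sq:
  fixes a u :: "complex ^ 'n"
  assumes "norm a < 1"
  shows "kmod \<alpha> a u = sqrt (mobius_density \<alpha> a u) * (1 - (norm a)\<^sup>2) powr (- N / 2)"
proof -
  define s where "s = 1 - (norm a)\<^sup>2"
  have s: "s > 0" using assms by (simp add: s_def abs_square_less_1)
  define q where "q = cmod (1 - cdot u a)"
  have "mobius_density \<alpha> a u = s powr N * (q powr (-N))\<^sup>2"
    unfolding mobius_density_def N_def[symmetric] s_def[symmetric] q_def[symmetric] using s
    by (simp add: powr_divide powr_minus power2_eq_square powr_mult q_def) (simp add: divide_inverse)
  then have "sqrt (mobius_density \<alpha> a u) = s powr (N / 2) * q powr (-N)"
    using s by (simp add: real_sqrt_mult powr_half_sqrt[symmetric] powr_powr del: powr_half_sqrt)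
  then show ?thesis unfolding kmod_def N_def[symmetric] s_def[symmetric] q_def[symmetric] using s
    by (simp add: powr_add[symmetric] mult.commute mult.left_commute)
qed

text \<open>The inequality of arithmetic and geometric means replaces a product of kernels at two
  points by densities at single points, to which the Carleson hypothesis applies.\<close>

lemma kmod_mult_le:
  fixes a b u :: "complex ^ 'n"
  assumes a: "norm a < 1" and b: "norm b < 1"
  shows "kmod \<alpha> a u * kmod \<alpha> b u \<le>
    (mobius_density \<alpha> a u + mobius_density \<alpha> b u) / 2 * ((1 - (norm a)\<^sup>2) powr (- N / 2) * (1 - (norm b)\<^sup>2) powr (- N / 2))"
proof -
  have "kmod \<alpha> a u * kmod \<alpha> b u = sqrt (mobius_density \<alpha> a u) * sqrt (mobius_density \<alpha> b u) *
      ((1 - (norm a)\<^sup>2) powr (- N / 2) * (1 - (norm b)\<^sup>2) powr (- N / 2))"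
    unfolding kmod_sq[OF a] kmod_sq[OF b] by (simp add: mult_ac)
  also have "\<dots> \<le> (mobius_density \<alpha> a u + mobius_density \<alpha> b u) / 2 *
      ((1 - (norm a)\<^sup>2) powr (- N / 2) * (1 - (norm b)\<^sup>2) powr (- N / 2))"
    using arith_geo_mean_sqrt[of "mobius_density \<alpha> a u" "mobius_density \<alpha> b u"]
    by (intro mult_right_mono) (auto simp: real_sqrt_mult)
  finally show ?thesis .
qed

lemma nn_integral_\<tau>_kmod_le:
  fixes a b :: "complex ^ 'n"
  assumes a: "norm a < 1" and b: "norm b < 1"
  shows "(\<integral>\<^sup>+ u. ennreal (cmod (\<tau> u) * (kmod \<alpha> a u * kmod \<alpha> b u)) \<partial>bnu \<alpha>) \<le>
    ennreal (M * ((1 - (norm a)\<^sup>2) powr (- N / 2) * (1 - (norm b)\<^sup>2) powr (- N / 2)))"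
proof -
  define c where "c = (1 - (norm a)\<^sup>2) powr (- N / 2) * (1 - (norm b)\<^sup>2) powr (- N / 2)"
  have c: "c \<ge> 0" by (simp add: c_def)
  have "(\<integral>\<^sup>+ u. ennreal (cmod (\<tau> u) * (kmod \<alpha> a u * kmod \<alpha> b u)) \<partial>bnu \<alpha>) \<le>
      (\<integral>\<^sup>+ u. ennreal (c / 2) * (ennreal (cmod (\<tau> u)) * ennreal (mobius_density \<alpha> a u)) +
         ennreal (c / 2) * (ennreal (cmod (\<tau> u)) * ennreal (mobius_density \<alpha> b u)) \<partial>bnu \<alpha>)"
  proof (rule nn_integral_mono)
    fix u
    have "cmod (\<tau> u) * (kmod \<alpha> a u * kmod \<alpha> b u) \<le>
        cmod (\<tau> u) * ((mobius_density \<alpha> a u + mobius_density \<alpha> b u) / 2 * c)"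
      unfolding c_def by (intro mult_left_mono kmod_mult_le a b) simp
    also have "\<dots> = c / 2 * (cmod (\<tau> u) * mobius_density \<alpha> a u) + c / 2 * (cmod (\<tau> u) * mobius_density \<alpha> b u)"
      by (simp add: algebra_simps)
    finally show "ennreal (cmod (\<tau> u) * (kmod \<alpha> a u * kmod \<alpha> b u)) \<le>
        ennreal (c / 2) * (ennreal (cmod (\<tau> u)) * ennreal (mobius_density \<alpha> a u)) +
         ennreal (c / 2) * (ennreal (cmod (\<tau> u)) * ennreal (mobius_density \<alpha> b u))"
      using c by (simp add: ennreal_leI flip: ennreal_mult ennreal_plus)
  qed
  also have "\<dots> = ennreal (c / 2) * (\<integral>\<^sup>+ u. ennreal (cmod (\<tau> u)) * ennreal (mobius_density \<alpha> a u) \<partial>bnu \<alpha>) +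
      ennreal (c / 2) * (\<integral>\<^sup>+ u. ennreal (cmod (\<tau> u)) * ennreal (mobius_density \<alpha> b u) \<partial>bnu \<alpha>)"
    by (simp add: nn_integral_add nn_integral_cmult)
  also have "\<dots> \<le> ennreal (c / 2) * ennreal M + ennreal (c / 2) * ennreal M"
    by (intro add_mono mult_left_mono M a b) auto
  also have "\<dots> = ennreal (c / 2 * M + c / 2 * M)"
    using c M_nonneg by (simp flip: ennreal_mult ennreal_plus)
  also have "c / 2 * M + c / 2 * M = M * c" by simp
  finally show ?thesis by (simp add: c_def)
qed

lemma H_measurable [measurable (raw)]:
  assumes [measurable]: "f \<in> borel_measurable L" "g \<in> borel_measurable L"
  shows "(\<lambda>x. H (f x) (g x)) \<in> borel_measurable L"
proof -
  interpret S: sigma_finite_measure "bnu \<alpha> :: (complex ^ 'n) measure" by (rule sigma_finite_bnu[OF \<alpha>])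
  show ?thesis unfolding H_def by measurable
qed

lemma cmod_H_le_nn:
  "ennreal (cmod (H z w)) \<le> (\<integral>\<^sup>+ u. ennreal (cmod (\<tau> u) * (kmod \<alpha> z u * kmod \<alpha> w u)) \<partial>bnu \<alpha>)"
proof (cases "integrable (bnu \<alpha>) (\<lambda>u. \<tau> u * bergman_kernel \<alpha> z u * cnj (bergman_kernel \<alpha> w u))")
  case True
  from integral_norm_bound_ennreal[OF this] show ?thesis
    unfolding H_def by (simp add: norm_mult cmod_bergman_kernel mult.assoc)
next
  \<comment> \<open>The Bochner integral is 0 by convention if the integrand is not
    integrable.\<close>
  case False
  then show ?thesis by (simp add: H_def not_integrable_integral_eq)
qed

lemma cmod_H_le:
  assumes "norm a < 1" "norm b < 1"
  shows "cmod (H a b) \<le> M * ((1 - (norm a)\<^sup>2) powr (- N / 2) * (1 - (norm b)\<^sup>2) powr (- N / 2))"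
  using order_trans[OF cmod_H_le_nn nn_integral_\<tau>_kmod_le[OF assms]] M_nonneg
  by (subst (asm) ennreal_le_iff) auto

end

lemma holomorphic_on_cnj_cnj:
  assumes "f holomorphic_on {l. cmod l * c < 1}"
  shows "(\<lambda>l. cnj (f (cnj l))) holomorphic_on {l. cmod l * c < 1}"
proof -
  have op: "open {l. cmod l * c < 1}" by (intro open_Collect_less continuous_intros)
  show ?thesis
    unfolding holomorphic_on_open[OF op]
  proof
    fix l assume "l \<in> {l. cmod l * c < 1}"
    then have "cnj l \<in> {l. cmod l * c < 1}" by simp
    from holomorphic_derivI[OF assms op this]
    have "((cnj \<circ> f \<circ> cnj) has_field_derivative cnj (deriv f (cnj l))) (at l)"
      by (rule has_field_derivative_cnj_cnj)
    then show "\<exists>f'. ((\<lambda>l. cnj (f (cnj l))) has_field_derivative f') (at l)"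
      unfolding o_def by blast
  qed
qed

text \<open>On a fixed ball |y| \<le> r the image \<open>mobius z y\<close> is as close to the
  sphere as z is, up to constants. The upper bound pushes the images to the boundary as |z| tends to
  1; the lower one keeps them in a smaller ball for fixed z.\<close>

lemma mobius_defect_le:
  assumes z: "norm z < 1" and y: "norm y \<le> r" and r: "r < 1"
  shows "mobius_defect z y \<le> (1 - (norm z)\<^sup>2) / (1 - r)\<^sup>2" "(1 - (norm z)\<^sup>2) * (1 - r\<^sup>2) / 4 \<le> mobius_defect z y"
proof -
  have s: "1 - (norm z)\<^sup>2 > 0" using z by (simp add: abs_square_less_1)
  have y1: "norm y < 1" using y r by simp
  have r0: "r \<ge> 0" using y norm_ge_zero order_trans by blast
  have q1: "1 - r \<le> cmod (1 - cdot y z)" using one_minus_cdot_bounds(3)[OF y1, of z] y z by simp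
  have "cmod (1 - cdot y z) \<le> 1 + cmod (cdot y z)" using norm_triangle_ineq4[of 1 "cdot y z"] by simp
  also have "cmod (cdot y z) \<le> 1 * 1"
    by (rule order_trans[OF cmod_cdot_le mult_mono]) (use y1 z in auto)
  finally have q2: "cmod (1 - cdot y z) \<le> 2" by simp
  have q0: "cmod (1 - cdot y z) > 0" using q1 r by linarith
  show "mobius_defect z y \<le> (1 - (norm z)\<^sup>2) / (1 - r)\<^sup>2"
    unfolding mobius_defect_def
  proof (rule frac_le)
    show "(1 - (norm z)\<^sup>2) * (1 - (norm y)\<^sup>2) \<le> 1 - (norm z)\<^sup>2"
      using s mult_left_le[of "1 - (norm y)\<^sup>2" "1 - (norm z)\<^sup>2"] by simp
    show "(1 - r)\<^sup>2 \<le> (cmod (1 - cdot y z))\<^sup>2" using q1 r by (intro power_mono) auto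
  qed (use s r in auto)
  have "(norm y)\<^sup>2 \<le> r\<^sup>2" using y by (intro power_mono) auto
  moreover have "(cmod (1 - cdot y z))\<^sup>2 \<le> 2\<^sup>2" using q2 by (intro power_mono) auto
  moreover have "r\<^sup>2 \<le> 1" using r r0 by (simp add: abs_square_le_1)
  ultimately show "(1 - (norm z)\<^sup>2) * (1 - r\<^sup>2) / 4 \<le> mobius_defect z y"
    unfolding mobius_defect_def using s q0 by (intro frac_le mult_mono mult_nonneg_nonneg) auto
qed

lemma norm_mobius_le:
  fixes z :: "complex ^ 'n"
  assumes z: "norm z < 1" and r: "0 \<le> r" "r < 1"
  obtains r' where "r' < 1" "\<And>y. norm y \<le> r \<Longrightarrow> norm (mobius z y) \<le> r'"
proof
  define k where "k = (1 - (norm z)\<^sup>2) * (1 - r\<^sup>2) / 4"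
  have "k > 0" using z r by (simp add: k_def abs_square_less_1)
  then show "sqrt (1 - k) < 1" by simp
  fix y :: "complex ^ 'n" assume y: "norm y \<le> r"
  have "k \<le> 1 - (norm (mobius z y))\<^sup>2"
    using mobius_defect_le(2)[OF z y r(2)] mobius_defect_eq[OF z, of y] y r by (simp add: k_def)
  then have "(norm (mobius z y))\<^sup>2 \<le> 1 - k" by simp
  then show "norm (mobius z y) \<le> sqrt (1 - k)" by (rule real_le_rsqrt)
qed

section \<open>The kernel pulled back by an automorphism\<close>

context carleson_symbol
begin

text \<open>The scalar factors are those which the substitution by \<open>mobius z\<close> produces:
  the expression is the function \<open>H\<close> of the symbol
  \<open>\<tau> \<circ> mobius z\<close> at the points \<open>cnj m *s x\<close> and
  \<open>l *s x\<close>. The conjugation makes it holomorphic in both \<open>l\<close> and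
  \<open>m\<close>.\<close>

definition offdiag :: "complex ^ 'n \<Rightarrow> complex ^ 'n \<Rightarrow> complex \<Rightarrow> complex \<Rightarrow> complex" where
  "offdiag z x l m = (1 - l * cdot x z) powr (- of_real N) * (1 - m * cdot z x) powr (- of_real N) *
     of_real ((1 - (norm z)\<^sup>2) powr N) * H (mobius z (cnj m *s x)) (mobius z (l *s x))"

text \<open>Two holomorphic functions are substituted for \<open>l\<close> and \<open>m\<close>
  because the Hadamard argument needs one variable at a time: once \<open>m\<close> is s^2 /
  \<open>l\<close>, once \<open>l\<close> is the constant 1.\<close>

lemma holomorphic_on_offdiag:
  assumes z: "norm z < 1" and U: "open U" and R: "0 \<le> R" "R < 1"
    and a: "a holomorphic_on U" "\<And>l. l \<in> U \<Longrightarrow> cmod (a l) * norm x \<le> R"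
    and b: "b holomorphic_on U" "\<And>l. l \<in> U \<Longrightarrow> cmod (b l) * norm x \<le> R"
  shows "(\<lambda>l. offdiag z x (a l) (b l)) holomorphic_on U"
proof -
  define W where "W = {l. cmod l * norm x < 1}"
  have aW: "a ` U \<subseteq> W" and bW: "b ` U \<subseteq> W" using a(2) b(2) R by (force simp: W_def)+
  obtain r where r: "r < 1" "\<And>y. norm y \<le> R \<Longrightarrow> norm (mobius z y) \<le> r"
    using norm_mobius_le[OF z R] by blast
  have ball_a: "norm (a l *s x) \<le> R" and ball_b: "norm (cnj (b l) *s x) \<le> R" if "l \<in> U" for l
    using a(2) b(2) that by (auto simp: norm_scale)
  \<comment> \<open>The indicator changes nothing \<open>bnu\<close>-almost everywhere and makes the
    bound and the holomorphy valid for every \<open>u\<close>.\<close>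
  define F where "F = (\<lambda>l u. indicator (ball 0 1) u *\<^sub>R (\<tau> u * bergman_kernel \<alpha> (mobius z (cnj (b l) *s x)) u *
      cnj (bergman_kernel \<alpha> (mobius z (a l *s x)) u)))"
  have HF: "H (mobius z (cnj (b l) *s x)) (mobius z (a l *s x)) = (\<integral>u. F l u \<partial>bnu \<alpha>)" for l
    unfolding H_def F_def
    by (intro integral_cong_AE, measurable, use AE_bnu_ball in eventually_elim, simp)
  have kb: "kmod \<alpha> (mobius z y) u \<le> (1 - r) powr (- N)" if "norm y \<le> R" "norm u < 1" for y u
    unfolding N_def using kmod_le[OF \<alpha> r(2)[OF that(1)] r(1) that(2)] .
  have "(\<lambda>l. \<integral>u. F l u \<partial>bnu \<alpha>) holomorphic_on U"
  proof (rule holomorphic_on_parametric_integral[OF U, where g = "\<lambda>u. ((1 - r) powr (- N))\<^sup>2 * cmod (\<tau> u)"])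
    show "F l \<in> borel_measurable (bnu \<alpha>)" for l unfolding F_def by measurable
    show "integrable (bnu \<alpha>) (\<lambda>u. ((1 - r) powr (- N))\<^sup>2 * cmod (\<tau> u))" using integrable_\<tau> by simp
    show "cmod (F l u) \<le> ((1 - r) powr (- N))\<^sup>2 * cmod (\<tau> u)" if l: "l \<in> U" for l u
    proof (cases "u \<in> ball 0 1")
      case True
      then have u: "norm u < 1" by simp
      have "cmod (F l u) = cmod (\<tau> u) * (kmod \<alpha> (mobius z (cnj (b l) *s x)) u * kmod \<alpha> (mobius z (a l *s x)) u)"
        using True by (simp add: F_def norm_mult cmod_bergman_kernel)
      also have "\<dots> \<le> cmod (\<tau> u) * ((1 - r) powr (- N) * (1 - r) powr (- N))"
        by (intro mult_left_mono mult_mono kb ball_a ball_b l u) auto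
      finally show ?thesis by (simp add: power2_eq_square mult_ac)
    qed (simp add: F_def)
    show "(\<lambda>l. F l u) holomorphic_on U" for u
    proof (cases "u \<in> ball 0 1")
      case True
      then have u: "norm u < 1" by simp
      define g where "g = (\<lambda>l. (1 - cdot (mobius z (l *s x)) u) powr (- of_real N))"
      have g: "g holomorphic_on W"
        unfolding g_def W_def using u by (intro holomorphic_on_one_minus_mobius_powr z) simp
      \<comment> \<open>Conjugating both argument and value handles the first slot of
        \<open>H\<close>, in which the kernel is antiholomorphic.\<close>
      have g': "(\<lambda>l. cnj (g (cnj l))) holomorphic_on W"
        using g unfolding W_def by (rule holomorphic_on_cnj_cnj)
      have ga: "(\<lambda>l. g (a l)) holomorphic_on U"
        using holomorphic_on_compose_gen[OF a(1) g aW] by (simp add: o_def)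
      have gb: "(\<lambda>l. cnj (g (cnj (b l)))) holomorphic_on U"
        using holomorphic_on_compose_gen[OF b(1) g' bW] by (simp add: o_def)
      have "F l u = \<tau> u * cnj (g (cnj (b l))) * g (a l)" if l: "l \<in> U" for l
      proof -
        have K: "cnj (bergman_kernel \<alpha> (mobius z y) u) = (1 - cdot (mobius z y) u) powr (- of_real N)" if "norm y \<le> R" for y
          using cnj_bergman_kernel[of "mobius z y" u \<alpha>] r(2)[OF that] r(1) u
          by (simp add: bergman_kernel_def N_def)
        then have K': "bergman_kernel \<alpha> (mobius z y) u = cnj ((1 - cdot (mobius z y) u) powr (- of_real N))" if "norm y \<le> R" for y
          using that by (metis complex_cnj_cnj)
        show ?thesis
          using True K[OF ball_a[OF l]] K'[OF ball_b[OF l]] by (simp add: F_def g_def)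
      qed
      then show ?thesis
        by (subst holomorphic_cong[OF refl]) (auto intro!: holomorphic_on_mult ga gb)
    qed (simp add: F_def)
  qed
  moreover have "(\<lambda>l. (1 - c l * d) powr (- of_real N)) holomorphic_on U"
    if c: "c holomorphic_on U" and cd: "\<And>l. l \<in> U \<Longrightarrow> cmod (c l * d) \<le> R" for c d
  proof -
    have "1 - c l * d \<notin> \<real>\<^sub>\<le>\<^sub>0" if "l \<in> U" for l
      using cd[OF that] R complex_Re_le_cmod[of "c l * d"] by (auto simp: complex_nonpos_Reals_iff)
    then show ?thesis using c by (intro holomorphic_intros) auto
  qed
  moreover have "cmod (a l * cdot x z) \<le> R" "cmod (b l * cdot z x) \<le> R" if l: "l \<in> U" for l
  proof -
    have "cmod (cdot x z) \<le> norm x" "cmod (cdot z x) \<le> norm x"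
      using cmod_cdot_le[of x z] cmod_cdot_le[of z x] z mult_left_le[of "norm z" "norm x"] mult_left_le_one_le[of "norm x" "norm z"] by auto
    then have "cmod (a l) * cmod (cdot x z) \<le> cmod (a l) * norm x" "cmod (b l) * cmod (cdot z x) \<le> cmod (b l) * norm x"
      by (auto intro: mult_left_mono)
    then show "cmod (a l * cdot x z) \<le> R" "cmod (b l * cdot z x) \<le> R"
      using a(2)[OF l] b(2)[OF l] by (auto simp: norm_mult)
  qed
  ultimately show ?thesis
    unfolding offdiag_def HF using a(1) b(1) by (intro holomorphic_on_mult holomorphic_on_const) auto
qed

text \<open>One of the two scalar factors of \<open>offdiag\<close> times the growth allowed by
  \<open>cmod_H_le\<close> in the corresponding variable. The dependence on z separates from that on
  y.\<close>

lemma kernel_factor_mobius: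
  fixes y z :: "complex ^ 'n"
  assumes z: "norm z < 1" and y: "norm y < 1"
  shows "cmod (1 - cdot y z) powr (- N) * (1 - (norm (mobius z y))\<^sup>2) powr (- N / 2) =
    (1 - (norm z)\<^sup>2) powr (- N / 2) * (1 - (norm y)\<^sup>2) powr (- N / 2)"
proof -
  define s where "s = 1 - (norm z)\<^sup>2"
  define t where "t = 1 - (norm y)\<^sup>2"
  define q where "q = cmod (1 - cdot y z)"
  have pos: "s > 0" "t > 0" using z y by (auto simp: s_def t_def abs_square_less_1)
  have q: "q > 0" using one_minus_cdot_bounds(5)[OF y, of z] z by (simp add: q_def)
  have e: "1 - (norm (mobius z y))\<^sup>2 = s * t / q\<^sup>2"
    using mobius_norm[OF z less_imp_le[OF y]] by (simp add: s_def q_def t_def)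
  have "(q\<^sup>2) powr (N / 2) = q powr N" using q by (simp add: powr_powr flip: powr_numeral)
  then show ?thesis unfolding e s_def[symmetric] t_def[symmetric] q_def[symmetric]
    using pos q by (simp add: powr_mult powr_divide powr_minus field_simps)
qed

lemma cmod_powr_N: "cmod (w powr (- of_real N)) = cmod w powr (- N)"
  unfolding of_real_minus[symmetric] by (simp only: norm_powr_real_powr' Reals_of_real Re_complex_of_real)

lemma cmod_offdiag:
  fixes x z :: "complex ^ 'n"
  shows "cmod (offdiag z x l m) = cmod (1 - cdot (l *s x) z) powr (- N) * cmod (1 - cdot (cnj m *s x) z) powr (- N) *
    (1 - (norm z)\<^sup>2) powr N * cmod (H (mobius z (cnj m *s x)) (mobius z (l *s x)))"
proof -
  have "cmod (1 - cdot (cnj m *s x) z) = cmod (1 - m * cdot z x)"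
    using cmod_one_minus_cdot_commute[of "cnj m *s x" z] by (simp add: cdot_scale_right)
  then show ?thesis
    unfolding offdiag_def norm_mult cmod_powr_N by (simp add: cdot_scale_left)
qed

text \<open>The factor s^N of \<open>offdiag\<close> cancels the two powers s^(-N/2) left over from
  the two variables, so the bound is uniform in z.\<close>

lemma cmod_offdiag_le:
  fixes x z :: "complex ^ 'n"
  assumes z: "norm z < 1" and R: "0 \<le> R" "R < 1" and l: "cmod l * norm x \<le> R" and m: "cmod m * norm x \<le> R"
  shows "cmod (offdiag z x l m) \<le> M * (1 - R\<^sup>2) powr (- N)"
proof -
  define s where "s = 1 - (norm z)\<^sup>2"
  have s: "s > 0" using z by (simp add: s_def abs_square_less_1)
  define y where "y = l *s x"
  define v where "v = cnj m *s x"
  have yR: "norm y \<le> R" and vR: "norm v \<le> R" using l m by (auto simp: y_def v_def norm_scale)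
  then have y: "norm y < 1" and v: "norm v < 1" using R by auto
  have b: "(1 - (norm w)\<^sup>2) powr (- N / 2) \<le> (1 - R\<^sup>2) powr (- N / 2)" if "norm w \<le> R" for w :: "complex ^ 'n"
  proof -
    have "(norm w)\<^sup>2 \<le> R\<^sup>2" using that by (intro power_mono) auto
    moreover have "R\<^sup>2 < 1" using R by (simp add: abs_square_less_1)
    ultimately show ?thesis using N_pos by (intro powr_mono2') auto
  qed
  have "cmod (offdiag z x l m) \<le> cmod (1 - cdot y z) powr (- N) * cmod (1 - cdot v z) powr (- N) * s powr N *
      (M * ((1 - (norm (mobius z v))\<^sup>2) powr (- N / 2) * (1 - (norm (mobius z y))\<^sup>2) powr (- N / 2)))"
    unfolding cmod_offdiag y_def[symmetric] v_def[symmetric] s_def[symmetric]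
    by (intro mult_left_mono cmod_H_le norm_mobius_less z y v) auto
  also have "\<dots> = M * s powr N * (cmod (1 - cdot y z) powr (- N) * (1 - (norm (mobius z y))\<^sup>2) powr (- N / 2)) *
      (cmod (1 - cdot v z) powr (- N) * (1 - (norm (mobius z v))\<^sup>2) powr (- N / 2))"
    by (simp add: mult_ac)
  also have "\<dots> = M * (s powr N * s powr (- N / 2) * s powr (- N / 2)) * ((1 - (norm y)\<^sup>2) powr (- N / 2) * (1 - (norm v)\<^sup>2) powr (- N / 2))"
    unfolding kernel_factor_mobius[OF z y] kernel_factor_mobius[OF z v] s_def by (simp add: mult_ac)
  also have "s powr N * s powr (- N / 2) * s powr (- N / 2) = 1"
    using s by (simp flip: powr_add)
  also have "M * 1 * ((1 - (norm y)\<^sup>2) powr (- N / 2) * (1 - (norm v)\<^sup>2) powr (- N / 2)) \<le>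
      M * 1 * ((1 - R\<^sup>2) powr (- N / 2) * (1 - R\<^sup>2) powr (- N / 2))"
    using M_nonneg by (intro mult_left_mono mult_mono b yR vR) auto
  also have "\<dots> = M * (1 - R\<^sup>2) powr (- N)"
    by (simp flip: powr_add)
  finally show ?thesis .
qed

text \<open>For m the conjugate of l both points coincide, and apart from a factor bounded on
  smaller balls the modulus is that of the Berezin transform at
  \<open>mobius z (l *s x)\<close>.\<close>

lemma cmod_offdiag_diagonal:
  fixes x z :: "complex ^ 'n"
  assumes z: "norm z < 1" and l: "cmod l * norm x < 1"
  shows "cmod (offdiag z x l (cnj l)) = (1 - (norm (l *s x))\<^sup>2) powr (- N) *
    ((1 - (norm (mobius z (l *s x)))\<^sup>2) powr N * cmod (H (mobius z (l *s x)) (mobius z (l *s x))))"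
proof -
  define s where "s = 1 - (norm z)\<^sup>2"
  have s: "s > 0" using z by (simp add: s_def abs_square_less_1)
  define y where "y = l *s x"
  have y: "norm y < 1" using l by (simp add: y_def norm_scale)
  define d where "d = 1 - (norm (mobius z y))\<^sup>2"
  have d: "d > 0" using norm_mobius_less[OF z y] by (simp add: d_def abs_square_less_1)
  define q where "q = cmod (1 - cdot y z) powr (- N)"
  have e: "q * d powr (- N / 2) = s powr (- N / 2) * (1 - (norm y)\<^sup>2) powr (- N / 2)"
    unfolding q_def d_def s_def by (rule kernel_factor_mobius[OF z y])
  have "q * q * s powr N = (q * d powr (- N / 2)) * (q * d powr (- N / 2)) * s powr N * d powr N"
    using d by (simp add: mult_ac) (simp add: mult.assoc flip: powr_add)
  also have "\<dots> = (1 - (norm y)\<^sup>2) powr (- N) * d powr N"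
    unfolding e using s by (simp add: mult_ac) (simp add: mult.assoc flip: powr_add)
  finally show ?thesis
    unfolding cmod_offdiag complex_cnj_cnj y_def[symmetric] q_def[symmetric] s_def[symmetric] d_def[symmetric]
    by (simp add: mult_ac)
qed

end

section \<open>Smallness of the kernel near the boundary\<close>

context carleson_symbol
begin

text \<open>The left side is the modulus of \<open>offdiag z x 1 0\<close>, since
  \<open>mobius z 0 = z\<close>. The parameters of the Hadamard argument are fixed in the order s,
  k, e; then z is taken so close to the sphere that the diagonal is below the level demanded by e on
  the whole pulled-back ball.\<close>

lemma kernel_small:
  fixes R \<eta> :: real
  assumes small: "\<And>e. e > 0 \<Longrightarrow> \<exists>\<rho><1. \<forall>w :: complex ^ 'n. \<rho> < norm w \<longrightarrow> norm w < 1 \<longrightarrow> (1 - (norm w)\<^sup>2) powr N * cmod (H w w) \<le> e"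
    and R: "R < 1" and \<eta>: "\<eta> > 0"
  obtains r0 where "r0 < 1" "\<And>z x :: complex ^ 'n. r0 < norm z \<Longrightarrow> norm z < 1 \<Longrightarrow> norm x \<le> R \<Longrightarrow>
    cmod (H z (mobius z x)) * (1 - (norm z)\<^sup>2) powr N * cmod (1 - cdot x z) powr (- N) \<le> \<eta>"
proof -
  \<comment> \<open>The lower bound 1/2 permits division by \<open>R1\<close>. The quotient of
    \<open>R2\<close> and \<open>R1\<close> is the radius up to which \<open>l\<close> and
    \<open>m\<close> may vary around 1.\<close>
  define R1 where "R1 = max R (1/2)"
  have R1: "1/2 \<le> R1" "R1 < 1" "R \<le> R1" using R by (auto simp: R1_def)
  define R2 where "R2 = (1 + R1) / 2"
  have R2: "R1 < R2" "0 < R2" "R2 < 1" using R1 by (auto simp: R2_def)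
  define \<rho> where "\<rho> = R2 / R1"
  have \<rho>: "1 < \<rho>" using R1 R2 by (simp add: \<rho>_def)
  have \<rho>R: "c * norm x \<le> R2" if "c < \<rho>" "0 \<le> c" "norm x \<le> R" for c and x :: "complex ^ 'n"
  proof -
    have "c * norm x \<le> \<rho> * R1" using that R1 \<rho> by (intro mult_mono) auto
    then show ?thesis using R1 by (simp add: \<rho>_def)
  qed
  define t where "t = (1 + \<rho>) / 2"
  have t: "1 < t" "t < \<rho>" using \<rho> by (auto simp: t_def)
  define C where "C = M * (1 - R2\<^sup>2) powr (- N)"
  have C: "C \<ge> 0" using M_nonneg by (simp add: C_def)
  \<comment> \<open>Chosen to make the Schwarz error (2 C + 1) s^2 at most \<eta>/2.\<close>
  define s where "s = min (1/2) (\<eta> / (2 * (2 * C + 1)))"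
  have s: "0 < s" "s < 1" using \<eta> C by (auto simp: s_def)
  have "(2 * C + 1) * s\<^sup>2 \<le> (2 * C + 1) * s"
    using s C by (intro mult_left_mono) (auto simp: power2_eq_square mult_left_le)
  also have "\<dots> \<le> (2 * C + 1) * (\<eta> / (2 * (2 * C + 1)))"
    using C by (intro mult_left_mono) (auto simp: s_def)
  also have "\<dots> = \<eta> / 2" using C by (simp add: field_simps)
  finally have s2: "(2 * C + 1) * s\<^sup>2 \<le> \<eta> / 2" .
  obtain k where "2 * C / \<eta> < t ^ k" using real_arch_pow[OF t(1)] by blast
  then have k: "C / t ^ k \<le> \<eta> / 2" using \<eta> t by (simp add: field_simps)
  \<comment> \<open>The power s^k compensates the division by l^k on the inner circle.\<close>
  define e where "e = \<eta> / 2 * s ^ k"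
  have e: "e > 0" using \<eta> s by (simp add: e_def)
  have es: "e / s ^ k \<le> \<eta> / 2" using s by (simp add: e_def)
  have R22: "R2\<^sup>2 < 1" using R2 by (simp add: abs_square_less_1)
  then have "e * (1 - R2\<^sup>2) powr N > 0" using e by simp
  from small[OF this] obtain \<rho>0 where \<rho>0: "\<rho>0 < 1"
    "\<And>w :: complex ^ 'n. \<rho>0 < norm w \<Longrightarrow> norm w < 1 \<Longrightarrow> (1 - (norm w)\<^sup>2) powr N * cmod (H w w) \<le> e * (1 - R2\<^sup>2) powr N"
    by blast
  define r1 where "r1 = max \<rho>0 0"
  have r1: "0 \<le> r1" "r1 < 1" "\<rho>0 \<le> r1" using \<rho>0(1) by (auto simp: r1_def)
  then have r1s: "r1\<^sup>2 < 1" by (simp add: abs_square_less_1)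
  \<comment> \<open>If 1 - |z|^2 < k0, the upper bound of \<open>mobius_defect_le\<close> places the
    image of the ball of radius \<open>R2\<close> outside radius \<open>r1\<close>.\<close>
  define k0 where "k0 = (1 - R2)\<^sup>2 * (1 - r1\<^sup>2)"
  have k0: "k0 > 0" using R2 r1s by (simp add: k0_def)
  show ?thesis
  proof (rule that[of "sqrt (1 - k0)"])
    show "sqrt (1 - k0) < 1" using k0 by simp
    fix z x :: "complex ^ 'n"
    assume z0: "sqrt (1 - k0) < norm z" and z: "norm z < 1" and x: "norm x \<le> R"
    have "1 - k0 < (norm z)\<^sup>2"
      using z0 real_le_rsqrt[of "norm z" "1 - k0"] by (cases "(norm z)\<^sup>2 \<le> 1 - k0") auto
    then have zk: "1 - (norm z)\<^sup>2 < k0" by simp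
    have near: "r1 < norm (mobius z y)" if y: "norm y \<le> R2" for y
    proof -
      have y1: "norm y \<le> 1" using y R2 by simp
      have "1 - (norm (mobius z y))\<^sup>2 \<le> (1 - (norm z)\<^sup>2) / (1 - R2)\<^sup>2"
        using mobius_defect_le(1)[OF z y R2(3)] mobius_defect_eq[OF z y1] by simp
      also have "\<dots> < k0 / (1 - R2)\<^sup>2" using zk R2 by (intro divide_strict_right_mono) auto
      also have "\<dots> = 1 - r1\<^sup>2" using R2 by (simp add: k0_def)
      finally have "r1\<^sup>2 < (norm (mobius z y))\<^sup>2" by simp
      then show ?thesis by (rule power2_less_imp_less) simp
    qed
    have "cmod (offdiag z x 1 0) \<le> max (e / s ^ k) (C / t ^ k) + (2 * C + 1) * s\<^sup>2"
    proof (rule off_diagonal_bound[OF s t])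
      show "(\<lambda>l. offdiag z x l (of_real (s\<^sup>2) / l)) holomorphic_on {l. s\<^sup>2 / \<rho> < cmod l \<and> cmod l < \<rho>}"
      proof (rule holomorphic_on_offdiag[OF z])
        show "open {l :: complex. s\<^sup>2 / \<rho> < cmod l \<and> cmod l < \<rho>}"
          by (intro open_Collect_conj open_Collect_less continuous_intros)
        have pos: "s\<^sup>2 / \<rho> \<ge> 0" using \<rho> by simp
        then have "l \<noteq> 0" if "s\<^sup>2 / \<rho> < cmod l" for l :: complex using that by auto
        then show "(\<lambda>l. of_real (s\<^sup>2) / l) holomorphic_on {l. s\<^sup>2 / \<rho> < cmod l \<and> cmod l < \<rho>}"
          by (intro holomorphic_intros) auto
        fix l assume l: "l \<in> {l :: complex. s\<^sup>2 / \<rho> < cmod l \<and> cmod l < \<rho>}"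
        then show "cmod l * norm x \<le> R2" by (intro \<rho>R x) auto
        have "cmod l > 0" using l pos by (auto intro: le_less_trans)
        then have "s\<^sup>2 / cmod l < \<rho>" using l \<rho> by (simp add: field_simps)
        then show "cmod (of_real (s\<^sup>2) / l) * norm x \<le> R2"
          by (intro \<rho>R x) (auto simp: norm_divide norm_power)
      qed (use R2 in \<open>auto intro: holomorphic_intros\<close>)
      show "offdiag z x 1 holomorphic_on ball 0 \<rho>"
        by (rule holomorphic_on_offdiag[OF z, where R = R2])
           (use R2 \<rho> \<rho>R[of 1 x] \<rho>R[OF _ _ x] x in \<open>auto intro: holomorphic_intros\<close>)
      show "cmod (offdiag z x l m) \<le> C" if "cmod l < \<rho>" "cmod m < \<rho>" for l m
        unfolding C_def using that R2 x by (intro cmod_offdiag_le z \<rho>R) auto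
      show "cmod (offdiag z x l (cnj l)) \<le> e" if l: "cmod l = s" for l
      proof -
        have ly: "cmod l * norm x \<le> R2" using l s \<rho> by (intro \<rho>R x) auto
        then have y: "norm (l *s x) \<le> R2" by (simp add: norm_scale)
        have y1: "norm (l *s x) < 1" using y R2 by simp
        have "cmod (offdiag z x l (cnj l)) \<le> (1 - (norm (l *s x))\<^sup>2) powr (- N) * (e * (1 - R2\<^sup>2) powr N)"
          unfolding cmod_offdiag_diagonal[OF z le_less_trans[OF ly R2(3)]]
          using near[OF y] r1 norm_mobius_less[OF z y1] by (intro mult_left_mono \<rho>0) auto
        also have "\<dots> \<le> (1 - R2\<^sup>2) powr (- N) * (e * (1 - R2\<^sup>2) powr N)"
        proof -
          have "(norm (l *s x))\<^sup>2 \<le> R2\<^sup>2" using y by (intro power_mono) auto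
          then show ?thesis using R22 N_pos e by (intro mult_right_mono powr_mono2') auto
        qed
        also have "\<dots> = e" using R22 by (simp add: powr_minus)
        finally show ?thesis .
      qed
    qed simp
    also have "\<dots> \<le> \<eta> / 2 + \<eta> / 2" using es k s2 by (intro add_mono) auto
    finally have "cmod (offdiag z x 1 0) \<le> \<eta>" by simp
    then show "cmod (H z (mobius z x)) * (1 - (norm z)\<^sup>2) powr N * cmod (1 - cdot x z) powr (- N) \<le> \<eta>"
      by (simp add: cmod_offdiag mult_ac)
  qed
qed

section \<open>The majorant of the kernel\<close>

text \<open>The majorant of |H| with the modulus inside the integral. It is symmetric and obeys
  Carleson estimates, but shows no decay at the boundary, so it serves for boundedness.\<close>

definition Hmaj :: "complex ^ 'n \<Rightarrow> complex ^ 'n \<Rightarrow> ennreal" where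
  "Hmaj z w = (\<integral>\<^sup>+ u. ennreal (cmod (\<tau> u) * (kmod \<alpha> z u * kmod \<alpha> w u)) \<partial>bnu \<alpha>)"

lemma H_le_Hmaj: "ennreal (cmod (H z w)) \<le> Hmaj z w"
  unfolding Hmaj_def by (rule cmod_H_le_nn)

lemma Hmaj_commute: "Hmaj z w = Hmaj w z"
  by (simp add: Hmaj_def mult_ac)

text \<open>The constant of \<open>carleson_nn_integral\<close> for a product of two kernels; each
  contributes 3^N by near constancy on pseudohyperbolic balls.\<close>

definition C\<^sub>1 :: real where
  "C\<^sub>1 = (3 powr N * 3 powr N) * 4 powr N * M / measure (bnu \<alpha>) (ball (0 :: complex ^ 'n) (1/2))"

lemma C1_nonneg: "C\<^sub>1 \<ge> 0"
  using M_nonneg by (simp add: C\<^sub>1_def)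

lemma Hmaj_le:
  assumes z: "norm z < 1" and w: "norm w < 1"
  shows "Hmaj z w \<le> ennreal C\<^sub>1 * (\<integral>\<^sup>+ u. ennreal (kmod \<alpha> z u * kmod \<alpha> w u) \<partial>bnu \<alpha>)"
proof -
  have "Hmaj z w = (\<integral>\<^sup>+ u. ennreal (cmod (\<tau> u)) * ennreal (kmod \<alpha> z u * kmod \<alpha> w u) \<partial>bnu \<alpha>)"
    unfolding Hmaj_def by (simp add: ennreal_mult)
  also have "\<dots> \<le> ennreal C\<^sub>1 * (\<integral>\<^sup>+ u. ennreal (kmod \<alpha> z u * kmod \<alpha> w u) \<partial>bnu \<alpha>)"
    unfolding C\<^sub>1_def unfolding N_def
  proof (rule carleson_nn_integral[OF \<alpha> _ _ _ M])
    fix u x :: "complex ^ 'n" assume u: "norm u < 1" and x: "norm x \<le> 1/2"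
    have "kmod \<alpha> z (mobius u x) * kmod \<alpha> w (mobius u x) \<le>
        (3 powr (real CARD('n) + 1 + \<alpha>) * kmod \<alpha> z u) * (3 powr (real CARD('n) + 1 + \<alpha>) * kmod \<alpha> w u)"
      by (intro mult_mono kmod_mobius_le \<alpha> u x z w) auto
    then show "ennreal (kmod \<alpha> z (mobius u x) * kmod \<alpha> w (mobius u x)) \<le>
        ennreal (3 powr (real CARD('n) + 1 + \<alpha>) * 3 powr (real CARD('n) + 1 + \<alpha>)) * ennreal (kmod \<alpha> z u * kmod \<alpha> w u)"
      by (simp add: ennreal_leI mult_ac flip: ennreal_mult)
  qed (use M_nonneg in auto)
  finally show ?thesis .
qed

text \<open>For a single kernel the factor 3^N is enlarged to its square, so that
  \<open>C\<^sub>1\<close> serves here as well.\<close>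

lemma nn_integral_\<tau>_kmod_single_le:
  assumes z: "norm z < 1"
  shows "(\<integral>\<^sup>+ u. ennreal (cmod (\<tau> u)) * ennreal (kmod \<alpha> z u) \<partial>bnu \<alpha>) \<le> ennreal C\<^sub>1 * (\<integral>\<^sup>+ u. ennreal (kmod \<alpha> z u) \<partial>bnu \<alpha>)"
  unfolding C\<^sub>1_def unfolding N_def
proof (rule carleson_nn_integral[OF \<alpha> _ _ _ M])
  fix u x :: "complex ^ 'n" assume u: "norm u < 1" and x: "norm x \<le> 1/2"
  have "kmod \<alpha> z (mobius u x) \<le> 1 * (3 powr (real CARD('n) + 1 + \<alpha>) * kmod \<alpha> z u)"
    using kmod_mobius_le[OF \<alpha> u x z] by simp
  also have "\<dots> \<le> 3 powr (real CARD('n) + 1 + \<alpha>) * (3 powr (real CARD('n) + 1 + \<alpha>) * kmod \<alpha> z u)"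
    using \<alpha> by (intro mult_right_mono ge_one_powr_ge_zero) auto
  finally show "ennreal (kmod \<alpha> z (mobius u x)) \<le>
      ennreal (3 powr (real CARD('n) + 1 + \<alpha>) * 3 powr (real CARD('n) + 1 + \<alpha>)) * ennreal (kmod \<alpha> z u)"
    by (simp add: ennreal_leI mult_ac flip: ennreal_mult)
qed (use M_nonneg in auto)

lemma kmod_forelli_rudin:
  fixes a :: real
  assumes "0 < a" "\<alpha> - a > -1" "2 * a \<le> N"
  obtains C where "C \<ge> 0" "\<And>z :: complex ^ 'n. norm z < 1 \<Longrightarrow>
    (\<integral>\<^sup>+ w. ennreal (kmod \<alpha> z w * (1 - (norm w)\<^sup>2) powr (-a)) \<partial>bnu \<alpha>) \<le> ennreal (C * (1 - (norm z)\<^sup>2) powr (-a))"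
  using forelli_rudin[OF \<alpha> assms(1,2), where 'n = 'n] assms(3) unfolding N_def kmod_def
  by (auto simp: mult.commute)

text \<open>The Carleson embedding removes the symbol and leaves two kernel operators in succession;
  each reproduces the weight up to a constant by the Forelli-Rudin estimate.\<close>

lemma nn_integral_Hmaj_le:
  fixes a :: real
  assumes a: "0 < a" "\<alpha> - a > -1" "2 * a \<le> N"
  obtains C where "C \<ge> 0" "\<And>w :: complex ^ 'n. norm w < 1 \<Longrightarrow>
    (\<integral>\<^sup>+ z. Hmaj z w * ennreal ((1 - (norm z)\<^sup>2) powr (-a)) \<partial>bnu \<alpha>) \<le> ennreal (C * (1 - (norm w)\<^sup>2) powr (-a))"
proof -
  interpret S: sigma_finite_measure "bnu \<alpha> :: (complex ^ 'n) measure" by (rule sigma_finite_bnu[OF \<alpha>])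
  interpret P: pair_sigma_finite "bnu \<alpha> :: (complex ^ 'n) measure" "bnu \<alpha> :: (complex ^ 'n) measure" ..
  obtain C where C: "C \<ge> 0" "\<And>z :: complex ^ 'n. norm z < 1 \<Longrightarrow>
    (\<integral>\<^sup>+ w. ennreal (kmod \<alpha> z w * (1 - (norm w)\<^sup>2) powr (-a)) \<partial>bnu \<alpha>) \<le> ennreal (C * (1 - (norm z)\<^sup>2) powr (-a))"
    using kmod_forelli_rudin[OF a] by blast
  show ?thesis
  proof (rule that[of "C\<^sub>1 * C * C"])
    show "C\<^sub>1 * C * C \<ge> 0" using C1_nonneg C by simp
    fix w :: "complex ^ 'n" assume w: "norm w < 1"
    have "(\<integral>\<^sup>+ z. Hmaj z w * ennreal ((1 - (norm z)\<^sup>2) powr (-a)) \<partial>bnu \<alpha>) \<le>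
        (\<integral>\<^sup>+ z. ennreal C\<^sub>1 * (\<integral>\<^sup>+ u. ennreal (kmod \<alpha> z u * kmod \<alpha> w u) \<partial>bnu \<alpha>) * ennreal ((1 - (norm z)\<^sup>2) powr (-a)) \<partial>bnu \<alpha>)"
      by (rule nn_integral_mono_AE, use AE_bnu_ball in eventually_elim) (auto intro!: mult_right_mono Hmaj_le w)
    also have "\<dots> = (\<integral>\<^sup>+ z. (\<integral>\<^sup>+ u. ennreal C\<^sub>1 * (ennreal (kmod \<alpha> w u) * ennreal (kmod \<alpha> u z * (1 - (norm z)\<^sup>2) powr (-a))) \<partial>bnu \<alpha>) \<partial>bnu \<alpha>)"
    proof (rule nn_integral_cong)
      fix z :: "complex ^ 'n"
      define h where "h = (1 - (norm z)\<^sup>2) powr (-a)"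
      have h: "h \<ge> 0" by (simp add: h_def)
      have "(\<integral>\<^sup>+ u. ennreal C\<^sub>1 * (ennreal (kmod \<alpha> w u) * ennreal (kmod \<alpha> u z * h)) \<partial>bnu \<alpha>) =
          (\<integral>\<^sup>+ u. (ennreal C\<^sub>1 * ennreal h) * ennreal (kmod \<alpha> z u * kmod \<alpha> w u) \<partial>bnu \<alpha>)"
        using h by (intro nn_integral_cong) (simp add: kmod_commute[of \<alpha> _ z] ennreal_mult mult_ac)
      also have "\<dots> = (ennreal C\<^sub>1 * ennreal h) * (\<integral>\<^sup>+ u. ennreal (kmod \<alpha> z u * kmod \<alpha> w u) \<partial>bnu \<alpha>)"
        by (rule nn_integral_cmult) measurable
      finally show "ennreal C\<^sub>1 * (\<integral>\<^sup>+ u. ennreal (kmod \<alpha> z u * kmod \<alpha> w u) \<partial>bnu \<alpha>) * ennreal ((1 - (norm z)\<^sup>2) powr (-a)) =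
          (\<integral>\<^sup>+ u. ennreal C\<^sub>1 * (ennreal (kmod \<alpha> w u) * ennreal (kmod \<alpha> u z * (1 - (norm z)\<^sup>2) powr (-a))) \<partial>bnu \<alpha>)"
        unfolding h_def[symmetric] by (simp add: mult_ac)
    qed
    also have "\<dots> = (\<integral>\<^sup>+ u. (\<integral>\<^sup>+ z. ennreal C\<^sub>1 * (ennreal (kmod \<alpha> w u) * ennreal (kmod \<alpha> u z * (1 - (norm z)\<^sup>2) powr (-a))) \<partial>bnu \<alpha>) \<partial>bnu \<alpha>)"
      by (rule P.Fubini'[symmetric]) measurable
    also have "\<dots> = (\<integral>\<^sup>+ u. ennreal C\<^sub>1 * (ennreal (kmod \<alpha> w u) * (\<integral>\<^sup>+ z. ennreal (kmod \<alpha> u z * (1 - (norm z)\<^sup>2) powr (-a)) \<partial>bnu \<alpha>)) \<partial>bnu \<alpha>)"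
      by (simp add: nn_integral_cmult)
    also have "\<dots> \<le> (\<integral>\<^sup>+ u. ennreal C\<^sub>1 * (ennreal (kmod \<alpha> w u) * ennreal (C * (1 - (norm u)\<^sup>2) powr (-a))) \<partial>bnu \<alpha>)"
      by (rule nn_integral_mono_AE, use AE_bnu_ball in eventually_elim) (auto intro!: mult_left_mono C)
    also have "\<dots> = ennreal (C\<^sub>1 * C) * (\<integral>\<^sup>+ u. ennreal (kmod \<alpha> w u * (1 - (norm u)\<^sup>2) powr (-a)) \<partial>bnu \<alpha>)"
      using C1_nonneg C by (simp add: nn_integral_cmult[symmetric] ennreal_mult mult_ac)
    also have "\<dots> \<le> ennreal (C\<^sub>1 * C) * ennreal (C * (1 - (norm w)\<^sup>2) powr (-a))"
      by (intro mult_left_mono C w) auto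
    also have "\<dots> = ennreal (C\<^sub>1 * C * C * (1 - (norm w)\<^sup>2) powr (-a))"
      using C1_nonneg C by (simp add: mult.assoc flip: ennreal_mult)
    finally show "(\<integral>\<^sup>+ z. Hmaj z w * ennreal ((1 - (norm z)\<^sup>2) powr (-a)) \<partial>bnu \<alpha>) \<le>
      ennreal (C\<^sub>1 * C * C * (1 - (norm w)\<^sup>2) powr (-a))" .
  qed
qed

end

section \<open>Weighted integrals of the kernel\<close>

context carleson_symbol
begin

lemma kmod_transform:
  fixes x v z :: "complex ^ 'n"
  assumes z: "norm z < 1" and x: "norm x < 1" and v: "norm v < 1"
  shows "mobius_density \<alpha> z v * (kmod \<alpha> z (mobius z v) * kmod \<alpha> (mobius z x) (mobius z v)) =
    (1 - (norm z)\<^sup>2) powr (- N) * cmod (1 - cdot x z) powr N * kmod \<alpha> x v"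
proof -
  define s where "s = 1 - (norm z)\<^sup>2"
  define p where "p = cmod (1 - cdot v z)"
  define q where "q = cmod (1 - cdot x z)"
  define r where "r = cmod (1 - cdot v x)"
  have s: "s > 0" using z by (simp add: s_def abs_square_less_1)
  have pos: "p > 0" "q > 0" "r > 0"
    using one_minus_cdot_bounds(5)[OF v, of z] one_minus_cdot_bounds(5)[OF x, of z] one_minus_cdot_bounds(5)[OF v, of x] z x
    by (auto simp: p_def q_def r_def)
  have 1: "cmod (1 - cdot (mobius z v) z) = s / p"
    using mobius_identity_1[OF z less_imp_le[OF v]] s unfolding s_def p_def
    by (simp add: norm_divide del: of_real_diff)
  have 2: "cmod (1 - cdot (mobius z v) (mobius z x)) = s * r / (p * q)"
    unfolding mobius_identity[OF z less_imp_le[OF v] less_imp_le[OF x]] q_def cmod_one_minus_cdot_commute[of x z]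
    using s unfolding s_def p_def r_def
    by (simp add: norm_divide norm_mult del: of_real_diff)
  have "(p\<^sup>2) powr N = p powr N * p powr N" by (simp add: power2_eq_square powr_mult)
  then show ?thesis
    unfolding mobius_density_def kmod_def N_def[symmetric] 1 2 s_def[symmetric] p_def[symmetric] q_def[symmetric] r_def[symmetric]
    using s pos by (simp add: powr_mult powr_divide powr_minus field_simps)
qed

text \<open>The substitution by \<open>mobius z\<close> collapses the product of kernels at z and at
  \<open>mobius z x\<close> to the single kernel at x; the dependence on z is left in a scalar that
  the normalization of \<open>H_pulled\<close> cancels.\<close>

lemma nn_integral_kmod_transform:
  fixes x z :: "complex ^ 'n"
  assumes z: "norm z < 1" and x: "norm x < 1"
  shows "(\<integral>\<^sup>+ u. ennreal (kmod \<alpha> z u * kmod \<alpha> (mobius z x) u) \<partial>bnu \<alpha>) =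
    ennreal ((1 - (norm z)\<^sup>2) powr (- N) * cmod (1 - cdot x z) powr N) * (\<integral>\<^sup>+ v. ennreal (kmod \<alpha> x v) \<partial>bnu \<alpha>)"
proof -
  have "(\<integral>\<^sup>+ u. ennreal (kmod \<alpha> z u * kmod \<alpha> (mobius z x) u) \<partial>bnu \<alpha>) =
      (\<integral>\<^sup>+ v. ennreal (mobius_density \<alpha> z v) * ennreal (kmod \<alpha> z (mobius z v) * kmod \<alpha> (mobius z x) (mobius z v)) \<partial>bnu \<alpha>)"
    by (rule nn_integral_bnu_mobius[OF \<alpha> z, symmetric]) measurable
  also have "\<dots> = (\<integral>\<^sup>+ v. ennreal ((1 - (norm z)\<^sup>2) powr (- N) * cmod (1 - cdot x z) powr N) * ennreal (kmod \<alpha> x v) \<partial>bnu \<alpha>)"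
    by (rule nn_integral_cong_AE, use AE_bnu_ball in eventually_elim)
       (simp add: kmod_transform[OF z x] flip: ennreal_mult)
  also have "\<dots> = ennreal ((1 - (norm z)\<^sup>2) powr (- N) * cmod (1 - cdot x z) powr N) * (\<integral>\<^sup>+ v. ennreal (kmod \<alpha> x v) \<partial>bnu \<alpha>)"
    by (rule nn_integral_cmult) measurable
  finally show ?thesis .
qed

text \<open>Up to a unimodular factor, \<open>H_pulled z x\<close> is the Bergman projection of \<open>\<tau> \<circ> mobius z\<close> at \<open>x\<close>.\<close>

definition H_pulled :: "complex ^ 'n \<Rightarrow> complex ^ 'n \<Rightarrow> real" where
  "H_pulled z x = cmod (H z (mobius z x)) * (1 - (norm z)\<^sup>2) powr N * cmod (1 - cdot x z) powr (- N)"

lemma H_pulled_nonneg [simp]: "H_pulled z x \<ge> 0"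
  by (simp add: H_pulled_def)

lemma H_pulled_measurable [measurable]: "H_pulled z \<in> borel_measurable borel"
  unfolding H_pulled_def[abs_def] by measurable

text \<open>The exponent of the kernel is critical and the growth logarithmic. A power with
  arbitrarily small positive exponent suffices and comes from inserting a weight that is at least
  1.\<close>

lemma nn_integral_kmod_le:
  fixes a :: real
  assumes a: "0 < a" "\<alpha> - a > -1" "2 * a \<le> N"
  obtains C where "C \<ge> 0" "\<And>z :: complex ^ 'n. norm z < 1 \<Longrightarrow>
    (\<integral>\<^sup>+ w. ennreal (kmod \<alpha> z w) \<partial>bnu \<alpha>) \<le> ennreal (C * (1 - (norm z)\<^sup>2) powr (-a))"
proof -
  obtain C where C: "C \<ge> 0" "\<And>z :: complex ^ 'n. norm z < 1 \<Longrightarrow>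
    (\<integral>\<^sup>+ w. ennreal (kmod \<alpha> z w * (1 - (norm w)\<^sup>2) powr (-a)) \<partial>bnu \<alpha>) \<le> ennreal (C * (1 - (norm z)\<^sup>2) powr (-a))"
    using kmod_forelli_rudin[OF a] by blast
  show ?thesis
  proof (rule that[OF C(1)])
    fix z :: "complex ^ 'n" assume z: "norm z < 1"
    have "(\<integral>\<^sup>+ w. ennreal (kmod \<alpha> z w) \<partial>bnu \<alpha>) \<le> (\<integral>\<^sup>+ w. ennreal (kmod \<alpha> z w * (1 - (norm w)\<^sup>2) powr (-a)) \<partial>bnu \<alpha>)"
    proof (rule nn_integral_mono_AE, use AE_bnu_ball in eventually_elim)
      fix w :: "complex ^ 'n" assume "w \<in> ball 0 1"
      then have "0 < 1 - (norm w)\<^sup>2" by (simp add: abs_square_less_1)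
      then have "1 powr (-a) \<le> (1 - (norm w)\<^sup>2) powr (-a)" using a by (intro powr_mono2') auto
      then have "kmod \<alpha> z w * 1 \<le> kmod \<alpha> z w * (1 - (norm w)\<^sup>2) powr (-a)" by (intro mult_left_mono) auto
      then show "ennreal (kmod \<alpha> z w) \<le> ennreal (kmod \<alpha> z w * (1 - (norm w)\<^sup>2) powr (-a))" by (simp add: ennreal_leI)
    qed
    also have "\<dots> \<le> ennreal (C * (1 - (norm z)\<^sup>2) powr (-a))" by (rule C(2)[OF z])
    finally show "(\<integral>\<^sup>+ w. ennreal (kmod \<alpha> z w) \<partial>bnu \<alpha>) \<le> ennreal (C * (1 - (norm z)\<^sup>2) powr (-a))" .
  qed
qed

text \<open>The bound is uniform in z, and its singularity at the sphere in x is as weak as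
  desired.\<close>

lemma H_pulled_le:
  fixes a :: real
  assumes a: "0 < a" "\<alpha> - a > -1" "2 * a \<le> N"
  obtains C where "C \<ge> 0" "\<And>z x :: complex ^ 'n. norm z < 1 \<Longrightarrow> norm x < 1 \<Longrightarrow>
    H_pulled z x \<le> C * (1 - (norm x)\<^sup>2) powr (-a)"
proof -
  obtain C where C: "C \<ge> 0" "\<And>z :: complex ^ 'n. norm z < 1 \<Longrightarrow>
    (\<integral>\<^sup>+ w. ennreal (kmod \<alpha> z w) \<partial>bnu \<alpha>) \<le> ennreal (C * (1 - (norm z)\<^sup>2) powr (-a))"
    using nn_integral_kmod_le[OF a] by blast
  show ?thesis
  proof (rule that[of "C\<^sub>1 * C"])
    show "C\<^sub>1 * C \<ge> 0" using C1_nonneg C by simp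
    fix z x :: "complex ^ 'n" assume z: "norm z < 1" and x: "norm x < 1"
    define s where "s = 1 - (norm z)\<^sup>2"
    have s: "s > 0" using z by (simp add: s_def abs_square_less_1)
    define q where "q = cmod (1 - cdot x z)"
    have q: "q > 0" using one_minus_cdot_bounds(5)[OF x, of z] z by (simp add: q_def)
    define t where "t = (1 - (norm x)\<^sup>2) powr (-a)"
    have t: "t \<ge> 0" by (simp add: t_def)
    have "ennreal (cmod (H z (mobius z x))) \<le> ennreal C\<^sub>1 * (\<integral>\<^sup>+ u. ennreal (kmod \<alpha> z u * kmod \<alpha> (mobius z x) u) \<partial>bnu \<alpha>)"
      by (rule order_trans[OF H_le_Hmaj Hmaj_le[OF z norm_mobius_less[OF z x]]])
    also have "\<dots> \<le> ennreal C\<^sub>1 * (ennreal (s powr (- N) * q powr N) * ennreal (C * t))"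
      unfolding nn_integral_kmod_transform[OF z x] s_def q_def t_def by (intro mult_left_mono C x) auto
    also have "\<dots> = ennreal (C\<^sub>1 * (s powr (- N) * q powr N * (C * t)))"
      using C1_nonneg C t by (simp add: mult.assoc flip: ennreal_mult)
    finally have "cmod (H z (mobius z x)) \<le> C\<^sub>1 * (s powr (- N) * q powr N * (C * t))"
      using C1_nonneg C t by (subst (asm) ennreal_le_iff) auto
    then have "H_pulled z x \<le> (C\<^sub>1 * (s powr (- N) * q powr N * (C * t))) * s powr N * q powr (- N)"
      unfolding H_pulled_def s_def[symmetric] q_def[symmetric] by (intro mult_right_mono) auto
    also have "\<dots> = C\<^sub>1 * C * t" using s q by (simp add: powr_minus field_simps)
    finally show "H_pulled z x \<le> C\<^sub>1 * C * (1 - (norm x)\<^sup>2) powr (-a)" by (simp add: t_def)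
  qed
qed

text \<open>The same shift of the exponent to N - 2 a as in \<open>forelli_rudin\<close>, with the
  pulled-back kernel kept inside as an additional factor.\<close>

lemma nn_integral_H_transform:
  fixes z :: "complex ^ 'n" and a :: real
  assumes z: "norm z < 1"
  shows "(\<integral>\<^sup>+ w. ennreal (cmod (H z w) * (1 - (norm w)\<^sup>2) powr (-a)) \<partial>bnu \<alpha>) =
    ennreal ((1 - (norm z)\<^sup>2) powr (-a)) *
      (\<integral>\<^sup>+ x. ennreal (H_pulled z x * ((1 - (norm x)\<^sup>2) powr (-a) * cmod (1 - cdot x z) powr (- (N - 2 * a)))) \<partial>bnu \<alpha>)"
proof -
  define s where "s = 1 - (norm z)\<^sup>2"
  have s: "s > 0" using z by (simp add: s_def abs_square_less_1)
  have "(\<integral>\<^sup>+ w. ennreal (cmod (H z w) * (1 - (norm w)\<^sup>2) powr (-a)) \<partial>bnu \<alpha>) =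
      (\<integral>\<^sup>+ x. ennreal (mobius_density \<alpha> z x) * ennreal (cmod (H z (mobius z x)) * (1 - (norm (mobius z x))\<^sup>2) powr (-a)) \<partial>bnu \<alpha>)"
    by (rule nn_integral_bnu_mobius[OF \<alpha> z, symmetric]) measurable
  also have "\<dots> = (\<integral>\<^sup>+ x. ennreal (s powr (-a)) * ennreal (H_pulled z x * ((1 - (norm x)\<^sup>2) powr (-a) * cmod (1 - cdot x z) powr (- (N - 2 * a)))) \<partial>bnu \<alpha>)"
  proof (rule nn_integral_cong_AE, use AE_bnu_ball in eventually_elim)
    fix x :: "complex ^ 'n" assume "x \<in> ball 0 1"
    then have x: "norm x < 1" by simp
    define t where "t = 1 - (norm x)\<^sup>2"
    define q where "q = cmod (1 - cdot x z)"
    have t: "t > 0" using x by (simp add: t_def abs_square_less_1)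
    have q: "q > 0" using one_minus_cdot_bounds(5)[OF x, of z] z by (simp add: q_def)
    have e: "1 - (norm (mobius z x))\<^sup>2 = s * t / q\<^sup>2"
      using mobius_norm[OF z less_imp_le[OF x]] by (simp add: s_def q_def t_def)
    have q2: "(q\<^sup>2) powr b = q powr b * q powr b" for b by (simp add: power2_eq_square powr_mult)
    have q2a: "q powr (N - 2 * a) = q powr N / (q powr a * q powr a)"
      using q by (simp add: powr_diff flip: powr_add)
    have "mobius_density \<alpha> z x * (cmod (H z (mobius z x)) * (s * t / q\<^sup>2) powr (-a)) =
        s powr (-a) * (H_pulled z x * (t powr (-a) * q powr (- (N - 2 * a))))"
      unfolding mobius_density_def H_pulled_def N_def[symmetric] s_def[symmetric] q_def[symmetric] powr_minus q2a
      using s t q by (simp add: powr_mult powr_divide powr_minus q2 field_simps)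
    then show "ennreal (mobius_density \<alpha> z x) * ennreal (cmod (H z (mobius z x)) * (1 - (norm (mobius z x))\<^sup>2) powr (-a)) =
        ennreal (s powr (-a)) * ennreal (H_pulled z x * ((1 - (norm x)\<^sup>2) powr (-a) * cmod (1 - cdot x z) powr (- (N - 2 * a))))"
      unfolding e t_def[symmetric] q_def[symmetric] by (simp flip: ennreal_mult)
  qed
  also have "\<dots> = ennreal (s powr (-a)) *
      (\<integral>\<^sup>+ x. ennreal (H_pulled z x * ((1 - (norm x)\<^sup>2) powr (-a) * cmod (1 - cdot x z) powr (- (N - 2 * a)))) \<partial>bnu \<alpha>)"
    by (rule nn_integral_cmult) measurable
  finally show ?thesis by (simp add: s_def)
qed

text \<open>In the pulled-back integral, \<open>kernel_small\<close> treats |x| \<le> R for z near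
  the sphere. For |x| > R the uniform growth bound is paid for by a slightly more singular weight,
  which leaves a positive power of 1 - |x|^2; R is fixed before z.\<close>

lemma nn_integral_H_small:
  fixes a \<eta> :: real
  assumes small: "\<And>e. e > 0 \<Longrightarrow> \<exists>\<rho><1. \<forall>w :: complex ^ 'n. \<rho> < norm w \<longrightarrow> norm w < 1 \<longrightarrow> (1 - (norm w)\<^sup>2) powr N * cmod (H w w) \<le> e"
    and a: "0 < a" "2 * a < 1 + \<alpha>" "2 * a \<le> N" and \<eta>: "\<eta> > 0"
  obtains r0 where "r0 < 1" "\<And>z :: complex ^ 'n. r0 < norm z \<Longrightarrow> norm z < 1 \<Longrightarrow>
    (\<integral>\<^sup>+ w. ennreal (cmod (H z w) * (1 - (norm w)\<^sup>2) powr (-a)) \<partial>bnu \<alpha>) \<le> ennreal (\<eta> * (1 - (norm z)\<^sup>2) powr (-a))"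
proof -
  \<comment> \<open>With t = 1 - |x|^2 these exponents give t^(-a') t^(-a) = t^(a') t^(-b). As a < b
    < 2 a < 1 + \<alpha>, the weight with exponent b is integrable and N - 2 a is still subcritical
    for it.\<close>
  define a' where "a' = a / 4"
  define b where "b = 3 / 2 * a"
  have a': "0 < a'" "\<alpha> - a' > -1" "2 * a' \<le> N" using a by (auto simp: a'_def)
  obtain C where C: "C \<ge> 0" "\<And>z x :: complex ^ 'n. norm z < 1 \<Longrightarrow> norm x < 1 \<Longrightarrow> H_pulled z x \<le> C * (1 - (norm x)\<^sup>2) powr (-a')"
    using H_pulled_le[OF a'] by blast
  have b: "0 \<le> b" "\<alpha> - b > -1" using a by (auto simp: b_def)
  have p: "0 \<le> N - 2 * a" "N - 2 * a < real CARD('n) + 1 + \<alpha> - b" using a by (auto simp: b_def N_def)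
  obtain D where D: "D \<ge> 0" "\<And>z :: complex ^ 'n. norm z < 1 \<Longrightarrow>
    (\<integral>\<^sup>+ w. ennreal ((1 - (norm w)\<^sup>2) powr (-b) * cmod (1 - cdot w z) powr (- (N - 2 * a))) \<partial>bnu \<alpha>) \<le> ennreal D"
    using forelli_rudin_bounded[OF \<alpha> b p] by blast
  \<comment> \<open>Makes 2 \<eta>' D at most \<eta>; the summand 1 allows D = 0.\<close>
  define \<eta>' where "\<eta>' = \<eta> / (2 * (D + 1))"
  have \<eta>': "\<eta>' > 0" using \<eta> D by (simp add: \<eta>'_def)
  have "((\<lambda>y :: real. C * y powr a') \<longlongrightarrow> C * 0) (at_right 0)"
    by (rule tendsto_mult[OF tendsto_const tendsto_zero_powrI[where b = a']])
       (use a'(1) in \<open>auto simp: eventually_at_filter\<close>)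
  then have "\<forall>\<^sub>F y in at_right (0::real). C * y powr a' < \<eta>'" by (rule order_tendstoD(2)) (use \<eta>' in simp)
  moreover have "\<forall>\<^sub>F y in at_right (0::real). y < 1" by (rule eventually_at_rightI[of 0 1]) auto
  moreover have "\<forall>\<^sub>F y in at_right (0::real). 0 < y" by (rule eventually_at_right_less)
  ultimately have ev: "\<forall>\<^sub>F y in at_right (0::real). C * y powr a' < \<eta>' \<and> y < 1 \<and> 0 < y" by eventually_elim simp
  \<comment> \<open>The threshold for 1 - |x|^2 below which the surplus power absorbs the constant;
    the radius R corresponds to it.\<close>
  obtain y0 :: real where y0: "C * y0 powr a' < \<eta>'" "y0 < 1" "0 < y0"
    using eventually_happens[OF ev] by auto
  define R where "R = sqrt (1 - y0)"
  have R: "R < 1" using y0 by (simp add: R_def)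
  obtain r0 where r0: "r0 < 1" "\<And>z x :: complex ^ 'n. r0 < norm z \<Longrightarrow> norm z < 1 \<Longrightarrow> norm x \<le> R \<Longrightarrow> H_pulled z x \<le> \<eta>'"
    using kernel_small[OF small R \<eta>'] unfolding H_pulled_def by blast
  show ?thesis
  proof (rule that[OF r0(1)])
    fix z :: "complex ^ 'n" assume z0: "r0 < norm z" and z: "norm z < 1"
    define g where "g = (\<lambda>w. (1 - (norm w)\<^sup>2) powr (-b) * cmod (1 - cdot w z) powr (- (N - 2 * a)))"
    have [measurable]: "g \<in> borel_measurable borel" unfolding g_def by measurable
    have "(\<integral>\<^sup>+ x. ennreal (H_pulled z x * ((1 - (norm x)\<^sup>2) powr (-a) * cmod (1 - cdot x z) powr (- (N - 2 * a)))) \<partial>bnu \<alpha>) \<le>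
        (\<integral>\<^sup>+ x. ennreal (2 * \<eta>') * ennreal (g x) \<partial>bnu \<alpha>)"
    proof (rule nn_integral_mono_AE, use AE_bnu_ball in eventually_elim)
      fix x :: "complex ^ 'n" assume "x \<in> ball 0 1"
      then have x: "norm x < 1" by simp
      define t where "t = 1 - (norm x)\<^sup>2"
      have t: "0 < t" "t \<le> 1" using x by (auto simp: t_def abs_square_less_1)
      have "H_pulled z x * t powr (-a) \<le> 2 * \<eta>' * t powr (-b)"
      proof (cases "norm x \<le> R")
        case True
        have "H_pulled z x * t powr (-a) \<le> \<eta>' * t powr (-b)"
          using r0(2)[OF z0 z True] t a \<eta>' by (intro mult_mono powr_mono') (auto simp: b_def)
        also have "\<dots> \<le> 2 * \<eta>' * t powr (-b)" using \<eta>' by (intro mult_right_mono) auto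
        finally show ?thesis .
      next
        case False
        then have "R < norm x" by simp
        then have "R\<^sup>2 < (norm x)\<^sup>2" using y0 by (intro power_strict_mono) (auto simp: R_def)
        then have ty: "t < y0" using y0 by (simp add: t_def R_def)
        have "H_pulled z x * t powr (-a) \<le> C * t powr (-a') * t powr (-a)"
          using C(2)[OF z x] by (intro mult_right_mono) (auto simp: t_def)
        also have "\<dots> = C * t powr a' * t powr (-b)"
          by (simp add: mult.assoc a'_def b_def flip: powr_add)
        also have "\<dots> \<le> C * y0 powr a' * t powr (-b)"
          using ty t a' C by (intro mult_right_mono mult_left_mono powr_mono2) auto
        also have "\<dots> \<le> 2 * \<eta>' * t powr (-b)" using y0 \<eta>' by (intro mult_right_mono) auto
        finally show ?thesis .
      qed
      then have "H_pulled z x * t powr (-a) * cmod (1 - cdot x z) powr (- (N - 2 * a)) \<le>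
          2 * \<eta>' * t powr (-b) * cmod (1 - cdot x z) powr (- (N - 2 * a))"
        by (intro mult_right_mono) auto
      then show "ennreal (H_pulled z x * ((1 - (norm x)\<^sup>2) powr (-a) * cmod (1 - cdot x z) powr (- (N - 2 * a)))) \<le> ennreal (2 * \<eta>') * ennreal (g x)"
        using \<eta>' by (simp add: g_def t_def mult.assoc ennreal_leI flip: ennreal_mult)
    qed
    also have "\<dots> = ennreal (2 * \<eta>') * (\<integral>\<^sup>+ x. ennreal (g x) \<partial>bnu \<alpha>)"
      by (rule nn_integral_cmult) measurable
    also have "\<dots> \<le> ennreal (2 * \<eta>') * ennreal D"
      unfolding g_def by (intro mult_left_mono D z) auto
    also have "\<dots> \<le> ennreal \<eta>"
    proof -
      have "2 * \<eta>' * D \<le> \<eta>" unfolding \<eta>'_def using \<eta> D by (simp add: field_simps)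
      then show ?thesis using \<eta>' D by (simp add: ennreal_leI flip: ennreal_mult)
    qed
    finally have "(\<integral>\<^sup>+ w. ennreal (cmod (H z w) * (1 - (norm w)\<^sup>2) powr (-a)) \<partial>bnu \<alpha>) \<le> ennreal ((1 - (norm z)\<^sup>2) powr (-a)) * ennreal \<eta>"
      unfolding nn_integral_H_transform[OF z] by (intro mult_left_mono) auto
    also have "\<dots> = ennreal (\<eta> * (1 - (norm z)\<^sup>2) powr (-a))"
      using \<eta> by (simp add: mult.commute flip: ennreal_mult)
    finally show "(\<integral>\<^sup>+ w. ennreal (cmod (H z w) * (1 - (norm w)\<^sup>2) powr (-a)) \<partial>bnu \<alpha>) \<le> ennreal (\<eta> * (1 - (norm z)\<^sup>2) powr (-a))" .
  qed
qed

end

section \<open>The Schur test\<close>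

context carleson_symbol
begin

sublocale S: sigma_finite_measure "bnu \<alpha> :: (complex ^ 'n) measure" by (rule sigma_finite_bnu[OF \<alpha>])
sublocale P: pair_sigma_finite "bnu \<alpha> :: (complex ^ 'n) measure" "bnu \<alpha> :: (complex ^ 'n) measure" ..

text \<open>The Schur weight with a = (1 + \<alpha>)/4. This leaves 2 a strictly below 1 + \<alpha>,
  as the smallness estimate requires, and makes \<open>wt\<close> square integrable.\<close>

definition wt :: "complex ^ 'n \<Rightarrow> real" where
  "wt z = (1 - (norm z)\<^sup>2) powr (- ((1 + \<alpha>) / 4))"

lemma wt_measurable [measurable]: "wt \<in> borel_measurable borel"
  unfolding wt_def[abs_def] by measurable

lemma wt_pos: "norm z < 1 \<Longrightarrow> wt z > 0" and wt_nonneg [simp]: "wt z \<ge> 0"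
  by (auto simp: wt_def abs_square_eq_1)

lemma wt_exponent: "0 < (1 + \<alpha>) / 4" "\<alpha> - (1 + \<alpha>) / 4 > -1" "2 * ((1 + \<alpha>) / 4) < 1 + \<alpha>" "2 * ((1 + \<alpha>) / 4) \<le> N"
  using \<alpha> by (auto simp: N_def field_simps)

text \<open>The Schur quotient, kept as a function of the point instead of being replaced by its
  supremum; its decay at the boundary is what compactness uses.\<close>

definition schur_weight :: "complex ^ 'n \<Rightarrow> ennreal" where
  "schur_weight z = (\<integral>\<^sup>+ w. ennreal (cmod (H z w) * wt w) \<partial>bnu \<alpha>) * ennreal (inverse (wt z))"

lemma schur_weight_measurable [measurable]: "schur_weight \<in> borel_measurable borel"
proof -
  have "(\<lambda>z. \<integral>\<^sup>+ w. ennreal (cmod (H z w) * wt w) \<partial>bnu \<alpha>) \<in> borel_measurable (bnu \<alpha> :: (complex ^ 'n) measure)"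
    by (intro S.borel_measurable_nn_integral) measurable
  then show ?thesis unfolding schur_weight_def[abs_def] by simp
qed

lemma schur_bounds:
  obtains C where "C \<ge> 0"
    "\<And>w :: complex ^ 'n. norm w < 1 \<Longrightarrow> (\<integral>\<^sup>+ z. ennreal (cmod (H z w) * wt z) \<partial>bnu \<alpha>) \<le> ennreal (C * wt w)"
    "\<And>z :: complex ^ 'n. norm z < 1 \<Longrightarrow> schur_weight z \<le> ennreal C"
proof -
  obtain C where C: "C \<ge> 0" "\<And>w :: complex ^ 'n. norm w < 1 \<Longrightarrow>
    (\<integral>\<^sup>+ z. Hmaj z w * ennreal (wt z) \<partial>bnu \<alpha>) \<le> ennreal (C * wt w)"
    using nn_integral_Hmaj_le[OF wt_exponent(1,2,4)] unfolding wt_def by blast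
  have H: "ennreal (cmod (H z w) * c) \<le> Hmaj z w * ennreal c" if "c \<ge> 0" for z w c
    using that H_le_Hmaj[of z w] by (simp add: ennreal_mult mult_right_mono)
  show ?thesis
  proof (rule that[OF C(1)])
    fix w :: "complex ^ 'n" assume w: "norm w < 1"
    have "(\<integral>\<^sup>+ z. ennreal (cmod (H z w) * wt z) \<partial>bnu \<alpha>) \<le> (\<integral>\<^sup>+ z. Hmaj z w * ennreal (wt z) \<partial>bnu \<alpha>)"
      by (intro nn_integral_mono H) simp
    also note C(2)[OF w]
    finally show "(\<integral>\<^sup>+ z. ennreal (cmod (H z w) * wt z) \<partial>bnu \<alpha>) \<le> ennreal (C * wt w)" .
    have "(\<integral>\<^sup>+ z. ennreal (cmod (H w z) * wt z) \<partial>bnu \<alpha>) \<le> (\<integral>\<^sup>+ z. Hmaj z w * ennreal (wt z) \<partial>bnu \<alpha>)"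
      unfolding Hmaj_commute[of _ w] by (intro nn_integral_mono H) simp
    also note C(2)[OF w]
    finally have "schur_weight w \<le> ennreal (C * wt w) * ennreal (inverse (wt w))"
      unfolding schur_weight_def by (intro mult_right_mono) auto
    also have "\<dots> = ennreal C" using wt_pos[OF w] C by (simp flip: ennreal_mult)
    finally show "schur_weight w \<le> ennreal C" .
  qed
qed

text \<open>Schur's test with the two sides treated differently: integration in the first argument
  of \<open>H\<close> is estimated by a constant, integration in the second is recorded exactly in
  \<open>schur_weight\<close>.\<close>

lemma schur_test:
  obtains C where "C \<ge> 0"
    "\<And>z :: complex ^ 'n. norm z < 1 \<Longrightarrow> schur_weight z \<le> ennreal C"
    "\<And>g :: complex ^ 'n \<Rightarrow> real. g \<in> borel_measurable borel \<Longrightarrow> (\<And>z. g z \<ge> 0) \<Longrightarrow>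
      (\<integral>\<^sup>+ w. (\<integral>\<^sup>+ z. ennreal (cmod (H z w) * g z) \<partial>bnu \<alpha>)\<^sup>2 \<partial>bnu \<alpha>) \<le>
        ennreal C * (\<integral>\<^sup>+ z. ennreal ((g z)\<^sup>2) * schur_weight z \<partial>bnu \<alpha>)"
proof -
  obtain C where C: "C \<ge> 0"
    "\<And>w :: complex ^ 'n. norm w < 1 \<Longrightarrow> (\<integral>\<^sup>+ z. ennreal (cmod (H z w) * wt z) \<partial>bnu \<alpha>) \<le> ennreal (C * wt w)"
    "\<And>z :: complex ^ 'n. norm z < 1 \<Longrightarrow> schur_weight z \<le> ennreal C"
    using schur_bounds by blast
  show ?thesis
  proof (rule that[OF C(1,3)])
    fix g :: "complex ^ 'n \<Rightarrow> real"
    assume g[measurable]: "g \<in> borel_measurable borel" and g0: "\<And>z. g z \<ge> 0"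
    define G where "G = (\<lambda>z. (g z)\<^sup>2 * inverse (wt z))"
    have [measurable]: "G \<in> borel_measurable borel" unfolding G_def by measurable
    have G0: "G z \<ge> 0" for z by (simp add: G_def)
    have "(\<integral>\<^sup>+ w. (\<integral>\<^sup>+ z. ennreal (cmod (H z w) * g z) \<partial>bnu \<alpha>)\<^sup>2 \<partial>bnu \<alpha>) \<le>
        (\<integral>\<^sup>+ w. ennreal (C * wt w) * (\<integral>\<^sup>+ z. ennreal (cmod (H z w) * G z) \<partial>bnu \<alpha>) \<partial>bnu \<alpha>)"
    proof (rule nn_integral_mono_AE, use AE_bnu_ball in eventually_elim)
      fix w :: "complex ^ 'n" assume "w \<in> ball 0 1"
      then have w: "norm w < 1" by simp
      \<comment> \<open>The splitting g = wt^(1/2) (g wt^(-1/2)), with the modulus of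
        \<open>H\<close> shared equally between the factors.\<close>
      define f1 where "f1 = (\<lambda>z. ennreal (sqrt (cmod (H z w) * wt z)))"
      define f2 where "f2 = (\<lambda>z. ennreal (sqrt (cmod (H z w) * G z)))"
      have [measurable]: "f1 \<in> borel_measurable borel" "f2 \<in> borel_measurable borel" unfolding f1_def f2_def by measurable
      have "(\<integral>\<^sup>+ z. ennreal (cmod (H z w) * g z) \<partial>bnu \<alpha>) = (\<integral>\<^sup>+ z. f1 z * f2 z \<partial>bnu \<alpha>)"
      proof (rule nn_integral_cong_AE, use AE_bnu_ball in eventually_elim)
        fix z :: "complex ^ 'n" assume "z \<in> ball 0 1"
        then have "wt z > 0" by (simp add: wt_pos)
        then have "sqrt (cmod (H z w) * wt z) * sqrt (cmod (H z w) * G z) = sqrt ((cmod (H z w) * g z)\<^sup>2)"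
          unfolding real_sqrt_mult[symmetric] G_def by (simp add: power2_eq_square mult_ac)
        then show "ennreal (cmod (H z w) * g z) = f1 z * f2 z"
          using g0[of z] by (simp add: f1_def f2_def G0 flip: ennreal_mult)
      qed
      then have "(\<integral>\<^sup>+ z. ennreal (cmod (H z w) * g z) \<partial>bnu \<alpha>)\<^sup>2 = (\<integral>\<^sup>+ z. f1 z * f2 z \<partial>bnu \<alpha>)\<^sup>2" by simp
      also have "\<dots> \<le> (\<integral>\<^sup>+ z. (f1 z)\<^sup>2 \<partial>bnu \<alpha>) * (\<integral>\<^sup>+ z. (f2 z)\<^sup>2 \<partial>bnu \<alpha>)"
        by (rule Cauchy_Schwarz_nn_integral) measurable
      also have "\<dots> = (\<integral>\<^sup>+ z. ennreal (cmod (H z w) * wt z) \<partial>bnu \<alpha>) * (\<integral>\<^sup>+ z. ennreal (cmod (H z w) * G z) \<partial>bnu \<alpha>)"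
        by (simp add: f1_def f2_def ennreal_power G0)
      also have "\<dots> \<le> ennreal (C * wt w) * (\<integral>\<^sup>+ z. ennreal (cmod (H z w) * G z) \<partial>bnu \<alpha>)"
        by (intro mult_right_mono C(2) w) auto
      finally show "(\<integral>\<^sup>+ z. ennreal (cmod (H z w) * g z) \<partial>bnu \<alpha>)\<^sup>2 \<le>
          ennreal (C * wt w) * (\<integral>\<^sup>+ z. ennreal (cmod (H z w) * G z) \<partial>bnu \<alpha>)" .
    qed
    also have "\<dots> = (\<integral>\<^sup>+ w. (\<integral>\<^sup>+ z. ennreal C * (ennreal (G z) * ennreal (cmod (H z w) * wt w)) \<partial>bnu \<alpha>) \<partial>bnu \<alpha>)"
      using C(1) G0 by (simp add: nn_integral_cmult[symmetric] ennreal_mult mult_ac)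
    also have "\<dots> = (\<integral>\<^sup>+ z. (\<integral>\<^sup>+ w. ennreal C * (ennreal (G z) * ennreal (cmod (H z w) * wt w)) \<partial>bnu \<alpha>) \<partial>bnu \<alpha>)"
      by (rule P.Fubini') measurable
    also have "\<dots> = ennreal C * (\<integral>\<^sup>+ z. ennreal ((g z)\<^sup>2) * schur_weight z \<partial>bnu \<alpha>)"
    proof -
      have "(\<integral>\<^sup>+ w. ennreal C * (ennreal (G z) * ennreal (cmod (H z w) * wt w)) \<partial>bnu \<alpha>) =
          ennreal C * (ennreal ((g z)\<^sup>2) * schur_weight z)" for z
      proof -
        have "(\<integral>\<^sup>+ w. ennreal C * (ennreal (G z) * ennreal (cmod (H z w) * wt w)) \<partial>bnu \<alpha>) =
            ennreal C * (ennreal (G z) * (\<integral>\<^sup>+ w. ennreal (cmod (H z w) * wt w) \<partial>bnu \<alpha>))"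
          by (simp add: nn_integral_cmult)
        then show ?thesis unfolding schur_weight_def G_def by (simp add: ennreal_mult mult_ac)
      qed
      then show ?thesis by (simp add: nn_integral_cmult)
    qed
    finally show "(\<integral>\<^sup>+ w. (\<integral>\<^sup>+ z. ennreal (cmod (H z w) * g z) \<partial>bnu \<alpha>)\<^sup>2 \<partial>bnu \<alpha>) \<le>
        ennreal C * (\<integral>\<^sup>+ z. ennreal ((g z)\<^sup>2) * schur_weight z \<partial>bnu \<alpha>)" .
  qed
qed

lemma schur_weight_small:
  assumes small: "\<And>e. e > 0 \<Longrightarrow> \<exists>\<rho><1. \<forall>w :: complex ^ 'n. \<rho> < norm w \<longrightarrow> norm w < 1 \<longrightarrow> (1 - (norm w)\<^sup>2) powr N * cmod (H w w) \<le> e"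
    and \<eta>: "\<eta> > 0"
  obtains r0 where "r0 < 1" "\<And>z :: complex ^ 'n. r0 < norm z \<Longrightarrow> norm z < 1 \<Longrightarrow> schur_weight z \<le> ennreal \<eta>"
proof -
  obtain r0 where r0: "r0 < 1" "\<And>z :: complex ^ 'n. r0 < norm z \<Longrightarrow> norm z < 1 \<Longrightarrow>
    (\<integral>\<^sup>+ w. ennreal (cmod (H z w) * wt w) \<partial>bnu \<alpha>) \<le> ennreal (\<eta> * wt z)"
    using nn_integral_H_small[OF small wt_exponent(1,3,4) \<eta>] unfolding wt_def by blast
  show ?thesis
  proof (rule that[OF r0(1)])
    fix z :: "complex ^ 'n" assume z: "r0 < norm z" "norm z < 1"
    have "schur_weight z \<le> ennreal (\<eta> * wt z) * ennreal (inverse (wt z))"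
      unfolding schur_weight_def by (intro mult_right_mono r0 z) auto
    also have "\<dots> = ennreal \<eta>" using wt_pos[OF z(2)] \<eta> by (simp flip: ennreal_mult)
    finally show "schur_weight z \<le> ennreal \<eta>" .
  qed
qed

section \<open>The vector-valued operator\<close>

text \<open>Membership in A^2 with holomorphy replaced by the reproducing formula on the ball. In
  this form the class is visibly stable under bounded complex-linear maps of \<open>ell2\<close> and
  under bounded pointwise limits.\<close>

definition reproduced :: "(complex ^ 'n \<Rightarrow> ell2) \<Rightarrow> bool" where
  "reproduced u \<longleftrightarrow> u \<in> borel_measurable borel \<and> (\<integral>\<^sup>+ z. ennreal ((norm (u z))\<^sup>2) \<partial>bnu \<alpha>) < \<infinity> \<and>
     (\<forall>v. norm v < 1 \<longrightarrow> u v = (\<integral>z. cnj (bergman_kernel \<alpha> v z) *\<^sub>C u z \<partial>bnu \<alpha>))"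

definition T :: "(complex ^ 'n \<Rightarrow> ell2) \<Rightarrow> complex ^ 'n \<Rightarrow> ell2" where
  "T u w = (\<integral>v. cnj (bergman_kernel \<alpha> w v) *\<^sub>C (\<tau> v *\<^sub>C u v) \<partial>bnu \<alpha>)"

lemma reproducedD:
  assumes "reproduced u"
  shows "u \<in> borel_measurable borel" "(\<integral>\<^sup>+ z. ennreal ((norm (u z))\<^sup>2) \<partial>bnu \<alpha>) < \<infinity>"
    "norm v < 1 \<Longrightarrow> u v = (\<integral>z. cnj (bergman_kernel \<alpha> v z) *\<^sub>C u z \<partial>bnu \<alpha>)"
  using assms by (auto simp: reproduced_def)

lemma nn_integral_norm_le:
  fixes u :: "complex ^ 'n \<Rightarrow> ell2"
  assumes [measurable]: "u \<in> borel_measurable borel"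
  shows "(\<integral>\<^sup>+ z. ennreal (norm (u z)) \<partial>bnu \<alpha>) \<le> 1 + (\<integral>\<^sup>+ z. ennreal ((norm (u z))\<^sup>2) \<partial>bnu \<alpha>)"
proof -
  have "(\<integral>\<^sup>+ z. ennreal (norm (u z)) \<partial>bnu \<alpha>) \<le> (\<integral>\<^sup>+ z. 1 + ennreal ((norm (u z))\<^sup>2) \<partial>bnu \<alpha>)"
  proof (rule nn_integral_mono)
    fix z
    have "norm (u z) \<le> 1 + (norm (u z))\<^sup>2"
      using sum_squares_bound[of "norm (u z)" 1] by (simp add: power2_eq_square) (smt (verit) norm_ge_zero mult_nonneg_nonneg)
    then have "ennreal (norm (u z)) \<le> ennreal (1 + (norm (u z))\<^sup>2)" by (rule ennreal_leI)
    then show "ennreal (norm (u z)) \<le> 1 + ennreal ((norm (u z))\<^sup>2)" by (simp add: ennreal_plus)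
  qed
  also have "\<dots> = 1 + (\<integral>\<^sup>+ z. ennreal ((norm (u z))\<^sup>2) \<partial>bnu \<alpha>)"
    by (subst nn_integral_add) (auto simp: emeasure_bnu_UNIV[OF \<alpha>])
  finally show ?thesis .
qed

lemma reproduced_integrable: "reproduced u \<Longrightarrow> integrable (bnu \<alpha>) u"
  using reproducedD[of u] nn_integral_norm_le[of u]
  by (intro integrableI_bounded) (auto simp: ennreal_add_less_top intro: le_less_trans)

lemma nn_integral_wt_sq_finite: "(\<integral>\<^sup>+ z. ennreal ((wt z)\<^sup>2) \<partial>(bnu \<alpha> :: (complex ^ 'n) measure)) < \<infinity>"
proof -
  have "(\<integral>\<^sup>+ z. ennreal ((wt z)\<^sup>2) \<partial>(bnu \<alpha> :: (complex ^ 'n) measure)) =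
      (\<integral>\<^sup>+ z. ennreal ((1 - (norm z)\<^sup>2) powr (- ((1 + \<alpha>) / 2))) \<partial>(bnu \<alpha> :: (complex ^ 'n) measure))"
    by (intro nn_integral_cong) (simp add: wt_def power2_eq_square flip: powr_add)
  also have "\<dots> < \<infinity>" using \<alpha> by (intro nn_integral_bnu_weight_finite) (auto simp: field_simps)
  finally show ?thesis .
qed

text \<open>Integrating first in v, the Carleson embedding and the kernel estimate leave a multiple
  of \<open>wt\<close> z, which is square integrable and so can be paired with u. This absolute
  convergence justifies both the existence of \<open>T u\<close> and the interchange in
  \<open>T_eq_H\<close>.\<close>

lemma nn_integral_\<tau>_reproduced:
  assumes u: "reproduced u"
  shows "(\<integral>\<^sup>+ v. (\<integral>\<^sup>+ z. ennreal (cmod (\<tau> v) * (kmod \<alpha> v z * norm (u z))) \<partial>bnu \<alpha>) \<partial>bnu \<alpha>) < \<infinity>"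
proof -
  note [measurable] = reproducedD(1)[OF u]
  obtain C where C: "C \<ge> 0" "\<And>z :: complex ^ 'n. norm z < 1 \<Longrightarrow>
    (\<integral>\<^sup>+ w. ennreal (kmod \<alpha> z w) \<partial>bnu \<alpha>) \<le> ennreal (C * wt z)"
    using nn_integral_kmod_le[OF wt_exponent(1,2,4)] unfolding wt_def by blast
  have "(\<integral>\<^sup>+ v. (\<integral>\<^sup>+ z. ennreal (cmod (\<tau> v) * (kmod \<alpha> v z * norm (u z))) \<partial>bnu \<alpha>) \<partial>bnu \<alpha>) =
      (\<integral>\<^sup>+ z. (\<integral>\<^sup>+ v. ennreal (cmod (\<tau> v) * (kmod \<alpha> v z * norm (u z))) \<partial>bnu \<alpha>) \<partial>bnu \<alpha>)"
    by (rule P.Fubini') measurable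
  also have "\<dots> = (\<integral>\<^sup>+ z. ennreal (norm (u z)) * (\<integral>\<^sup>+ v. ennreal (cmod (\<tau> v)) * ennreal (kmod \<alpha> z v) \<partial>bnu \<alpha>) \<partial>bnu \<alpha>)"
  proof (rule nn_integral_cong)
    fix z
    have "(\<integral>\<^sup>+ v. ennreal (cmod (\<tau> v) * (kmod \<alpha> v z * norm (u z))) \<partial>bnu \<alpha>) =
        (\<integral>\<^sup>+ v. ennreal (norm (u z)) * (ennreal (cmod (\<tau> v)) * ennreal (kmod \<alpha> z v)) \<partial>bnu \<alpha>)"
      by (intro nn_integral_cong) (simp add: kmod_commute[of \<alpha> _ z] ennreal_mult mult_ac)
    then show "(\<integral>\<^sup>+ v. ennreal (cmod (\<tau> v) * (kmod \<alpha> v z * norm (u z))) \<partial>bnu \<alpha>) =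
        ennreal (norm (u z)) * (\<integral>\<^sup>+ v. ennreal (cmod (\<tau> v)) * ennreal (kmod \<alpha> z v) \<partial>bnu \<alpha>)"
      by (simp add: nn_integral_cmult)
  qed
  also have "\<dots> \<le> (\<integral>\<^sup>+ z. ennreal (C\<^sub>1 * C) * (ennreal ((norm (u z))\<^sup>2) + ennreal ((wt z)\<^sup>2)) \<partial>bnu \<alpha>)"
  proof (rule nn_integral_mono_AE, use AE_bnu_ball in eventually_elim)
    fix z :: "complex ^ 'n" assume "z \<in> ball 0 1"
    then have z: "norm z < 1" by simp
    have "(\<integral>\<^sup>+ v. ennreal (cmod (\<tau> v)) * ennreal (kmod \<alpha> z v) \<partial>bnu \<alpha>) \<le> ennreal C\<^sub>1 * ennreal (C * wt z)"
      by (rule order_trans[OF nn_integral_\<tau>_kmod_single_le[OF z] mult_left_mono[OF C(2)[OF z]]]) simp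
    then have "ennreal (norm (u z)) * (\<integral>\<^sup>+ v. ennreal (cmod (\<tau> v)) * ennreal (kmod \<alpha> z v) \<partial>bnu \<alpha>) \<le>
        ennreal (norm (u z)) * (ennreal C\<^sub>1 * ennreal (C * wt z))"
      by (rule mult_left_mono) simp
    also have "\<dots> = ennreal (C\<^sub>1 * C * (norm (u z) * wt z))"
      using C1_nonneg C(1) by (simp add: mult_ac flip: ennreal_mult)
    also have "\<dots> \<le> ennreal (C\<^sub>1 * C * ((norm (u z))\<^sup>2 + (wt z)\<^sup>2))"
    proof (intro ennreal_leI mult_left_mono)
      have "0 \<le> norm (u z) * wt z" by simp
      then show "norm (u z) * wt z \<le> (norm (u z))\<^sup>2 + (wt z)\<^sup>2"
        using sum_squares_bound[of "norm (u z)" "wt z"] by linarith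
    qed (use C1_nonneg C(1) in simp)
    also have "\<dots> = ennreal (C\<^sub>1 * C) * (ennreal ((norm (u z))\<^sup>2) + ennreal ((wt z)\<^sup>2))"
      using C1_nonneg C(1) by (simp add: ennreal_mult ennreal_plus)
    finally show "ennreal (norm (u z)) * (\<integral>\<^sup>+ v. ennreal (cmod (\<tau> v)) * ennreal (kmod \<alpha> z v) \<partial>bnu \<alpha>) \<le>
        ennreal (C\<^sub>1 * C) * (ennreal ((norm (u z))\<^sup>2) + ennreal ((wt z)\<^sup>2))" .
  qed
  also have "\<dots> = ennreal (C\<^sub>1 * C) * ((\<integral>\<^sup>+ z. ennreal ((norm (u z))\<^sup>2) \<partial>bnu \<alpha>) + (\<integral>\<^sup>+ z. ennreal ((wt z)\<^sup>2) \<partial>bnu \<alpha>))"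
    by (simp add: nn_integral_cmult nn_integral_add)
  also have "\<dots> < \<infinity>"
    using reproducedD(2)[OF u] nn_integral_wt_sq_finite by (simp add: ennreal_mult_less_top ennreal_add_less_top)
  finally show ?thesis .
qed

lemma reproduced_norm_le:
  assumes u: "reproduced u" and v: "norm v < 1"
  shows "ennreal (norm (u v)) \<le> (\<integral>\<^sup>+ z. ennreal (kmod \<alpha> v z * norm (u z)) \<partial>bnu \<alpha>)"
proof -
  have "ennreal (norm (u v)) \<le> (\<integral>\<^sup>+ z. ennreal (norm (cnj (bergman_kernel \<alpha> v z) *\<^sub>C u z)) \<partial>bnu \<alpha>)"
    using integral_norm_bound_ennreal[OF integrable_kernel[OF \<alpha> reproduced_integrable[OF u] v]] reproducedD(3)[OF u v] by simp
  then show ?thesis by (simp add: norm_scaleC cmod_bergman_kernel)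
qed

text \<open>As \<open>\<tau>\<close> is unbounded, square integrability of u alone would not do; the
  reproducing formula bounds |u v| by a kernel integral and reduces the claim to the double integral
  above.\<close>

lemma integrable_\<tau>_reproduced:
  assumes u: "reproduced u"
  shows "integrable (bnu \<alpha>) (\<lambda>v. \<tau> v *\<^sub>C u v)"
proof (rule integrableI_bounded)
  note [measurable] = reproducedD(1)[OF u]
  show "(\<lambda>v. \<tau> v *\<^sub>C u v) \<in> borel_measurable (bnu \<alpha>)" by measurable
  have "(\<integral>\<^sup>+ v. ennreal (norm (\<tau> v *\<^sub>C u v)) \<partial>bnu \<alpha>) \<le>
      (\<integral>\<^sup>+ v. (\<integral>\<^sup>+ z. ennreal (cmod (\<tau> v) * (kmod \<alpha> v z * norm (u z))) \<partial>bnu \<alpha>) \<partial>bnu \<alpha>)"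
  proof (rule nn_integral_mono_AE, use AE_bnu_ball in eventually_elim)
    fix v :: "complex ^ 'n" assume "v \<in> ball 0 1"
    then have v: "norm v < 1" by simp
    have "ennreal (norm (\<tau> v *\<^sub>C u v)) = ennreal (cmod (\<tau> v)) * ennreal (norm (u v))"
      by (simp add: norm_scaleC ennreal_mult)
    also have "\<dots> \<le> ennreal (cmod (\<tau> v)) * (\<integral>\<^sup>+ z. ennreal (kmod \<alpha> v z * norm (u z)) \<partial>bnu \<alpha>)"
      by (intro mult_left_mono reproduced_norm_le[OF u v]) simp
    also have "\<dots> = (\<integral>\<^sup>+ z. ennreal (cmod (\<tau> v) * (kmod \<alpha> v z * norm (u z))) \<partial>bnu \<alpha>)"
      by (simp add: nn_integral_cmult[symmetric] ennreal_mult)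
    finally show "ennreal (norm (\<tau> v *\<^sub>C u v)) \<le> (\<integral>\<^sup>+ z. ennreal (cmod (\<tau> v) * (kmod \<alpha> v z * norm (u z))) \<partial>bnu \<alpha>)" .
  qed
  then show "(\<integral>\<^sup>+ v. ennreal (norm (\<tau> v *\<^sub>C u v)) \<partial>bnu \<alpha>) < \<infinity>"
    using nn_integral_\<tau>_reproduced[OF u] by (rule le_less_trans)
qed

text \<open>The reproducing formula is substituted for \<open>u\<close> and the integrals are
  interchanged, which puts \<open>\<tau>\<close> between two kernels with its cancellation
  intact.\<close>

lemma T_eq_H:
  assumes u: "reproduced u" and w: "norm w < 1"
  shows "T u w = (\<integral>z. H z w *\<^sub>C u z \<partial>bnu \<alpha>)"
proof -
  note [measurable] = reproducedD(1)[OF u]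
  define F where "F = (\<lambda>v z. (\<tau> v * bergman_kernel \<alpha> z v * cnj (bergman_kernel \<alpha> w v)) *\<^sub>C u z)"
  define c where "c = (1 - norm w) powr (- N)"
  have c: "kmod \<alpha> w v \<le> c" if "norm v < 1" for v
    unfolding c_def N_def using kmod_le[OF \<alpha> order_refl w that] .
  have Fm: "(\<lambda>(v, z). F v z) \<in> borel_measurable (bnu \<alpha> \<Otimes>\<^sub>M bnu \<alpha>)" unfolding F_def by measurable
  have int: "integrable (bnu \<alpha> \<Otimes>\<^sub>M bnu \<alpha>) (\<lambda>(v, z). F v z)"
  proof (rule integrableI_bounded[OF Fm])
    have "(\<integral>\<^sup>+ p. ennreal (norm (case p of (v, z) \<Rightarrow> F v z)) \<partial>(bnu \<alpha> \<Otimes>\<^sub>M bnu \<alpha>)) =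
        (\<integral>\<^sup>+ v. (\<integral>\<^sup>+ z. ennreal (norm (F v z)) \<partial>bnu \<alpha>) \<partial>bnu \<alpha>)"
      using S.nn_integral_fst[of "\<lambda>p. ennreal (norm (case p of (v, z) \<Rightarrow> F v z))" "bnu \<alpha>"] Fm by simp
    also have "\<dots> \<le> (\<integral>\<^sup>+ v. (\<integral>\<^sup>+ z. ennreal c * ennreal (cmod (\<tau> v) * (kmod \<alpha> v z * norm (u z))) \<partial>bnu \<alpha>) \<partial>bnu \<alpha>)"
    proof (rule nn_integral_mono_AE, use AE_bnu_ball in eventually_elim, rule nn_integral_mono)
      fix v z :: "complex ^ 'n" assume "v \<in> ball 0 1"
      then have "kmod \<alpha> w v \<le> c" using c by simp
      then have "(cmod (\<tau> v) * (kmod \<alpha> v z * norm (u z))) * kmod \<alpha> w v \<le> (cmod (\<tau> v) * (kmod \<alpha> v z * norm (u z))) * c"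
        by (intro mult_left_mono) auto
      then show "ennreal (norm (F v z)) \<le> ennreal c * ennreal (cmod (\<tau> v) * (kmod \<alpha> v z * norm (u z)))"
        by (simp add: F_def norm_scaleC norm_mult cmod_bergman_kernel kmod_commute[of \<alpha> z v] c_def ennreal_leI mult_ac flip: ennreal_mult)
    qed
    also have "\<dots> = ennreal c * (\<integral>\<^sup>+ v. (\<integral>\<^sup>+ z. ennreal (cmod (\<tau> v) * (kmod \<alpha> v z * norm (u z))) \<partial>bnu \<alpha>) \<partial>bnu \<alpha>)"
      by (simp add: nn_integral_cmult)
    also have "\<dots> < \<infinity>" using nn_integral_\<tau>_reproduced[OF u] by (simp add: ennreal_mult_less_top)
    finally show "(\<integral>\<^sup>+ p. ennreal (norm (case p of (v, z) \<Rightarrow> F v z)) \<partial>(bnu \<alpha> \<Otimes>\<^sub>M bnu \<alpha>)) < \<infinity>" .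
  qed
  have "T u w = (\<integral>v. (\<integral>z. F v z \<partial>bnu \<alpha>) \<partial>bnu \<alpha>)"
    unfolding T_def
  proof (rule integral_cong_AE)
    show "AE v in bnu \<alpha>. cnj (bergman_kernel \<alpha> w v) *\<^sub>C (\<tau> v *\<^sub>C u v) = (\<integral>z. F v z \<partial>bnu \<alpha>)"
      using AE_bnu_ball
    proof eventually_elim
      case (elim v)
      then have v: "norm v < 1" by simp
      have "(\<integral>z. F v z \<partial>bnu \<alpha>) = (\<integral>z. (cnj (bergman_kernel \<alpha> w v) * \<tau> v) *\<^sub>C (cnj (bergman_kernel \<alpha> v z) *\<^sub>C u z) \<partial>bnu \<alpha>)"
      proof (rule integral_cong_AE)
        show "AE z in bnu \<alpha>. F v z = (cnj (bergman_kernel \<alpha> w v) * \<tau> v) *\<^sub>C (cnj (bergman_kernel \<alpha> v z) *\<^sub>C u z)"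
          using AE_bnu_ball by eventually_elim (simp add: F_def cnj_bergman_kernel[OF v] mult_ac)
      qed (auto simp: F_def)
      also have "\<dots> = (cnj (bergman_kernel \<alpha> w v) * \<tau> v) *\<^sub>C u v"
        unfolding reproducedD(3)[OF u v]
        by (rule integral_bounded_linear[OF bounded_linear_scaleC_right integrable_kernel[OF \<alpha> reproduced_integrable[OF u] v]])
      finally show ?case by simp
    qed
    show "(\<lambda>v. \<integral>z. F v z \<partial>bnu \<alpha>) \<in> borel_measurable (bnu \<alpha>)"
      using Fm by (rule S.borel_measurable_lebesgue_integral)
  qed measurable
  also have "\<dots> = (\<integral>z. (\<integral>v. F v z \<partial>bnu \<alpha>) \<partial>bnu \<alpha>)"
    by (rule P.Fubini_integral[OF int, symmetric])
  also have "\<dots> = (\<integral>z. H z w *\<^sub>C u z \<partial>bnu \<alpha>)"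
  proof (rule integral_cong_AE)
    show "AE z in bnu \<alpha>. (\<integral>v. F v z \<partial>bnu \<alpha>) = H z w *\<^sub>C u z"
      using AE_bnu_ball
    proof eventually_elim
      case (elim z)
      then have z: "norm z < 1" by simp
      have "integrable (bnu \<alpha>) (\<lambda>v. \<tau> v * bergman_kernel \<alpha> z v * cnj (bergman_kernel \<alpha> w v))"
      proof (rule integrableI_bounded)
        show "(\<integral>\<^sup>+ v. ennreal (norm (\<tau> v * bergman_kernel \<alpha> z v * cnj (bergman_kernel \<alpha> w v))) \<partial>bnu \<alpha>) < \<infinity>"
          using nn_integral_\<tau>_kmod_le[OF z w]
          by (auto simp: norm_mult cmod_bergman_kernel mult.assoc intro: le_less_trans)
      qed measurable
      then show ?case unfolding F_def H_def
        by (rule integral_bounded_linear[OF bounded_bilinear.bounded_linear_left[OF bounded_bilinear_scaleC]])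
    qed
    show "(\<lambda>z. \<integral>v. F v z \<partial>bnu \<alpha>) \<in> borel_measurable (bnu \<alpha>)"
      by (rule S.borel_measurable_lebesgue_integral) (simp add: F_def)
  qed measurable
  finally show ?thesis .
qed

lemma norm_T_le:
  assumes u: "reproduced u" and w: "norm w < 1"
  shows "ennreal (norm (T u w)) \<le> (\<integral>\<^sup>+ z. ennreal (cmod (H z w) * norm (u z)) \<partial>bnu \<alpha>)"
proof (cases "integrable (bnu \<alpha>) (\<lambda>z. H z w *\<^sub>C u z)")
  case True
  then show ?thesis using integral_norm_bound_ennreal[OF True] by (simp add: T_eq_H[OF u w] norm_scaleC)
next
  case False
  then show ?thesis by (simp add: T_eq_H[OF u w] not_integrable_integral_eq)
qed

lemma T_measurable [measurable]:
  assumes [measurable]: "u \<in> borel_measurable borel"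
  shows "T u \<in> borel_measurable borel"
proof -
  have "(\<lambda>w. \<integral>v. cnj (bergman_kernel \<alpha> w v) *\<^sub>C (\<tau> v *\<^sub>C u v) \<partial>bnu \<alpha>) \<in> borel_measurable (bnu \<alpha> :: (complex ^ 'n) measure)"
    by (rule S.borel_measurable_lebesgue_integral) measurable
  then show ?thesis unfolding T_def[abs_def] by simp
qed

lemma T_L2_le:
  obtains C where "C \<ge> 0" "\<And>z :: complex ^ 'n. norm z < 1 \<Longrightarrow> schur_weight z \<le> ennreal C"
    "\<And>u. reproduced u \<Longrightarrow> (\<integral>\<^sup>+ w. ennreal ((norm (T u w))\<^sup>2) \<partial>bnu \<alpha>) \<le>
      ennreal C * (\<integral>\<^sup>+ z. ennreal ((norm (u z))\<^sup>2) * schur_weight z \<partial>bnu \<alpha>)"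
proof -
  obtain C where C: "C \<ge> 0" "\<And>z :: complex ^ 'n. norm z < 1 \<Longrightarrow> schur_weight z \<le> ennreal C"
    "\<And>g :: complex ^ 'n \<Rightarrow> real. g \<in> borel_measurable borel \<Longrightarrow> (\<And>z. g z \<ge> 0) \<Longrightarrow>
      (\<integral>\<^sup>+ w. (\<integral>\<^sup>+ z. ennreal (cmod (H z w) * g z) \<partial>bnu \<alpha>)\<^sup>2 \<partial>bnu \<alpha>) \<le>
        ennreal C * (\<integral>\<^sup>+ z. ennreal ((g z)\<^sup>2) * schur_weight z \<partial>bnu \<alpha>)"
    using schur_test by blast
  show ?thesis
  proof (rule that[OF C(1,2)])
    fix u assume u: "reproduced u"
    note [measurable] = reproducedD(1)[OF u]
    have "(\<integral>\<^sup>+ w. ennreal ((norm (T u w))\<^sup>2) \<partial>bnu \<alpha>) \<le> (\<integral>\<^sup>+ w. (\<integral>\<^sup>+ z. ennreal (cmod (H z w) * norm (u z)) \<partial>bnu \<alpha>)\<^sup>2 \<partial>bnu \<alpha>)"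
    proof (rule nn_integral_mono_AE, use AE_bnu_ball in eventually_elim)
      fix w :: "complex ^ 'n" assume "w \<in> ball 0 1"
      then have "(ennreal (norm (T u w)))\<^sup>2 \<le> (\<integral>\<^sup>+ z. ennreal (cmod (H z w) * norm (u z)) \<partial>bnu \<alpha>)\<^sup>2"
        by (intro power_mono norm_T_le u) auto
      then show "ennreal ((norm (T u w))\<^sup>2) \<le> (\<integral>\<^sup>+ z. ennreal (cmod (H z w) * norm (u z)) \<partial>bnu \<alpha>)\<^sup>2"
        by (simp add: ennreal_power)
    qed
    also have "\<dots> \<le> ennreal C * (\<integral>\<^sup>+ z. ennreal ((norm (u z))\<^sup>2) * schur_weight z \<partial>bnu \<alpha>)"
      by (rule C(3)) auto
    finally show "(\<integral>\<^sup>+ w. ennreal ((norm (T u w))\<^sup>2) \<partial>bnu \<alpha>) \<le>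
      ennreal C * (\<integral>\<^sup>+ z. ennreal ((norm (u z))\<^sup>2) * schur_weight z \<partial>bnu \<alpha>)" .
  qed
qed

end

section \<open>Linearity of \<open>T\<close> and sequences of reproduced functions\<close>

context carleson_symbol
begin

lemma holomorphic_T: "reproduced u \<Longrightarrow> holomorphic_ball (T u)"
  unfolding T_def[abs_def] by (rule holomorphic_kernel_integral[OF \<alpha> integrable_\<tau>_reproduced])

lemma reproduced_add:
  assumes u: "reproduced u" and v: "reproduced v"
  shows "reproduced (\<lambda>z. u z + v z)"
proof -
  note [measurable] = reproducedD(1)[OF u] reproducedD(1)[OF v]
  have "(\<integral>\<^sup>+ z. ennreal ((norm (u z + v z))\<^sup>2) \<partial>bnu \<alpha>) \<le>
      (\<integral>\<^sup>+ z. 2 * ennreal ((norm (u z))\<^sup>2) + 2 * ennreal ((norm (v z))\<^sup>2) \<partial>bnu \<alpha>)"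
  proof (rule nn_integral_mono)
    fix z
    have "(norm (u z + v z))\<^sup>2 \<le> (norm (u z) + norm (v z))\<^sup>2" by (intro power_mono norm_triangle_ineq) auto
    also have "\<dots> \<le> 2 * (norm (u z))\<^sup>2 + 2 * (norm (v z))\<^sup>2"
      using sum_squares_bound[of "norm (u z)" "norm (v z)"] by (simp add: power2_sum)
    finally have "ennreal ((norm (u z + v z))\<^sup>2) \<le> ennreal (2 * (norm (u z))\<^sup>2 + 2 * (norm (v z))\<^sup>2)" by (rule ennreal_leI)
    then show "ennreal ((norm (u z + v z))\<^sup>2) \<le> 2 * ennreal ((norm (u z))\<^sup>2) + 2 * ennreal ((norm (v z))\<^sup>2)"
      by (simp add: ennreal_plus ennreal_mult)
  qed
  also have "\<dots> = 2 * (\<integral>\<^sup>+ z. ennreal ((norm (u z))\<^sup>2) \<partial>bnu \<alpha>) + 2 * (\<integral>\<^sup>+ z. ennreal ((norm (v z))\<^sup>2) \<partial>bnu \<alpha>)"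
    by (simp add: nn_integral_add nn_integral_cmult)
  also have "\<dots> < \<infinity>" using reproducedD(2)[OF u] reproducedD(2)[OF v]
    by (simp add: ennreal_add_less_top ennreal_mult_less_top)
  finally have fin: "(\<integral>\<^sup>+ z. ennreal ((norm (u z + v z))\<^sup>2) \<partial>bnu \<alpha>) < \<infinity>" .
  show ?thesis
    unfolding reproduced_def
  proof (intro conjI allI impI fin)
    fix w :: "complex ^ 'n" assume w: "norm w < 1"
    show "u w + v w = (\<integral>z. cnj (bergman_kernel \<alpha> w z) *\<^sub>C (u z + v z) \<partial>bnu \<alpha>)"
      using integrable_kernel[OF \<alpha> reproduced_integrable[OF u] w] integrable_kernel[OF \<alpha> reproduced_integrable[OF v] w]
      by (simp add: scaleC_add_right reproducedD(3)[OF u w] reproducedD(3)[OF v w])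
  qed measurable
qed

lemma reproduced_image:
  assumes u: "reproduced u" and D: "bounded_linear D" and Dc: "\<And>c x. D (c *\<^sub>C x) = c *\<^sub>C D x"
  shows "reproduced (\<lambda>z. D (u z))"
proof -
  note [measurable] = reproducedD(1)[OF u] borel_measurable_continuous_onI[OF linear_continuous_on[OF D]]
  obtain K where K: "K > 0" "\<And>x. norm (D x) \<le> norm x * K" using bounded_linear.pos_bounded[OF D] by blast
  have "(\<integral>\<^sup>+ z. ennreal ((norm (D (u z)))\<^sup>2) \<partial>bnu \<alpha>) \<le> (\<integral>\<^sup>+ z. ennreal (K\<^sup>2) * ennreal ((norm (u z))\<^sup>2) \<partial>bnu \<alpha>)"
  proof (rule nn_integral_mono)
    fix z
    have "(norm (D (u z)))\<^sup>2 \<le> (norm (u z) * K)\<^sup>2" using K by (intro power_mono) auto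
    then show "ennreal ((norm (D (u z)))\<^sup>2) \<le> ennreal (K\<^sup>2) * ennreal ((norm (u z))\<^sup>2)"
      by (simp add: power_mult_distrib mult.commute ennreal_leI flip: ennreal_mult)
  qed
  also have "\<dots> = ennreal (K\<^sup>2) * (\<integral>\<^sup>+ z. ennreal ((norm (u z))\<^sup>2) \<partial>bnu \<alpha>)" by (simp add: nn_integral_cmult)
  also have "\<dots> < \<infinity>" using reproducedD(2)[OF u] by (simp add: ennreal_mult_less_top)
  finally have fin: "(\<integral>\<^sup>+ z. ennreal ((norm (D (u z)))\<^sup>2) \<partial>bnu \<alpha>) < \<infinity>" .
  show ?thesis
    unfolding reproduced_def
  proof (intro conjI allI impI fin)
    fix w :: "complex ^ 'n" assume w: "norm w < 1"
    show "D (u w) = (\<integral>z. cnj (bergman_kernel \<alpha> w z) *\<^sub>C D (u z) \<partial>bnu \<alpha>)"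
      using integral_bounded_linear[OF D integrable_kernel[OF \<alpha> reproduced_integrable[OF u] w]]
      by (simp add: Dc reproducedD(3)[OF u w])
  qed measurable
qed

lemma reproduced_diff:
  assumes u: "reproduced u" and v: "reproduced v"
  shows "reproduced (\<lambda>z. u z - v z)"
  using reproduced_add[OF u reproduced_image[OF v, of "\<lambda>x. - x"]]
  by (simp add: bounded_linear_minus bounded_bilinear.minus_right[OF bounded_bilinear_scaleC] bounded_linear_ident)

lemma T_add:
  assumes u: "reproduced u" and v: "reproduced v" and w: "norm w < 1"
  shows "T (\<lambda>z. u z + v z) w = T u w + T v w"
  unfolding T_def
  using integrable_kernel[OF \<alpha> integrable_\<tau>_reproduced[OF u] w] integrable_kernel[OF \<alpha> integrable_\<tau>_reproduced[OF v] w]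
  by (simp add: scaleC_add_right del: scaleC_scaleC)

lemma T_diff:
  assumes u: "reproduced u" and v: "reproduced v" and w: "norm w < 1"
  shows "T (\<lambda>z. u z - v z) w = T u w - T v w"
  using T_add[OF reproduced_diff[OF u v] v w] by simp

lemma T_scale:
  assumes u: "reproduced u" and w: "norm w < 1"
  shows "T (\<lambda>z. c *\<^sub>C u z) w = c *\<^sub>C T u w"
  unfolding T_def
  using integral_bounded_linear[OF bounded_linear_scaleC_right[of c] integrable_kernel[OF \<alpha> integrable_\<tau>_reproduced[OF u] w]]
  by (simp add: mult_ac)

text \<open>The kernel at z is at most (1 - r)^(-N) for |z| \<le> r, and the L^1 norm is controlled
  by the L^2 norm because the measure is a probability.\<close>

lemma reproduced_local_bound:
  assumes B: "B \<ge> 0" and r: "r < 1"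
  obtains L where "L \<ge> 0" "\<And>u z. reproduced u \<Longrightarrow> (\<integral>\<^sup>+ z. ennreal ((norm (u z))\<^sup>2) \<partial>bnu \<alpha>) \<le> ennreal B \<Longrightarrow> norm z \<le> r \<Longrightarrow> norm (u z) \<le> L"
proof (rule that[of "(1 - r) powr (- N) * (1 + B)"])
  show "(1 - r) powr (- N) * (1 + B) \<ge> 0" using B by simp
  fix u and z :: "complex ^ 'n"
  assume u: "reproduced u" and uB: "(\<integral>\<^sup>+ z. ennreal ((norm (u z))\<^sup>2) \<partial>bnu \<alpha>) \<le> ennreal B" and z: "norm z \<le> r"
  note [measurable] = reproducedD(1)[OF u]
  have "ennreal (norm (u z)) \<le> (\<integral>\<^sup>+ v. ennreal (kmod \<alpha> z v * norm (u v)) \<partial>bnu \<alpha>)"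
    using r z by (intro reproduced_norm_le u) simp
  also have "\<dots> \<le> (\<integral>\<^sup>+ v. ennreal ((1 - r) powr (- N)) * ennreal (norm (u v)) \<partial>bnu \<alpha>)"
  proof (rule nn_integral_mono_AE, use AE_bnu_ball in eventually_elim)
    fix v :: "complex ^ 'n" assume "v \<in> ball 0 1"
    then have "kmod \<alpha> z v \<le> (1 - r) powr (- N)" unfolding N_def using kmod_le[OF \<alpha> z r] by simp
    then show "ennreal (kmod \<alpha> z v * norm (u v)) \<le> ennreal ((1 - r) powr (- N)) * ennreal (norm (u v))"
      by (simp add: ennreal_leI mult_right_mono flip: ennreal_mult)
  qed
  also have "\<dots> = ennreal ((1 - r) powr (- N)) * (\<integral>\<^sup>+ v. ennreal (norm (u v)) \<partial>bnu \<alpha>)" by (simp add: nn_integral_cmult)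
  also have "\<dots> \<le> ennreal ((1 - r) powr (- N)) * (1 + ennreal B)"
    by (intro mult_left_mono order_trans[OF nn_integral_norm_le] add_mono uB) auto
  also have "\<dots> = ennreal ((1 - r) powr (- N) * (1 + B))"
  proof -
    have "1 + ennreal B = ennreal (1 + B)" using B by (simp add: ennreal_plus)
    then show ?thesis using B by (simp only:) (rule ennreal_mult[symmetric], auto)
  qed
  finally show "norm (u z) \<le> (1 - r) powr (- N) * (1 + B)"
    using B by (subst (asm) ennreal_le_iff) auto
qed

text \<open>The weighted L^2 bound is split at radius r0. Outside, \<open>schur_weight\<close> is at
  most \<eta> and the norms are bounded; inside, \<open>schur_weight\<close> is at most C and
  bounded pointwise convergence makes the integral small.\<close>

lemma T_tendsto_0:
  fixes v :: "nat \<Rightarrow> complex ^ 'n \<Rightarrow> ell2"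
  assumes small: "\<And>e. e > 0 \<Longrightarrow> \<exists>\<rho><1. \<forall>w :: complex ^ 'n. \<rho> < norm w \<longrightarrow> norm w < 1 \<longrightarrow> (1 - (norm w)\<^sup>2) powr N * cmod (H w w) \<le> e"
    and v: "\<And>j. reproduced (v j)" and B: "B \<ge> 0" "\<And>j. (\<integral>\<^sup>+ z. ennreal ((norm (v j z))\<^sup>2) \<partial>bnu \<alpha>) \<le> ennreal B"
    and lim: "\<And>z. norm z < 1 \<Longrightarrow> (\<lambda>j. v j z) \<longlonglongrightarrow> 0" and e: "e > 0"
  shows "\<forall>\<^sub>F j in sequentially. (\<integral>\<^sup>+ w. ennreal ((norm (T (v j) w))\<^sup>2) \<partial>bnu \<alpha>) \<le> ennreal e"
proof -
  note [measurable] = reproducedD(1)[OF v]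
  obtain C where C: "C \<ge> 0" "\<And>z :: complex ^ 'n. norm z < 1 \<Longrightarrow> schur_weight z \<le> ennreal C"
    "\<And>u. reproduced u \<Longrightarrow> (\<integral>\<^sup>+ w. ennreal ((norm (T u w))\<^sup>2) \<partial>bnu \<alpha>) \<le>
      ennreal C * (\<integral>\<^sup>+ z. ennreal ((norm (u z))\<^sup>2) * schur_weight z \<partial>bnu \<alpha>)"
    using T_L2_le by blast
  \<comment> \<open>The two parts of the split contribute C \<eta> B and C C \<delta>, each at most
    e/2; the summands 1 avoid division by 0.\<close>
  define \<eta> where "\<eta> = e / (2 * (C + 1) * (B + 1))"
  define \<delta> where "\<delta> = e / (2 * (C + 1) * (C + 1))"
  have \<eta>: "\<eta> > 0" and \<delta>: "\<delta> > 0" using e B(1) C(1) by (auto simp: \<eta>_def \<delta>_def)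
  have "C * (\<eta> * B) = e / 2 * (C / (C + 1) * (B / (B + 1)))" unfolding \<eta>_def times_divide_times_eq times_divide_eq_left times_divide_eq_right by (simp only: divide_divide_eq_left mult_ac)
  also have "\<dots> \<le> e / 2 * (1 * 1)" using e B(1) C(1) by (intro mult_left_mono mult_mono) auto
  finally have 1: "C * (\<eta> * B) \<le> e / 2" by simp
  have "C * (C * \<delta>) = e / 2 * (C / (C + 1) * (C / (C + 1)))" unfolding \<delta>_def times_divide_times_eq times_divide_eq_left times_divide_eq_right by (simp only: divide_divide_eq_left mult_ac)
  also have "\<dots> \<le> e / 2 * (1 * 1)" using e C(1) by (intro mult_left_mono mult_mono) auto
  finally have 2: "C * (C * \<delta>) \<le> e / 2" by simp
  obtain r0 where r0: "r0 < 1" "\<And>z :: complex ^ 'n. r0 < norm z \<Longrightarrow> norm z < 1 \<Longrightarrow> schur_weight z \<le> ennreal \<eta>"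
    using schur_weight_small[OF small \<eta>] by blast
  obtain L where L: "L \<ge> 0" "\<And>u z. reproduced u \<Longrightarrow> (\<integral>\<^sup>+ z. ennreal ((norm (u z))\<^sup>2) \<partial>bnu \<alpha>) \<le> ennreal B \<Longrightarrow> norm z \<le> r0 \<Longrightarrow> norm (u z) \<le> L"
    using reproduced_local_bound[OF B(1) r0(1)] by blast
  define g where "g = (\<lambda>j z. ennreal ((norm (v j z))\<^sup>2) * indicator (cball 0 r0) z)"
  have [measurable]: "g j \<in> borel_measurable borel" for j
    unfolding g_def by (intro borel_measurable_times_ennreal borel_measurable_indicator) auto
  have "(\<lambda>j. \<integral>\<^sup>+ z. g j z \<partial>bnu \<alpha>) \<longlonglongrightarrow> (\<integral>\<^sup>+ z. 0 \<partial>(bnu \<alpha> :: (complex ^ 'n) measure))"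
  proof (rule nn_integral_dominated_convergence[where w = "\<lambda>_. ennreal (L\<^sup>2)"])
    show "AE z in bnu \<alpha>. g j z \<le> ennreal (L\<^sup>2)" for j
    proof (rule AE_I2)
      fix z
      have "norm z \<le> r0 \<Longrightarrow> (norm (v j z))\<^sup>2 \<le> L\<^sup>2" using L(2)[OF v B(2)] by (intro power_mono) auto
      then show "g j z \<le> ennreal (L\<^sup>2)" by (auto simp: g_def indicator_def ennreal_leI)
    qed
    show "(\<integral>\<^sup>+ z. ennreal (L\<^sup>2) \<partial>(bnu \<alpha> :: (complex ^ 'n) measure)) < \<infinity>" by (simp add: emeasure_bnu_UNIV[OF \<alpha>])
    show "AE z in bnu \<alpha>. (\<lambda>j. g j z) \<longlonglongrightarrow> 0"
    proof (rule AE_I2)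
      fix z :: "complex ^ 'n"
      show "(\<lambda>j. g j z) \<longlonglongrightarrow> 0"
      proof (cases "norm z \<le> r0")
        case True
        then have "(\<lambda>j. (norm (v j z))\<^sup>2) \<longlonglongrightarrow> 0"
          using lim[of z] r0(1) tendsto_power[OF tendsto_norm[of "\<lambda>j. v j z" 0], of sequentially 2] by simp
        then have "(\<lambda>j. ennreal ((norm (v j z))\<^sup>2)) \<longlonglongrightarrow> ennreal 0" by (rule tendsto_ennrealI)
        then show ?thesis using True by (simp add: g_def)
      qed (simp add: g_def)
    qed
  qed auto
  then have "\<forall>\<^sub>F j in sequentially. (\<integral>\<^sup>+ z. g j z \<partial>bnu \<alpha>) < ennreal \<delta>"
    by (rule order_tendstoD(2)) (use \<delta> in simp)
  then show ?thesis
  proof eventually_elim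
    case (elim j)
    have "(\<integral>\<^sup>+ z. ennreal ((norm (v j z))\<^sup>2) * schur_weight z \<partial>bnu \<alpha>) \<le>
        (\<integral>\<^sup>+ z. ennreal \<eta> * ennreal ((norm (v j z))\<^sup>2) + ennreal C * g j z \<partial>bnu \<alpha>)"
    proof (rule nn_integral_mono_AE, use AE_bnu_ball in eventually_elim)
      fix z :: "complex ^ 'n" assume "z \<in> ball 0 1"
      then have z: "norm z < 1" by simp
      show "ennreal ((norm (v j z))\<^sup>2) * schur_weight z \<le> ennreal \<eta> * ennreal ((norm (v j z))\<^sup>2) + ennreal C * g j z"
      proof (cases "norm z \<le> r0")
        case True
        have "ennreal ((norm (v j z))\<^sup>2) * schur_weight z \<le> ennreal ((norm (v j z))\<^sup>2) * ennreal C"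
          by (intro mult_left_mono C(2) z) simp
        also have "\<dots> \<le> ennreal \<eta> * ennreal ((norm (v j z))\<^sup>2) + ennreal C * g j z"
          using True by (simp add: g_def mult.commute)
        finally show ?thesis .
      next
        case False
        then have "ennreal ((norm (v j z))\<^sup>2) * schur_weight z \<le> ennreal ((norm (v j z))\<^sup>2) * ennreal \<eta>"
          by (intro mult_left_mono r0(2) z) auto
        then show ?thesis using False by (simp add: g_def mult.commute)
      qed
    qed
    also have "\<dots> = ennreal \<eta> * (\<integral>\<^sup>+ z. ennreal ((norm (v j z))\<^sup>2) \<partial>bnu \<alpha>) + ennreal C * (\<integral>\<^sup>+ z. g j z \<partial>bnu \<alpha>)"
      by (simp add: nn_integral_add nn_integral_cmult)
    also have "\<dots> \<le> ennreal \<eta> * ennreal B + ennreal C * ennreal \<delta>"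
      using elim by (intro add_mono mult_left_mono B) auto
    also have "\<dots> = ennreal (\<eta> * B + C * \<delta>)"
      using \<eta> \<delta> B(1) C(1) by (simp add: ennreal_plus ennreal_mult)
    finally have "ennreal C * (\<integral>\<^sup>+ z. ennreal ((norm (v j z))\<^sup>2) * schur_weight z \<partial>bnu \<alpha>) \<le> ennreal C * ennreal (\<eta> * B + C * \<delta>)"
      by (rule mult_left_mono) simp
    also have "\<dots> = ennreal (C * (\<eta> * B) + C * (C * \<delta>))"
      using \<eta> \<delta> B(1) C(1) by (simp add: distrib_left flip: ennreal_mult)
    also have "\<dots> \<le> ennreal e" using 1 2 by (intro ennreal_leI) simp
    finally show ?case using C(3)[OF v[of j]] by (rule order_trans[rotated])
  qed
qed

text \<open>Fatou's lemma gives the norm bound. An L^2 bound upgrades pointwise convergence to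
  convergence in L^1, which suffices for the reproducing formula since the kernel is bounded for
  fixed w.\<close>

lemma reproduced_limit:
  fixes u :: "nat \<Rightarrow> complex ^ 'n \<Rightarrow> ell2"
  assumes u: "\<And>j. reproduced (u j)" and B: "\<And>j. (\<integral>\<^sup>+ z. ennreal ((norm (u j z))\<^sup>2) \<partial>bnu \<alpha>) \<le> ennreal B"
    and lim: "\<And>z. norm z < 1 \<Longrightarrow> (\<lambda>j. u j z) \<longlonglongrightarrow> g z" and [measurable]: "g \<in> borel_measurable borel"
  shows "(\<integral>\<^sup>+ z. ennreal ((norm (g z))\<^sup>2) \<partial>bnu \<alpha>) \<le> ennreal B" "reproduced g"
proof -
  note [measurable] = reproducedD(1)[OF u]
  have "(\<integral>\<^sup>+ z. ennreal ((norm (g z))\<^sup>2) \<partial>bnu \<alpha>) = (\<integral>\<^sup>+ z. liminf (\<lambda>j. ennreal ((norm (u j z))\<^sup>2)) \<partial>bnu \<alpha>)"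
  proof (rule nn_integral_cong_AE, use AE_bnu_ball in eventually_elim)
    fix z :: "complex ^ 'n" assume "z \<in> ball 0 1"
    then have "(\<lambda>j. ennreal ((norm (u j z))\<^sup>2)) \<longlonglongrightarrow> ennreal ((norm (g z))\<^sup>2)"
      by (intro tendsto_ennrealI tendsto_power tendsto_norm lim) simp
    then show "ennreal ((norm (g z))\<^sup>2) = liminf (\<lambda>j. ennreal ((norm (u j z))\<^sup>2))"
      by (metis lim_imp_Liminf sequentially_bot)
  qed
  also have "\<dots> \<le> liminf (\<lambda>j. \<integral>\<^sup>+ z. ennreal ((norm (u j z))\<^sup>2) \<partial>bnu \<alpha>)"
    by (rule nn_integral_liminf) measurable
  also have "\<dots> \<le> ennreal B"
    using B by (intro Liminf_le) auto
  finally show gB: "(\<integral>\<^sup>+ z. ennreal ((norm (g z))\<^sup>2) \<partial>bnu \<alpha>) \<le> ennreal B" .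
  have gi: "integrable (bnu \<alpha>) g"
  proof (rule integrableI_bounded)
    have "(\<integral>\<^sup>+ z. ennreal (norm (g z)) \<partial>bnu \<alpha>) \<le> 1 + ennreal B"
      by (rule order_trans[OF nn_integral_norm_le add_left_mono[OF gB]]) measurable
    then show "(\<integral>\<^sup>+ z. ennreal (norm (g z)) \<partial>bnu \<alpha>) < \<infinity>" by (rule le_less_trans) (simp add: ennreal_add_less_top)
  qed simp
  have dB: "(\<integral>\<^sup>+ z. ennreal ((norm (u j z - g z))\<^sup>2) \<partial>bnu \<alpha>) \<le> ennreal (4 * \<bar>B\<bar>)" for j
  proof -
    have "(\<integral>\<^sup>+ z. ennreal ((norm (u j z - g z))\<^sup>2) \<partial>bnu \<alpha>) \<le>
        (\<integral>\<^sup>+ z. 2 * ennreal ((norm (u j z))\<^sup>2) + 2 * ennreal ((norm (g z))\<^sup>2) \<partial>bnu \<alpha>)"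
    proof (rule nn_integral_mono)
      fix z
      have "(norm (u j z - g z))\<^sup>2 \<le> (norm (u j z) + norm (g z))\<^sup>2" by (intro power_mono norm_triangle_ineq4) auto
      also have "\<dots> \<le> 2 * (norm (u j z))\<^sup>2 + 2 * (norm (g z))\<^sup>2"
        using sum_squares_bound[of "norm (u j z)" "norm (g z)"] by (simp add: power2_sum)
      finally have "ennreal ((norm (u j z - g z))\<^sup>2) \<le> ennreal (2 * (norm (u j z))\<^sup>2 + 2 * (norm (g z))\<^sup>2)" by (rule ennreal_leI)
      then show "ennreal ((norm (u j z - g z))\<^sup>2) \<le> 2 * ennreal ((norm (u j z))\<^sup>2) + 2 * ennreal ((norm (g z))\<^sup>2)"
        by (simp add: ennreal_plus ennreal_mult)
    qed
    also have "\<dots> = 2 * (\<integral>\<^sup>+ z. ennreal ((norm (u j z))\<^sup>2) \<partial>bnu \<alpha>) + 2 * (\<integral>\<^sup>+ z. ennreal ((norm (g z))\<^sup>2) \<partial>bnu \<alpha>)"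
      by (simp add: nn_integral_add nn_integral_cmult)
    also have "\<dots> \<le> 2 * ennreal \<bar>B\<bar> + 2 * ennreal \<bar>B\<bar>"
      by (intro add_mono mult_left_mono order_trans[OF B] order_trans[OF gB] ennreal_leI) auto
    also have "\<dots> = ennreal (4 * \<bar>B\<bar>)" by (simp add: ennreal_mult flip: distrib_right)
    finally show ?thesis .
  qed
  text \<open>Convergence in \<open>L\<^sup>1\<close>, from \<open>x \<le> min x K + x\<^sup>2 / K\<close>.\<close>
  have L1: "\<forall>\<^sub>F j in sequentially. (\<integral>\<^sup>+ z. ennreal (norm (u j z - g z)) \<partial>bnu \<alpha>) \<le> ennreal e" if e: "e > 0" for e
  proof -
    \<comment> \<open>The part above the truncation level is at most 4 \<bar>B\<bar> / K, hence at
      most e/2.\<close>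
    define K where "K = 2 * (4 * \<bar>B\<bar> + 1) / e"
    have K: "K > 0" using e by (simp add: K_def add_nonneg_pos)
    define m where "m = (\<lambda>j z. ennreal (min (norm (u j z - g z)) K))"
    have [measurable]: "m j \<in> borel_measurable borel" for j unfolding m_def by measurable
    have "(\<lambda>j. \<integral>\<^sup>+ z. m j z \<partial>bnu \<alpha>) \<longlonglongrightarrow> (\<integral>\<^sup>+ z. 0 \<partial>(bnu \<alpha> :: (complex ^ 'n) measure))"
    proof (rule nn_integral_dominated_convergence[where w = "\<lambda>_. ennreal K"])
      show "AE z in bnu \<alpha>. m j z \<le> ennreal K" for j by (simp add: m_def ennreal_leI)
      show "(\<integral>\<^sup>+ z. ennreal K \<partial>(bnu \<alpha> :: (complex ^ 'n) measure)) < \<infinity>" by (simp add: emeasure_bnu_UNIV[OF \<alpha>])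
      show "AE z in bnu \<alpha>. (\<lambda>j. m j z) \<longlonglongrightarrow> 0"
        using AE_bnu_ball
      proof eventually_elim
        case (elim z)
        then have "(\<lambda>j. min (norm (u j z - g z)) K) \<longlonglongrightarrow> min (norm (g z - g z)) K"
          by (intro tendsto_min tendsto_norm tendsto_diff lim tendsto_const) simp
        then have "(\<lambda>j. m j z) \<longlonglongrightarrow> ennreal (min (norm (g z - g z)) K)"
          unfolding m_def by (rule tendsto_ennrealI)
        then show ?case using K by simp
      qed
    qed auto
    then have "\<forall>\<^sub>F j in sequentially. (\<integral>\<^sup>+ z. m j z \<partial>bnu \<alpha>) < ennreal (e / 2)"
      by (rule order_tendstoD(2)) (use e in simp)
    then show ?thesis
    proof eventually_elim
      case (elim j)
      have "(\<integral>\<^sup>+ z. ennreal (norm (u j z - g z)) \<partial>bnu \<alpha>) \<le> (\<integral>\<^sup>+ z. m j z + ennreal (1 / K) * ennreal ((norm (u j z - g z))\<^sup>2) \<partial>bnu \<alpha>)"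
      proof (rule nn_integral_mono)
        fix z
        define x where "x = norm (u j z - g z)"
        have x: "x \<ge> 0" by (simp add: x_def)
        have "x \<le> min x K + 1 / K * x\<^sup>2"
        proof (cases "x \<le> K")
          case False
          then have "K * x \<le> x * x" using x by (intro mult_right_mono) auto
          then have "x \<le> 1 / K * x\<^sup>2" using K by (simp add: power2_eq_square field_simps)
          then show ?thesis using K False by simp
        qed (use K in simp)
        then have "ennreal x \<le> ennreal (min x K + 1 / K * x\<^sup>2)" by (rule ennreal_leI)
        then show "ennreal (norm (u j z - g z)) \<le> m j z + ennreal (1 / K) * ennreal ((norm (u j z - g z))\<^sup>2)"
          using K x by (simp add: m_def x_def[symmetric] ennreal_plus ennreal_mult[symmetric])
      qed
      also have "\<dots> = (\<integral>\<^sup>+ z. m j z \<partial>bnu \<alpha>) + ennreal (1 / K) * (\<integral>\<^sup>+ z. ennreal ((norm (u j z - g z))\<^sup>2) \<partial>bnu \<alpha>)"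
        by (simp add: nn_integral_add nn_integral_cmult)
      also have "\<dots> \<le> ennreal (e / 2) + ennreal (1 / K) * ennreal (4 * \<bar>B\<bar>)"
        using elim by (intro add_mono mult_left_mono dB) auto
      also have "\<dots> \<le> ennreal (e / 2) + ennreal (e / 2)"
      proof -
        have "1 / K * (4 * \<bar>B\<bar>) \<le> e / 2" using e by (simp add: K_def field_simps add_nonneg_pos)
        then show ?thesis using K by (intro add_left_mono) (simp add: ennreal_leI flip: ennreal_mult)
      qed
      also have "\<dots> = ennreal e" using e by (simp flip: ennreal_plus)
      finally show ?case .
    qed
  qed
  show "reproduced g"
    unfolding reproduced_def
  proof (intro conjI allI impI)
    show "(\<integral>\<^sup>+ z. ennreal ((norm (g z))\<^sup>2) \<partial>bnu \<alpha>) < \<infinity>" using gB by (rule le_less_trans) simp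
    fix w :: "complex ^ 'n" assume w: "norm w < 1"
    define c where "c = (1 - norm w) powr (- N)"
    have c: "c > 0" using w by (simp add: c_def)
    have "(\<lambda>j. u j w) \<longlonglongrightarrow> (\<integral>z. cnj (bergman_kernel \<alpha> w z) *\<^sub>C g z \<partial>bnu \<alpha>)"
    proof (rule metric_LIMSEQ_I)
      fix e :: real assume e: "e > 0"
      define e' where "e' = e / (2 * c)"
      have e': "e' > 0" using e c by (simp add: e'_def)
      obtain j0 where j0: "\<And>j. j \<ge> j0 \<Longrightarrow> (\<integral>\<^sup>+ z. ennreal (norm (u j z - g z)) \<partial>bnu \<alpha>) \<le> ennreal e'"
        using L1[OF e'] by (auto simp: eventually_sequentially)
      have "dist (u j w) (\<integral>z. cnj (bergman_kernel \<alpha> w z) *\<^sub>C g z \<partial>bnu \<alpha>) < e" if j: "j \<ge> j0" for j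
      proof -
        have di: "integrable (bnu \<alpha>) (\<lambda>z. u j z - g z)"
          using reproduced_integrable[OF u] gi by (rule Bochner_Integration.integrable_diff)
        have "u j w - (\<integral>z. cnj (bergman_kernel \<alpha> w z) *\<^sub>C g z \<partial>bnu \<alpha>) = (\<integral>z. cnj (bergman_kernel \<alpha> w z) *\<^sub>C (u j z - g z) \<partial>bnu \<alpha>)"
          unfolding reproducedD(3)[OF u w] bounded_bilinear.diff_right[OF bounded_bilinear_scaleC]
          by (intro Bochner_Integration.integral_diff[symmetric] integrable_kernel \<alpha> w gi reproduced_integrable u)
        then have "dist (u j w) (\<integral>z. cnj (bergman_kernel \<alpha> w z) *\<^sub>C g z \<partial>bnu \<alpha>) \<le> c * (\<integral>z. norm (u j z - g z) \<partial>bnu \<alpha>)"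
          unfolding dist_norm
          using norm_integral_scaleC_le[OF di, of "\<lambda>z. cnj (bergman_kernel \<alpha> w z)" c]
            kmod_le[OF \<alpha> order_refl w] by (simp add: cmod_bergman_kernel c_def N_def)
        also have "\<dots> \<le> c * e'"
        proof (intro mult_left_mono)
          have "ennreal (\<integral>z. norm (u j z - g z) \<partial>bnu \<alpha>) = (\<integral>\<^sup>+ z. ennreal (norm (u j z - g z)) \<partial>bnu \<alpha>)"
            using di by (intro nn_integral_eq_integral[symmetric]) auto
          also have "\<dots> \<le> ennreal e'" by (rule j0[OF j])
          finally show "(\<integral>z. norm (u j z - g z) \<partial>bnu \<alpha>) \<le> e'" using e' by (simp add: ennreal_le_iff)
        qed (use c in simp)
        also have "\<dots> < e" using c e by (simp add: e'_def)
        finally show ?thesis .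
      qed
      then show "\<exists>j0. \<forall>j\<ge>j0. dist (u j w) (\<integral>z. cnj (bergman_kernel \<alpha> w z) *\<^sub>C g z \<partial>bnu \<alpha>) < e" by blast
    qed
    then show "g w = (\<integral>z. cnj (bergman_kernel \<alpha> w z) *\<^sub>C g z \<partial>bnu \<alpha>)"
      using lim[OF w] LIMSEQ_unique by blast
  qed measurable
qed

end

section \<open>The diagonal operator\<close>

lemma cinner_add_left: "cinner_ell2 (x + y) z = cinner_ell2 x z + cinner_ell2 y z"
  unfolding cinner_ell2_def by (simp add: algebra_simps suminf_add[symmetric] summable_coord_mult)

lemma cinner_scaleC_left: "cinner_ell2 (c *\<^sub>C x) z = c * cinner_ell2 x z"
  unfolding cinner_ell2_def by (simp add: mult.assoc suminf_mult summable_coord_mult)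

lemma cmod_cinner_le: "cmod (cinner_ell2 x y) \<le> norm x * norm y"
proof (cases "cinner_ell2 x y = 0")
  case False
  define g where "g = cnj (sgn (cinner_ell2 x y))"
  have g: "cmod g = 1" using False by (simp add: g_def norm_sgn)
  have "g * cinner_ell2 x y = of_real (cmod (cinner_ell2 x y))"
    using False by (simp add: g_def sgn_eq complex_norm_square [symmetric] power2_eq_square field_simps)
  then have "cmod (cinner_ell2 x y) = inner (g *\<^sub>C x) y"
    by (simp add: inner_ell2_def cinner_scaleC_left)
  also have "\<dots> \<le> norm (g *\<^sub>C x) * norm y" by (rule norm_cauchy_schwarz)
  finally show ?thesis by (simp add: norm_scaleC g)
qed simp

locale diagonal_operator =
  fixes e :: "nat \<Rightarrow> ell2"
  assumes e: "orthonormal_basis e"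
begin

lemma norm_e: "i \<ge> 1 \<Longrightarrow> norm (e i) = 1"
proof -
  assume "i \<ge> 1"
  then have "cinner_ell2 (e i) (e i) = 1" using e by (simp add: orthonormal_basis_def)
  then show ?thesis by (simp add: norm_eq_sqrt_inner inner_ell2_def)
qed

text \<open>The basis starts at index 1, hence the shift. The powers of 1/2 dominate the series by a
  geometric one, which later allows the limit to be taken term by term.\<close>

definition D :: "ell2 \<Rightarrow> ell2" where
  "D x = (\<Sum>i. (1/2) ^ Suc i *\<^sub>R (cinner_ell2 x (e (Suc i)) *\<^sub>C e (Suc i)))"

lemma norm_D_term_le: "norm ((1/2) ^ Suc i *\<^sub>R (cinner_ell2 x (e (Suc i)) *\<^sub>C e (Suc i))) \<le> (1/2) ^ Suc i * norm x"
  using cmod_cinner_le[of x "e (Suc i)"] norm_e[of "Suc i"] by (simp add: norm_scaleC)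

lemma sums_half_norm: "(\<lambda>i. (1/2) ^ Suc i * norm (x :: ell2)) sums norm x"
proof -
  have "(\<lambda>i. (1/2 :: real) ^ i) sums (1 / (1 - 1/2))" by (rule geometric_sums) simp
  then have "(\<lambda>i. (1/2 * norm x) * (1/2 :: real) ^ i) sums ((1/2 * norm x) * 2)" by (intro sums_mult) simp
  then show ?thesis by (simp add: mult_ac)
qed

lemma summable_D_norm: "summable (\<lambda>i. norm ((1/2) ^ Suc i *\<^sub>R (cinner_ell2 x (e (Suc i)) *\<^sub>C e (Suc i))))"
  by (rule summable_comparison_test'[OF sums_summable[OF sums_half_norm[of x]]]) (use norm_D_term_le in simp)

lemma D_sums: "(\<lambda>i. (1/2) ^ Suc i *\<^sub>R (cinner_ell2 x (e (Suc i)) *\<^sub>C e (Suc i))) sums D x"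
  unfolding D_def by (rule summable_sums[OF summable_norm_cancel[OF summable_D_norm]])

lemma norm_D_le: "norm (D x) \<le> norm x"
proof -
  have "norm (D x) \<le> (\<Sum>i. norm ((1/2) ^ Suc i *\<^sub>R (cinner_ell2 x (e (Suc i)) *\<^sub>C e (Suc i))))"
    unfolding D_def by (rule summable_norm[OF summable_D_norm])
  also have "\<dots> \<le> (\<Sum>i. (1/2) ^ Suc i * norm x)"
    by (intro suminf_le norm_D_term_le summable_D_norm sums_summable[OF sums_half_norm])
  finally show ?thesis using sums_unique[OF sums_half_norm[of x]] by simp
qed

lemma bounded_linear_D: "bounded_linear D"
proof (rule bounded_linear_intro[where K = 1])
  show "D (x + y) = D x + D y" for x y
    by (rule sums_unique2[OF D_sums]) (use sums_add[OF D_sums[of x] D_sums[of y]] in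
      \<open>simp add: cinner_add_left scaleC_add_left scaleR_add_right\<close>)
  show "D (c *\<^sub>R x) = c *\<^sub>R D x" for c x
    by (rule sums_unique2[OF D_sums]) (use sums_scaleR_right[OF D_sums[of x], of c] in
      \<open>simp add: scaleR_eq_scaleC cinner_scaleC_left mult_ac\<close>)
  show "norm (D x) \<le> norm x * 1" for x using norm_D_le by simp
qed

lemma D_scaleC: "D (c *\<^sub>C x) = c *\<^sub>C D x"
  by (rule sums_unique2[OF D_sums]) (use bounded_linear.sums[OF bounded_linear_scaleC_right[of c] D_sums[of x]] in
    \<open>simp add: scaleR_eq_scaleC cinner_scaleC_left mult_ac\<close>)

text \<open>A bounded operator is applied to the basis expansion term by term, and complex
  homogeneity extracts the coefficients. The unordered sum over the indices from 1 is reindexed to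
  an ordinary series.\<close>

lemma diagonal_eq_D:
  assumes B: "complex_homogeneous B" and Be: "\<And>i. i \<ge> 1 \<Longrightarrow> blinfun_apply B (e i) = (t / 2 ^ i) *\<^sub>C e i"
  shows "blinfun_apply B x = t *\<^sub>C D x"
proof -
  have "((\<lambda>j. cinner_ell2 x (e j) *\<^sub>C e j) has_sum x) {1..}" using e by (simp add: orthonormal_basis_def)
  then have "((\<lambda>j. blinfun_apply B (cinner_ell2 x (e j) *\<^sub>C e j)) has_sum blinfun_apply B x) {1..}"
    by (rule has_sum_bounded_linear[OF blinfun.bounded_linear_right])
  moreover have "bij_betw Suc UNIV {1..}"
    by (rule bij_betwI[where g = "\<lambda>n. n - 1"]) auto
  ultimately have "((\<lambda>i. blinfun_apply B (cinner_ell2 x (e (Suc i)) *\<^sub>C e (Suc i))) has_sum blinfun_apply B x) UNIV"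
    using has_sum_reindex_bij_betw[of Suc UNIV "{1..}" "\<lambda>j. blinfun_apply B (cinner_ell2 x (e j) *\<^sub>C e j)"] by simp
  then have 1: "(\<lambda>i. blinfun_apply B (cinner_ell2 x (e (Suc i)) *\<^sub>C e (Suc i))) sums blinfun_apply B x"
    by (rule has_sum_imp_sums)
  have "blinfun_apply B (cinner_ell2 x (e (Suc i)) *\<^sub>C e (Suc i)) = t *\<^sub>C ((1/2) ^ Suc i *\<^sub>R (cinner_ell2 x (e (Suc i)) *\<^sub>C e (Suc i)))" for i
    using B Be[of "Suc i"] by (simp add: complex_homogeneous_def scaleR_eq_scaleC power_divide mult_ac)
  with 1 have "(\<lambda>i. t *\<^sub>C ((1/2) ^ Suc i *\<^sub>R (cinner_ell2 x (e (Suc i)) *\<^sub>C e (Suc i)))) sums blinfun_apply B x"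
    by (simp only:)
  moreover have "(\<lambda>i. t *\<^sub>C ((1/2) ^ Suc i *\<^sub>R (cinner_ell2 x (e (Suc i)) *\<^sub>C e (Suc i)))) sums (t *\<^sub>C D x)"
    by (rule bounded_linear.sums[OF bounded_linear_scaleC_right D_sums])
  ultimately show ?thesis by (rule sums_unique2)
qed

text \<open>Dominated convergence for series.\<close>

lemma D_convergent:
  fixes x :: "nat \<Rightarrow> ell2"
  assumes bound: "\<And>n. norm (x n) \<le> L" and conv: "\<And>i. i \<ge> 1 \<Longrightarrow> \<exists>l. (\<lambda>n. cinner_ell2 (x n) (e i)) \<longlonglongrightarrow> l"
  shows "convergent (\<lambda>n. D (x n))"
proof -
  obtain l where l: "\<And>i. (\<lambda>n. cinner_ell2 (x n) (e (Suc i))) \<longlonglongrightarrow> l i"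
    using conv by (metis le_add1 plus_1_eq_Suc)
  define a where "a = (\<lambda>n i. (1/2 :: real) ^ Suc i *\<^sub>R (cinner_ell2 (x n) (e (Suc i)) *\<^sub>C e (Suc i)))"
  define c where "c = (\<lambda>i. (1/2 :: real) ^ Suc i *\<^sub>R (l i *\<^sub>C e (Suc i)))"
  have L: "L \<ge> 0" using bound[of 0] norm_ge_zero order_trans by blast
  have w: "integrable (count_space UNIV) (\<lambda>i. (1/2 :: real) ^ Suc i * L)"
    using L unfolding integrable_count_space_nat_iff
    by (auto intro!: summable_mult2 simp: summable_geometric)
  have "norm (a n i) \<le> (1/2) ^ Suc i * L" for n i
    unfolding a_def by (rule order_trans[OF norm_D_term_le mult_left_mono[OF bound]]) simp
  moreover have "(\<lambda>n. a n i) \<longlonglongrightarrow> c i" for i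
    unfolding a_def c_def
    by (intro tendsto_scaleR tendsto_const bounded_bilinear.tendsto[OF bounded_bilinear_scaleC] l)
  ultimately have "(\<lambda>n. \<integral>i. a n i \<partial>count_space UNIV) \<longlonglongrightarrow> (\<integral>i. c i \<partial>count_space UNIV)"
    by (intro integral_dominated_convergence[OF _ _ w]) auto
  moreover have "(\<integral>i. a n i \<partial>count_space UNIV) = D (x n)" for n
    unfolding D_def a_def using summable_D_norm[of "x n"]
    by (intro integral_count_space_nat) (simp add: integrable_count_space_nat_iff)
  ultimately show ?thesis by (auto simp: convergent_def)
qed

end

section \<open>Symbols of bounded mean oscillation\<close>

lemma AE_nu_of_bnu:
  fixes P :: "complex ^ 'n \<Rightarrow> bool"
  assumes \<alpha>: "\<alpha> > -1" and P: "AE w in bnu \<alpha>. P w"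
  shows "AE w in nu \<alpha>. P w"
  unfolding AE_nu_iff[OF \<alpha>]
proof (rule AE_completion)
  have "AE w in lborel. 0 < ennreal (bweight TYPE('n) \<alpha> w) \<longrightarrow> P w"
    using P unfolding bnu_def by (subst (asm) AE_density) auto
  then show "AE w in lborel. w \<in> ball 0 1 \<longrightarrow> P w"
  proof eventually_elim
    case (elim w)
    then show ?case using c_const_pos[OF \<alpha>, where 'n = 'n] by (auto simp: bweight_def abs_square_eq_1)
  qed
qed

lemma emeasure_bnu_null:
  assumes "Z \<in> null_sets lborel"
  shows "emeasure (bnu \<alpha>) Z = 0"
  using absolutely_continuousI_density[of "\<lambda>z. ennreal (bweight TYPE('a) \<alpha> z)" lborel] assms
  unfolding bnu_def absolutely_continuous_def by (auto simp: null_sets_def)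

lemma AE_nu_not_null:
  assumes \<alpha>: "\<alpha> > -1" and Z: "Z \<in> null_sets lborel"
  shows "AE w in nu \<alpha>. w \<notin> Z"
proof (rule AE_nu_of_bnu[OF \<alpha>])
  have "Z \<in> null_sets (bnu \<alpha>)" using emeasure_bnu_null[OF Z, of \<alpha>] Z by (auto simp: null_sets_def)
  then show "AE w in bnu \<alpha>. w \<notin> Z" by (rule AE_not_in)
qed

text \<open>Since the density of the substitution is positive, automorphisms pull null sets back to
  null sets. Thus a change of the symbol on a null set does not affect its mean
  oscillations.\<close>

lemma AE_nu_mobius_not_null:
  assumes \<alpha>: "\<alpha> > -1" and Z: "Z \<in> null_sets lborel" and z: "norm z < 1"
  shows "AE w in nu \<alpha>. mobius z w \<notin> Z"
proof (rule AE_nu_of_bnu[OF \<alpha>])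
  have [measurable]: "Z \<in> sets borel" using Z by (auto simp: null_sets_def)
  have "(\<integral>\<^sup>+ w. ennreal (mobius_density \<alpha> z w) * indicator Z (mobius z w) \<partial>bnu \<alpha>) = (\<integral>\<^sup>+ w. indicator Z w \<partial>bnu \<alpha>)"
    by (rule nn_integral_bnu_mobius[OF \<alpha> z]) measurable
  also have "\<dots> = 0" using emeasure_bnu_null[OF Z] by simp
  finally have "AE w in bnu \<alpha>. ennreal (mobius_density \<alpha> z w) * indicator Z (mobius z w) = 0"
    by (subst (asm) nn_integral_0_iff_AE) auto
  then show "AE w in bnu \<alpha>. mobius z w \<notin> Z"
    using AE_bnu_ball
  proof eventually_elim
    case (elim w)
    then have "norm w < 1" by simp
    then have "mobius_density \<alpha> z w > 0"
      using z one_minus_cdot_bounds(5)[of w z] by (auto simp: mobius_density_def abs_square_eq_1)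
    then show ?case using elim by (auto simp: indicator_def split: if_splits)
  qed
qed

text \<open>The symbol is measurable for the completed measure, whereas compositions with
  automorphisms and Fubini are handled for Borel functions. The exceptional set is taken Borel, so
  that its preimages are measurable too.\<close>

lemma borel_representative:
  fixes \<tau> :: "complex ^ 'n \<Rightarrow> complex"
  assumes "\<tau> \<in> borel_measurable (nu \<alpha>)"
  obtains \<tau>' Z where "\<tau>' \<in> borel_measurable borel" "Z \<in> null_sets lborel"
    "\<And>w. norm w < 1 \<Longrightarrow> w \<notin> Z \<Longrightarrow> \<tau> w = \<tau>' w"
proof -
  define f where "f = (\<lambda>w. indicator (ball 0 1) w *\<^sub>R \<tau> w)"
  have "\<tau> \<in> borel_measurable (lebesgue_on (ball 0 1))"
    using assms measurable_cong_sets[OF sets_nu refl] by blast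
  then have [measurable]: "f \<in> borel_measurable lebesgue"
    unfolding f_def by (subst (asm) borel_measurable_restrict_space_iff) auto
  obtain g h where gh: "g \<in> borel_measurable lborel" "AE w in lborel. Re (f w) = g w"
      "h \<in> borel_measurable lborel" "AE w in lborel. Im (f w) = h w"
    using completion_ex_borel_measurable_real[of "\<lambda>w. Re (f w)" lborel]
      completion_ex_borel_measurable_real[of "\<lambda>w. Im (f w)" lborel] by auto
  have "AE w in lborel. Re (f w) = g w \<and> Im (f w) = h w" using gh(2,4) by eventually_elim simp
  then obtain Z where Z: "{w \<in> space lborel. \<not> (Re (f w) = g w \<and> Im (f w) = h w)} \<subseteq> Z" "Z \<in> null_sets lborel"
    unfolding eventually_ae_filter by blast
  show ?thesis
  proof (rule that[OF _ Z(2)])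
    show "(\<lambda>w. of_real (g w) + \<i> * of_real (h w)) \<in> borel_measurable borel"
      using gh(1,3) by simp
    show "\<tau> w = of_real (g w) + \<i> * of_real (h w)" if "norm w < 1" "w \<notin> Z" for w
    proof -
      have "Re (f w) = g w \<and> Im (f w) = h w" using Z(1) that(2) by auto
      then show ?thesis using that(1) by (simp add: f_def complex_eq_iff)
    qed
  qed
qed

context carleson_symbol
begin

lemma H_diagonal:
  fixes w :: "complex ^ 'n"
  assumes w: "norm w < 1"
  shows "(\<integral>u. mobius_density \<alpha> w u *\<^sub>R \<tau> u \<partial>bnu \<alpha>) = of_real ((1 - (norm w)\<^sup>2) powr N) * H w w"
proof -
  have s: "1 - (norm w)\<^sup>2 > 0" using w by (simp add: abs_square_less_1)
  have "mobius_density \<alpha> w u *\<^sub>R \<tau> u = of_real ((1 - (norm w)\<^sup>2) powr N) * (\<tau> u * bergman_kernel \<alpha> w u * cnj (bergman_kernel \<alpha> w u))" for u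
  proof -
    have "(kmod \<alpha> w u)\<^sup>2 = mobius_density \<alpha> w u * (1 - (norm w)\<^sup>2) powr (- N)"
      unfolding kmod_sq[OF w] by (simp add: power_mult_distrib power2_eq_square[of "_ powr _"] flip: powr_add)
    then have "mobius_density \<alpha> w u = (1 - (norm w)\<^sup>2) powr N * (kmod \<alpha> w u)\<^sup>2"
      using s by (simp add: powr_minus field_simps)
    moreover have "bergman_kernel \<alpha> w u * cnj (bergman_kernel \<alpha> w u) = of_real ((kmod \<alpha> w u)\<^sup>2)"
      by (simp only: complex_norm_square cmod_bergman_kernel[symmetric])
    ultimately show ?thesis by (simp add: scaleR_conv_of_real mult_ac)
  qed
  then show ?thesis unfolding H_def by simp
qed

lemma T_L2_finite:
  assumes u: "reproduced u"
  shows "(\<integral>\<^sup>+ w. ennreal ((norm (T u w))\<^sup>2) \<partial>bnu \<alpha>) < \<infinity>"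
proof -
  note [measurable] = reproducedD(1)[OF u]
  obtain C where C: "C \<ge> 0" "\<And>z :: complex ^ 'n. norm z < 1 \<Longrightarrow> schur_weight z \<le> ennreal C"
    "\<And>u. reproduced u \<Longrightarrow> (\<integral>\<^sup>+ w. ennreal ((norm (T u w))\<^sup>2) \<partial>bnu \<alpha>) \<le>
      ennreal C * (\<integral>\<^sup>+ z. ennreal ((norm (u z))\<^sup>2) * schur_weight z \<partial>bnu \<alpha>)"
    using T_L2_le by blast
  have "(\<integral>\<^sup>+ z. ennreal ((norm (u z))\<^sup>2) * schur_weight z \<partial>bnu \<alpha>) \<le> (\<integral>\<^sup>+ z. ennreal ((norm (u z))\<^sup>2) * ennreal C \<partial>bnu \<alpha>)"
    by (rule nn_integral_mono_AE, use AE_bnu_ball in eventually_elim) (auto intro!: mult_left_mono C)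
  also have "\<dots> < \<infinity>" using reproducedD(2)[OF u] by (simp add: nn_integral_multc ennreal_mult_less_top)
  finally show ?thesis
    by (intro le_less_trans[OF C(3)[OF u]]) (simp add: ennreal_mult_less_top)
qed

end

lemma eventually_filtercomap_norm_at_left:
  fixes P :: "complex ^ 'n \<Rightarrow> bool"
  assumes "eventually P (filtercomap norm (at_left 1))"
  obtains r :: real where "r < 1" "\<And>w. r < norm w \<Longrightarrow> norm w < 1 \<Longrightarrow> P w"
proof -
  obtain Q where Q: "eventually Q (at_left (1::real))" "\<And>w :: complex ^ 'n. Q (norm w) \<Longrightarrow> P w"
    using assms by (auto simp: eventually_filtercomap)
  obtain r where "r < 1" "\<And>y. r < y \<Longrightarrow> y < 1 \<Longrightarrow> Q y"
    using Q(1) eventually_at_left[of 0 "1::real" Q] by auto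
  then show ?thesis using Q(2) that by blast
qed

text \<open>For z near the sphere the average of the modulus of \<tau> \<circ>
  \<open>mobius z\<close> is at most the oscillation plus the modulus of the Berezin transform,
  which is at most 1 there. For the remaining z the density is bounded and integrability of \<tau>
  suffices.\<close>

lemma carleson_of_BMO1:
  fixes \<tau> \<tau>' :: "complex ^ 'n \<Rightarrow> complex"
  assumes \<alpha>: "\<alpha> > -1" and \<tau>: "\<tau> \<in> BMO1 \<alpha>" and lim: "(berezin \<alpha> \<tau> \<longlongrightarrow> 0) (filtercomap norm (at_left 1))"
    and [measurable]: "\<tau>' \<in> borel_measurable borel" and Z: "Z \<in> null_sets lborel"
    and eq: "\<And>w. norm w < 1 \<Longrightarrow> w \<notin> Z \<Longrightarrow> \<tau> w = \<tau>' w"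
  obtains M where "carleson_symbol \<alpha> (real CARD('n) + 1 + \<alpha>) M \<tau>'"
    "\<And>e. e > 0 \<Longrightarrow> \<exists>\<rho><1. \<forall>w :: complex ^ 'n. \<rho> < norm w \<longrightarrow> norm w < 1 \<longrightarrow>
       (1 - (norm w)\<^sup>2) powr (real CARD('n) + 1 + \<alpha>) * cmod (carleson_symbol.H \<alpha> \<tau>' w w) \<le> e"
proof -
  define N where "N = real CARD('n) + 1 + \<alpha>"
  have \<tau>m: "\<tau> \<in> borel_measurable (nu \<alpha>)" and \<tau>1: "Lp_power \<alpha> 1 \<tau> < \<infinity>"
    and \<tau>S: "(SUP z\<in>ball 0 1. Lp_power \<alpha> 1 (\<lambda>w. \<tau> (mobius z w) - berezin \<alpha> \<tau> z)) < \<infinity>"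
    using \<tau> by (auto simp: BMO1_def Lp_def)
  have ball: "AE w in nu \<alpha>. norm w < 1" by (rule AE_I2) (simp add: space_nu)
  have ber: "berezin \<alpha> \<tau> z = (\<integral>w. mobius_density \<alpha> z w *\<^sub>R \<tau>' w \<partial>bnu \<alpha>)" if z: "norm z < 1" for z
  proof -
    have "berezin \<alpha> \<tau> z = (\<integral>w. mobius_density \<alpha> z w *\<^sub>R \<tau>' w \<partial>nu \<alpha>)"
      unfolding berezin_def
    proof (rule integral_cong_AE)
      have "(\<lambda>w. (cmod (normalized_kernel \<alpha> z w))\<^sup>2) \<in> borel_measurable (nu \<alpha>)"
        unfolding normalized_kernel_def by (rule measurable_nu_borel) measurable
      then show "(\<lambda>w. (cmod (normalized_kernel \<alpha> z w))\<^sup>2 *\<^sub>R \<tau> w) \<in> borel_measurable (nu \<alpha>)"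
        using \<tau>m by (rule borel_measurable_scaleR)
      show "(\<lambda>w. mobius_density \<alpha> z w *\<^sub>R \<tau>' w) \<in> borel_measurable (nu \<alpha>)"
        by (rule measurable_nu_borel) measurable
      show "AE w in nu \<alpha>. (cmod (normalized_kernel \<alpha> z w))\<^sup>2 *\<^sub>R \<tau> w = mobius_density \<alpha> z w *\<^sub>R \<tau>' w"
        using ball AE_nu_not_null[OF \<alpha> Z] by eventually_elim (simp add: normalized_kernel_sq[OF z] eq)
    qed
    also have "\<dots> = (\<integral>w. mobius_density \<alpha> z w *\<^sub>R \<tau>' w \<partial>bnu \<alpha>)"
      by (rule integral_nu[OF \<alpha>]) measurable
    finally show ?thesis .
  qed
  have osc: "Lp_power \<alpha> 1 (\<lambda>w. \<tau> (mobius z w) - c) = (\<integral>\<^sup>+ w. ennreal (cmod (\<tau>' (mobius z w) - c)) \<partial>bnu \<alpha>)"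
    if z: "norm z < 1" for z c
  proof -
    have "Lp_power \<alpha> 1 (\<lambda>w. \<tau> (mobius z w) - c) = (\<integral>\<^sup>+ w. ennreal (cmod (\<tau>' (mobius z w) - c)) \<partial>nu \<alpha>)"
      unfolding Lp_power_def
      by (rule nn_integral_cong_AE, use ball AE_nu_mobius_not_null[OF \<alpha> Z z] in eventually_elim)
         (simp add: eq norm_mobius_less[OF z])
    then show ?thesis by (simp add: nn_integral_nu)
  qed
  have tot: "Lp_power \<alpha> 1 \<tau> = (\<integral>\<^sup>+ w. ennreal (cmod (\<tau>' w)) \<partial>bnu \<alpha>)"
  proof -
    have "Lp_power \<alpha> 1 \<tau> = (\<integral>\<^sup>+ w. ennreal (cmod (\<tau>' w)) \<partial>nu \<alpha>)"
      unfolding Lp_power_def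
      by (rule nn_integral_cong_AE, use ball AE_nu_not_null[OF \<alpha> Z] in eventually_elim) (simp add: eq)
    then show ?thesis by (simp add: nn_integral_nu)
  qed
  have small: "\<exists>\<rho><1. \<forall>w :: complex ^ 'n. \<rho> < norm w \<longrightarrow> norm w < 1 \<longrightarrow> cmod (berezin \<alpha> \<tau> w) \<le> e" if "e > 0" for e
  proof -
    have "eventually (\<lambda>w. dist (berezin \<alpha> \<tau> w) 0 < e) (filtercomap norm (at_left 1))"
      using lim that by (rule tendstoD)
    from eventually_filtercomap_norm_at_left[OF this] show ?thesis by (metis dist_0_norm dist_commute less_imp_le)
  qed
  obtain r0 where r0: "r0 < 1" "\<And>w :: complex ^ 'n. r0 < norm w \<Longrightarrow> norm w < 1 \<Longrightarrow> cmod (berezin \<alpha> \<tau> w) \<le> 1"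
    using small[of 1] by auto
  define r1 where "r1 = max r0 0"
  have r1: "0 \<le> r1" "r1 < 1" using r0(1) by (auto simp: r1_def)
  define I where "I = enn2real (Lp_power \<alpha> 1 \<tau>)"
  have I: "(\<integral>\<^sup>+ w. ennreal (cmod (\<tau>' w)) \<partial>bnu \<alpha>) = ennreal I" using \<tau>1 by (simp add: tot I_def)
  define S where "S = enn2real (SUP z\<in>ball 0 1. Lp_power \<alpha> 1 (\<lambda>w. \<tau> (mobius z w) - berezin \<alpha> \<tau> z))"
  have S: "(\<integral>\<^sup>+ w. ennreal (cmod (\<tau>' (mobius z w) - berezin \<alpha> \<tau> z)) \<partial>bnu \<alpha>) \<le> ennreal S" if "norm z < 1" for z
  proof -
    have "Lp_power \<alpha> 1 (\<lambda>w. \<tau> (mobius z w) - berezin \<alpha> \<tau> z) \<le> (SUP z\<in>ball 0 1. Lp_power \<alpha> 1 (\<lambda>w. \<tau> (mobius z w) - berezin \<alpha> \<tau> z))"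
      using that by (intro SUP_upper) simp
    then show ?thesis using \<tau>S by (simp add: S_def osc[OF that])
  qed
  have IS: "I \<ge> 0" "S \<ge> 0" by (auto simp: I_def S_def)
  \<comment> \<open>A bound for \<open>mobius_density\<close> when |z| \<le> r1. The constant M then
    adds the contributions of the two cases.\<close>
  define k where "k = (1 / (1 - r1)\<^sup>2) powr N"
  define M where "M = (S + 1) + k * I"
  have M0: "M \<ge> 0" using IS by (simp add: M_def k_def)
  have M: "(\<integral>\<^sup>+ u. ennreal (cmod (\<tau>' u)) * ennreal (mobius_density \<alpha> z u) \<partial>bnu \<alpha>) \<le> ennreal M" if z: "norm z < 1" for z
  proof (cases "norm z \<le> r1")
    case True
    have "(\<integral>\<^sup>+ u. ennreal (cmod (\<tau>' u)) * ennreal (mobius_density \<alpha> z u) \<partial>bnu \<alpha>) \<le> (\<integral>\<^sup>+ u. ennreal (cmod (\<tau>' u)) * ennreal k \<partial>bnu \<alpha>)"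
    proof (rule nn_integral_mono_AE, use AE_bnu_ball in eventually_elim)
      fix u :: "complex ^ 'n" assume "u \<in> ball 0 1"
      then have u: "norm u < 1" by simp
      have "1 - r1 \<le> cmod (1 - cdot u z)"
        using one_minus_cdot_bounds(4)[of z u] z u True by simp
      then have "(1 - (norm z)\<^sup>2) / (cmod (1 - cdot u z))\<^sup>2 \<le> 1 / (1 - r1)\<^sup>2"
        using r1 by (intro frac_le power_mono) auto
      then have "mobius_density \<alpha> z u \<le> k"
        unfolding mobius_density_def k_def N_def using z \<alpha> by (intro powr_mono2) (auto simp: abs_square_le_1)
      then show "ennreal (cmod (\<tau>' u)) * ennreal (mobius_density \<alpha> z u) \<le> ennreal (cmod (\<tau>' u)) * ennreal k"
        by (intro mult_left_mono ennreal_leI) auto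
    qed
    also have "\<dots> = ennreal I * ennreal k" by (simp add: nn_integral_multc I)
    also have "\<dots> = ennreal (k * I)" using IS by (simp add: k_def mult.commute flip: ennreal_mult)
    also have "\<dots> \<le> ennreal M" using IS by (intro ennreal_leI) (simp add: M_def)
    finally show ?thesis .
  next
    case False
    then have c: "cmod (berezin \<alpha> \<tau> z) \<le> 1" using r0(2)[of z] z by (simp add: r1_def)
    have "(\<integral>\<^sup>+ u. ennreal (cmod (\<tau>' u)) * ennreal (mobius_density \<alpha> z u) \<partial>bnu \<alpha>) =
        (\<integral>\<^sup>+ u. ennreal (mobius_density \<alpha> z u) * ennreal (cmod (\<tau>' (mobius z (mobius z u)))) \<partial>bnu \<alpha>)"
      by (rule nn_integral_cong_AE, use AE_bnu_ball in eventually_elim) (simp add: mobius_involution[OF z] mult.commute)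
    also have "\<dots> = (\<integral>\<^sup>+ u. ennreal (cmod (\<tau>' (mobius z u))) \<partial>bnu \<alpha>)"
      by (rule nn_integral_bnu_mobius[OF \<alpha> z]) measurable
    also have "\<dots> \<le> (\<integral>\<^sup>+ u. ennreal (cmod (\<tau>' (mobius z u) - berezin \<alpha> \<tau> z)) + 1 \<partial>bnu \<alpha>)"
    proof (rule nn_integral_mono)
      fix u
      have "cmod (\<tau>' (mobius z u)) \<le> cmod (\<tau>' (mobius z u) - berezin \<alpha> \<tau> z) + 1"
        using c norm_triangle_sub[of "\<tau>' (mobius z u)" "berezin \<alpha> \<tau> z"] by linarith
      then have "ennreal (cmod (\<tau>' (mobius z u))) \<le> ennreal (cmod (\<tau>' (mobius z u) - berezin \<alpha> \<tau> z) + 1)" by (rule ennreal_leI)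
      then show "ennreal (cmod (\<tau>' (mobius z u))) \<le> ennreal (cmod (\<tau>' (mobius z u) - berezin \<alpha> \<tau> z)) + 1" by (simp add: ennreal_plus)
    qed
    also have "\<dots> = (\<integral>\<^sup>+ u. ennreal (cmod (\<tau>' (mobius z u) - berezin \<alpha> \<tau> z)) \<partial>bnu \<alpha>) + 1"
      by (subst nn_integral_add) (auto simp: emeasure_bnu_UNIV[OF \<alpha>])
    also have "\<dots> \<le> ennreal S + 1" by (intro add_right_mono S z)
    also have "\<dots> = ennreal (S + 1)" using IS by (simp add: ennreal_plus)
    also have "\<dots> \<le> ennreal M" using IS by (intro ennreal_leI) (simp add: M_def k_def)
    finally show ?thesis .
  qed
  have cs: "carleson_symbol \<alpha> (real CARD('n) + 1 + \<alpha>) M \<tau>'"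
    by unfold_locales (use \<alpha> M M0 in auto)
  show ?thesis
  proof (rule that[OF cs])
    fix e :: real assume "e > 0"
    from small[OF this] obtain \<rho> where \<rho>: "\<rho> < 1" "\<And>w :: complex ^ 'n. \<rho> < norm w \<Longrightarrow> norm w < 1 \<Longrightarrow> cmod (berezin \<alpha> \<tau> w) \<le> e"
      by blast
    have "(1 - (norm w)\<^sup>2) powr (real CARD('n) + 1 + \<alpha>) * cmod (carleson_symbol.H \<alpha> \<tau>' w w) \<le> e"
      if "\<rho> < norm w" "norm w < 1" for w
    proof -
      have "berezin \<alpha> \<tau> w = of_real ((1 - (norm w)\<^sup>2) powr (real CARD('n) + 1 + \<alpha>)) * carleson_symbol.H \<alpha> \<tau>' w w"
        unfolding ber[OF that(2)] by (rule carleson_symbol.H_diagonal[OF cs that(2)])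
      then show ?thesis using \<rho>(2)[OF that] by (simp add: norm_mult)
    qed
    then show "\<exists>\<rho><1. \<forall>w :: complex ^ 'n. \<rho> < norm w \<longrightarrow> norm w < 1 \<longrightarrow>
       (1 - (norm w)\<^sup>2) powr (real CARD('n) + 1 + \<alpha>) * cmod (carleson_symbol.H \<alpha> \<tau>' w w) \<le> e"
      using \<rho>(1) by blast
  qed
qed

section \<open>The compact Toeplitz operator\<close>

text \<open>Elements of the Bergman space have arbitrary values off the ball; extension by zero
  makes them Borel functions on the whole space.\<close>

definition on_ball :: "(complex ^ 'n \<Rightarrow> ell2) \<Rightarrow> complex ^ 'n \<Rightarrow> ell2" where
  "on_ball f w = indicator (ball 0 1) w *\<^sub>R f w"

lemma on_ball_eq [simp]: "norm w < 1 \<Longrightarrow> on_ball f w = f w"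
  by (simp add: on_ball_def)

context carleson_symbol
begin

text \<open>Holomorphic functions are continuous on the open ball, so the extension by zero is
  Borel. The reproducing formula then applies, square integrability giving integrability.\<close>

lemma
  fixes f :: "complex ^ 'n \<Rightarrow> ell2"
  assumes f: "f \<in> Bergman \<alpha> 2"
  shows reproduced_on_ball: "reproduced (on_ball f)"
    and nn_integral_on_ball: "(\<integral>\<^sup>+ z. ennreal ((norm (on_ball f z))\<^sup>2) \<partial>bnu \<alpha>) = Lp_power \<alpha> 2 f"
proof -
  have hol: "holomorphic_ball f" and fin: "Lp_power \<alpha> 2 f < \<infinity>" using f by (auto simp: Bergman_def Lp_def)
  have "continuous_on (ball 0 1) f"
    by (intro continuous_at_imp_continuous_on ballI)
       (use hol has_derivative_continuous in \<open>unfold holomorphic_ball_def, blast\<close>)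
  then have m[measurable]: "on_ball f \<in> borel_measurable borel"
    unfolding on_ball_def[abs_def] by (intro borel_measurable_continuous_on_indicator) auto
  have "Lp_power \<alpha> 2 f = (\<integral>\<^sup>+ z. ennreal ((norm (on_ball f z))\<^sup>2) \<partial>nu \<alpha>)"
    unfolding Lp_power_def by (rule nn_integral_cong) (simp add: space_nu)
  then show eq: "(\<integral>\<^sup>+ z. ennreal ((norm (on_ball f z))\<^sup>2) \<partial>bnu \<alpha>) = Lp_power \<alpha> 2 f"
    by (simp add: nn_integral_nu)
  have "holomorphic_ball (on_ball f)"
    unfolding holomorphic_ball_def
  proof
    fix z :: "complex ^ 'n" assume z: "z \<in> ball 0 1"
    then obtain D where D: "(f has_derivative D) (at z)" "\<forall>c v. D (c *s v) = c *\<^sub>C D v"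
      using hol unfolding holomorphic_ball_def by blast
    have "(on_ball f has_derivative D) (at z)"
      by (rule has_derivative_transform_within_open[OF D(1) open_ball z]) simp
    then show "\<exists>D. (on_ball f has_derivative D) (at z) \<and> (\<forall>c v. D (c *s v) = c *\<^sub>C D v)" using D(2) by blast
  qed
  moreover have "integrable (bnu \<alpha>) (on_ball f)"
    using nn_integral_norm_le[OF m] eq fin
    by (intro integrableI_bounded) (auto simp: ennreal_add_less_top intro: le_less_trans)
  ultimately show "reproduced (on_ball f)"
    using m eq fin reproducing_ell2[OF \<alpha>, of "on_ball f"] by (simp add: reproduced_def)
qed

lemma T_in_Bergman:
  fixes u :: "complex ^ 'n \<Rightarrow> ell2"
  assumes u: "reproduced u"
  shows "T u \<in> Bergman \<alpha> 2"
proof -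
  note [measurable] = reproducedD(1)[OF u]
  have "Lp_power \<alpha> 2 (T u) = (\<integral>\<^sup>+ w. ennreal ((norm (T u w))\<^sup>2) \<partial>bnu \<alpha>)"
    by (simp add: Lp_power_def nn_integral_nu)
  then show ?thesis
    using T_L2_finite[OF u] holomorphic_T[OF u] by (simp add: Bergman_def Lp_def measurable_nu_borel)
qed

text \<open>Bounded families of reproduced functions are equicontinuous on smaller balls, so
  convergence on a dense set spreads to every point.\<close>

lemma reproduced_Cauchy:
  fixes u :: "nat \<Rightarrow> complex ^ 'n \<Rightarrow> ell2"
  assumes u: "\<And>k. reproduced (u k)" and B: "B \<ge> 0" "\<And>k. (\<integral>\<^sup>+ z. ennreal ((norm (u k z))\<^sup>2) \<partial>bnu \<alpha>) \<le> ennreal B"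
    and dense: "\<And>U :: (complex ^ 'n) set. open U \<Longrightarrow> U \<noteq> {} \<Longrightarrow> \<exists>y\<in>Z. y \<in> U"
    and conv: "\<And>y. y \<in> Z \<Longrightarrow> norm y < 1 \<Longrightarrow> convergent (\<lambda>k. u k y)" and z: "norm z < 1"
  shows "convergent (\<lambda>k. u k z)"
proof -
  define r where "r = (1 + norm z) / 2"
  have r: "r < 1" "norm z < r" using z by (auto simp: r_def)
  obtain C where C: "C \<ge> 0" "\<And>\<phi> z y. integrable (bnu \<alpha>) (\<phi> :: complex ^ 'n \<Rightarrow> ell2) \<Longrightarrow> norm z \<le> r \<Longrightarrow> norm y \<le> r \<Longrightarrow>
      norm ((\<integral>w. cnj (bergman_kernel \<alpha> y w) *\<^sub>C \<phi> w \<partial>bnu \<alpha>) - (\<integral>w. cnj (bergman_kernel \<alpha> z w) *\<^sub>C \<phi> w \<partial>bnu \<alpha>))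
        \<le> C * norm (y - z) * (\<integral>w. norm (\<phi> w) \<partial>bnu \<alpha>)"
    using kernel_integral_lipschitz[OF \<alpha> r(1), where 'n = 'n] by blast
  have lip: "norm (u k y - u k z) \<le> C * (1 + B) * norm (y - z)" if y: "norm y \<le> r" for k y
  proof -
    note [measurable] = reproducedD(1)[OF u[of k]]
    have "ennreal (\<integral>w. norm (u k w) \<partial>bnu \<alpha>) = (\<integral>\<^sup>+ w. ennreal (norm (u k w)) \<partial>bnu \<alpha>)"
      using reproduced_integrable[OF u[of k]] by (intro nn_integral_eq_integral[symmetric]) auto
    also have "\<dots> \<le> 1 + ennreal B" using nn_integral_norm_le[of "u k"] B(2)[of k] by (meson add_left_mono order_trans reproducedD(1) u)
    also have "\<dots> = ennreal (1 + B)" using B(1) by (simp add: ennreal_plus)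
    finally have "(\<integral>w. norm (u k w) \<partial>bnu \<alpha>) \<le> 1 + B" using B(1) by (subst (asm) ennreal_le_iff) auto
    then have "C * norm (y - z) * (\<integral>w. norm (u k w) \<partial>bnu \<alpha>) \<le> C * norm (y - z) * (1 + B)"
      using C(1) by (intro mult_left_mono) auto
    moreover have "norm (u k y - u k z) \<le> C * norm (y - z) * (\<integral>w. norm (u k w) \<partial>bnu \<alpha>)"
      using C(2)[OF reproduced_integrable[OF u[of k]], of z y] y r reproducedD(3)[OF u[of k], of y] reproducedD(3)[OF u[of k], of z] z
      by simp
    ultimately show ?thesis by (simp add: mult_ac)
  qed
  have "Cauchy (\<lambda>k. u k z)"
  proof (rule metric_CauchyI)
    fix \<epsilon> :: real assume \<epsilon>: "\<epsilon> > 0"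
    define K where "K = C * (1 + B) + 1"
    have K: "K > 0" "C * (1 + B) \<le> K" using C(1) B(1) by (auto simp: K_def intro: add_nonneg_pos)
    \<comment> \<open>The first entry keeps \<open>y\<close> in the ball of radius r where the
      Lipschitz bound holds; the second makes each replacement error less than a third of
      \<epsilon>.\<close>
    define \<delta> where "\<delta> = min (r - norm z) (\<epsilon> / (3 * K))"
    have "\<delta> > 0" using r(2) \<epsilon> K by (simp add: \<delta>_def)
    then obtain y where y: "y \<in> Z" "y \<in> ball z \<delta>" using dense[of "ball z \<delta>"] by auto
    have yz: "norm (y - z) < \<delta>" using y(2) by (simp add: dist_norm norm_minus_commute)
    then have yr: "norm y \<le> r" using norm_triangle_sub[of y z] by (simp add: \<delta>_def)
    have near: "norm (u k y - u k z) < \<epsilon> / 3" for k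
    proof -
      have "norm (u k y - u k z) \<le> K * norm (y - z)"
        using lip[OF yr, of k] mult_right_mono[OF K(2), of "norm (y - z)"] by simp
      also have "\<dots> < K * (\<epsilon> / (3 * K))" using yz K(1) by (intro mult_strict_left_mono) (auto simp: \<delta>_def)
      also have "\<dots> = \<epsilon> / 3" using K(1) by simp
      finally show ?thesis .
    qed
    have "Cauchy (\<lambda>k. u k y)" using conv[OF y(1)] yr r(1) by (simp add: Cauchy_convergent_iff)
    then obtain n0 where n0: "\<And>m n. m \<ge> n0 \<Longrightarrow> n \<ge> n0 \<Longrightarrow> dist (u m y) (u n y) < \<epsilon> / 3"
      using metric_CauchyD[of _ "\<epsilon> / 3"] \<epsilon> by (metis divide_pos_pos zero_less_numeral)
    have "dist (u m z) (u n z) < \<epsilon>" if "m \<ge> n0" "n \<ge> n0" for m n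
    proof -
      have "dist (u m z) (u n z) \<le> dist (u m z) (u m y) + dist (u m y) (u n y) + dist (u n y) (u n z)"
        using dist_triangle[of "u m z" "u n z" "u m y"] dist_triangle[of "u m y" "u n z" "u n y"] by linarith
      then show ?thesis using near[of m] near[of n] n0[OF that] by (simp add: dist_norm norm_minus_commute)
    qed
    then show "\<exists>M. \<forall>m\<ge>M. \<forall>n\<ge>M. dist (u m z) (u n z) < \<epsilon>" by blast
  qed
  then show ?thesis by (simp add: Cauchy_convergent_iff)
qed

end

section \<open>Compactness of the composition of \<open>T\<close> and \<open>D\<close>\<close>

locale compact_symbol = carleson_symbol \<alpha> N M \<tau> + diagonal_operator e
  for \<alpha> N M :: real and \<tau> :: "complex ^ 'n \<Rightarrow> complex" and e +
  assumes small: "\<And>\<epsilon>. \<epsilon> > 0 \<Longrightarrow> \<exists>\<rho><1. \<forall>w :: complex ^ 'n. \<rho> < norm w \<longrightarrow> norm w < 1 \<longrightarrow>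
    (1 - (norm w)\<^sup>2) powr N * cmod (H w w) \<le> \<epsilon>"
begin

lemma reproduced_D: "reproduced u \<Longrightarrow> reproduced (\<lambda>z. D (u z))"
  by (rule reproduced_image[OF _ bounded_linear_D D_scaleC])

lemma nn_integral_D_le:
  "(\<integral>\<^sup>+ z. ennreal ((norm (D (u z)))\<^sup>2) \<partial>bnu \<alpha>) \<le> (\<integral>\<^sup>+ z. ennreal ((norm (u z :: ell2))\<^sup>2) \<partial>bnu \<alpha>)"
  by (intro nn_integral_mono ennreal_leI power_mono norm_D_le) auto

text \<open>A diagonal argument over a countable dense set of points and the basis vectors.\<close>

lemma D_Montel:
  fixes u :: "nat \<Rightarrow> complex ^ 'n \<Rightarrow> ell2"
  assumes u: "\<And>k. reproduced (u k)" and B: "B \<ge> 0" "\<And>k. (\<integral>\<^sup>+ z. ennreal ((norm (u k z))\<^sup>2) \<partial>bnu \<alpha>) \<le> ennreal B"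
  obtains r where "strict_mono r" "\<And>z. norm z < 1 \<Longrightarrow> convergent (\<lambda>k. D (u (r k) z))"
proof -
  have "\<exists>L. norm z < 1 \<longrightarrow> L \<ge> 0 \<and> (\<forall>k. norm (u k z) \<le> L)" for z
  proof (cases "norm z < 1")
    case True
    then show ?thesis using reproduced_local_bound[OF B(1) True] u B(2) by (metis order_refl)
  qed auto
  then obtain L where L: "\<And>z. norm z < 1 \<Longrightarrow> L z \<ge> 0" "\<And>z k. norm z < 1 \<Longrightarrow> norm (u k z) \<le> L z" by metis
  obtain Z :: "(complex ^ 'n) set" where Z: "countable Z" and dense: "\<And>U. open U \<Longrightarrow> U \<noteq> {} \<Longrightarrow> \<exists>y\<in>Z. y \<in> U"
    using countable_dense_setE by blast
  \<comment> \<open>Division by L z + 1 brings all coefficients into the unit disc, as the diagonal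
    subsequence argument requires.\<close>
  define f where "f = (\<lambda>k (z, i). cinner_ell2 (u k z) (e i) / of_real (L z + 1))"
  define S where "S = (Z \<inter> ball 0 1) \<times> {1 :: nat..}"
  have "countable S" unfolding S_def using Z by (intro countable_SIGMA countable_Int1) auto
  moreover have "cmod (f k x) \<le> 1" if xS: "x \<in> S" for k x
  proof -
    obtain z i where x: "x = (z, i)" "norm z < 1" "i \<ge> 1" using xS by (cases x) (auto simp: S_def)
    have "cmod (cinner_ell2 (u k z) (e i)) \<le> L z"
      using cmod_cinner_le[of "u k z" "e i"] norm_e[OF x(3)] L(2)[OF x(2), of k] by simp
    then show ?thesis using L(1)[OF x(2)] by (simp add: f_def x(1) norm_divide del: of_real_add)
  qed
  ultimately obtain r where r: "strict_mono (r :: nat \<Rightarrow> nat)" "\<And>x. x \<in> S \<Longrightarrow> \<exists>l. (\<lambda>n. f (r n) x) \<longlonglongrightarrow> l"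
    using function_convergent_subsequence[of S f 1] by blast
  have "convergent (\<lambda>k. D (u (r k) y))" if y: "y \<in> Z" "norm y < 1" for y
  proof (rule D_convergent)
    show "norm (u (r k) y) \<le> L y" for k by (rule L(2)[OF y(2)])
    fix i :: nat assume "i \<ge> 1"
    then obtain l where "(\<lambda>n. f (r n) (y, i)) \<longlonglongrightarrow> l" using r(2)[of "(y, i)"] y by (auto simp: S_def)
    from tendsto_mult_right[OF this, of "of_real (L y + 1)"]
    have "(\<lambda>n. cinner_ell2 (u (r n) y) (e i)) \<longlonglongrightarrow> l * of_real (L y + 1)"
      using L(1)[OF y(2)] by (simp add: f_def del: of_real_add)
    then show "\<exists>l. (\<lambda>n. cinner_ell2 (u (r n) y) (e i)) \<longlonglongrightarrow> l" by blast
  qed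
  moreover have "(\<integral>\<^sup>+ z. ennreal ((norm (D (u (r k) z)))\<^sup>2) \<partial>bnu \<alpha>) \<le> ennreal B" for k
    using nn_integral_D_le B(2) by (rule order_trans)
  ultimately have "convergent (\<lambda>k. D (u (r k) z))" if "norm z < 1" for z
    by (intro reproduced_Cauchy[OF reproduced_D[OF u] B(1) _ dense _ that]) auto
  then show ?thesis using that r(1) by blast
qed

text \<open>The pointwise limit of a subsequence of the functions D(u z) is itself reproduced, so
  the differences form a bounded sequence of reproduced functions tending to 0 pointwise, to which
  \<open>T_tendsto_0\<close> applies.\<close>

lemma T_D_compact:
  fixes u :: "nat \<Rightarrow> complex ^ 'n \<Rightarrow> ell2"
  assumes u: "\<And>k. reproduced (u k)" and B: "B \<ge> 0" "\<And>k. (\<integral>\<^sup>+ z. ennreal ((norm (u k z))\<^sup>2) \<partial>bnu \<alpha>) \<le> ennreal B"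
  obtains r g where "strict_mono r" "reproduced g"
    "\<And>\<epsilon>. \<epsilon> > 0 \<Longrightarrow> \<forall>\<^sub>F k in sequentially. (\<integral>\<^sup>+ w. ennreal ((norm (T (\<lambda>z. D (u (r k) z)) w - T g w))\<^sup>2) \<partial>bnu \<alpha>) \<le> ennreal \<epsilon>"
proof -
  obtain r where r: "strict_mono r" "\<And>z. norm z < 1 \<Longrightarrow> convergent (\<lambda>k. D (u (r k) z))"
    using D_Montel[of u B, OF u B] by blast
  define d where "d = (\<lambda>k z. D (u (r k) z))"
  have d: "reproduced (d k)" for k unfolding d_def by (rule reproduced_D[OF u])
  have T_d: "T (\<lambda>z. D (u (r k) z)) = T (d k)" for k by (simp add: d_def)
  have dB: "(\<integral>\<^sup>+ z. ennreal ((norm (d k z))\<^sup>2) \<partial>bnu \<alpha>) \<le> ennreal B" for k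
    unfolding d_def using nn_integral_D_le B(2) by (rule order_trans)
  \<comment> \<open>The indicator makes the limit exist at every point, so that \<open>g\<close> is
    Borel.\<close>
  define g where "g = (\<lambda>z. lim (\<lambda>k. indicator (ball 0 1) z *\<^sub>R d k z))"
  note [measurable] = reproducedD(1)[OF d]
  have lim: "(\<lambda>k. indicator (ball 0 1) z *\<^sub>R d k z) \<longlonglongrightarrow> g z" for z
    unfolding g_def convergent_LIMSEQ_iff[symmetric]
    using r(2)[of z] by (cases "norm z < 1") (auto simp: d_def convergent_const)
  have [measurable]: "g \<in> borel_measurable borel"
    by (rule borel_measurable_LIMSEQ_metric[OF _ lim]) measurable
  have lim': "(\<lambda>k. d k z) \<longlonglongrightarrow> g z" if "norm z < 1" for z using lim[of z] that by simp
  have g: "reproduced g" "(\<integral>\<^sup>+ z. ennreal ((norm (g z))\<^sup>2) \<partial>bnu \<alpha>) \<le> ennreal B"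
    using reproduced_limit[OF d dB lim'] by auto
  have v: "reproduced (\<lambda>z. d k z - g z)" for k by (rule reproduced_diff[OF d g(1)])
  have vB: "(\<integral>\<^sup>+ z. ennreal ((norm (d k z - g z))\<^sup>2) \<partial>bnu \<alpha>) \<le> ennreal (4 * B)" for k
  proof -
    have "(\<integral>\<^sup>+ z. ennreal ((norm (d k z - g z))\<^sup>2) \<partial>bnu \<alpha>) \<le>
        (\<integral>\<^sup>+ z. ennreal 2 * (ennreal ((norm (d k z))\<^sup>2) + ennreal ((norm (g z))\<^sup>2)) \<partial>bnu \<alpha>)"
    proof (rule nn_integral_mono)
      fix z
      have "(norm (d k z - g z))\<^sup>2 \<le> (norm (d k z) + norm (g z))\<^sup>2" by (intro power_mono norm_triangle_ineq4) auto
      also have "\<dots> \<le> 2 * ((norm (d k z))\<^sup>2 + (norm (g z))\<^sup>2)"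
        using sum_squares_bound[of "norm (d k z)" "norm (g z)"] by (simp add: power2_sum)
      finally show "ennreal ((norm (d k z - g z))\<^sup>2) \<le> ennreal 2 * (ennreal ((norm (d k z))\<^sup>2) + ennreal ((norm (g z))\<^sup>2))"
        by (metis ennreal_leI ennreal_mult ennreal_plus add_nonneg_nonneg zero_le_numeral zero_le_power2)
    qed
    also have "\<dots> = ennreal 2 * ((\<integral>\<^sup>+ z. ennreal ((norm (d k z))\<^sup>2) \<partial>bnu \<alpha>) + (\<integral>\<^sup>+ z. ennreal ((norm (g z))\<^sup>2) \<partial>bnu \<alpha>))"
      by (subst nn_integral_cmult, simp, subst nn_integral_add) auto
    also have "\<dots> \<le> ennreal 2 * (ennreal B + ennreal B)" by (intro mult_left_mono add_mono dB g) auto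
    also have "\<dots> = ennreal (4 * B)" using B(1) ennreal_mult[of 2 "B + B"] by (simp flip: ennreal_plus)
    finally show ?thesis .
  qed
  show ?thesis
  proof (rule that[OF r(1) g(1)])
    fix \<epsilon> :: real assume "\<epsilon> > 0"
    have "\<forall>\<^sub>F k in sequentially. (\<integral>\<^sup>+ w. ennreal ((norm (T (\<lambda>z. d k z - g z) w))\<^sup>2) \<partial>bnu \<alpha>) \<le> ennreal \<epsilon>"
    proof (rule T_tendsto_0[OF small v _ vB _ \<open>\<epsilon> > 0\<close>])
      show "(\<lambda>k. d k z - g z) \<longlonglongrightarrow> 0" if "norm z < 1" for z using lim'[OF that] by (simp add: LIM_zero)
    qed (use B(1) in auto)
    then show "\<forall>\<^sub>F k in sequentially. (\<integral>\<^sup>+ w. ennreal ((norm (T (\<lambda>z. D (u (r k) z)) w - T g w))\<^sup>2) \<partial>bnu \<alpha>) \<le> ennreal \<epsilon>"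
    proof eventually_elim
      case (elim k)
      have "(\<integral>\<^sup>+ w. ennreal ((norm (T (\<lambda>z. D (u (r k) z)) w - T g w))\<^sup>2) \<partial>bnu \<alpha>) =
          (\<integral>\<^sup>+ w. ennreal ((norm (T (\<lambda>z. d k z - g z) w))\<^sup>2) \<partial>bnu \<alpha>)"
        by (rule nn_integral_cong_AE, use AE_bnu_ball in eventually_elim) (simp add: T_diff[OF d g(1)] T_d)
      then show ?case using elim by simp
    qed
  qed
qed

text \<open>The hypothesis on \<open>S\<close> concerns Borel extensions by zero, for which the
  completed and the Borel integrals agree; members of A^2 have them. Limits of subsequences are of
  the form \<open>T g\<close>.\<close>

lemma compact_operator_T_D:
  fixes S :: "(complex ^ 'n \<Rightarrow> ell2) \<Rightarrow> complex ^ 'n \<Rightarrow> ell2"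
  assumes S: "\<And>f. on_ball f \<in> borel_measurable borel \<Longrightarrow> S f = T (\<lambda>z. D (on_ball f z))"
  shows "compact_operator_A2 \<alpha> S"
proof -
  have rep: "reproduced (\<lambda>z. D (on_ball f z))" if "f \<in> Bergman \<alpha> 2" for f :: "complex ^ 'n \<Rightarrow> ell2"
    by (rule reproduced_D[OF reproduced_on_ball[OF that]])
  have meas: "on_ball f \<in> borel_measurable borel" if "f \<in> Bergman \<alpha> 2" for f :: "complex ^ 'n \<Rightarrow> ell2"
    by (rule reproducedD(1)[OF reproduced_on_ball[OF that]])
  interpret D: bounded_linear D by (rule bounded_linear_D)
  have "S f \<in> Bergman \<alpha> 2" if "f \<in> Bergman \<alpha> 2" for f :: "complex ^ 'n \<Rightarrow> ell2"
    using T_in_Bergman[OF rep[OF that]] S[OF meas[OF that]] by simp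
  moreover have "S (\<lambda>w. f w + g w) z = S f z + S g z"
    if fg: "f \<in> Bergman \<alpha> 2" "g \<in> Bergman \<alpha> 2" and z: "z \<in> ball 0 1" for f g and z :: "complex ^ 'n"
  proof -
    have eq: "on_ball (\<lambda>w. f w + g w) = (\<lambda>w. on_ball f w + on_ball g w)"
      by (simp add: on_ball_def fun_eq_iff scaleR_add_right)
    have "on_ball (\<lambda>w. f w + g w) \<in> borel_measurable borel"
      unfolding eq using fg by (intro borel_measurable_add meas)
    then show ?thesis
      using T_add[OF rep[OF fg(1)] rep[OF fg(2)], of z] z by (simp add: S meas fg eq D.add)
  qed
  moreover have "S (\<lambda>w. c *\<^sub>C f w) z = c *\<^sub>C S f z" if f: "f \<in> Bergman \<alpha> 2" and z: "z \<in> ball 0 1" for c f and z :: "complex ^ 'n"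
  proof -
    have eq: "on_ball (\<lambda>w. c *\<^sub>C f w) = (\<lambda>w. c *\<^sub>C on_ball f w)"
      by (simp add: on_ball_def fun_eq_iff scaleR_eq_scaleC mult.commute)
    have "on_ball (\<lambda>w. c *\<^sub>C f w) \<in> borel_measurable borel"
      unfolding eq using f by (intro borel_measurable_scaleC borel_measurable_const meas)
    then show ?thesis
      using T_scale[OF rep[OF f], of z c] z by (simp add: S meas f eq D_scaleC)
  qed
  moreover have "\<exists>g\<in>Bergman \<alpha> 2. \<exists>r. strict_mono r \<and> (\<lambda>k. Lp_norm \<alpha> 2 (\<lambda>z. S (F (r k)) z - g z)) \<longlonglongrightarrow> 0"
    if F: "\<And>k. F k \<in> Bergman \<alpha> 2" and bdd: "bounded (range (\<lambda>k. Lp_norm \<alpha> 2 (F k)))"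
    for F :: "nat \<Rightarrow> complex ^ 'n \<Rightarrow> ell2"
  proof -
    obtain K where K: "\<And>k. Lp_norm \<alpha> 2 (F k) \<le> K"
      using bdd by (auto simp: bounded_iff) (metis abs_le_D1)
    have B: "(\<integral>\<^sup>+ z. ennreal ((norm (on_ball (F k) z))\<^sup>2) \<partial>bnu \<alpha>) \<le> ennreal (K\<^sup>2)" for k
    proof -
      have "Lp_power \<alpha> 2 (F k) < \<infinity>" using F by (auto simp: Bergman_def Lp_def)
      moreover have "enn2real (Lp_power \<alpha> 2 (F k)) \<le> K\<^sup>2"
        using power_mono[OF K[of k], of 2] by (simp add: Lp_norm_def powr_half_sqrt)
      ultimately have "Lp_power \<alpha> 2 (F k) \<le> ennreal (K\<^sup>2)"
        by (metis ennreal_enn2real ennreal_leI infinity_ennreal_def)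
      then show ?thesis by (simp add: nn_integral_on_ball F)
    qed
    obtain r g where r: "strict_mono r" and g: "reproduced g" and
      lim: "\<And>\<epsilon>. \<epsilon> > 0 \<Longrightarrow> \<forall>\<^sub>F k in sequentially.
        (\<integral>\<^sup>+ w. ennreal ((norm (T (\<lambda>z. D (on_ball (F (r k)) z)) w - T g w))\<^sup>2) \<partial>bnu \<alpha>) \<le> ennreal \<epsilon>"
      using T_D_compact[of "\<lambda>k. on_ball (F k)" "K\<^sup>2", OF reproduced_on_ball[OF F] _ B] by auto
    have eq: "Lp_power \<alpha> 2 (\<lambda>z. S (F (r k)) z - T g z) =
        (\<integral>\<^sup>+ w. ennreal ((norm (T (\<lambda>z. D (on_ball (F (r k)) z)) w - T g w))\<^sup>2) \<partial>bnu \<alpha>)" for k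
    proof -
      note [measurable] = reproducedD(1)[OF rep[OF F]] reproducedD(1)[OF g]
      show ?thesis by (simp add: Lp_power_def nn_integral_nu S meas F)
    qed
    have "(\<lambda>k. Lp_norm \<alpha> 2 (\<lambda>z. S (F (r k)) z - T g z)) \<longlonglongrightarrow> 0"
    proof (rule tendstoI)
      fix \<epsilon> :: real assume \<epsilon>: "\<epsilon> > 0"
      then have "(\<epsilon> / 2)\<^sup>2 > 0" by simp
      from lim[OF this] show "\<forall>\<^sub>F k in sequentially. dist (Lp_norm \<alpha> 2 (\<lambda>z. S (F (r k)) z - T g z)) 0 < \<epsilon>"
      proof eventually_elim
        case (elim k)
        then have "enn2real (Lp_power \<alpha> 2 (\<lambda>z. S (F (r k)) z - T g z)) \<le> (\<epsilon> / 2)\<^sup>2"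
          unfolding eq by (rule enn2real_leI[rotated]) simp
        then have "Lp_norm \<alpha> 2 (\<lambda>z. S (F (r k)) z - T g z) \<le> \<epsilon> / 2"
          using \<epsilon> real_sqrt_le_mono by (fastforce simp: Lp_norm_def powr_half_sqrt)
        then show ?case using \<epsilon> by (simp add: Lp_norm_def)
      qed
    qed
    then show ?thesis using T_in_Bergman[OF g] r by blast
  qed
  ultimately show ?thesis unfolding compact_operator_A2_def by blast
qed

end

text \<open>Three replacements: b(w) is a multiple of \<open>D\<close>, the symbol is exchanged for
  its Borel representative off a null set, and \<open>nu\<close> for \<open>bnu\<close>.\<close>

lemma toeplitz_eq_T:
  fixes \<tau> \<tau>' :: "complex ^ 'n \<Rightarrow> complex"
  assumes cs: "carleson_symbol \<alpha> N M \<tau>'" and e: "diagonal_operator e"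
    and Z: "Z \<in> null_sets lborel" and eq: "\<And>w. norm w < 1 \<Longrightarrow> w \<notin> Z \<Longrightarrow> \<tau> w = \<tau>' w"
    and \<tau>: "\<tau> \<in> borel_measurable (nu \<alpha>)"
    and b: "\<And>w x. norm w < 1 \<Longrightarrow> blinfun_apply (b w) x = \<tau> w *\<^sub>C diagonal_operator.D e x"
    and f: "on_ball f \<in> borel_measurable borel"
  shows "toeplitz \<alpha> b f = carleson_symbol.T \<alpha> \<tau>' (\<lambda>w. diagonal_operator.D e (on_ball f w))"
proof
  fix z :: "complex ^ 'n"
  interpret carleson_symbol \<alpha> N M \<tau>' by (rule cs)
  interpret diagonal_operator e by (rule e)
  have D[measurable]: "(\<lambda>w. D (on_ball f w)) \<in> borel_measurable borel"
    using f by (rule measurable_compose) (rule borel_measurable_continuous_onI[OF linear_continuous_on[OF bounded_linear_D]])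
  have "toeplitz \<alpha> b f z = (\<integral>w. cnj (bergman_kernel \<alpha> z w) *\<^sub>C (\<tau> w *\<^sub>C D (on_ball f w)) \<partial>nu \<alpha>)"
    unfolding toeplitz_def by (rule Bochner_Integration.integral_cong) (auto simp: space_nu b)
  also have "\<dots> = (\<integral>w. cnj (bergman_kernel \<alpha> z w) *\<^sub>C (\<tau>' w *\<^sub>C D (on_ball f w)) \<partial>nu \<alpha>)"
  proof (rule integral_cong_AE)
    have m: "(\<lambda>w. cnj (bergman_kernel \<alpha> z w)) \<in> borel_measurable (nu \<alpha>)" by (rule measurable_nu_borel) measurable
    show "(\<lambda>w. cnj (bergman_kernel \<alpha> z w) *\<^sub>C (\<tau> w *\<^sub>C D (on_ball f w))) \<in> borel_measurable (nu \<alpha>)"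
      by (intro borel_measurable_scaleC m \<tau> measurable_nu_borel[OF D])
    show "(\<lambda>w. cnj (bergman_kernel \<alpha> z w) *\<^sub>C (\<tau>' w *\<^sub>C D (on_ball f w))) \<in> borel_measurable (nu \<alpha>)"
      by (intro borel_measurable_scaleC m measurable_nu_borel[OF \<tau>_measurable] measurable_nu_borel[OF D])
    have "AE w in nu \<alpha>. norm (w :: complex ^ 'n) < 1" by (rule AE_I2) (simp add: space_nu)
    then show "AE w in nu \<alpha>. cnj (bergman_kernel \<alpha> z w) *\<^sub>C (\<tau> w *\<^sub>C D (on_ball f w)) =
        cnj (bergman_kernel \<alpha> z w) *\<^sub>C (\<tau>' w *\<^sub>C D (on_ball f w))"
      using AE_nu_not_null[OF \<alpha> Z] by eventually_elim (simp add: eq)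
  qed
  also have "\<dots> = T (\<lambda>w. D (on_ball f w)) z"
    unfolding T_def by (rule integral_nu[OF \<alpha>]) measurable
  finally show "toeplitz \<alpha> b f z = T (\<lambda>w. D (on_ball f w)) z" .
qed

theorem theorem6p1:
  fixes \<alpha> :: real
    and e :: "nat \<Rightarrow> ell2"
    and \<tau> :: "complex ^ 'n \<Rightarrow> complex"
    and b :: "complex ^ 'n \<Rightarrow> ell2 \<Rightarrow>\<^sub>L ell2"
  assumes "\<alpha> > - 1"
    and "orthonormal_basis e"
    and "\<tau> \<in> BMO1 \<alpha>"
    and "berezin \<alpha> \<tau> \<in> Linf"
    and "\<forall>z\<in>ball 0 1. complex_homogeneous (b z)"
    and "\<forall>z\<in>ball 0 1. \<forall>i\<ge>1. blinfun_apply (b z) (e i) = (\<tau> z / 2 ^ i) *\<^sub>C e i"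
    and "(berezin \<alpha> \<tau> \<longlongrightarrow> 0) (filtercomap norm (at_left 1))"
  shows "toeplitz_compact \<alpha> b"
proof -
  have \<tau>m: "\<tau> \<in> borel_measurable (nu \<alpha>)" using assms(3) by (simp add: BMO1_def Lp_def)
  obtain \<tau>' Z where \<tau>': "\<tau>' \<in> borel_measurable borel" "Z \<in> null_sets lborel"
      "\<And>w. norm w < 1 \<Longrightarrow> w \<notin> Z \<Longrightarrow> \<tau> w = \<tau>' w"
    using borel_representative[OF \<tau>m] by blast
  obtain M where cs: "carleson_symbol \<alpha> (real CARD('n) + 1 + \<alpha>) M \<tau>'" and
    small: "\<And>\<epsilon>. \<epsilon> > 0 \<Longrightarrow> \<exists>\<rho><1. \<forall>w :: complex ^ 'n. \<rho> < norm w \<longrightarrow> norm w < 1 \<longrightarrow>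
       (1 - (norm w)\<^sup>2) powr (real CARD('n) + 1 + \<alpha>) * cmod (carleson_symbol.H \<alpha> \<tau>' w w) \<le> \<epsilon>"
    using carleson_of_BMO1[OF assms(1,3,7) \<tau>'] by blast
  have e: "diagonal_operator e" by (rule diagonal_operator.intro[OF assms(2)])
  have b: "blinfun_apply (b w) x = \<tau> w *\<^sub>C diagonal_operator.D e x" if "norm w < 1" for w x
    using assms(5,6) that by (intro diagonal_operator.diagonal_eq_D[OF e]) auto
  have "compact_symbol \<alpha> (real CARD('n) + 1 + \<alpha>) M \<tau>' e"
    by (intro compact_symbol.intro compact_symbol_axioms.intro cs e small)
  then have "compact_operator_A2 \<alpha> (toeplitz \<alpha> b)"
    by (rule compact_symbol.compact_operator_T_D) (rule toeplitz_eq_T[OF cs e \<tau>'(2,3) \<tau>m b])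
  \<comment> \<open>The integral defining \<open>toeplitz \<alpha> b\<close> converges on all of
    A^2, so the operator is its own extension from \<open>Hinf\<close>.\<close>
  then show ?thesis unfolding toeplitz_compact_def by blast
qed

end
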